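(* Let $K$ be a multi-quadratic number field containing $\mathbb{Q}(\sqrt{-3})$. Then $J_1(6,6)(K)_{\mathrm{tors}} = J_1(6,6)(\mathbb{Q}(\sqrt{-3})) \cong \mathbb{Z}/2 \times \mathbb{Z}/6$.
   Context: A multi-quadratic number field is a number field which is a compositum of quadratic number fields. For positive integers $M,N$, $X_1(M,MN)$ is the modular curve (coarse moduli space) attached to the level structure $\Gamma_1(M,MN) = \{\begin{pmatrix}1&b\\0&d\end{pmatrix} \in \mathrm{GL}_2(\mathbb{Z}/MN) : b \equiv 0,\ d\equiv 1 \bmod M\}$; it is defined over $\mathbb{Q}(\zeta_M)$, and $J_1(M,MN)$ denotes its Jacobian. Here $X_1(6,6)$ is defined over $\mathbb{Q}(\sqrt{-3}) = \mathbb{Q}(\zeta_6)$; it is the base change of the elliptic curve with Cremona label 36a1. *)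

theory Defs
  imports
    Complex_Main
    "HOL-Computational_Algebra.Polynomial"
    "HOL-Algebra.Algebraic_Closure_Type"
    "HOL-Algebra.Finite_Extensions"
    "HOL-Algebra.Generated_Fields"
    "HOL-Algebra.Free_Abelian_Groups"
    "HOL-Algebra.Elementary_Groups"
begin

abbreviation CC :: "complex ring" where
  "CC \<equiv> ring_of_type_algebra"


section \<open>Multi-quadratic number fields\<close>

text \<open>Number fields are taken inside the complex numbers.\<close>

definition quadratic_number_field :: "complex set \<Rightarrow> bool" where
  "quadratic_number_field L \<longleftrightarrow> subfield L CC \<and> ring.dimension CC 2 \<rat> L"

definition multi_quadratic :: "complex set \<Rightarrow> bool" where
  "multi_quadratic K \<longleftrightarrow>
     (\<exists>\<L>. finite \<L> \<and> \<L> \<noteq> {} \<and> (\<forall>L\<in>\<L>. quadratic_number_field L) \<and>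
          K = generate_field CC (\<Union>\<L>))"

definition Q_sqrt_m3 :: "complex set" where
  "Q_sqrt_m3 = generate_field CC (\<rat> \<union> {csqrt (-3)})"


section \<open>Divisor classes of an algebraic function field\<close>

text \<open>
  A smooth projective geometrically irreducible curve over \<open>K\<close> is given by its function field
  \<open>F\<close>, which here is a subfield of the complex numbers containing \<open>K\<close>. Its closed points are the
  places of \<open>F\<close> over \<open>K\<close>, represented by their valuation rings \<open>V\<close>.
\<close>

definition places :: "complex set \<Rightarrow> complex set \<Rightarrow> complex set set" where
  "places K F = {V. subring V CC \<and> K \<subset> V \<and> V \<subset> F \<and> (\<forall>z\<in>F. z \<in> V \<or> inverse z \<in> V)}"

definition maximal_ideal :: "complex set \<Rightarrow> complex set" where
  "maximal_ideal V = {z \<in> V. z = 0 \<or> inverse z \<notin> V}"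

definition uniformizer :: "complex set \<Rightarrow> complex \<Rightarrow> bool" where
  "uniformizer V t \<longleftrightarrow> t \<in> V \<and> maximal_ideal V = (*) t ` V"

definition ord_at :: "complex set \<Rightarrow> complex \<Rightarrow> int" where
  "ord_at V z = (THE n. \<exists>t u. uniformizer V t \<and> u \<in> V - maximal_ideal V \<and> z = t powi n * u)"

text \<open>The dimension over \<open>K\<close> of the residue field of \<open>V\<close>.\<close>

definition place_degree :: "complex set \<Rightarrow> complex set \<Rightarrow> nat" where
  "place_degree K V =
     (let R = CC\<lparr>carrier := V\<rparr>; k = R Quot maximal_ideal V
      in ring.dim k ((\<lambda>c. maximal_ideal V +>\<^bsub>R\<^esub> c) ` K) (carrier k))"

definition divisor_degree :: "complex set \<Rightarrow> (complex set \<Rightarrow>\<^sub>0 int) \<Rightarrow> int" where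
  "divisor_degree K D =
     (\<Sum>V\<in>Poly_Mapping.keys D. Poly_Mapping.lookup D V * int (place_degree K V))"

definition divisors0 :: "complex set \<Rightarrow> complex set \<Rightarrow> (complex set \<Rightarrow>\<^sub>0 int) monoid" where
  "divisors0 K F = (free_Abelian_group (places K F))
     \<lparr>carrier := {D \<in> carrier (free_Abelian_group (places K F)). divisor_degree K D = 0}\<rparr>"

text \<open>For nonzero \<open>z\<close> only finitely many places have \<open>ord_at V z \<noteq> 0\<close>.\<close>

definition principal_divisor ::
    "complex set \<Rightarrow> complex set \<Rightarrow> complex \<Rightarrow> (complex set \<Rightarrow>\<^sub>0 int)" where
  "principal_divisor K F z =
     (\<Sum>V\<in>{V \<in> places K F. ord_at V z \<noteq> 0}. frag_cmul (ord_at V z) (frag_of V))"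

definition principal_divisors ::
    "complex set \<Rightarrow> complex set \<Rightarrow> (complex set \<Rightarrow>\<^sub>0 int) set" where
  "principal_divisors K F = principal_divisor K F ` (F - {0})"

text \<open>
  The group of divisor classes of degree 0. When the curve has a \<open>K\<close>-rational point (for modular
  curves: a rational cusp) this is the group of \<open>K\<close>-rational points of its Jacobian.
\<close>

definition jacobian_points ::
    "complex set \<Rightarrow> complex set \<Rightarrow> (complex set \<Rightarrow>\<^sub>0 int) set monoid" where
  "jacobian_points K F = divisors0 K F Mod principal_divisors K F"

text \<open>
  Pullback of divisors along an extension \<open>F \<subseteq> F'\<close> of function fields over \<open>K'\<close>; the coefficient
  of a place above \<open>V\<close> is its ramification index, i.e. its order at a uniformizer of \<open>V\<close>.
\<close>

definition conorm ::
    "complex set \<Rightarrow> complex set \<Rightarrow> complex set \<Rightarrow> (complex set \<Rightarrow>\<^sub>0 int) \<Rightarrow> (complex set \<Rightarrow>\<^sub>0 int)"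
  where
  "conorm F K' F' = frag_extend (\<lambda>V. \<Sum>W\<in>{W \<in> places K' F'. W \<inter> F = V}.
     frag_cmul (ord_at W (SOME t. uniformizer V t)) (frag_of W))"

text \<open>
  The inclusion of the \<open>K\<close>-points of the Jacobian of \<open>F\<close> into the \<open>K'\<close>-points, \<open>F'\<close> being the
  constant field extension \<open>K' F\<close>. The cosets in the union all coincide.
\<close>

definition base_change ::
    "complex set \<Rightarrow> complex set \<Rightarrow> complex set \<Rightarrow>
     (complex set \<Rightarrow>\<^sub>0 int) set \<Rightarrow> (complex set \<Rightarrow>\<^sub>0 int) set" where
  "base_change F K' F' C =
     (\<Union>D\<in>C. principal_divisors K' F' #>\<^bsub>divisors0 K' F'\<^esub> conorm F K' F' D)"

definition torsion_points :: "('a, 'b) monoid_scheme \<Rightarrow> 'a set" where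
  "torsion_points G = {g \<in> carrier G. \<exists>n::nat. n > 0 \<and> g [^]\<^bsub>G\<^esub> n = \<one>\<^bsub>G\<^esub>}"


section \<open>Elliptic curves and level structures\<close>

text \<open>
  Complex points of \<open>y\<^sup>2 = x\<^sup>3 + a x + b\<close> with the chord and tangent law; \<open>None\<close> is the point at
  infinity.
\<close>

fun ec_add :: "complex \<Rightarrow> (complex \<times> complex) option \<Rightarrow> (complex \<times> complex) option
    \<Rightarrow> (complex \<times> complex) option" where
  "ec_add a None Q = Q"
| "ec_add a P None = P"
| "ec_add a (Some (x1, y1)) (Some (x2, y2)) =
     (if x1 = x2 \<and> y1 = - y2 then None
      else let l = (if x1 = x2 then (3 * x1\<^sup>2 + a) / (2 * y1) else (y2 - y1) / (x2 - x1));
               x3 = l\<^sup>2 - x1 - x2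
           in Some (x3, l * (x1 - x3) - y1))"

definition elliptic_curve :: "complex \<Rightarrow> complex \<Rightarrow> (complex \<times> complex) option monoid" where
  "elliptic_curve a b =
     \<lparr>carrier = insert None {Some (x, y) |x y. y\<^sup>2 = x ^ 3 + a * x + b},
      monoid.mult = ec_add a, one = None\<rparr>"

text \<open>An elliptic curve with j-invariant \<open>j\<close>, for \<open>j\<close> different from 0 and 1728.\<close>

definition universal_curve :: "complex \<Rightarrow> (complex \<times> complex) option monoid" where
  "universal_curve j = (let c = - 27 * j / (4 * (j - 1728)) in elliptic_curve c c)"

text \<open>
  The matrices in \<open>\<Gamma>\<^sub>1(M, MN)\<close> are exactly those which, on a basis \<open>(e1, e2)\<close> of \<open>(\<int>/MN)\<^sup>2\<close>,
  fix \<open>P = e1\<close> and \<open>Q = N e2\<close>. So a level structure is an embedding of \<open>\<int>/MN \<times> \<int>/M\<close>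
  into the curve, given by the images \<open>P\<close> and \<open>Q\<close> of the two generators.
\<close>

definition Gamma1_structure :: "nat \<Rightarrow> nat \<Rightarrow> ('a, 'b) monoid_scheme \<Rightarrow> 'a \<Rightarrow> 'a \<Rightarrow> bool" where
  "Gamma1_structure M N E P Q \<longleftrightarrow>
     P \<in> carrier E \<and> Q \<in> carrier E \<and>
     P [^]\<^bsub>E\<^esub> (M * N) = \<one>\<^bsub>E\<^esub> \<and> Q [^]\<^bsub>E\<^esub> M = \<one>\<^bsub>E\<^esub> \<and>
     inj_on (\<lambda>(r, s). P [^]\<^bsub>E\<^esub> r \<otimes>\<^bsub>E\<^esub> Q [^]\<^bsub>E\<^esub> s) ({..<M * N} \<times> {..<M})"


section \<open>The modular curve and its Jacobian\<close>

text \<open>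
  The function field over \<open>K\<close> (a number field containing the \<open>M\<close>-th roots of unity) of the coarse
  moduli space \<open>X\<^sub>1(M, MN)\<close>. The generic point of the \<open>j\<close>-line is represented by a complex number
  \<open>j\<close> transcendental over the rationals, so that \<open>K(j)\<close> is a rational function field and the complex
  numbers serve as an algebraically closed overfield containing all torsion points of the generic
  curve. If \<open>(P, Q)\<close> is a level structure on the generic curve, the field of definition over \<open>K(j)\<close>
  of its isomorphism class, i.e. of \<open>(P, Q)\<close> up to \<open>\<plusminus>1\<close>, is obtained by adjoining the
  x-coordinates of all points \<open>r P + s Q\<close>.
\<close>

definition X1_function_field ::
    "complex set \<Rightarrow> complex \<Rightarrow> (complex \<times> complex) option \<Rightarrow> (complex \<times> complex) option
     \<Rightarrow> complex set" where
  "X1_function_field K j P Q = generate_field CC (K \<union> {j} \<union>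
     {x. \<exists>y (r::nat) (s::nat).
        P [^]\<^bsub>universal_curve j\<^esub> r \<otimes>\<^bsub>universal_curve j\<^esub> Q [^]\<^bsub>universal_curve j\<^esub> s = Some (x, y)})"

definition J1_points ::
    "complex set \<Rightarrow> complex \<Rightarrow> (complex \<times> complex) option \<Rightarrow> (complex \<times> complex) option
     \<Rightarrow> (complex set \<Rightarrow>\<^sub>0 int) set monoid" where
  "J1_points K j P Q = jacobian_points K (X1_function_field K j P Q)"

definition J1_base_change ::
    "complex set \<Rightarrow> complex set \<Rightarrow> complex \<Rightarrow>
     (complex \<times> complex) option \<Rightarrow> (complex \<times> complex) option \<Rightarrow>
     (complex set \<Rightarrow>\<^sub>0 int) set \<Rightarrow> (complex set \<Rightarrow>\<^sub>0 int) set" where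
  "J1_base_change K K' j P Q =
     base_change (X1_function_field K j P Q) K' (X1_function_field K' j P Q)"

end

theory Submission
 imports Defs "HOL-Analysis.Analysis"
begin

text \<open>
 By the Hesse parametrization of the 3-torsion and an explicit description of the 2-torsion, the function
 field of \<open>X\<^sub>1(6,6)\<close> over \<open>K\<close> is \<open>K(s, w)\<close> with \<open>w\<^sup>2 = s\<^sup>3 + 1\<close>. The degree 0 class group of
 \<open>K(x, y)\<close>, \<open>y\<^sup>2 = x\<^sup>3 + a x + b\<close>, is identified with the group of \<open>K\<close>-points of the curve by
 computing the divisors of lines; this also yields associativity of the chord and tangent law. A torsion point over
 a multi-quadratic \<open>K\<close> is killed by 6: at a valuation above 5 the ramification index of \<open>K\<close> is at most 2, so that
 the kernel of reduction is torsion-free, while all elements of the residue field satisfy \<open>z\<^sup>2\<^sup>5 = z\<close>, which forces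
 six times any point into that kernel. The only candidates for torsion points not defined over \<open>\<rat>(\<surd>-3)\<close> satisfy
 \<open>x\<^sup>3 = -4\<close>, which is excluded at 7. Finally the points over \<open>\<rat>(\<surd>-3)\<close> are found by infinite descent on
 \<open>u\<^sup>3 + v\<^sup>3 = 2 w\<^sup>3\<close> over the Eisenstein integers.
\<close>

text \<open>The bound must hold for multi-quadratic fields of any degree. At an odd prime such a
  field has ramification index and residue degree at most 2, however many square roots are adjoined,
  so its residue field at 5 has at most 25 elements. The curve \<open>y^2 = x^3 + 1\<close> is
  supersingular at 5: the Frobenius of the field with 25 elements acts as -5, its 36 points are the
  kernel of 1 + 5, and the exponent is 6. Ramification 2 is below 5 - 1, which keeps torsion out of
  the kernel of reduction. Of the 36 complex points killed by 6, the 24 that double to a point with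
  \<open>x^3 = -4\<close> remain to be excluded. Valuation rings of the whole field of complex
  numbers, supplied by Chevalley's theorem, take the place of rings of integers and of prime
  decomposition; the same theorem produces the places of the function fields. The three claims are
  read off on points: over either field the classes of degree 0 are in bijection with points, and on
  points base change is the inclusion.\<close>

abbreviation "mx \<equiv> maximal_ideal"

lemmas square_simps = algebra_simps power2_eq_square
lemmas cube_simps = square_simps power3_eq_cube

section \<open>Subfields and subrings of the complex numbers\<close>

lemma CC_simps [simp]:
 "carrier CC = UNIV" "x \<otimes>\<^bsub>CC\<^esub> y = x*y" "x \<oplus>\<^bsub>CC\<^esub> y = x + y"
 "\<one>\<^bsub>CC\<^esub> = 1" "\<zero>\<^bsub>CC\<^esub> = 0"
 by (simp_all add: ring_of_type_algebra_def)

lemma CC_field: "field CC" and CC_cring: "cring CC" and CC_ring: "ring CC"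
 by (rule field_from_type_algebra cring_from_type_algebra ring_from_type_algebra)+

lemma CC_minus [simp]: "\<ominus>\<^bsub>CC\<^esub> x = - x"
proof -
 interpret ring CC by (rule CC_ring)
 show ?thesis by (rule minus_equality) auto
qed

lemma CC_inv [simp]: "x ~= 0 ==> inv\<^bsub>CC\<^esub> x = inverse x"
proof -
 interpret cring CC by (rule CC_cring)
 assume "x ~= 0"
 then show ?thesis by (intro comm_inv_char) auto
qed

text \<open>The algebraic notions of the statement are recast with the ordinary operations on
  complex numbers, so that arithmetic can be left to the simplifier; \<open>subring_CC_iff\<close>
  and \<open>subfield_CC_imp_csubfield\<close> pass between the two.\<close>

locale csubring =
 fixes R :: "complex set"
 assumes one_closed [simp]: "1 \<in> R"
  and add_closed [simp]: "x \<in> R ==> y \<in> R ==> x + y \<in> R"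
  and mult_closed [simp]: "x \<in> R ==> y \<in> R ==> x*y \<in> R"
  and uminus_closed [simp]: "x \<in> R ==> - x \<in> R"
begin

lemma zero_closed [simp]: "0 \<in> R"
 using add_closed[OF one_closed uminus_closed[OF one_closed]] by simp

lemma diff_closed [simp]: "x \<in> R ==> y \<in> R ==> x - y \<in> R"
 using add_closed[of x "- y"] by simp

lemma power_closed [simp]: "x \<in> R ==> x^n \<in> R"
 by (induction n) auto

lemma sum_closed: "(\<And>i. i \<in> A ==> f i \<in> R) ==> sum f A \<in> R"
 by (induction A rule: infinite_finite_induct) auto

lemma of_nat_closed [simp]: "of_nat n \<in> R"
 by (induction n) auto

lemma of_int_closed [simp]: "of_int n \<in> R"
 by (cases n) (auto simp del: of_nat_Suc)

lemma numeral_closed [simp]: "numeral n \<in> R"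
 using of_nat_closed[of "numeral n"] by (simp only: of_nat_numeral)

lemma uminus_iff [simp]: "- x \<in> R \<longleftrightarrow> x \<in> R"
 using uminus_closed[of "- x"] by auto

end

locale csubfield = csubring K for K :: "complex set" +
 assumes inverse_closed [simp]: "x \<in> K ==> inverse x \<in> K"
begin

lemma divide_closed [simp]: "x \<in> K ==> y \<in> K ==> x / y \<in> K"
 by (simp add: divide_inverse)

lemma powi_closed [simp]: "x \<in> K ==> x powi n \<in> K"
 by (auto simp: power_int_def)

lemma Rats_closed: "x \<in> \<rat> ==> x \<in> K"
 by (elim Rats_cases') auto

lemma subfield_CC: "subfield K CC"
proof -
 interpret field CC by (rule CC_field)
 show ?thesis by (rule subfieldI') (auto intro!: subringI)
qed

end

lemma subring_CC_iff: "subring R CC \<longleftrightarrow> csubring R"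
proof
 assume "subring R CC"
 then show "csubring R"
  using subringE(3,5,6,7)[OF \<open>subring R CC\<close>] by unfold_locales auto
next
 interpret ring CC by (rule CC_ring)
 assume "csubring R"
 then interpret R: csubring R .
 show "subring R CC" by (rule subringI) auto
qed

lemma subfield_CC_imp_csubfield:
 assumes "subfield K CC"
 shows "csubfield K"
proof -
 interpret field CC by (rule CC_field)
 from assms interpret csubring K using subfieldE(1) subring_CC_iff by blast
 show ?thesis
 proof unfold_locales
  fix x assume "x \<in> K"
  then show "inverse x \<in> K"
   using subfield_m_inv(1)[OF assms, of x] by (cases "x = 0") auto
 qed
qed

lemma csubfield_Rats: "csubfield \<rat>"
 by unfold_locales auto

lemma csubfield_generate_field: "csubfield (generate_field CC H)"
 by (intro subfield_CC_imp_csubfield field.generate_field_is_subfield CC_field) auto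

lemma generate_field_min: "csubfield E ==> H \<subseteq> E ==> generate_field CC H \<subseteq> E"
 by (intro field.generate_field_min_subfield1 CC_field csubfield.subfield_CC) auto

lemma generate_field_subset: "H \<subseteq> generate_field CC H"
 by (auto intro: generate_field.incl)

lemma generate_field_mono: "H \<subseteq> H' ==> generate_field CC H \<subseteq> generate_field CC H'"
 by (rule generate_field_min[OF csubfield_generate_field])
   (auto intro: generate_field.incl)

subsection \<open>Polynomials over a subring\<close>

text \<open>Polynomials over a subring are complex polynomials with restricted coefficients.
  Divisibility, degree and roots are then always those of complex polynomials, whatever the
  subring.\<close>

definition polys :: "complex set \<Rightarrow> complex poly set" where
 "polys R = {p. \<forall>i. coeff p i \<in> R}"

lemma polysD: "p \<in> polys R ==> coeff p i \<in> R"
 by (simp add: polys_def)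

lemma polys_mono: "R \<subseteq> S ==> polys R \<subseteq> polys S"
 by (auto simp: polys_def)

context csubring
begin

lemma polys_0 [simp]: "0 \<in> polys R" and polys_1 [simp]: "1 \<in> polys R"
 by (auto simp: polys_def coeff_pCons one_pCons split: nat.split)

lemma polys_pCons [simp]: "pCons c p \<in> polys R \<longleftrightarrow> c \<in> R \<and> p \<in> polys R"
proof -
 have "(\<forall>i. coeff (pCons c p) i \<in> R) \<longleftrightarrow> (coeff (pCons c p) 0 \<in> R \<and> (\<forall>i. coeff (pCons c p) (Suc i) \<in> R))"
  by (metis not0_implies_Suc)
 then show ?thesis by (simp add: polys_def)
qed

lemma polys_add [simp]: "p \<in> polys R ==> q \<in> polys R ==> p + q \<in> polys R"
 and polys_diff [simp]: "p \<in> polys R ==> q \<in> polys R ==> p - q \<in> polys R"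
 and polys_uminus [simp]: "p \<in> polys R ==> - p \<in> polys R"
 and polys_smult [simp]: "c \<in> R ==> p \<in> polys R ==> Polynomial.smult c p \<in> polys R"
 and polys_monom [simp]: "c \<in> R ==> Polynomial.monom c n \<in> polys R"
 by (auto simp: polys_def)

lemma polys_mult [simp]: "p \<in> polys R ==> q \<in> polys R ==> p*q \<in> polys R"
 by (auto simp: polys_def coeff_mult intro!: sum_closed)

lemma polys_power [simp]: "p \<in> polys R ==> p^n \<in> polys R"
 by (induction n) auto

lemma poly_closed: "p \<in> polys R ==> x \<in> R ==> poly p x \<in> R"
 by (auto simp: poly_altdef polys_def intro!: sum_closed)

end

context csubfield
begin

lemma polys_euclid:
 assumes "p \<in> polys K" "d \<in> polys K" "d ~= 0"
 obtains q r where "q \<in> polys K" "r \<in> polys K" "p = d*q + r" "r = 0 \<or> degree r < degree d"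
proof -
 have "\<exists>q\<in>polys K. \<exists>r\<in>polys K. p = d*q + r \<and> (r = 0 \<or> degree r < degree d)"
  using assms(1)
 proof (induction "degree p" arbitrary: p rule: less_induct)
  case less
  show ?case
  proof (cases "p = 0 \<or> degree p < degree d")
   case True
   then show ?thesis using less.prems by (intro bexI[of _ 0] bexI[of _ p]) auto
  next
   case False
   define m where "m = Polynomial.monom (lead_coeff p / lead_coeff d) (degree p - degree d)"
   have m: "m \<in> polys K" using less.prems assms by (auto simp: m_def polysD)
   have m0: "m ~= 0" "degree m = degree p - degree d" "lead_coeff m = lead_coeff p / lead_coeff d"
    using False assms by (auto simp: m_def degree_monom_eq lead_coeff_monom)
   then have dm: "degree (d*m) = degree p" "lead_coeff (d*m) = lead_coeff p" "m ~= 0"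
    using False assms lead_coeff_mult[of d m] by (auto simp: degree_mult_eq)
   show ?thesis
   proof (cases "p - d*m = 0")
    case True
    then show ?thesis using m by (intro bexI[of _ m] bexI[of _ 0]) auto
   next
    case nz: False
    have "degree (p - d*m) \<le> degree p" using dm by (metis degree_diff_le order_refl)
    moreover have "coeff (p - d*m) (degree p) = 0" using dm by simp
    ultimately have "degree (p - d*m) < degree p"
     using nz by (metis leading_coeff_0_iff order_less_le)
    from less.hyps[OF this] less.prems m assms obtain q r
     where "q \<in> polys K" "r \<in> polys K" "p - d*m = d*q + r" "r = 0 \<or> degree r < degree d"
     by (metis polys_diff polys_mult)
    then show ?thesis using m
     by (intro bexI[of _ "q + m"] bexI[of _ r]) (auto simp: algebra_simps)
   qed
  qed
 qed
 then show ?thesis using that by blast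
qed

text \<open>\<open>d dvd p\<close> only says that the quotient is a complex polynomial. The
  remainder of the division over \<open>K\<close> is again a multiple of \<open>d\<close> and of
  smaller degree, so it is zero and the quotient lies over \<open>K\<close>.\<close>

lemma polys_dvdE:
 assumes "p \<in> polys K" "d \<in> polys K" "d dvd p"
 obtains q where "q \<in> polys K" "p = d*q"
proof (cases "d = 0")
 case True
 then show ?thesis using assms that[of 0] by auto
next
 case False
 from polys_euclid[OF assms(1,2) False] obtain q r
  where qr: "q \<in> polys K" "r \<in> polys K" "p = d*q + r" "r = 0 \<or> degree r < degree d" .
 have "d dvd r" using assms(3) qr(3) by (simp add: dvd_add_right_iff)
 then have "r = 0" using qr(4) by (meson dvd_imp_degree_le not_le)
 then show ?thesis using qr that by auto
qed

text \<open>A nonzero combination of least degree divides every combination, by division with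
  remainder.\<close>

lemma polys_bezout:
 assumes "p \<in> polys K" "q \<in> polys K" "p ~= 0"
 obtains u v g where "u \<in> polys K" "v \<in> polys K" "g \<in> polys K" "g = u*p + v * q" "g ~= 0" "g dvd p" "g dvd q"
proof -
 define S where "S = {g. g ~= 0 \<and> (\<exists>u\<in>polys K. \<exists>v\<in>polys K. g = u*p + v * q)}"
 have "p \<in> S" unfolding S_def using assms
  by (intro CollectI conjI bexI[where x = 1] bexI[where x = 0]) simp_all
 then obtain g where g: "g \<in> S" "\<And>h. h \<in> S ==> degree g \<le> degree h"
  using ex_has_least_nat[of "\<lambda>g. g \<in> S" p degree] by blast
 obtain u v where uv: "u \<in> polys K" "v \<in> polys K" "g = u*p + v * q" "g ~= 0"
  using g(1) unfolding S_def by blast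
 have gK: "g \<in> polys K" using uv assms by simp
 have *: "g dvd h" if h: "h \<in> polys K" "h = s*p + t*q" "s \<in> polys K" "t \<in> polys K" for h s t
 proof -
  obtain k r where kr: "k \<in> polys K" "r \<in> polys K" "h = g * k + r" "r = 0 \<or> degree r < degree g"
   using polys_euclid[OF h(1) gK uv(4)] .
  have "r = (s - k*u)*p + (t - k * v)*q"
   using kr(3) h(2) uv(3) by (simp add: algebra_simps)
  moreover have "s - k*u \<in> polys K" "t - k * v \<in> polys K" using h kr uv by auto
  ultimately have "r = 0 \<or> r \<in> S" unfolding S_def by blast
  then have "r = 0" using g(2)[of r] kr(4) by auto
  then show ?thesis using kr(3) by simp
 qed
 show ?thesis
  by (rule that[OF uv(1,2) gK uv(3,4)]) (use *[of p 1 0] *[of q 0 1] assms in auto)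
qed

end

section \<open>Valuation rings\<close>

locale valring = F: csubfield F + V: csubring V for F V :: "complex set" +
 assumes V_sub: "V \<subseteq> F" and val: "z \<in> F ==> z \<in> V \<or> inverse z \<in> V"
begin

abbreviation "\<mm> \<equiv> mx V"

lemma max_sub: "z \<in> \<mm> ==> z \<in> V"
 by (simp add: maximal_ideal_def)

lemma max_0 [simp]: "0 \<in> \<mm>"
 by (simp add: maximal_ideal_def)

lemma max_1 [simp]: "1 \<notin> \<mm>"
 by (simp add: maximal_ideal_def)

lemma in_F: "z \<in> V ==> z \<in> F"
 using V_sub by blast

lemma max_mult: "z \<in> \<mm> ==> w \<in> V ==> z*w \<in> \<mm>"
proof -
 assume *: "z \<in> \<mm>" "w \<in> V"
 have False if "z*w ~= 0" "inverse (z*w) \<in> V"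
 proof -
  have "inverse z = w*inverse (z*w)" using that by (auto simp: field_simps)
  then have "inverse z \<in> V" using * that V.mult_closed by metis
  then show False using * that by (auto simp: maximal_ideal_def)
 qed
 then show ?thesis using * by (auto simp: maximal_ideal_def)
qed

lemma max_mult': "z \<in> \<mm> ==> w \<in> V ==> w*z \<in> \<mm>"
 by (subst mult.commute) (rule max_mult)

lemma max_uminus: "z \<in> \<mm> ==> - z \<in> \<mm>"
 using max_mult[of z "- 1"] by simp

lemma unit_or_max: "z \<in> V ==> z \<notin> \<mm> ==> z ~= 0 \<and> inverse z \<in> V"
 by (auto simp: maximal_ideal_def)

lemma max_inverse: "z \<in> F ==> z \<notin> V ==> inverse z \<in> \<mm>"
 using val[of z] by (auto simp: maximal_ideal_def)

text \<open>One of \<open>z / w\<close> and \<open>w / z\<close> lies in \<open>V\<close>, so the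
  summand of lower order can be factored out.\<close>

lemma max_add: "z \<in> \<mm> ==> w \<in> \<mm> ==> z + w \<in> \<mm>"
proof -
 have *: "z + w \<in> \<mm>" if "z \<in> \<mm>" "w \<in> \<mm>" "z / w \<in> V" "w ~= 0" for z w
 proof -
  have "z + w = w*(1 + z / w)" using that by (simp add: field_simps)
  then show ?thesis using max_mult[of w "1 + z / w"] that by simp
 qed
 assume "z \<in> \<mm>" "w \<in> \<mm>"
 then show ?thesis
  using *[of z w] *[of w z] val[of "z / w"] in_F max_sub
  by (cases "z = 0"; cases "w = 0") (auto simp: add.commute)
qed

lemma max_diff: "z \<in> \<mm> ==> w \<in> \<mm> ==> z - w \<in> \<mm>"
 using max_add[of z "- w"] max_uminus[of w] by simp

lemma max_prime: "z*w \<in> \<mm> ==> z \<in> V ==> w \<in> V ==> z \<in> \<mm> \<or> w \<in> \<mm>"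
 by (auto simp: maximal_ideal_def)

lemma max_power_iff: "n > 0 ==> z \<in> V ==> z^n \<in> \<mm> \<longleftrightarrow> z \<in> \<mm>"
proof
 show "z^n \<in> \<mm> ==> z \<in> V ==> z \<in> \<mm>" by (induction n) (auto dest: max_prime)
 show "n > 0 ==> z \<in> V ==> z \<in> \<mm> ==> z^n \<in> \<mm>" by (cases n) (auto intro: max_mult)
qed

lemma unit_add_max: "z \<in> V ==> z \<notin> \<mm> ==> w \<in> \<mm> ==> z + w \<notin> \<mm>"
 using max_diff[of "z + w" w] by auto

lemma unit_mult: "z \<in> V ==> z \<notin> \<mm> ==> w \<in> V ==> w \<notin> \<mm> ==> z*w \<notin> \<mm>"
 using max_prime by blast

lemma unit_inverse: "z \<in> V ==> z \<notin> \<mm> ==> inverse z \<in> V \<and> inverse z \<notin> \<mm>"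
 by (auto simp: maximal_ideal_def)

lemma not_in_V_iff: "z \<in> F ==> z \<notin> V \<longleftrightarrow> z ~= 0 \<and> inverse z \<in> \<mm>"
 using max_inverse[of z] by (auto simp: maximal_ideal_def)

text \<open>Integral closedness for roots of elements of \<open>V\<close>. If \<open>z\<close> were
  outside, its inverse would lie in the maximal ideal, and so would 1, the product of the powers of
  \<open>z\<close> and of its inverse.\<close>

lemma integral_closed:
 assumes "z \<in> F" "z^Suc n \<in> V"
 shows "z \<in> V"
proof (rule ccontr)
 assume nz: "z \<notin> V"
 then have "inverse z \<in> \<mm>" "z ~= 0" using not_in_V_iff assms by auto
 then have "inverse z^Suc n \<in> \<mm>" using max_power_iff max_sub by blast
 then have "inverse z^Suc n*z^Suc n \<in> \<mm>" using assms max_mult by blast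
 then show False using \<open>z ~= 0\<close> by (simp add: power_inverse del: power_Suc)
qed

end

section \<open>Chevalley's theorem: a proper ideal of a subring extends to a valuation ring\<close>

inductive_set ideal_span :: "complex set \<Rightarrow> complex set \<Rightarrow> complex set" for I R where
 zero: "0 \<in> ideal_span I R"
| step: "s \<in> ideal_span I R ==> i \<in> I ==> r \<in> R ==> i*r + s \<in> ideal_span I R"

lemma ideal_span_mono: "z \<in> ideal_span I R ==> R \<subseteq> S ==> z \<in> ideal_span I S"
 by (induction rule: ideal_span.induct) (auto intro: ideal_span.intros)

lemma ideal_span_Union:
 assumes "z \<in> ideal_span I (\<Union>C)" "C ~= {}" "\<And>R S. R \<in> C ==> S \<in> C ==> R \<subseteq> S \<or> S \<subseteq> R"
 shows "\<exists>R\<in>C. z \<in> ideal_span I R"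
 using assms(1)
proof induction
 case zero
 then show ?case using assms(2) by (auto intro: ideal_span.zero)
next
 case (step s i r)
 then obtain R S where "R \<in> C" "s \<in> ideal_span I R" "S \<in> C" "r \<in> S" by blast
 then show ?case using assms(3)[of R S] step.hyps ideal_span_mono
  by (metis (no_types, lifting) ideal_span.step subsetD)
qed

context csubring
begin

lemma ideal_span_add: "z \<in> ideal_span I R ==> w \<in> ideal_span I R ==> z + w \<in> ideal_span I R"
 by (induction rule: ideal_span.induct) (auto simp: add.assoc intro: ideal_span.intros)

lemma ideal_span_mult: "z \<in> ideal_span I R ==> w \<in> R ==> z*w \<in> ideal_span I R"
 by (induction rule: ideal_span.induct) (auto simp: ring_distribs mult.assoc intro: ideal_span.intros)

lemma ideal_span_incl: "i \<in> I ==> i \<in> ideal_span I R"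
 using ideal_span.step[OF ideal_span.zero, of i I 1] by simp

lemma ideal_span_subset: "z \<in> ideal_span I R ==> I \<subseteq> R ==> z \<in> R"
 by (induction rule: ideal_span.induct) auto

lemma polys_ideal_span_add: "p \<in> polys (ideal_span I R) ==> q \<in> polys (ideal_span I R) ==> p + q \<in> polys (ideal_span I R)"
 by (auto simp: polys_def ideal_span_add)

lemma polys_ideal_span_mult: "p \<in> polys (ideal_span I R) ==> q \<in> polys R ==> p*q \<in> polys (ideal_span I R)"
proof -
 have "sum f A \<in> ideal_span I R" if "\<And>k. k \<in> A ==> f k \<in> ideal_span I R" for f and A :: "nat set"
  using that by (induction A rule: infinite_finite_induct) (auto intro: ideal_span.zero ideal_span_add)
 then show "p \<in> polys (ideal_span I R) ==> q \<in> polys R ==> p*q \<in> polys (ideal_span I R)"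
  by (auto simp: polys_def coeff_mult ideal_span_mult)
qed

lemma csubring_adjoin: "csubring {poly p z |p. p \<in> polys R}"
proof
 show "1 \<in> {poly p z |p. p \<in> polys R}" by (auto intro!: exI[of _ 1])
next
 fix a b assume "a \<in> {poly p z |p. p \<in> polys R}" "b \<in> {poly p z |p. p \<in> polys R}"
 then obtain p q where "p \<in> polys R" "q \<in> polys R" "a = poly p z" "b = poly q z" by blast
 then show "a + b \<in> {poly p z |p. p \<in> polys R}" "a * b \<in> {poly p z |p. p \<in> polys R}"
  "- a \<in> {poly p z |p. p \<in> polys R}"
  by (auto intro: exI[of _ "p + q"] exI[of _ "p*q"] exI[of _ "- p"])
qed

lemma ideal_span_adjoin:
 assumes "w \<in> ideal_span I {poly p z |p. p \<in> polys R}"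
 shows "\<exists>p\<in>polys (ideal_span I R). w = poly p z"
 using assms
proof induction
 case zero
 then show ?case by (intro bexI[of _ 0]) (auto simp: polys_def intro: ideal_span.zero)
next
 case (step s i r)
 then obtain p q where "p \<in> polys (ideal_span I R)" "s = poly p z" "q \<in> polys R" "r = poly q z" by blast
 moreover have "[:i:]*q \<in> polys (ideal_span I R)" using step \<open>q \<in> polys R\<close>
  by (auto simp: polys_def ideal_span_incl ideal_span_mult)
 ultimately show ?case by (intro bexI[of _ "[:i:]*q + p"] polys_ideal_span_add) auto
qed

text \<open>One step of the descent in Chevalley's theorem: the relation for the inverse of \<open>z\<close>
 lowers the degree of the relation for \<open>z\<close>.\<close>

lemma chevalley_step:
 assumes I: "I \<subseteq> R" and p: "p \<in> polys (ideal_span I R)" "poly p z = 1"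
  and q: "q \<in> polys (ideal_span I R)" "poly q (inverse z) = 1"
  and z: "z ~= 0" and deg: "degree q \<le> degree p" "degree p > 0"
 shows "\<exists>p'\<in>polys (ideal_span I R). poly p' z = 1 \<and> degree p' < degree p"
proof -
 define n where "n = degree p"
 define r where "r = (\<Sum>k\<in>{1..degree q}. Polynomial.monom (coeff q k) (n - k))"
 have J: "c \<in> R" if "c \<in> ideal_span I R" for c using ideal_span_subset[OF _ I] that by blast
 have qR: "q \<in> polys R" using q J by (auto simp: polys_def)
 have rR: "r \<in> polys R" using qR by (auto simp: polys_def r_def coeff_sum intro!: sum_closed)
 define q0 where "q0 = coeff q 0"
 define b where "b = p - Polynomial.monom (lead_coeff p) n"
 have bJ: "b \<in> polys (ideal_span I R)"
  using p by (auto simp: polys_def b_def n_def ideal_span.zero)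
 have degb: "degree b < n"
 proof (cases "b = 0")
  case False
  have "degree b \<le> n" unfolding b_def n_def by (rule degree_diff_le) (auto simp: degree_monom_le)
  moreover have "coeff b n = 0" by (simp add: b_def n_def)
  ultimately show ?thesis using False by (metis leading_coeff_0_iff order_less_le)
 qed (use deg n_def in auto)
 have degr: "degree r \<le> n - 1" unfolding r_def
 proof (intro degree_sum_le)
  fix k assume "k \<in> {1..degree q}"
  then show "degree (Polynomial.monom (coeff q k) (n - k)) \<le> n - 1"
   using degree_monom_le[of "coeff q k" "n - k"] by auto
 qed auto
 have "poly q (inverse z) = (\<Sum>k\<le>degree q. coeff q k*inverse z^k)" by (simp add: poly_altdef)
 also have "{..degree q} = insert 0 {1..degree q}" by auto
 finally have "1 = q0 + (\<Sum>k\<in>{1..degree q}. coeff q k*inverse z^k)" using q by (simp add: q0_def)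
 then have "1 - q0 = (\<Sum>k\<in>{1..degree q}. coeff q k*inverse z^k)" by (metis add_diff_cancel_left')
 then have "(1 - q0)*z^n = (\<Sum>k\<in>{1..degree q}. coeff q k*inverse z^k)*z^n" by (simp only:)
 also have "\<dots> = poly r z" unfolding r_def poly_sum sum_distrib_right poly_monom
 proof (intro sum.cong refl)
  fix k assume "k \<in> {1..degree q}"
  then have "k \<le> n" using deg n_def by auto
  then show "coeff q k*inverse z^k*z^n = coeff q k*z^(n - k)"
   using z by (simp add: power_diff power_inverse divide_inverse)
 qed
 finally have r: "poly r z = (1 - q0)*z^n" by simp
 \<comment> \<open>Multiplying \<open>p(z) = 1\<close> by \<open>1 - q0\<close> leaves the top term
   \<open>lead_coeff p * (1 - q0) * z^n\<close>, and \<open>(1 - q0) * z^n\<close> is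
   \<open>r(z)\<close> with \<open>r\<close> of degree below \<open>n\<close>. Adding
   \<open>q0\<close> restores the value 1.\<close>
 define p' where "p' = b*[:1 - q0:] + [:lead_coeff p:]*r + [:q0:]"
 have const: "[:c:] \<in> polys (ideal_span I R)" if "c \<in> ideal_span I R" for c
  using that ideal_span.zero by (auto simp: polys_def coeff_pCons split: nat.split)
 have "p' \<in> polys (ideal_span I R)" unfolding p'_def
  using bJ p q rR J const[OF polysD[OF p(1)]] const[OF polysD[OF q(1)]]
  by (intro polys_ideal_span_add polys_ideal_span_mult) (auto simp: q0_def polysD)
 moreover have "poly p' z = 1"
 proof -
  have "poly p' z = (1 - lead_coeff p*z^n)*(1 - q0) + lead_coeff p*((1 - q0)*z^n) + q0"
   unfolding p'_def using p(2) r by (simp add: b_def poly_monom)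
  then show ?thesis by (simp add: algebra_simps)
 qed
 moreover have "degree p' < n" unfolding p'_def
 proof (intro degree_add_less)
  show "degree (b*[:1 - q0:]) < n" using degb degree_mult_le[of b "[:1 - q0:]"] by simp
  show "degree ([:lead_coeff p:]*r) < n" using degr degree_mult_le[of "[:lead_coeff p:]" r] deg n_def by auto
  show "degree [:q0:] < n" using deg n_def by simp
 qed
 ultimately show ?thesis unfolding n_def by blast
qed

end

text \<open>Zorn's lemma gives a maximal subring \<open>V\<close> in which \<open>I\<close> still
  generates a proper ideal. If neither \<open>z\<close> nor its inverse were in \<open>V\<close>,
  adjoining either one would make 1 a polynomial in it with coefficients in \<open>I V\<close>; of
  the two least degrees, the one that is not smaller could be lowered by
  \<open>chevalley_step\<close>.\<close>

theorem chevalley: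
 assumes F: "csubfield F" and R: "csubring R" "R \<subseteq> F" and I: "I \<subseteq> R" "1 \<notin> ideal_span I R"
 obtains V where "valring F V" "R \<subseteq> V" "I \<subseteq> mx V"
proof -
 interpret F: csubfield F by fact
 define A where "A = {V. csubring V \<and> R \<subseteq> V \<and> V \<subseteq> F \<and> 1 \<notin> ideal_span I V}"
 have "\<exists>T\<in>A. \<forall>U\<in>A. T \<subseteq> U \<longrightarrow> U = T"
 proof (rule subset_Zorn_nonempty)
  show "A ~= {}" using assms by (auto simp: A_def)
 next
  fix C assume C: "C ~= {}" "subset.chain A C"
  have ch: "S \<subseteq> T \<or> T \<subseteq> S" if "S \<in> C" "T \<in> C" for S T
   using C(2) that by (auto simp: subset.chain_def)
  have mem: "csubring S" "R \<subseteq> S" "S \<subseteq> F" "1 \<notin> ideal_span I S" if "S \<in> C" for S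
   using C(2) that by (auto simp: subset.chain_def A_def)
  have two: "\<exists>S\<in>C. z \<in> S \<and> w \<in> S" if "z \<in> \<Union>C" "w \<in> \<Union>C" for z w using that ch by blast
  have "csubring (\<Union>C)"
  proof
   obtain S where "S \<in> C" using C by blast
   then show "1 \<in> \<Union>C" using mem(1) csubring.one_closed by blast
  next
   fix z w assume "z \<in> \<Union>C" "w \<in> \<Union>C"
   then obtain S where S: "S \<in> C" "z \<in> S" "w \<in> S" using two by blast
   then interpret csubring S using mem by blast
   show "z + w \<in> \<Union>C" "z*w \<in> \<Union>C" "- z \<in> \<Union>C"
    using S add_closed[of z w] mult_closed[of z w] uminus_closed[of z] by blast+
  qed
  moreover have "1 \<notin> ideal_span I (\<Union>C)" using ideal_span_Union[OF _ C(1) ch] mem(4) by metis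
  moreover have "\<Union>C \<subseteq> F" using mem(3) by (intro Union_least)
  moreover have "R \<subseteq> \<Union>C"
  proof -
   obtain S where "S \<in> C" using C by blast
   then show ?thesis using mem(2)[of S] Union_upper[of S C] by (rule_tac order.trans)
  qed
  ultimately show "\<Union>C \<in> A" unfolding A_def by simp
 qed
 then obtain V where "V \<in> A" and max: "\<And>U. U \<in> A ==> V \<subseteq> U ==> U = V" by metis
 then have V: "csubring V" "R \<subseteq> V" "V \<subseteq> F" "1 \<notin> ideal_span I V" unfolding A_def by simp_all
 interpret V: csubring V by fact
 have IV: "I \<subseteq> V" using I V by blast
 have ex: "\<exists>p\<in>polys (ideal_span I V). poly p z = 1" if "z \<in> F" "z \<notin> V" for z
 proof -
  define U where "U = {poly p z |p. p \<in> polys V}"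
  have U1: "V \<subseteq> U" 
  proof
   fix v assume "v \<in> V"
   then show "v \<in> U" unfolding U_def by (intro CollectI exI[of _ "[:v:]"]) auto
  qed
  have U2: "z \<in> U" unfolding U_def by (intro CollectI exI[of _ "[:0, 1:]"]) auto
  have U3: "U \<subseteq> F"
  proof
   fix w assume "w \<in> U"
   then obtain p where "p \<in> polys V" "w = poly p z" unfolding U_def by blast
   then show "w \<in> F" using that(1) polys_mono[OF V(3)] F.poly_closed by auto
  qed
  have "U \<notin> A" using max[OF _ U1] that(2) U2 by metis
  moreover have "R \<subseteq> U" using V(2) U1 by (rule order.trans)
  moreover have "csubring U" unfolding U_def by (rule V.csubring_adjoin)
  ultimately have "1 \<in> ideal_span I U"
   using U3 unfolding A_def by simp
  from V.ideal_span_adjoin[OF this[unfolded U_def]] show ?thesis by metis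
 qed
 have val: "z \<in> V \<or> inverse z \<in> V" if z: "z \<in> F" for z
 proof (rule ccontr)
  assume contra: "\<not> (z \<in> V \<or> inverse z \<in> V)"
  then have z0: "z ~= 0" by auto
  define deg where "deg w = (LEAST n. \<exists>p\<in>polys (ideal_span I V). poly p w = 1 \<and> degree p = n)" for w
  have degE: "\<exists>p\<in>polys (ideal_span I V). poly p w = 1 \<and> degree p = deg w" if "w \<in> F" "w \<notin> V" for w
  proof -
   from ex[OF that] obtain p where "p \<in> polys (ideal_span I V)" "poly p w = 1" by metis
   then have "\<exists>n. \<exists>p\<in>polys (ideal_span I V). poly p w = 1 \<and> degree p = n"
    by (intro exI[of _ "degree p"] bexI[of _ p]) auto
   then show ?thesis unfolding deg_def by (rule LeastI_ex)
  qed
  have degL: "deg w \<le> degree p" if "p \<in> polys (ideal_span I V)" "poly p w = 1" for w p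
   unfolding deg_def using that by (intro Least_le bexI[of _ p]) auto
  have pos: "degree p > 0" if "p \<in> polys (ideal_span I V)" "poly p w = 1" for p w
  proof (rule ccontr)
   assume "\<not> degree p > 0"
   then have "poly p w = coeff p 0" by (auto elim!: degree_eq_zeroE)
   then show False using that(2) polysD[OF that(1), of 0] V(4) by simp
  qed
  have *: "\<not> deg (inverse w) \<le> deg w" if w: "w \<in> F" "w \<notin> V" "inverse w \<notin> V" "w ~= 0" for w
  proof
   assume le: "deg (inverse w) \<le> deg w"
   obtain p where p: "p \<in> polys (ideal_span I V)" "poly p w = 1" "degree p = deg w"
    using degE[OF w(1,2)] by metis
   obtain q where q: "q \<in> polys (ideal_span I V)" "poly q (inverse w) = 1" "degree q = deg (inverse w)"
    using degE[of "inverse w"] w by auto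
   have "degree q \<le> degree p" using le p(3) q(3) by simp
   from V.chevalley_step[OF IV p(1,2) q(1,2) w(4) this pos[OF p(1,2)]]
   obtain p' where "p' \<in> polys (ideal_span I V)" "poly p' w = 1" "degree p' < degree p" by metis
   then show False using degL[of p' w] p(3) by simp
  qed
  have "\<not> deg (inverse z) \<le> deg z" by (rule *) (use z contra z0 in auto)
  moreover have "\<not> deg (inverse (inverse z)) \<le> deg (inverse z)" by (rule *) (use z contra z0 in auto)
  ultimately show False by simp
 qed
 show ?thesis
 proof (rule that)
  show "valring F V" using V val by (intro valring.intro valring_axioms.intro F) auto
  show "R \<subseteq> V" by fact
  show "I \<subseteq> mx V"
  proof
   fix i assume i: "i \<in> I"
   have False if "i ~= 0" "inverse i \<in> V"
    using V.ideal_span_mult[OF V.ideal_span_incl[OF i] that(2)] that V(4) by simp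
   then show "i \<in> mx V" using i IV by (auto simp: maximal_ideal_def)
  qed
 qed
qed

section \<open>Discrete valuation rings\<close>

text \<open>Discreteness is required as a representation \<open>t powi n * u\<close>: this is the
  form in which uniformizers are found for the places below and in which \<open>ord_at\<close> is
  evaluated.\<close>

locale dvr = valring +
 fixes t :: complex
 assumes t_max: "t \<in> \<mm>" and t_nz: "t ~= 0"
  and t_repr: "z \<in> F ==> z ~= 0 ==> \<exists>n u. u \<in> V \<and> u \<notin> \<mm> \<and> z = t powi n*u"
begin

lemma powi_unit: "u \<in> V ==> u \<notin> \<mm> ==> u powi n \<in> V \<and> u powi n \<notin> \<mm>"
proof -
 have *: "w^k \<in> V \<and> w^k \<notin> \<mm>" if "w \<in> V" "w \<notin> \<mm>" for w k
  using that by (induction k) (auto dest: max_prime)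
 assume "u \<in> V" "u \<notin> \<mm>"
 then show ?thesis using *[of u] *[of "inverse u"] unit_inverse[of u]
  by (auto simp: power_int_def)
qed

lemma repr_pos: "u \<in> V ==> u \<notin> \<mm> ==> t powi n*u \<in> \<mm> \<longleftrightarrow> n > 0"
proof -
 assume u: "u \<in> V" "u \<notin> \<mm>"
 have pos: "t powi m*w \<in> \<mm>" if "m > 0" "w \<in> V" for m w
 proof -
  have "t powi m = t^(nat m)" using that by (simp add: power_int_def)
  then show ?thesis using that t_max max_power_iff[of "nat m" t] max_sub max_mult by auto
 qed
 show ?thesis
 proof
  assume *: "t powi n*u \<in> \<mm>"
  show "n > 0"
  proof (rule ccontr)
   assume "\<not> n > 0"
   then have "t powi (- n) \<in> V" using t_max max_sub by (auto simp: power_int_def)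
   then have "(t powi n*u)*t powi (- n) \<in> \<mm>" using * max_mult by blast
   also have "(t powi n*u)*t powi (- n) = u" using t_nz by (simp add: power_int_minus field_simps)
   finally show False using u by simp
  qed
 qed (use pos u in auto)
qed

lemma repr_nonneg: "u \<in> V ==> u \<notin> \<mm> ==> t powi n*u \<in> V \<longleftrightarrow> n \<ge> 0"
proof
 assume u: "u \<in> V" "u \<notin> \<mm>"
 { assume "t powi n*u \<in> V"
  show "n \<ge> 0"
  proof (rule ccontr)
   assume "\<not> n \<ge> 0"
   then have "t powi (- n)*inverse u \<in> \<mm>" using repr_pos[of "inverse u" "- n"] unit_inverse u by auto
   then have "(t powi n*u)*(t powi (- n)*inverse u) \<in> \<mm>" using \<open>t powi n * u \<in> V\<close> max_mult' by blast
   also have "(t powi n*u)*(t powi (- n)*inverse u) = 1"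
    using t_nz u by (auto simp: power_int_minus field_simps)
   finally show False by simp
  qed }
 { assume "n \<ge> 0"
  then show "t powi n*u \<in> V" using u t_max max_sub by (auto simp: power_int_def) }
qed

lemma uniformizer_t: "uniformizer V t"
 unfolding uniformizer_def
proof
 show "t \<in> V" using t_max max_sub by blast
 show "\<mm> = (*) t ` V"
 proof (intro equalityI subsetI)
  fix z assume z: "z \<in> \<mm>"
  show "z \<in> (*) t ` V"
  proof (cases "z = 0")
   case False
   then obtain n u where u: "u \<in> V" "u \<notin> \<mm>" "z = t powi n*u"
    using t_repr[of z] z max_sub in_F by blast
   then have "n > 0" using repr_pos z by auto
   then have "t powi (n - 1)*u \<in> V" using repr_nonneg u by auto
   moreover have "z = t*(t powi (n - 1)*u)" using u t_nz by (simp add: power_int_diff)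
   ultimately show ?thesis by blast
  qed (auto intro!: image_eqI[of _ _ 0])
 qed (use t_max max_mult in auto)
qed

lemma uniformizer_repr:
 assumes "uniformizer V s"
 obtains e where "e \<in> V" "e \<notin> \<mm>" "s = t*e"
proof -
 have s: "s \<in> V" "\<mm> = (*) s ` V" using assms by (auto simp: uniformizer_def)
 have "1 \<in> V" by simp
 then have "s*1 \<in> \<mm>" unfolding s(2) by (rule imageI)
 then obtain e where e: "e \<in> V" "s = t*e" using uniformizer_t by (auto simp: uniformizer_def)
 obtain d where d: "d \<in> V" "t = s*d" using t_max s(2) by blast
 have "t*(e*d) = s*d" using e(2) by (simp only: mult.assoc)
 then have "t*(e*d) = t*1" using d(2) by simp
 then have "e*d = 1" using t_nz mult_left_cancel by blast
 then have "e \<notin> \<mm>" using d max_mult[of e d] by auto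
 then show ?thesis using that e by blast
qed

text \<open>\<open>ord_at\<close> admits every uniformizer. Two of them differ by a unit, so two
  exponents \<open>n\<close> and \<open>k\<close> give \<open>t powi (k - n) * c = 1\<close> with a
  unit \<open>c\<close>; a positive exponent in this equation or in its inverse would put 1 into the
  maximal ideal.\<close>

lemma ord_at_repr:
 assumes "u \<in> V" "u \<notin> \<mm>"
 shows "ord_at V (t powi n*u) = n"
 unfolding ord_at_def
proof (rule the_equality)
 show "\<exists>s w. uniformizer V s \<and> w \<in> V - \<mm> \<and> t powi n*u = s powi n*w"
  using assms uniformizer_t by blast
next
 fix k assume "\<exists>s w. uniformizer V s \<and> w \<in> V - \<mm> \<and> t powi n*u = s powi k*w"
 then obtain s w where s: "uniformizer V s" "w \<in> V" "w \<notin> \<mm>" "t powi n*u = s powi k*w" by blast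
 obtain e where e: "e \<in> V" "e \<notin> \<mm>" "s = t*e" using uniformizer_repr s by blast
 define c where "c = e powi k*w*inverse u"
 have c: "c \<in> V" "c \<notin> \<mm>" unfolding c_def
  using powi_unit[OF e(1,2), of k] unit_inverse[OF assms] s unit_mult by auto
 have "u ~= 0" using assms by auto
 then have "t powi n = t powi k * c"
  using s(4) e(3) by (simp add: c_def power_int_mult_distrib field_simps)
 then have "t powi (k - n) * c = 1" "t powi (n - k)*inverse c = 1"
  using t_nz c by (auto simp: power_int_diff field_simps)
 then have "\<not> k - n > 0" "\<not> n - k > 0"
  using repr_pos[OF c, of "k - n"] repr_pos[of "inverse c" "n - k"] unit_inverse[OF c] max_1 by metis+
 then show "k = n" by simp
qed

lemma ordE:
 assumes "z \<in> F" "z ~= 0"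
 obtains u where "u \<in> V" "u \<notin> \<mm>" "z = t powi (ord_at V z)*u"
proof -
 from t_repr[OF assms] obtain n u where u: "u \<in> V" "u \<notin> \<mm>" "z = t powi n*u" by metis
 then have "ord_at V z = n" using ord_at_repr by simp
 then show ?thesis using that[of u] u by simp
qed

lemma ord_mult:
 assumes "z \<in> F" "z ~= 0" "w \<in> F" "w ~= 0"
 shows "ord_at V (z*w) = ord_at V z + ord_at V w"
proof -
 obtain u where u: "u \<in> V" "u \<notin> \<mm>" "z = t powi (ord_at V z)*u" using ordE assms(1,2) by blast
 obtain u' where u': "u' \<in> V" "u' \<notin> \<mm>" "w = t powi (ord_at V w)*u'" using ordE assms(3,4) by blast
 have "z*w = t powi (ord_at V z + ord_at V w)*(u*u')"
  by (subst u(3), subst u'(3)) (simp add: power_int_add t_nz)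
 then show ?thesis using ord_at_repr[of "u*u'"] u u' unit_mult by auto
qed

lemma ord_unit: "u \<in> V ==> u \<notin> \<mm> ==> ord_at V u = 0"
 using ord_at_repr[of u 0] by simp

lemma ord_t: "ord_at V t = 1"
 using ord_at_repr[of 1 1] by simp

lemma ord_inverse:
 assumes "z \<in> F" "z ~= 0"
 shows "ord_at V (inverse z) = - ord_at V z"
 using ord_mult[of z "inverse z"] ord_unit[of 1] assms by simp

lemma ord_divide:
 assumes "z \<in> F" "z ~= 0" "w \<in> F" "w ~= 0"
 shows "ord_at V (z / w) = ord_at V z - ord_at V w"
 using ord_mult[of z "inverse w"] ord_inverse[of w] assms by (simp add: divide_inverse)

lemma ord_power: "z \<in> F ==> z ~= 0 ==> ord_at V (z^n) = int n * ord_at V z"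
 by (induction n) (auto simp: ord_unit ord_mult algebra_simps)

lemma ord_pos_iff: "z \<in> F ==> z ~= 0 ==> ord_at V z > 0 \<longleftrightarrow> z \<in> \<mm>"
 by (erule (1) ordE) (metis repr_pos ord_at_repr)

lemma ord_nonneg_iff: "z \<in> F ==> z ~= 0 ==> ord_at V z \<ge> 0 \<longleftrightarrow> z \<in> V"
 by (erule (1) ordE) (metis repr_nonneg ord_at_repr)

lemma ord_uniformizer: "uniformizer V s ==> ord_at V s = 1"
 using ord_at_repr[of _ 1] by (elim uniformizer_repr) auto

end

section \<open>The function field of a Weierstrass curve\<close>

text \<open>\<open>trans\<close> says that \<open>x\<close> is transcendental over \<open>K\<close>;
  together with \<open>y_sq\<close> this makes \<open>K(x, y)\<close> the function field of the
  curve, realized inside the complex numbers.\<close>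

locale ell_ff = csubfield K for K :: "complex set" +
 fixes a b x y :: complex
 assumes a_closed [simp]: "a \<in> K" and b_closed [simp]: "b \<in> K"
  and disc: "4 * a^3 + 27 * b^2 ~= 0"
  and y_sq: "y^2 = x^3 + a*x + b"
  and trans: "p \<in> polys K ==> poly p x = 0 ==> p = 0"
begin

definition "F = generate_field CC (K \<union> {x, y})"

definition "fpoly = [:b, a, 0, 1:]"

text \<open>\<open>el u v\<close> is the general element of the coordinate ring
  \<open>K[x, y]\<close>. Its norm to \<open>K[x]\<close>, \<open>nrm u v\<close>, is kept as a
  polynomial so that its degree and its divisors are available.\<close>

definition "el u v = poly u x + poly v x*y"

definition "nrm u v = u^2 - v^2*fpoly"

lemma poly_f: "poly fpoly z = z^3 + a*z + b"
 by (simp add: fpoly_def algebra_simps power3_eq_cube)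

lemma f_closed [simp]: "fpoly \<in> polys K" and degree_f: "degree fpoly = 3" and f_nz: "fpoly ~= 0"
 by (simp_all add: fpoly_def)

lemma y2: "y*y = poly fpoly x"
 using y_sq by (simp add: poly_f power2_eq_square)

text \<open>A multiple root \<open>z\<close> of \<open>fpoly\<close> forces
  \<open>a = -3 z^2\<close> and \<open>b = 2 z^3\<close>, and then the discriminant
  vanishes.\<close>

lemma f_squarefree: "d^2 dvd fpoly ==> degree d = 0"
proof (rule ccontr)
 assume d: "d^2 dvd fpoly" "degree d ~= 0"
 have "\<not> constant (poly d)" using d(2) by (simp add: constant_degree)
 then obtain z where z: "poly d z = 0"
  using fundamental_theorem_of_algebra[of d] by metis
 from d(1) obtain k where k: "fpoly = d^2 * k" by (rule dvdE)
 have "poly fpoly z = 0" using z by (simp add: k)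
 then have e1: "z^3 + a*z + b = 0" by (simp add: poly_f)
 have "poly (pderiv (d^2 * k)) z = 0" using z
  by (simp add: pderiv_mult power2_eq_square)
 then have "poly (pderiv fpoly) z = 0" by (simp only: k[symmetric])
 then have e2: "a + 3*z^2 = 0" by (simp add: fpoly_def pderiv_pCons square_simps)
 have a: "a = - (3*z^2)" using e2 by (simp add: eq_neg_iff_add_eq_0)
 have b: "b = 2*z^3" using e1 unfolding a by (simp add: power2_eq_square power3_eq_cube algebra_simps)
 have "4 * a^3 + 27 * b^2 = 0" unfolding a b
  by (simp add: power2_eq_square power3_eq_cube algebra_simps)
 then show False using disc by simp
qed

lemma nrm_closed [simp]: "u \<in> polys K ==> v \<in> polys K ==> nrm u v \<in> polys K"
 by (simp add: nrm_def)

lemma nrm_uminus [simp]: "nrm u (- v) = nrm u v"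
 by (simp add: nrm_def)

lemma el_conj: "el u v * el u (- v) = poly (nrm u v) x"
 using y2 by (simp add: el_def nrm_def square_simps)

lemma el_mult: "el u v * el u' v' = el (u*u' + v * v'*fpoly) (u * v' + v * u')"
 using y2 by (simp add: el_def algebra_simps)

lemma el_add: "el u v + el u' v' = el (u + u') (v + v')"
 by (simp add: el_def algebra_simps)

lemma el_smult: "el (r*u) (r * v) = poly r x*el u v"
 by (simp add: el_def algebra_simps)

lemma el_poly: "el u 0 = poly u x"
 by (simp add: el_def)

text \<open>\<open>u^2\<close> has even and \<open>v^2 * fpoly\<close> odd degree, so leading terms
  never cancel. The same parity later gives the pole order at infinity and excludes functions with a
  single simple pole.\<close>

lemma degree_nrm:
 assumes "u ~= 0 \<or> v ~= 0"
 shows "nrm u v ~= 0" "degree (nrm u v) = (if v = 0 then 2*degree u else if u = 0 then 2*degree v + 3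
   else max (2*degree u) (2*degree v + 3))"
proof -
 have du: "degree (u^2) = 2*degree u"
  by (cases "u = 0") (simp_all add: degree_mult_eq power2_eq_square)
 have dv: "degree (v^2*fpoly) = 2*degree v + 3" if "v ~= 0"
  using that f_nz degree_f by (simp add: degree_mult_eq power2_eq_square)
 have "nrm u v ~= 0 \<and> degree (nrm u v) = (if v = 0 then 2*degree u else if u = 0 then 2*degree v + 3
   else max (2*degree u) (2*degree v + 3))"
 proof (cases "v = 0 \<or> u = 0")
  case True
  then show ?thesis using du dv assms f_nz by (auto simp: nrm_def)
 next
  case False
  then have ne: "degree (u^2) ~= degree (v^2*fpoly)" using du dv by presburger
  have e: "nrm u v = u^2 + - (v^2*fpoly)" by (simp add: nrm_def)
  have "degree (nrm u v) = max (degree (u^2)) (degree (v^2*fpoly))"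
   unfolding e using ne degree_add_eq_left[of "- (v^2*fpoly)" "u^2"]
    degree_add_eq_right[of "u^2" "- (v^2*fpoly)"]
   by (cases "degree (u^2) < degree (v^2*fpoly)") auto
  then show ?thesis using False du dv by auto
 qed
 then show "nrm u v ~= 0" "degree (nrm u v) = (if v = 0 then 2*degree u else if u = 0 then 2*degree v + 3
   else max (2*degree u) (2*degree v + 3))" by blast+
qed

lemma el_eq_0: 
 assumes "u \<in> polys K" "v \<in> polys K" "el u v = 0"
 shows "u = 0" "v = 0"
proof -
 have "poly (nrm u v) x = 0" using el_conj[of u v] assms by simp
 then have "nrm u v = 0" using trans assms by simp
 then show "u = 0" "v = 0" using degree_nrm(1)[of u v] by blast+
qed

lemma poly_x_nz: "p \<in> polys K ==> p ~= 0 ==> poly p x ~= 0"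
 using trans by blast

sublocale F: csubfield F
 unfolding F_def by (rule csubfield_generate_field)

lemma K_F: "K \<subseteq> F" and x_F [simp]: "x \<in> F" and y_F [simp]: "y \<in> F"
 using generate_field_subset[of "K \<union> {x, y}"] unfolding F_def by auto

lemma poly_F [simp]: "p \<in> polys K ==> poly p x \<in> F"
 using polys_mono[OF K_F] F.poly_closed x_F by auto

lemma el_F [simp]: "u \<in> polys K ==> v \<in> polys K ==> el u v \<in> F"
 by (simp add: el_def)

text \<open>The fractions form a field, because the product of \<open>el u v\<close> with its
  conjugate is a polynomial in \<open>x\<close>.\<close>

lemma F_repr:
 assumes "z \<in> F"
 obtains u v r where "u \<in> polys K" "v \<in> polys K" "r \<in> polys K" "r ~= 0" "z = el u v / poly r x"
proof -
 define E where "E = {z. \<exists>u\<in>polys K. \<exists>v\<in>polys K. \<exists>r\<in>polys K. r ~= 0 \<and> z = el u v / poly r x}"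
 have EI: "el u v / poly r x \<in> E" if "u \<in> polys K" "v \<in> polys K" "r \<in> polys K" "r ~= 0" for u v r
  unfolding E_def using that by blast
 have "csubfield E"
 proof
  show "1 \<in> E" using EI[of 1 0 1] by (simp add: el_poly)
 next
  fix z w assume "z \<in> E" "w \<in> E"
  then obtain u v r u' v' r' where *: "u \<in> polys K" "v \<in> polys K" "r \<in> polys K" "r ~= 0" "z = el u v / poly r x"
   "u' \<in> polys K" "v' \<in> polys K" "r' \<in> polys K" "r' ~= 0" "w = el u' v' / poly r' x"
   unfolding E_def by blast
  have nz: "poly r x ~= 0" "poly r' x ~= 0" using poly_x_nz[OF *(3,4)] poly_x_nz[OF *(8,9)] .
  have "z + w = (poly r' x*el u v + poly r x*el u' v') / poly (r*r') x"
   unfolding *(5,10) poly_mult add_frac_eq[OF nz] by (simp only: mult.commute)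
  also have "\<dots> = el (r'*u + r*u') (r' * v + r * v') / poly (r*r') x"
   by (simp only: el_smult[symmetric] el_add)
  finally have e: "z + w = el (r'*u + r*u') (r' * v + r * v') / poly (r*r') x" .
  show "z + w \<in> E" unfolding e by (rule EI) (use *(1-4,6-9) in auto)
  have e: "z*w = el (u*u' + v * v'*fpoly) (u * v' + v * u') / poly (r*r') x"
   unfolding *(5,10) el_mult[symmetric] by simp
  show "z*w \<in> E" unfolding e by (rule EI) (use *(1-4,6-9) in auto)
  have e: "- z = el (- u) (- v) / poly r x" unfolding *(5) by (simp add: el_def minus_divide_left)
  show "- z \<in> E" unfolding e by (rule EI) (use *(1-4,6-9) in auto)
  show "inverse z \<in> E"
  proof (cases "z = 0")
   case True
   then show ?thesis using EI[of 0 0 1] by (simp add: el_def)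
  next
   case False
   then have e: "el u v ~= 0" using *(5) by auto
   then have "u ~= 0 \<or> v ~= 0" by (auto simp: el_def)
   then have n: "nrm u v ~= 0" using degree_nrm by blast
   then have "poly (nrm u v) x ~= 0" using poly_x_nz[OF nrm_closed[OF *(1,2)]] by simp
   then have "inverse z = poly r x*el u (- v) / poly (nrm u v) x"
    unfolding *(5) el_conj[of u v, symmetric] using e
    by (cases "el u (- v) = 0") (simp_all add: divide_simps)
   then have e: "inverse z = el (r*u) (r * - v) / poly (nrm u v) x" by (simp only: el_smult)
   show ?thesis unfolding e by (rule EI) (use *(1-4) n in auto)
  qed
 qed
 moreover have "K \<union> {x, y} \<subseteq> E"
 proof -
  have "k \<in> E" if "k \<in> K" for k using EI[of "[:k:]" 0 1] that by (simp add: el_poly)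
  moreover have "x \<in> E" using EI[of "[:0, 1:]" 0 1] by (simp add: el_poly)
  moreover have "y \<in> E" using EI[of 0 1 1] by (simp add: el_def)
  ultimately show ?thesis by blast
 qed
 ultimately have "F \<subseteq> E" unfolding F_def by (rule generate_field_min)
 then show ?thesis using assms that unfolding E_def by blast
qed

subsection \<open>Places\<close>

abbreviation "place V \<equiv> V \<in> places K F"

lemma placeD:
 assumes "place V"
 shows "valring F V" "K \<subseteq> V" "V ~= F"
proof -
 from assms have *: "csubring V" "K \<subset> V" "V \<subset> F" "\<forall>z\<in>F. z \<in> V \<or> inverse z \<in> V"
  by (auto simp: places_def subring_CC_iff)
 then show "valring F V"
  by (intro valring.intro valring_axioms.intro F.csubfield_axioms) auto
 show "K \<subseteq> V" "V ~= F" using * by auto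
qed

lemma x_notin_K: "x \<notin> K"
proof
 assume "x \<in> K"
 then have "[:- x, 1:] \<in> polys K" "poly [:- x, 1:] x = 0" by auto
 then show False using trans by (metis one_neq_zero pCons_eq_0_iff)
qed

lemma placeI:
 assumes "valring F V" "K \<subseteq> V" "V ~= F"
 shows "place V"
proof -
 interpret V: valring F V by fact
 have "K ~= V"
 proof
  assume "K = V"
  then have "x \<in> K \<or> inverse x \<in> K" using V.val[OF x_F] by (simp only:)
  then show False using x_notin_K inverse_closed[of "inverse x"] by auto
 qed
 moreover have "\<forall>z\<in>F. z \<in> V \<or> inverse z \<in> V" using V.val by (intro ballI)
 ultimately show ?thesis using assms(2,3) V.V_sub V.V.csubring_axioms
  unfolding places_def subring_CC_iff by (intro CollectI conjI psubsetI) simp_all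
qed

lemma placeI':
 assumes "valring F V" "K \<subseteq> V" "z \<in> mx V" "z ~= 0"
 shows "place V"
proof -
 interpret V: valring F V by fact
 have "z \<in> F" using assms(3) V.max_sub V.in_F by simp
 then have "inverse z \<in> F" by simp
 moreover have "inverse z \<notin> V" using assms(3,4) by (simp add: maximal_ideal_def)
 ultimately have "V ~= F" by metis
 then show ?thesis using placeI assms by simp
qed

end

text \<open>A place at which \<open>x\<close> is finite. By \<open>dvd_iff\<close>, \<open>p\<close>
  generates the prime ideal of \<open>K[x]\<close> below \<open>V\<close>; it is irreducible over
  \<open>K\<close> and determined up to a constant.\<close>

locale affine = ell_ff K a b x y for K a b x y +
 fixes V p
 assumes plV: "V \<in> places K F" and xV [simp]: "x \<in> V" and pK [simp]: "p \<in> polys K"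
  and degp: "degree p > 0"
  and dvd_iff: "q \<in> polys K ==> poly q x \<in> mx V \<longleftrightarrow> p dvd q"
begin

sublocale V: valring F V
 by (rule placeD(1)[OF plV])

lemma K_V: "c \<in> K ==> c \<in> V"
 using placeD(2)[OF plV] by auto

lemma poly_V [simp]: "q \<in> polys K ==> poly q x \<in> V"
 using polys_mono[OF placeD(2)[OF plV]] V.V.poly_closed xV by auto

lemma y_V [simp]: "y \<in> V"
proof -
 have "y^Suc 1 = poly fpoly x" using y2 by simp
 then have "y^Suc 1 \<in> V" by (simp only: poly_V f_closed)
 then show ?thesis by (rule V.integral_closed[OF y_F])
qed

lemma el_V [simp]: "u \<in> polys K ==> v \<in> polys K ==> el u v \<in> V"
 by (simp add: el_def)

lemma K_unit: "c \<in> K ==> c ~= 0 ==> c \<in> V \<and> c \<notin> mx V"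
 using K_V[of c] K_V[of "inverse c"] by (simp add: maximal_ideal_def)

lemma p_nz: "p ~= 0" using degp by auto

lemma p_max: "poly p x \<in> mx V"
 by (simp add: dvd_iff)

lemma p_prime: "q \<in> polys K ==> r \<in> polys K ==> p dvd q*r ==> p dvd q \<or> p dvd r"
 using V.max_prime[of "poly q x" "poly r x"] by (simp add: dvd_iff[symmetric])

lemma unit_iff: "q \<in> polys K ==> \<not> p dvd q ==> poly q x \<in> V \<and> poly q x \<notin> mx V"
 by (simp add: dvd_iff)

lemma not_p_dvd_1: "\<not> p dvd 1"
 using dvd_iff[of 1] by simp

lemma inv_mod:
 assumes v: "v \<in> polys K" "\<not> p dvd v"
 obtains s where "s \<in> polys K" "p dvd s * v - 1"
proof -
 obtain c s g where g: "c \<in> polys K" "s \<in> polys K" "g \<in> polys K" "g = c*p + s * v" "g ~= 0" "g dvd p" "g dvd v"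
  using polys_bezout[OF pK v(1) p_nz] by metis
 obtain k where k: "k \<in> polys K" "p = g * k" using polys_dvdE[OF pK g(3,6)] .
 have "\<not> p dvd g" using v(2) g(7) dvd_trans by blast
 then have "p dvd k" using p_prime[OF g(3) k(1)] k(2) by simp
 moreover have "k ~= 0" using k(2) p_nz by auto
 ultimately have "degree p \<le> degree k" by (rule dvd_imp_degree_le)
 moreover have "degree p = degree g + degree k" using k(2) g(5) \<open>k ~= 0\<close> by (simp add: degree_mult_eq)
 ultimately have "degree g = 0" by simp
 then obtain e where e: "g = [:e:]" by (rule degree_eq_zeroE)
 then have eK: "e \<in> K" "e ~= 0" using g(3,5) by auto
 have "Polynomial.smult (inverse e) s * v - 1 = Polynomial.smult (inverse e) (s * v - g)"
  using e eK by (simp add: smult_diff_right one_pCons)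
 also have "s * v - g = p * - c" using g(4) by (simp add: algebra_simps)
 finally have "p dvd Polynomial.smult (inverse e) s * v - 1" by (simp add: dvd_smult)
 then show ?thesis using that[of "Polynomial.smult (inverse e) s"] g eK by simp
qed

text \<open>Taking out the common power of \<open>p\<close> leaves a primitive pair, whose order at
  \<open>V\<close> can be read off the norm.\<close>

lemma p_split:
 assumes "u \<in> polys K" "v \<in> polys K" "u ~= 0 \<or> v ~= 0"
 shows "\<exists>n. \<exists>u'\<in>polys K. \<exists>v'\<in>polys K. u = p^n*u' \<and> v = p^n * v' \<and> \<not> (p dvd u' \<and> p dvd v')"
 using assms
proof (induction "degree u + degree v" arbitrary: u v rule: less_induct)
 case less
 show ?case
 proof (cases "p dvd u \<and> p dvd v")
  case False
  then show ?thesis using less.prems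
   by (intro exI[of _ 0] bexI[of _ u] bexI[of _ v]) auto
 next
  case True
  obtain u1 where u1: "u1 \<in> polys K" "u = p*u1" using polys_dvdE[OF less.prems(1) pK] True by blast
  obtain v1 where v1: "v1 \<in> polys K" "v = p * v1" using polys_dvdE[OF less.prems(2) pK] True by blast
  have le: "degree w \<le> degree (p*w)" "w ~= 0 ==> degree w < degree (p*w)" for w
   using p_nz degp by (cases "w = 0"; simp add: degree_mult_eq)+
  have "degree u1 + degree v1 < degree u + degree v"
   using le[of u1] le[of v1] less.prems(3) u1(2) v1(2) p_nz by (cases "u1 = 0") force+
  moreover have "u1 ~= 0 \<or> v1 ~= 0" using less.prems(3) u1 v1 by auto
  ultimately obtain n u' v' where "u' \<in> polys K" "v' \<in> polys K" "u1 = p^n*u'" "v1 = p^n * v'"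
   "\<not> (p dvd u' \<and> p dvd v')" using less.hyps[OF _ u1(1) v1(1)] by metis
  then show ?thesis using u1 v1
   by (intro exI[of _ "Suc n"] bexI[of _ u'] bexI[of _ v']) (auto simp: mult.assoc)
 qed
qed

lemma p_split1:
 assumes "q \<in> polys K" "q ~= 0"
 obtains n q' where "q' \<in> polys K" "q = p^n*q'" "\<not> p dvd q'"
 using p_split[OF assms(1) polys_0] assms(2) p_nz by auto

text \<open>For a primitive pair \<open>v\<close> is invertible modulo \<open>p\<close>, so the
  vanishing of \<open>u + v y\<close> can be solved for \<open>y\<close>: its residue is that of
  \<open>- u / v\<close>, hence of a polynomial \<open>h\<close> in \<open>x\<close>.\<close>

lemma el_in_max_imp:
 assumes uv: "u \<in> polys K" "v \<in> polys K" "\<not> (p dvd u \<and> p dvd v)" and z: "el u v \<in> mx V"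
 shows "\<not> p dvd v" "\<exists>h\<in>polys K. degree h < degree p \<and> y - poly h x \<in> mx V"
proof -
 show nv: "\<not> p dvd v"
 proof
  assume "p dvd v"
  then have "poly v x*y \<in> mx V" using uv dvd_iff V.max_mult y_V by blast
  then have "el u v - poly v x*y \<in> mx V" using z V.max_diff by blast
  then have "p dvd u" using dvd_iff[OF uv(1)] by (simp add: el_def)
  then show False using uv(3) \<open>p dvd v\<close> by blast
 qed
 obtain s where s: "s \<in> polys K" "p dvd s * v - 1" using inv_mod[OF uv(2) nv] .
 obtain k h where h: "k \<in> polys K" "h \<in> polys K" "- (s*u) = p * k + h" "h = 0 \<or> degree h < degree p"
  using polys_euclid[of "- (s*u)" p] s uv p_nz by auto
 have m1: "poly s x*el u v \<in> mx V" using z V.max_mult'[of "el u v" "poly s x"] s by simp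
 have m2: "poly (s * v - 1) x*y \<in> mx V"
  by (rule V.max_mult) (use s(2) dvd_iff[of "s * v - 1"] s(1) uv(2) in simp_all)
 have m3: "poly p x*poly k x \<in> mx V" by (rule V.max_mult[OF p_max]) (use h in simp)
 have "poly (- (s*u)) x = poly (p * k + h) x" using h(3) by simp
 then have hx: "poly h x = - (poly s x*poly u x) - poly p x*poly k x" by simp
 have "y - poly h x = poly s x*el u v - poly (s * v - 1) x*y + poly p x*poly k x"
  unfolding hx by (simp add: el_def algebra_simps)
 also have "\<dots> \<in> mx V" by (intro V.max_add V.max_diff m1 m2 m3)
 finally show "\<exists>h\<in>polys K. degree h < degree p \<and> y - poly h x \<in> mx V"
  using h degp by (intro bexI[of _ h]) auto
qed

lemma el_max_iff_h:
 assumes "u \<in> polys K" "v \<in> polys K" "h \<in> polys K" "y - poly h x \<in> mx V"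
 shows "el u v \<in> mx V \<longleftrightarrow> p dvd u + v * h"
proof -
 have m: "poly v x*(y - poly h x) \<in> mx V" by (rule V.max_mult'[OF assms(4)]) (use assms in simp)
 have e: "el u v = poly (u + v * h) x + poly v x*(y - poly h x)" by (simp add: el_def algebra_simps)
 have "el u v \<in> mx V \<longleftrightarrow> poly (u + v * h) x \<in> mx V"
  using V.max_add[OF _ m, of "poly (u + v * h) x"] V.max_diff[OF _ m, of "el u v"] unfolding e by auto
 then show ?thesis using dvd_iff[of "u + v * h"] assms(1-3) by simp
qed

text \<open>The residue of \<open>y\<close> lies outside \<open>K[x]/(p)\<close>, so the residue
  field is quadratic over it. The other places are ramified (where \<open>y\<close> vanishes) or
  split.\<close>

definition "inert \<longleftrightarrow> \<not> (\<exists>h\<in>polys K. y - poly h x \<in> mx V)"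

lemma el_max_iff_inert:
 assumes "u \<in> polys K" "v \<in> polys K" "inert"
 shows "el u v \<in> mx V \<longleftrightarrow> p dvd u \<and> p dvd v"
proof
 show "el u v \<in> mx V ==> p dvd u \<and> p dvd v"
  using el_in_max_imp(2)[OF assms(1,2)] assms(3) unfolding inert_def by blast
 assume "p dvd u \<and> p dvd v"
 then have "poly u x \<in> mx V" "poly v x \<in> mx V" using dvd_iff assms by auto
 then show "el u v \<in> mx V" unfolding el_def by (intro V.max_add V.max_mult y_V)
qed

lemma y_max_iff: "y \<in> mx V \<longleftrightarrow> p dvd fpoly"
proof -
 have "y^2 = poly fpoly x" using y2 by (simp add: power2_eq_square)
 then show ?thesis using V.max_power_iff[of 2 y] dvd_iff[of fpoly] by simp
qed

lemma ram_cofactor: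
 assumes "y \<in> mx V"
 obtains f1 where "f1 \<in> polys K" "fpoly = p*f1" "\<not> p dvd f1"
proof -
 obtain f1 where f1: "f1 \<in> polys K" "fpoly = p*f1"
  using polys_dvdE[OF f_closed pK] assms y_max_iff by blast
 have "\<not> p dvd f1"
 proof
  assume "p dvd f1"
  then have "p^2 dvd fpoly" using f1(2) by (simp add: power2_eq_square mult_dvd_mono)
  then show False using f_squarefree degp by auto
 qed
 then show ?thesis using that f1 by blast
qed

lemma two_max: "z \<in> V ==> 2*z \<in> mx V ==> z \<in> mx V"
 using V.max_prime[of 2 z] K_unit[of 2] by auto

lemma conj_max:
 assumes uv: "u \<in> polys K" "v \<in> polys K" and "y \<notin> mx V"
  "el u v \<in> mx V" "el u (- v) \<in> mx V"
 shows "p dvd u" "p dvd v"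
proof -
 have "2*poly u x = el u v + el u (- v)" by (simp add: el_def)
 then have "2*poly u x \<in> mx V" using V.max_add assms(4,5) by simp
 then show "p dvd u" using two_max[of "poly u x"] uv dvd_iff by simp
 have "2*(poly v x*y) = el u v - el u (- v)" by (simp add: el_def)
 then have "2*(poly v x*y) \<in> mx V" using V.max_diff assms(4,5) by simp
 then have "poly v x*y \<in> mx V" using two_max[of "poly v x*y"] uv by simp
 then have "poly v x \<in> mx V" using V.max_prime[of "poly v x" y] uv assms(3) by simp
 then show "p dvd v" using uv dvd_iff by simp
qed

text \<open>Where \<open>y\<close> vanishes, \<open>p\<close> divides the squarefree
  \<open>fpoly\<close> exactly once, so \<open>p(x)\<close> is \<open>y^2\<close> up to a
  unit.\<close>

definition "unif = (if y \<in> mx V then y else poly p x)"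

definition "rep z \<longleftrightarrow> (\<exists>n u. u \<in> V \<and> u \<notin> mx V \<and> z = unif powi n*u)"

lemma y_nz: "y ~= 0"
proof
 assume "y = 0"
 then have "poly fpoly x = 0" using y2 by simp
 then show False using poly_x_nz[OF f_closed f_nz] by simp
qed

lemma unif_nz: "unif ~= 0"
 using y_nz poly_x_nz[OF pK p_nz] by (simp add: unif_def)

lemma rep_unit: "u \<in> V ==> u \<notin> mx V ==> rep u"
 unfolding rep_def by (rule exI[of _ 0], rule exI[of _ u]) simp

lemma rep_mult: "rep z ==> rep w ==> rep (z*w)"
proof -
 assume "rep z" "rep w"
 then obtain n u m u' where *: "u \<in> V" "u \<notin> mx V" "z = unif powi n*u"
  "u' \<in> V" "u' \<notin> mx V" "w = unif powi m*u'" unfolding rep_def by metis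
 have "z*w = unif powi (n + m)*(u*u')" unfolding *(3,6) by (simp add: power_int_add unif_nz)
 then show ?thesis unfolding rep_def
  using V.unit_mult[OF *(1,2,4,5)] * by (intro exI[of _ "n + m"] exI[of _ "u*u'"]) simp
qed

lemma rep_inverse: "rep z ==> rep (inverse z)"
proof -
 assume "rep z"
 then obtain n u where *: "u \<in> V" "u \<notin> mx V" "z = unif powi n*u" unfolding rep_def by metis
 have "inverse z = unif powi (- n)*inverse u" unfolding *(3) by (simp add: power_int_minus)
 then show ?thesis unfolding rep_def
  using V.unit_inverse[OF *(1,2)] by (intro exI[of _ "- n"] exI[of _ "inverse u"]) simp
qed

lemma rep_power: "rep z ==> rep (z^n)"
 by (induction n) (auto intro: rep_mult rep_unit)

lemma p_rep: "\<exists>u. u \<in> V \<and> u \<notin> mx V \<and> poly p x = unif powi (if y \<in> mx V then 2 else 1)*u"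
proof (cases "y \<in> mx V")
 case True
 obtain f1 where f1: "f1 \<in> polys K" "fpoly = p*f1" "\<not> p dvd f1" using ram_cofactor[OF True] .
 have u: "poly f1 x \<in> V" "poly f1 x \<notin> mx V" using unit_iff f1 by auto
 then have "poly f1 x ~= 0" using V.max_0 by metis
 moreover have "y^2 = poly p x*poly f1 x" using y2 f1(2) by (simp add: power2_eq_square)
 ultimately have "poly p x = y^2*inverse (poly f1 x)" by (simp add: field_simps)
 then show ?thesis using True V.unit_inverse[OF u] by (intro exI[of _ "inverse (poly f1 x)"]) (simp add: unif_def)
next
 case False
 then show ?thesis by (intro exI[of _ 1]) (simp add: unif_def)
qed

text \<open>If \<open>y\<close> does not vanish at \<open>V\<close>, the conjugate of a primitive
  element of the ideal is a unit, since otherwise both \<open>u\<close> and \<open>v\<close> would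
  be divisible by \<open>p\<close>; so the norm carries the whole order \<open>k\<close>. If
  \<open>y\<close> vanishes, \<open>p\<close> divides \<open>u\<close> but not \<open>v\<close>, the
  norm contains \<open>p\<close> exactly once, and the element is \<open>y\<close> times a
  unit.\<close>

lemma prim_rep:
 assumes uv: "u \<in> polys K" "v \<in> polys K" "\<not> (p dvd u \<and> p dvd v)" and z: "el u v \<in> mx V"
  and n: "n \<in> polys K" "nrm u v = p^k*n" "\<not> p dvd n"
 shows "\<exists>w. w \<in> V \<and> w \<notin> mx V \<and> el u v = unif powi (int k)*w"
proof (cases "y \<in> mx V")
 case False
 then have c: "el u (- v) \<in> V" "el u (- v) \<notin> mx V" using conj_max[OF uv(1,2)] z uv by auto
 define w where "w = poly n x*inverse (el u (- v))"
 have w: "w \<in> V" "w \<notin> mx V" unfolding w_def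
  using V.unit_inverse[OF c] unit_iff[OF n(1,3)] V.unit_mult by auto
 have "el u (- v) ~= 0" using c V.max_0 by metis
 moreover have "el u v * el u (- v) = poly p x^k*poly n x" using el_conj[of u v] n(2) by simp
 ultimately have "el u v = poly p x^k*w" by (simp add: w_def field_simps)
 then show ?thesis using w False by (intro exI[of _ w]) (simp add: unif_def)
next
 case True
 obtain f1 where f1: "f1 \<in> polys K" "fpoly = p*f1" "\<not> p dvd f1" using ram_cofactor[OF True] .
 have nv: "\<not> p dvd v" using el_in_max_imp(1)[OF uv z] .
 have "poly v x*y \<in> mx V" using V.max_mult'[OF True, of "poly v x"] uv by simp
 then have "el u v - poly v x*y \<in> mx V" using z V.max_diff by blast
 then have "p dvd u" using dvd_iff[OF uv(1)] by (simp add: el_def)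
 then obtain u' where u': "u' \<in> polys K" "u = p*u'" using polys_dvdE[OF uv(1) pK] by blast
 define n' where "n' = p*u'^2 - v^2*f1"
 have "p*n' = nrm u v" unfolding n'_def nrm_def f1(2) u'(2) by (simp add: square_simps)
 then have e: "p*n' = p^k*n" using n(2) by simp
 have nn': "\<not> p dvd n'"
 proof
  assume "p dvd n'"
  then have "p dvd p*u'^2 - n'" by simp
  then have "p dvd v^2*f1" by (simp add: n'_def)
  then show False using p_prime[of "v^2" f1] p_prime[of v v] uv f1 nv by (auto simp: power2_eq_square)
 qed
 have "k = 1"
 proof -
  have "k ~= 0" using e n(3) by (metis dvd_triv_left mult_1 power_0)
  moreover have False if k: "k = Suc (Suc j)" for j
  proof -
   have "p*n' = p*(p*(p^j*n))" using e k by (simp add: mult.assoc)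
   then have "n' = p*(p^j*n)" using p_nz by simp
   then show False using nn' by simp
  qed
  ultimately show ?thesis by (metis One_nat_def not0_implies_Suc)
 qed
 have u: "poly f1 x \<in> V" "poly f1 x \<notin> mx V" using unit_iff f1 by auto
 then have f1n: "poly f1 x ~= 0" using V.max_0 by metis
 have "y*y = poly p x*poly f1 x" using y2 f1(2) by simp
 then have px: "poly p x = y*y*inverse (poly f1 x)" using f1n by (simp add: field_simps)
 define w where "w = poly v x + y*(poly u' x*inverse (poly f1 x))"
 have "poly u' x*inverse (poly f1 x) \<in> V" using u' V.unit_inverse[OF u] by simp
 then have "y*(poly u' x*inverse (poly f1 x)) \<in> mx V" by (rule V.max_mult[OF True])
 then have w: "w \<in> V" "w \<notin> mx V" unfolding w_def
  using V.unit_add_max unit_iff[OF uv(2) nv] V.max_sub by auto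
 have "el u v = y*w" unfolding el_def u'(2) poly_mult px w_def by (simp add: algebra_simps)
 then show ?thesis using w True \<open>k = 1\<close> by (intro exI[of _ w]) (simp add: unif_def)
qed

lemma rep_poly:
 assumes "q \<in> polys K" "q ~= 0"
 shows "rep (poly q x)"
proof -
 obtain n q' where q': "q' \<in> polys K" "q = p^n*q'" "\<not> p dvd q'" using p_split1[OF assms] .
 have "rep (poly p x)" using p_rep unfolding rep_def by metis
 then have "rep (poly p x^n*poly q' x)" using rep_mult rep_power rep_unit unit_iff[OF q'(1,3)] by simp
 then show ?thesis using q' by simp
qed

lemma rep_el:
 assumes "u \<in> polys K" "v \<in> polys K" "u ~= 0 \<or> v ~= 0"
 shows "rep (el u v)"
proof -
 obtain n u' v' where *: "u' \<in> polys K" "v' \<in> polys K" "u = p^n*u'" "v = p^n * v'" "\<not> (p dvd u' \<and> p dvd v')"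
  using p_split[OF assms] by metis
 have "rep (el u' v')"
 proof (cases "el u' v' \<in> mx V")
  case True
  have "u' ~= 0 \<or> v' ~= 0" using *(5) by auto
  then have "nrm u' v' ~= 0" by (rule degree_nrm)
  then obtain k m where "m \<in> polys K" "nrm u' v' = p^k*m" "\<not> p dvd m"
   using p_split1[of "nrm u' v'"] *(1,2) nrm_closed by metis
  from prim_rep[OF *(1,2,5) True this] show ?thesis unfolding rep_def by metis
 qed (use rep_unit * in auto)
 moreover have "rep (poly (p^n) x)" by (rule rep_poly) (use p_nz in simp_all)
 ultimately show ?thesis unfolding *(3,4) el_smult using rep_mult by blast
qed

sublocale V: dvr F V unif
proof
 show "unif \<in> mx V" using p_max by (simp add: unif_def)
 show "unif ~= 0" by (rule unif_nz)
 fix z assume z: "z \<in> F" "z ~= 0"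
 obtain u v r where *: "u \<in> polys K" "v \<in> polys K" "r \<in> polys K" "r ~= 0" "z = el u v / poly r x"
  using F_repr[OF z(1)] .
 have "u ~= 0 \<or> v ~= 0" using z(2) *(5) by (auto simp: el_def)
 then have "rep (el u v * inverse (poly r x))"
  using rep_mult rep_inverse rep_poly[OF *(3,4)] rep_el[OF *(1,2)] by simp
 then have "rep z" using *(5) by (simp add: divide_inverse)
 then show "\<exists>n u. u \<in> V \<and> u \<notin> mx V \<and> z = unif powi n*u" unfolding rep_def .
qed

lemma ord_p: "ord_at V (poly p x) = (if y \<in> mx V then 2 else 1)"
 using p_rep V.ord_at_repr by metis

lemma ord_prim:
 assumes "u \<in> polys K" "v \<in> polys K" "\<not> (p dvd u \<and> p dvd v)"
  and "n \<in> polys K" "nrm u v = p^k*n" "\<not> p dvd n"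
 shows "ord_at V (el u v) = (if el u v \<in> mx V then int k else 0)"
proof (cases "el u v \<in> mx V")
 case True
 then show ?thesis using prim_rep[OF assms(1-3) True assms(4-6)] V.ord_at_repr by metis
next
 case False
 then show ?thesis using V.ord_unit assms(1,2) by simp
qed

lemma ord_poly:
 assumes "q \<in> polys K" "q = p^n*q'" "q' \<in> polys K" "\<not> p dvd q'"
 shows "ord_at V (poly q x) = int n*(if y \<in> mx V then 2 else 1)"
proof -
 have "poly q' x ~= 0" using unit_iff[OF assms(3,4)] V.max_0 by metis
 moreover have "poly p x ~= 0" using poly_x_nz[OF pK p_nz] .
 ultimately show ?thesis unfolding assms(2)
  using V.ord_mult[of "poly p x^n" "poly q' x"] V.ord_power[of "poly p x" n] ord_p
   V.ord_unit unit_iff[OF assms(3,4)] assms(3) by simp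
qed

end

context ell_ff
begin

text \<open>\<open>p\<close> is a nonzero polynomial of least degree that vanishes at
  \<open>V\<close>. There is one, as otherwise all denominators would be units at \<open>V\<close>
  and \<open>V\<close> would be all of \<open>F\<close>.\<close>

lemma affine_ex:
 assumes V: "place V" "x \<in> V"
 obtains p where "affine K a b x y V p"
proof -
 interpret V: valring F V using placeD(1)[OF V(1)] .
 have KV: "K \<subseteq> V" using placeD(2)[OF V(1)] .
 have polyV: "poly q x \<in> V" if "q \<in> polys K" for q
  using polys_mono[OF KV] V.V.poly_closed V(2) that by auto
 have yV: "y \<in> V"
 proof -
  have "y^Suc 1 = poly fpoly x" using y2 by simp
  then have "y^Suc 1 \<in> V" by (simp only: polyV f_closed)
  then show ?thesis by (rule V.integral_closed[OF y_F])
 qed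
 define S where "S = {q \<in> polys K. q ~= 0 \<and> poly q x \<in> mx V}"
 have "S ~= {}"
 proof
  assume S: "S = {}"
  have "F \<subseteq> V"
  proof
   fix z assume "z \<in> F"
   then obtain u v r where *: "u \<in> polys K" "v \<in> polys K" "r \<in> polys K" "r ~= 0" "z = el u v / poly r x"
    by (rule F_repr)
   have "poly r x \<notin> mx V" using S * unfolding S_def by blast
   then have "inverse (poly r x) \<in> V" using V.unit_inverse polyV[OF *(3)] by blast
   then show "z \<in> V" unfolding *(5) using polyV *(1,2) yV by (simp add: divide_inverse el_def)
  qed
  then show False using V.V_sub placeD(3)[OF V(1)] by blast
 qed
 then obtain q where "q \<in> S" by blast
 then obtain p where p: "p \<in> S" "\<And>r. r \<in> S ==> degree p \<le> degree r"
  using ex_has_least_nat[of "\<lambda>p. p \<in> S" q degree] by metis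
 then have pS: "p \<in> polys K" "p ~= 0" "poly p x \<in> mx V" unfolding S_def by auto
 show ?thesis
 proof (rule that, unfold_locales)
  show "V \<in> places K F" "x \<in> V" "p \<in> polys K" by (fact V pS)+
  show "degree p > 0"
  proof (rule ccontr)
   assume "\<not> degree p > 0"
   then obtain c where c: "p = [:c:]" by (auto elim: degree_eq_zeroE)
   then have "c \<in> K" "c ~= 0" "c \<in> mx V" using pS by auto
   moreover have "inverse c \<in> V" using KV \<open>c \<in> K\<close> inverse_closed[of c] by blast
   ultimately show False by (simp add: maximal_ideal_def)
  qed
  fix q assume q: "q \<in> polys K"
  show "poly q x \<in> mx V \<longleftrightarrow> p dvd q"
  proof
   assume "p dvd q"
   then obtain k where "k \<in> polys K" "q = p * k" using polys_dvdE q pS by metis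
   then show "poly q x \<in> mx V" using V.max_mult[OF pS(3) polyV[of k]] by simp
  next
   assume m: "poly q x \<in> mx V"
   obtain k r where r: "k \<in> polys K" "r \<in> polys K" "q = p * k + r" "r = 0 \<or> degree r < degree p"
    using polys_euclid[OF q pS(1,2)] .
   have "poly r x = poly q x - poly p x*poly k x" unfolding r(3) by simp
   then have "poly r x \<in> mx V"
    using V.max_diff[OF m V.max_mult[OF pS(3) polyV[OF r(1)]]] by simp
   then have "r = 0" using p(2)[of r] r(2,4) unfolding S_def by (cases "r = 0") auto
   then show "p dvd q" using r(3) by simp
  qed
 qed
qed

text \<open>Chevalley's theorem for the coordinate ring and the ideal generated by
  \<open>q(x)\<close>. This ideal is proper, because 1 and \<open>y\<close> are independent over
  \<open>K[x]\<close> and \<open>q\<close> is not constant.\<close>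

lemma ex_place_over:
 assumes q: "q \<in> polys K" "degree q > 0"
 obtains V where "place V" "x \<in> V" "poly q x \<in> mx V"
proof -
 define R where "R = {el u v |u v. u \<in> polys K \<and> v \<in> polys K}"
 have RI: "el u v \<in> R" if "u \<in> polys K" "v \<in> polys K" for u v using that unfolding R_def by blast
 have "csubring R"
 proof
  show "1 \<in> R" using RI[of 1 0] by (simp add: el_def)
  fix z w assume "z \<in> R" "w \<in> R"
  then obtain u v u' v' where *: "u \<in> polys K" "v \<in> polys K" "z = el u v" "u' \<in> polys K" "v' \<in> polys K" "w = el u' v'"
   unfolding R_def by blast
  show "z + w \<in> R" unfolding *(3,6) el_add by (rule RI) (use * in auto)
  show "z*w \<in> R" unfolding *(3,6) el_mult by (rule RI) (use *(1,2,4,5) in auto)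
  have "- z = el (- u) (- v)" using *(3) by (simp add: el_def)
  then show "- z \<in> R" using RI *(1,2) by simp
 qed
 moreover have "R \<subseteq> F" unfolding R_def by auto
 moreover have "{poly q x} \<subseteq> R" using RI[OF q(1) polys_0] by (simp add: el_def)
 moreover have span: "\<exists>u\<in>polys K. \<exists>v\<in>polys K. z = poly q x*el u v" if "z \<in> ideal_span {poly q x} R" for z
  using that
 proof induction
  case zero
  then show ?case by (intro bexI[of _ 0]) (auto simp: el_def)
 next
  case (step s i r)
  then obtain u v u' v' where *: "u \<in> polys K" "v \<in> polys K" "s = poly q x*el u v"
   "u' \<in> polys K" "v' \<in> polys K" "r = el u' v'" unfolding R_def by blast
  have "i*r + s = poly q x*el (u' + u) (v' + v)"
   using step * by (simp add: el_add[symmetric] distrib_left)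
  then show ?case using * by (intro bexI[of _ "u' + u"] bexI[of _ "v' + v"]) auto
 qed
 moreover have "1 \<notin> ideal_span {poly q x} R"
 proof
  assume "1 \<in> ideal_span {poly q x} R"
  then obtain u v where uv: "u \<in> polys K" "v \<in> polys K" "1 = poly q x*el u v" using span by blast
  then have "el (q*u - 1) (q * v) = 0" by (simp add: el_def algebra_simps)
  then have "q*u = 1" using el_eq_0(1)[of "q*u - 1" "q * v"] uv q by simp
  then have "degree (q*u) = 0" by simp
  moreover have "q ~= 0" "u ~= 0" using \<open>q * u = 1\<close> by auto
  ultimately show False using q(2) by (simp add: degree_mult_eq)
 qed
 ultimately obtain V where V: "valring F V" "R \<subseteq> V" "{poly q x} \<subseteq> mx V"
  using chevalley[OF F.csubfield_axioms, of R "{poly q x}"] by blast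
 have "K \<subseteq> V" 
 proof
  fix c assume "c \<in> K"
  then have "el [:c:] 0 \<in> R" by (intro RI) auto
  then show "c \<in> V" using V(2) by (auto simp: el_def)
 qed
 moreover have "q ~= 0" using q by auto
 ultimately have "place V" using placeI'[of V "poly q x"] V(1,3) poly_x_nz[OF q(1)] by auto
 moreover have "x \<in> V" using RI[of "[:0,1:]" 0] V(2) by (auto simp: el_def)
 ultimately show ?thesis using that V(3) by simp
qed

text \<open>By \<open>ord_prim\<close> the order of a primitive element depends only on its norm and
  on whether it lies in the ideal. So the two places have the same order function, and a valuation
  ring is recovered from its order function.\<close>

lemma affine_eqI:
 assumes "affine K a b x y V p" "affine K a b x y W p"
  and eq: "\<And>u v. u \<in> polys K ==> v \<in> polys K ==> el u v \<in> mx V \<longleftrightarrow> el u v \<in> mx W"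
 shows "V = W"
proof -
 interpret V: affine K a b x y V p by fact
 interpret W: affine K a b x y W p by fact
 have ymax: "y \<in> mx V \<longleftrightarrow> y \<in> mx W" using V.y_max_iff W.y_max_iff by simp
 have op: "ord_at V (poly q x) = ord_at W (poly q x)" if q0: "q \<in> polys K" "q ~= 0" for q
 proof -
  obtain n q' where q': "q' \<in> polys K" "q = p^n*q'" "\<not> p dvd q'" by (rule V.p_split1[OF q0])
  show ?thesis using V.ord_poly[OF q0(1) q'(2,1,3)] W.ord_poly[OF q0(1) q'(2,1,3)] ymax by simp
 qed
 have oel: "ord_at V (el u v) = ord_at W (el u v)" if uv0: "u \<in> polys K" "v \<in> polys K" "u ~= 0 \<or> v ~= 0" for u v
 proof -
  obtain n u' v' where *: "u' \<in> polys K" "v' \<in> polys K" "u = p^n*u'" "v = p^n * v'" "\<not> (p dvd u' \<and> p dvd v')"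
   using V.p_split[OF uv0] by metis
  have nz: "u' ~= 0 \<or> v' ~= 0" using *(5) by auto
  then have "nrm u' v' ~= 0" by (rule degree_nrm)
  then obtain k m where m: "m \<in> polys K" "nrm u' v' = p^k*m" "\<not> p dvd m"
   using V.p_split1[of "nrm u' v'"] *(1,2) nrm_closed by metis
  have "ord_at V (el u' v') = ord_at W (el u' v')"
   using V.ord_prim[OF *(1,2,5) m] W.ord_prim[OF *(1,2,5) m] eq[OF *(1,2)] by simp
  moreover have "el u' v' ~= 0" using el_eq_0[OF *(1,2)] nz by blast
  moreover have "p^n ~= 0" using V.p_nz by simp
  then have "poly (p^n) x ~= 0" "ord_at V (poly (p^n) x) = ord_at W (poly (p^n) x)"
   using poly_x_nz[of "p^n"] op[of "p^n"] V.pK by auto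
  ultimately show ?thesis unfolding *(3,4) el_smult
   using V.V.ord_mult[of "poly (p^n) x" "el u' v'"] W.V.ord_mult[of "poly (p^n) x" "el u' v'"] * by simp
 qed
 have o: "ord_at V z = ord_at W z" if z0: "z \<in> F" "z ~= 0" for z
 proof -
  obtain u v r where *: "u \<in> polys K" "v \<in> polys K" "r \<in> polys K" "r ~= 0" "z = el u v / poly r x"
   using F_repr[OF z0(1)] .
  have nz: "el u v ~= 0" "poly r x ~= 0" "u ~= 0 \<or> v ~= 0" using z0(2) *(5) by (auto simp: el_def)
  show ?thesis unfolding *(5)
   using V.V.ord_divide[OF el_F[OF *(1,2)] nz(1) poly_F[OF *(3)] nz(2)]
    W.V.ord_divide[OF el_F[OF *(1,2)] nz(1) poly_F[OF *(3)] nz(2)] oel[OF *(1,2) nz(3)] op[OF *(3,4)] by simp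
 qed
 have "z \<in> V \<longleftrightarrow> z \<in> W" if "z \<in> F" for z
  using V.V.ord_nonneg_iff[OF that] W.V.ord_nonneg_iff[OF that] o[OF that] by (cases "z = 0") auto
 then show ?thesis using V.V.V_sub W.V.V_sub by blast
qed

end

subsection \<open>The place at infinity\<close>

locale infty = ell_ff K a b x y for K a b x y +
 fixes V
 assumes plV: "V \<in> places K F" and xV: "x \<notin> V"
begin

sublocale V: valring F V
 by (rule placeD(1)[OF plV])

lemma K_V: "c \<in> K ==> c \<in> V"
 using placeD(2)[OF plV] by auto

lemma K_unit: "c \<in> K ==> c ~= 0 ==> c \<in> V \<and> c \<notin> mx V"
 using K_V[of c] K_V[of "inverse c"] by (simp add: maximal_ideal_def)

lemma inv_x_max: "inverse x \<in> mx V"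
 by (rule V.max_inverse[OF x_F xV])

lemma inv_x_V: "inverse x \<in> V" by (rule V.max_sub[OF inv_x_max])

lemma x_nz: "x ~= 0"
 using xV V.V.zero_closed by metis

text \<open>A unit at infinity, as its inverse is \<open>1 + a / x^2 + b / x^3\<close>. Through
  \<open>unif = x / y\<close> it gives \<open>x = unif powi (-2) * w0\<close> and
  \<open>y = unif powi (-3) * w0\<close>, the double and the triple pole.\<close>

definition "w0 = x^3 / y^2"

lemma inverse_w0: "inverse w0 = 1 + inverse x*(a*inverse x + b*inverse x*inverse x)"
proof -
 have "inverse w0 = (x^3 + a*x + b) / x^3" by (simp add: w0_def y_sq)
 also have "\<dots> = (x^3 + a*x + b)*inverse x^3" by (simp only: divide_inverse power_inverse)
 also have "\<dots> = 1 + inverse x*(a*inverse x + b*inverse x*inverse x)"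
 proof -
  have "(x^3 + a*x + b)*i^3 = (x*i)^3 + i*(a*i*(x*i) + b*i*i)" for i
   by (simp add: power3_eq_cube algebra_simps)
  from this[of "inverse x"] show ?thesis using x_nz by simp
 qed
 finally show ?thesis .
qed

lemma w0_unit: "w0 \<in> V" "w0 \<notin> mx V"
proof -
 have "a*inverse x + b*inverse x*inverse x \<in> V" using inv_x_V K_V by simp
 then have "inverse x*(a*inverse x + b*inverse x*inverse x) \<in> mx V"
  by (rule V.max_mult[OF inv_x_max])
 then have "inverse w0 \<in> V" "inverse w0 \<notin> mx V" unfolding inverse_w0
  using V.unit_add_max[of 1] V.max_sub by auto
 then show "w0 \<in> V" "w0 \<notin> mx V" using V.unit_inverse[of "inverse w0"] by auto
qed

lemma y_nz: "y ~= 0"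
 using w0_unit(2) by (auto simp: w0_def)

definition "unif = x / y"

lemma unif_nz: "unif ~= 0" using x_nz y_nz by (simp add: unif_def)

lemma unif_sq: "unif^2 = inverse x*w0"
 using x_nz y_nz by (simp add: unif_def w0_def field_simps power3_eq_cube power2_eq_square)

lemma unif_max: "unif \<in> mx V"
proof -
 have m: "unif^2 \<in> mx V" unfolding unif_sq by (rule V.max_mult[OF inv_x_max w0_unit(1)])
 then have "unif^Suc 1 \<in> V" using V.max_sub by (simp add: numeral_2_eq_2)
 moreover have "unif \<in> F" by (simp add: unif_def)
 ultimately have "unif \<in> V" by (rule V.integral_closed[rotated])
 then show ?thesis using m V.max_power_iff[of 2 unif] by simp
qed

lemma unif_powi_max: "n > 0 ==> u \<in> V ==> unif powi n*u \<in> mx V"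
proof -
 assume *: "n > 0" "u \<in> V"
 have "unif powi n = unif^nat n" using * by (simp add: power_int_def)
 moreover have "unif^nat n \<in> mx V"
  using V.max_power_iff[of "nat n" unif] unif_max V.max_sub * by simp
 ultimately show ?thesis using V.max_mult * by simp
qed

lemma x_rep: "x = unif powi (- 2)*w0"
 using unif_sq x_nz unif_nz w0_unit(2) y_nz
 by (simp add: power_int_minus field_simps w0_def)

lemma y_rep: "y = unif powi (- 3)*w0"
proof -
 have "y = x / unif" using x_nz by (simp add: unif_def)
 also have "\<dots> = (unif powi (- 2)*w0) / unif" using x_rep by (simp only:)
 also have "\<dots> = unif powi (- 3)*w0" using power_int_diff[of unif "- 2" 1] unif_nz by simp
 finally show ?thesis .
qed

lemma unit_power: "u \<in> V ==> u \<notin> mx V ==> u^n \<in> V \<and> u^n \<notin> mx V"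
 by (induction n) (auto dest: V.max_prime)

text \<open>\<open>q(x)\<close> is \<open>x^degree q\<close> times the reversed polynomial at
  \<open>1 / x\<close>, whose constant term is the leading coefficient of \<open>q\<close>, a
  unit.\<close>

lemma poly_rep:
 assumes q: "q \<in> polys K" "q ~= 0"
 obtains u where "u \<in> V" "u \<notin> mx V" "poly q x = unif powi (- 2*int (degree q))*u"
proof -
 define r where "r = reflect_poly q"
 define c where "c = poly r (inverse x)"
 have rK: "coeff r i \<in> K" for i unfolding r_def using q by (auto simp: coeff_reflect_poly polysD)
 obtain r0 r' where r': "r = pCons r0 r'" by (cases r)
 have r0: "r0 = lead_coeff q" using arg_cong[OF r', of "\<lambda>p. coeff p 0"] by (simp add: r_def)
 have "coeff r' i \<in> K" for i using rK[of "Suc i"] unfolding r' by simp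
 then have "poly r' (inverse x) \<in> V"
  using V.V.poly_closed[of r' "inverse x"] inv_x_V K_V by (simp add: polys_def)
 then have "inverse x*poly r' (inverse x) \<in> mx V" by (rule V.max_mult[OF inv_x_max])
 moreover have "r0 \<in> V" "r0 \<notin> mx V" using K_unit[of r0] r0 q by (auto simp: polysD)
 ultimately have c: "c \<in> V" "c \<notin> mx V" unfolding c_def r'
  using V.unit_add_max V.max_sub by auto
 have "poly q x = x^degree q * c"
  using poly_reflect_poly_nz[of "inverse x" q] x_nz by (simp add: c_def r_def power_inverse)
 also have "x^degree q = (unif powi (- 2)*w0)^degree q" using x_rep by simp
 also have "\<dots> = unif powi (- 2*int (degree q))*w0^degree q"
  by (simp only: power_mult_distrib power_int_mult power_int_of_nat)
 finally have "poly q x = unif powi (- 2*int (degree q))*(w0^degree q * c)" by simp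
 moreover have "w0^degree q * c \<in> V" "w0^degree q * c \<notin> mx V"
  using unit_power[OF w0_unit, of "degree q"] c V.unit_mult by auto
 ultimately show ?thesis using that by blast
qed

lemma sum_rep:
 assumes "i < j" "u \<in> V" "u \<notin> mx V" "u' \<in> V"
 obtains w where "w \<in> V" "w \<notin> mx V" "unif powi i*u + unif powi j*u' = unif powi i*w"
proof -
 define w where "w = u + unif powi (j - i)*u'"
 have "unif powi (j - i)*u' \<in> mx V" using assms unif_powi_max by simp
 then have "w \<in> V" "w \<notin> mx V" unfolding w_def using assms V.unit_add_max V.max_sub by auto
 moreover have "unif powi i*u + unif powi j*u' = unif powi i*w"
 proof -
  have "unif powi j = unif powi i*unif powi (j - i)" by (subst power_int_add[symmetric]) (use unif_nz in auto)
  then show ?thesis unfolding w_def by (simp add: distrib_left)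
 qed
 ultimately show ?thesis using that by blast
qed

text \<open>The two terms have poles of the orders \<open>2 * degree u\<close> and
  \<open>2 * degree v + 3\<close>, which are never equal; the larger one dominates and is the degree
  of the norm.\<close>

lemma el_rep:
 assumes "u \<in> polys K" "v \<in> polys K" "u ~= 0 \<or> v ~= 0"
 obtains w where "w \<in> V" "w \<notin> mx V" "el u v = unif powi (- int (degree (nrm u v)))*w"
proof -
 have vy: "\<exists>w. w \<in> V \<and> w \<notin> mx V \<and> poly v x*y = unif powi (- int (2*degree v + 3))*w" if v: "v ~= 0"
 proof -
  obtain w where w: "w \<in> V" "w \<notin> mx V" "poly v x = unif powi (- 2*int (degree v))*w"
   using poly_rep[OF assms(2) v] .
  have "poly v x*y = (unif powi (- 2*int (degree v))*w)*(unif powi (- 3)*w0)"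
   using w(3) y_rep by simp
  also have "\<dots> = (unif powi (- 2*int (degree v))*unif powi (- 3))*(w*w0)" by (simp only: ac_simps)
  also have "unif powi (- 2*int (degree v))*unif powi (- 3) = unif powi (- int (2*degree v + 3))"
   by (subst power_int_add[symmetric]) (use unif_nz in simp_all)
  finally show ?thesis using V.unit_mult[OF w(1,2) w0_unit] w w0_unit by (intro exI[of _ "w*w0"]) simp
 qed
 consider "v = 0" "u ~= 0" | "u = 0" "v ~= 0" | "u ~= 0" "v ~= 0" using assms(3) by blast
 then show ?thesis
 proof cases
  case 1
  obtain w where w: "w \<in> V" "w \<notin> mx V" "poly u x = unif powi (- 2*int (degree u))*w"
   using poly_rep[OF assms(1) 1(2)] .
  have "degree (nrm u v) = 2*degree u" using degree_nrm(2)[OF assms(3)] 1 by simp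
  then show ?thesis using that[OF w(1,2)] w(3) 1 by (simp add: el_def)
 next
  case 2
  have "degree (nrm u v) = 2*degree v + 3" using degree_nrm(2)[OF assms(3)] 2 by simp
  then show ?thesis using vy[OF 2(2)] 2(1) that by (auto simp: el_def)
 next
  case 3
  obtain w where w: "w \<in> V" "w \<notin> mx V" "poly u x = unif powi (- 2*int (degree u))*w"
   using poly_rep[OF assms(1) 3(1)] .
  obtain w' where w': "w' \<in> V" "w' \<notin> mx V" "poly v x*y = unif powi (- int (2*degree v + 3))*w'"
   using vy[OF 3(2)] by metis
  have d: "degree (nrm u v) = max (2*degree u) (2*degree v + 3)" using degree_nrm(2)[OF assms(3)] 3 by simp
  have "2*degree u ~= 2*degree v + 3" by presburger
  then consider "2*degree u > 2*degree v + 3" | "2*degree u < 2*degree v + 3"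
   using nat_neq_iff by blast
  then show ?thesis
  proof cases
   case 1
   then have "- 2*int (degree u) < - int (2*degree v + 3)" by linarith
   from sum_rep[OF this w(1,2) w'(1)] obtain s where s: "s \<in> V" "s \<notin> mx V"
    "unif powi (- 2*int (degree u))*w + unif powi (- int (2*degree v + 3))*w' = unif powi (- 2*int (degree u)) * s" .
   have "el u v = unif powi (- 2*int (degree u)) * s" unfolding el_def w(3) w'(3) by (rule s(3))
   moreover have "- 2*int (degree u) = - int (degree (nrm u v))" using d 1 by simp
   ultimately show ?thesis using that[OF s(1,2)] by simp
  next
   case 2
   then have "- int (2*degree v + 3) < - 2*int (degree u)" by linarith
   from sum_rep[OF this w'(1,2) w(1)] obtain s where s: "s \<in> V" "s \<notin> mx V"
    "unif powi (- int (2*degree v + 3))*w' + unif powi (- 2*int (degree u))*w = unif powi (- int (2*degree v + 3)) * s" .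
   have "el u v = unif powi (- int (2*degree v + 3)) * s" unfolding el_def w(3) w'(3) s(3)[symmetric] by (rule add.commute)
   moreover have "- int (2*degree v + 3) = - int (degree (nrm u v))" using d 2 by simp
   ultimately show ?thesis using that[OF s(1,2)] by simp
  qed
 qed
qed

sublocale V: dvr F V unif
proof
 show "unif \<in> mx V" by (rule unif_max)
 show "unif ~= 0" by (rule unif_nz)
 fix z assume z: "z \<in> F" "z ~= 0"
 obtain u v r where *: "u \<in> polys K" "v \<in> polys K" "r \<in> polys K" "r ~= 0" "z = el u v / poly r x"
  using F_repr[OF z(1)] .
 have "u ~= 0 \<or> v ~= 0" using z(2) *(5) by (auto simp: el_def)
 then obtain w where w: "w \<in> V" "w \<notin> mx V" "el u v = unif powi (- int (degree (nrm u v)))*w"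
  using el_rep[OF *(1,2)] by metis
 obtain w' where w': "w' \<in> V" "w' \<notin> mx V" "poly r x = unif powi (- 2*int (degree r))*w'"
  using poly_rep[OF *(3,4)] .
 have "z = unif powi (- int (degree (nrm u v)) - (- 2*int (degree r)))*(w*inverse w')"
  unfolding *(5) w(3) w'(3) using unif_nz by (simp add: power_int_diff divide_inverse power_int_minus mult_ac)
 moreover have "w*inverse w' \<in> V" "w*inverse w' \<notin> mx V"
  using V.unit_inverse[OF w'(1,2)] V.unit_mult w by auto
 ultimately show "\<exists>n u. u \<in> V \<and> u \<notin> mx V \<and> z = unif powi n*u" by blast
qed

lemma ord_el:
 assumes "u \<in> polys K" "v \<in> polys K" "u ~= 0 \<or> v ~= 0"
 shows "ord_at V (el u v) = - int (degree (nrm u v))"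
 using el_rep[OF assms] V.ord_at_repr by metis

lemma ord_poly:
 assumes "q \<in> polys K" "q ~= 0"
 shows "ord_at V (poly q x) = - 2*int (degree q)"
 using poly_rep[OF assms] V.ord_at_repr by metis

lemma ord_quot:
 assumes "u \<in> polys K" "v \<in> polys K" "u ~= 0 \<or> v ~= 0" "r \<in> polys K" "r ~= 0"
 shows "ord_at V (el u v / poly r x) = 2*int (degree r) - int (degree (nrm u v))"
 using V.ord_divide[of "el u v" "poly r x"] ord_el[OF assms(1-3)] ord_poly[OF assms(4,5)]
  el_eq_0[OF assms(1,2)] assms(3) poly_x_nz[OF assms(4,5)] assms by auto

end

context ell_ff
begin

text \<open>By \<open>ord_quot\<close> the order at a place where \<open>x\<close> has a pole
  depends on degrees only.\<close>

lemma infty_unique: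
 assumes "infty K a b x y V" "infty K a b x y W"
 shows "V = W"
proof -
 interpret V: infty K a b x y V by fact
 interpret W: infty K a b x y W by fact
 have o: "ord_at V z = ord_at W z" if z0: "z \<in> F" "z ~= 0" for z
 proof -
  obtain u v r where *: "u \<in> polys K" "v \<in> polys K" "r \<in> polys K" "r ~= 0" "z = el u v / poly r x"
   using F_repr[OF z0(1)] .
  have nz: "u ~= 0 \<or> v ~= 0" using z0(2) *(5) by (auto simp: el_def)
  show ?thesis unfolding *(5) using V.ord_quot[OF *(1,2) nz *(3,4)] W.ord_quot[OF *(1,2) nz *(3,4)] by simp
 qed
 have "z \<in> V \<longleftrightarrow> z \<in> W" if "z \<in> F" for z
  using V.V.ord_nonneg_iff[OF that] W.V.ord_nonneg_iff[OF that] o[OF that] by (cases "z = 0") auto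
 then show ?thesis using V.V.V_sub W.V.V_sub by blast
qed

text \<open>Chevalley's theorem for \<open>K[1/x]\<close> and the ideal of \<open>1/x\<close>. A
  relation that puts 1 into this ideal would become, with its coefficients reversed, an algebraic
  equation for \<open>x\<close>.\<close>

lemma infty_ex: "\<exists>V. infty K a b x y V"
proof -
 have x0: "x ~= 0" using x_notin_K by auto
 define R where "R = {poly p (inverse x) |p. p \<in> polys K}"
 have Rc: "csubring R" unfolding R_def by (rule csubring_adjoin)
 have RF: "R \<subseteq> F"
 proof
  fix z assume "z \<in> R"
  then obtain p where "p \<in> polys K" "z = poly p (inverse x)" unfolding R_def by blast
  then show "z \<in> F" using polys_mono[OF K_F] F.poly_closed[of p "inverse x"] by auto
 qed
 have KR: "K \<subseteq> R"
 proof
  fix c assume "c \<in> K"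
  then show "c \<in> R" unfolding R_def by (intro CollectI exI[of _ "[:c:]"]) auto
 qed
 have xR: "{inverse x} \<subseteq> R" unfolding R_def by (auto intro!: exI[of _ "[:0, 1:]"])
 have span: "\<exists>p\<in>polys K. z = inverse x*poly p (inverse x)" if "z \<in> ideal_span {inverse x} R" for z
  using that
 proof induction
  case zero
  then show ?case by (intro bexI[of _ 0]) auto
 next
  case (step s i r)
  then obtain p q where "p \<in> polys K" "s = inverse x*poly p (inverse x)" "q \<in> polys K" "r = poly q (inverse x)"
   unfolding R_def by blast
  then show ?case using step by (intro bexI[of _ "q + p"]) (auto simp: algebra_simps)
 qed
 have "1 \<notin> ideal_span {inverse x} R"
 proof
  assume "1 \<in> ideal_span {inverse x} R"
  then obtain p where p: "p \<in> polys K" "1 = inverse x*poly p (inverse x)" using span by blast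
  define q where "q = pCons (- 1) p"
  have q: "q \<in> polys K" "poly q (inverse x) = 0" "q ~= 0" using p by (auto simp: q_def)
  have "poly (reflect_poly q) x = x^degree q*poly q (inverse x)" by (rule poly_reflect_poly_nz[OF x0])
  then have "poly (reflect_poly q) x = 0" using q by simp
  moreover have "reflect_poly q \<in> polys K" using q by (auto simp: polys_def coeff_reflect_poly)
  ultimately have "reflect_poly q = 0" using trans by blast
  then show False using q by simp
 qed
 then obtain V where V: "valring F V" "R \<subseteq> V" "{inverse x} \<subseteq> mx V"
  using chevalley[OF F.csubfield_axioms Rc RF xR] by blast
 have "place V" using placeI'[of V "inverse x"] V KR x0 by auto
 moreover have "x \<notin> V" using V(3) x0 by (auto simp: maximal_ideal_def)
 ultimately show ?thesis using ell_ff_axioms by (intro exI[of _ V] infty.intro infty_axioms.intro)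
qed

definition "Inf_pl = (THE V. infty K a b x y V)"

lemma infty_O: "infty K a b x y Inf_pl"
 unfolding Inf_pl_def using infty_ex infty_unique by (metis theI)

lemma place_O: "place Inf_pl" and x_O: "x \<notin> Inf_pl"
 using infty_O unfolding infty_def infty_axioms_def by auto

lemma place_cases:
 assumes "place V"
 obtains "V = Inf_pl" | p where "affine K a b x y V p"
proof (cases "x \<in> V")
 case True
 then show ?thesis using affine_ex[OF assms] that by metis
next
 case False
 then have "infty K a b x y V" using assms ell_ff_axioms by (intro infty.intro infty_axioms.intro)
 then show ?thesis using infty_unique infty_O that by metis
qed

lemma affine_ne_O: "affine K a b x y V p ==> V ~= Inf_pl"
 using x_O affine.xV by metis

lemma place_dvr:
 assumes "place V"
 obtains t where "dvr F V t"
 using assms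
proof (cases rule: place_cases)
 case 1
 interpret infty K a b x y Inf_pl by (rule infty_O)
 show ?thesis using that V.dvr_axioms 1 by simp
next
 case (2 p)
 interpret affine K a b x y V p by fact
 show ?thesis using that V.dvr_axioms by simp
qed

subsection \<open>The conjugation\<close>

text \<open>The automorphism of \<open>F\<close> over \<open>K(x)\<close> with \<open>y\<close>
  going to \<open>- y\<close>, defined through any fraction that represents \<open>z\<close>;
  \<open>sig_el\<close> shows that the choice does not matter.\<close>

definition "sig z = (THE w. \<exists>u\<in>polys K. \<exists>v\<in>polys K. \<exists>r\<in>polys K. r ~= 0 \<and>
 z = el u v / poly r x \<and> w = el u (- v) / poly r x)"

lemma sig_el:
 assumes "u \<in> polys K" "v \<in> polys K" "r \<in> polys K" "r ~= 0"
 shows "sig (el u v / poly r x) = el u (- v) / poly r x"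
 unfolding sig_def
proof (rule the_equality)
 show "\<exists>u'\<in>polys K. \<exists>v'\<in>polys K. \<exists>r'\<in>polys K. r' ~= 0 \<and> el u v / poly r x = el u' v' / poly r' x \<and>
  el u (- v) / poly r x = el u' (- v') / poly r' x" using assms by blast
next
 fix w assume "\<exists>u'\<in>polys K. \<exists>v'\<in>polys K. \<exists>r'\<in>polys K. r' ~= 0 \<and> el u v / poly r x = el u' v' / poly r' x \<and>
  w = el u' (- v') / poly r' x"
 then obtain u' v' r' where *: "u' \<in> polys K" "v' \<in> polys K" "r' \<in> polys K" "r' ~= 0"
  "el u v / poly r x = el u' v' / poly r' x" "w = el u' (- v') / poly r' x" by blast
 have nz: "poly r x ~= 0" "poly r' x ~= 0" using poly_x_nz assms * by auto
 then have "poly r' x*el u v = poly r x*el u' v'" using *(5) by (simp add: frac_eq_eq mult.commute)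
 then have "el (r'*u - r*u') (r' * v - r * v') = 0" by (simp add: el_def algebra_simps)
 then have "r'*u - r*u' = 0" "r' * v - r * v' = 0" using el_eq_0[of "r'*u - r*u'" "r' * v - r * v'"] assms * by auto
 then have e: "r'*u = r*u'" "r' * v = r * v'" by auto
 have "poly r' x*el u (- v) = poly r x*el u' (- v')" unfolding el_smult[symmetric] using e by simp
 then show "w = el u (- v) / poly r x" unfolding *(6) using nz by (simp add: frac_eq_eq mult.commute)
qed

lemma sigE:
 assumes "z \<in> F"
 obtains u v r where "u \<in> polys K" "v \<in> polys K" "r \<in> polys K" "r ~= 0" "z = el u v / poly r x"
  "sig z = el u (- v) / poly r x"
 using F_repr[OF assms] sig_el by metis

lemma sig_F [simp]: "z \<in> F ==> sig z \<in> F"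
 by (erule sigE) auto

lemma sig_sig: "z \<in> F ==> sig (sig z) = z"
 by (erule sigE) (auto simp: sig_el)

lemma sig_el1: "u \<in> polys K ==> v \<in> polys K ==> sig (el u v) = el u (- v)"
 using sig_el[of u v 1] by simp

lemma sig_poly: "u \<in> polys K ==> sig (poly u x) = poly u x"
 using sig_el1[of u 0] by (simp add: el_poly)

lemma sig_x: "sig x = x" and sig_1: "sig 1 = 1"
 using sig_poly[of "[:0, 1:]"] sig_poly[of 1] by auto

lemma sig_add: "z \<in> F ==> w \<in> F ==> sig (z + w) = sig z + sig w"
 and sig_mult: "z \<in> F ==> w \<in> F ==> sig (z*w) = sig z * sig w"
proof -
 assume "z \<in> F" "w \<in> F"
 obtain u v r where *: "u \<in> polys K" "v \<in> polys K" "r \<in> polys K" "r ~= 0" "z = el u v / poly r x"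
  "sig z = el u (- v) / poly r x" using sigE[OF \<open>z \<in> F\<close>] .
 obtain u' v' r' where **: "u' \<in> polys K" "v' \<in> polys K" "r' \<in> polys K" "r' ~= 0" "w = el u' v' / poly r' x"
  "sig w = el u' (- v') / poly r' x" using sigE[OF \<open>w \<in> F\<close>] .
 have nz: "poly r x ~= 0" "poly r' x ~= 0" using poly_x_nz *(3,4) **(3,4) by auto
 have s: "el u1 v1 / poly r x + el u2 v2 / poly r' x = el (r'*u1 + r*u2) (r' * v1 + r * v2) / poly (r*r') x" for u1 v1 u2 v2
  unfolding el_add[symmetric] el_smult poly_mult add_frac_eq[OF nz] by (simp only: mult.commute)
 have rr: "r*r' \<in> polys K" "r*r' ~= 0" using * ** by auto
 show "sig (z + w) = sig z + sig w"
  unfolding *(6) **(6) unfolding *(5) **(5) s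
  by (subst sig_el) (use *(1-4) **(1-4) in simp_all)
 have m: "(el u1 v1 / poly r x)*(el u2 v2 / poly r' x) = el (u1*u2 + v1 * v2*fpoly) (u1 * v2 + v1*u2) / poly (r*r') x" for u1 v1 u2 v2
  unfolding el_mult[symmetric] by simp
 show "sig (z*w) = sig z * sig w"
  unfolding *(6) **(6) unfolding *(5) **(5) m
  by (subst sig_el) (use *(1-4) **(1-4) in simp_all)
qed

lemma sig_0: "sig 0 = 0"
 using sig_poly[of 0] by simp

lemma sig_eq_0: "z \<in> F ==> sig z = 0 \<longleftrightarrow> z = 0"
 using sig_sig[of z] sig_0 by metis

lemma sig_inverse: "z \<in> F ==> sig (inverse z) = inverse (sig z)"
proof (cases "z = 0")
 case False
 assume z: "z \<in> F"
 then have "sig z * sig (inverse z) = 1" using sig_mult[of z "inverse z"] sig_1 False by simp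
 then show ?thesis by (metis inverse_unique)
qed (simp add: sig_0)

lemma sig_uminus: "z \<in> F ==> sig (- z) = - sig z"
 using sig_mult[of "- 1" z] sig_poly[of "- 1"] by simp

definition "sigp V = {z \<in> F. sig z \<in> V}"

lemma sigp_sigp: "V \<subseteq> F ==> sigp (sigp V) = V"
 by (auto simp: sigp_def sig_sig)

lemma sigp_max: "valring F V ==> z \<in> mx (sigp V) \<longleftrightarrow> z \<in> F \<and> sig z \<in> mx V"
 by (auto simp: sigp_def maximal_ideal_def sig_eq_0 sig_0 sig_inverse)

lemma valring_sigp:
 assumes "valring F V"
 shows "valring F (sigp V)"
proof -
 interpret V: valring F V by fact
 show ?thesis
 proof
  show "sigp V \<subseteq> F" by (auto simp: sigp_def)
  show "1 \<in> sigp V" by (simp add: sigp_def sig_1)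
  fix z assume "z \<in> F"
  then show "z \<in> sigp V \<or> inverse z \<in> sigp V" using V.val[of "sig z"] by (auto simp: sigp_def sig_inverse)
 qed (auto simp: sigp_def sig_add sig_mult sig_uminus)
qed

lemma place_sigp:
 assumes "place V"
 shows "place (sigp V)"
proof (rule placeI)
 note V = placeD[OF assms]
 interpret V: valring F V by fact
 show "valring F (sigp V)" using valring_sigp V by blast
 show "K \<subseteq> sigp V"
 proof
  fix c assume "c \<in> K"
  moreover have "sig c = c" using sig_poly[of "[:c:]"] \<open>c \<in> K\<close> by simp
  ultimately show "c \<in> sigp V" using V(2) K_F by (auto simp: sigp_def)
 qed
 show "sigp V ~= F"
 proof
  assume "sigp V = F"
  have "F \<subseteq> V"
  proof
   fix z assume "z \<in> F"
   then have "sig z \<in> sigp V" using \<open>sigp V = F\<close> by simp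
   then show "z \<in> V" using \<open>z \<in> F\<close> by (simp add: sigp_def sig_sig)
  qed
  then show False using V V.V_sub by blast
 qed
qed

lemma x_sigp: "x \<in> sigp V \<longleftrightarrow> x \<in> V"
 by (simp add: sigp_def sig_x)

lemma sigp_O: "sigp Inf_pl = Inf_pl"
proof -
 have "infty K a b x y (sigp Inf_pl)"
  using place_sigp[OF place_O] x_sigp x_O ell_ff_axioms by (intro infty.intro infty_axioms.intro) auto
 then show ?thesis using infty_unique infty_O by blast
qed

lemma affine_sigp:
 assumes "affine K a b x y V p"
 shows "affine K a b x y (sigp V) p"
proof -
 interpret V: affine K a b x y V p by fact
 show ?thesis
 proof unfold_locales
  show "sigp V \<in> places K F" by (rule place_sigp[OF V.plV])
  show "x \<in> sigp V" by (simp add: x_sigp)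
  show "p \<in> polys K" "0 < degree p" using V.degp by auto
  fix q assume "q \<in> polys K"
  then show "poly q x \<in> mx (sigp V) \<longleftrightarrow> p dvd q"
   by (simp add: sigp_max[OF V.V.valring_axioms] sig_poly V.dvd_iff)
 qed
qed

lemma sig_powi: "z \<in> F ==> sig (z powi n) = sig z powi n"
proof -
 have *: "sig (w^k) = sig w^k" if "w \<in> F" for w k
  using that by (induction k) (auto simp: sig_1 sig_mult)
 assume "z \<in> F"
 then show ?thesis by (auto simp: power_int_def * sig_inverse)
qed

lemma ord_sigp:
 assumes V: "place V" and z: "z \<in> F" "z ~= 0"
 shows "ord_at (sigp V) z = ord_at V (sig z)"
proof -
 obtain t where "dvr F V t" using place_dvr[OF V] .
 then interpret V: dvr F V t .
 have S: "valring F (sigp V)" by (rule valring_sigp[OF V.valring_axioms])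
 have tF: "t \<in> F" using V.t_max V.max_sub V.in_F by blast
 have rep: "\<exists>u. u \<in> sigp V \<and> u \<notin> mx (sigp V) \<and> w = sig t powi (ord_at V (sig w))*u"
  if w: "w \<in> F" "w ~= 0" for w
 proof -
  obtain u where u: "u \<in> V" "u \<notin> mx V" "sig w = t powi (ord_at V (sig w))*u"
   using V.ordE[of "sig w"] sig_eq_0 w by auto
  have uF: "u \<in> F" using u V.in_F by blast
  have "w = sig (sig w)" using sig_sig w by simp
  also have "\<dots> = sig t powi (ord_at V (sig w)) * sig u"
   by (subst u(3)) (simp add: sig_mult sig_powi tF uF)
  finally have "w = sig t powi (ord_at V (sig w)) * sig u" .
  moreover have "sig u \<notin> mx (sigp V)"
   using u uF by (simp add: sigp_max[OF V.valring_axioms] sig_sig)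
  moreover have "sig u \<in> sigp V" using u uF by (simp add: sigp_def sig_sig)
  ultimately show ?thesis by blast
 qed
 interpret S: dvr F "sigp V" "sig t"
 proof (intro dvr.intro S dvr_axioms.intro)
  show "sig t \<in> mx (sigp V)" by (simp add: sigp_max[OF V.valring_axioms] tF sig_sig V.t_max)
  show "sig t ~= 0" using sig_eq_0 tF V.t_nz by blast
 qed (use rep in blast)
 show ?thesis using rep[OF z] S.ord_at_repr by metis
qed

subsection \<open>Finiteness of supports\<close>

text \<open>Both polynomials are irreducible over \<open>K\<close>, and a common complex root makes
  their greatest common divisor nonconstant.\<close>

lemma affine_common_root:
 assumes "affine K a b x y V p" "affine K a b x y W q" "poly p z = 0" "poly q z = 0"
 shows "p dvd q"
proof -
 interpret V: affine K a b x y V p by fact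
 interpret W: affine K a b x y W q by fact
 obtain c s g where g: "c \<in> polys K" "s \<in> polys K" "g \<in> polys K" "g = c*p + s*q" "g ~= 0" "g dvd p" "g dvd q"
  using polys_bezout[OF V.pK W.pK V.p_nz] by metis
 obtain k where k: "k \<in> polys K" "p = g * k" using polys_dvdE[OF V.pK g(3,6)] .
 have "poly g z = 0" using g(4) assms(3,4) by simp
 have "p dvd g \<or> p dvd k" using V.p_prime[OF g(3) k(1)] k(2) by simp
 moreover have False if "p dvd k"
 proof -
  have "k ~= 0" using k(2) V.p_nz by auto
  then have "degree p \<le> degree k" using that dvd_imp_degree_le by blast
  moreover have "degree p = degree g + degree k" using k(2) g(5) \<open>k ~= 0\<close> by (simp add: degree_mult_eq)
  ultimately have "degree g = 0" by simp
  then obtain e where "g = [:e:]" by (rule degree_eq_zeroE)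
  then show False using \<open>poly g z = 0\<close> g(5) by simp
 qed
 ultimately show ?thesis using g(7) dvd_trans by blast
qed

lemma affine_assoc:
 assumes "affine K a b x y V p" "affine K a b x y W q" "p dvd q"
 shows "affine K a b x y W p"
proof -
 interpret V: affine K a b x y V p by fact
 interpret W: affine K a b x y W q by fact
 obtain z where z: "poly p z = 0"
  using fundamental_theorem_of_algebra[of p] V.degp constant_degree[of p] by auto
 then have "poly q z = 0" using assms(3) by (metis dvdE mult_zero_left poly_mult)
 then have "q dvd p" using affine_common_root[OF assms(2,1) _ z] by blast
 then have "q dvd r \<longleftrightarrow> p dvd r" for r using assms(3) dvd_trans by blast
 then show ?thesis
  by unfold_locales (use W.plV W.xV V.pK V.degp W.dvd_iff in auto)
qed

lemma affine_same_h:
 assumes "affine K a b x y V p" "affine K a b x y W p" "h \<in> polys K"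
  "y - poly h x \<in> mx V" "y - poly h x \<in> mx W"
 shows "V = W"
proof -
 interpret V: affine K a b x y V p by fact
 interpret W: affine K a b x y W p by fact
 show ?thesis
  by (rule affine_eqI[OF assms(1,2)]) (simp add: V.el_max_iff_h[OF _ _ assms(3,4)] W.el_max_iff_h[OF _ _ assms(3,5)])
qed

lemma affine_h_cases:
 assumes "affine K a b x y V p" "affine K a b x y W p" "h \<in> polys K" "y - poly h x \<in> mx V"
 shows "W = V \<or> y + poly h x \<in> mx W"
proof -
 interpret V: affine K a b x y V p by fact
 interpret W: affine K a b x y W p by fact
 have e: "(y - poly h x)*(y + poly h x) = poly (fpoly - h^2) x" using y2 by (simp add: square_simps)
 have "(y - poly h x)*(y + poly h x) \<in> mx V" using assms by (intro V.V.max_mult) auto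
 then have "p dvd fpoly - h^2" unfolding e using V.dvd_iff[of "fpoly - h^2"] assms(3) by simp
 then have "(y - poly h x)*(y + poly h x) \<in> mx W"
  unfolding e using W.dvd_iff[of "fpoly - h^2"] assms(3) by simp
 then have "y - poly h x \<in> mx W \<or> y + poly h x \<in> mx W"
  using W.V.max_prime assms(3) by auto
 then show ?thesis using affine_same_h[OF assms(1,2,3,4)] by blast
qed

lemma sigp_h:
 assumes "affine K a b x y V p" "h \<in> polys K"
 shows "y + poly h x \<in> mx (sigp V) \<longleftrightarrow> y - poly h x \<in> mx V"
proof -
 interpret V: affine K a b x y V p by fact
 have e: "y + poly h x = el h 1" "y - poly h x = - el h (- 1)" by (simp_all add: el_def)
 have "sig (el h 1) = el h (- 1)" using sig_el1[of h 1] assms(2) by simp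
 then show ?thesis unfolding e using sigp_max[OF V.V.valring_axioms, of "el h 1"] assms(2)
   V.V.max_uminus[of "el h (- 1)"] V.V.max_uminus[of "- el h (- 1)"] by auto
qed

text \<open>If \<open>y = h\<close> at \<open>V\<close>, then \<open>p\<close> divides
  \<open>fpoly - h^2\<close>, whose value at \<open>x\<close> is \<open>(y - h) (y + h)\<close>; so
  at every place over \<open>p\<close> either \<open>y = h\<close> or \<open>y = - h\<close>, and
  the sign determines the place. If \<open>V\<close> is inert, so is \<open>W\<close>, and then
  membership in the ideals is decided by divisibility by \<open>p\<close> alone.\<close>

lemma affine_over_cases:
 assumes V: "affine K a b x y V p" and W: "affine K a b x y W p"
 shows "W = V \<or> W = sigp V"
proof -
 interpret V: affine K a b x y V p by fact
 interpret W: affine K a b x y W p by fact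
 show ?thesis
 proof (cases "V.inert")
  case False
  then obtain h where h: "h \<in> polys K" "y - poly h x \<in> mx V" unfolding V.inert_def by blast
  consider "W = V" | "y + poly h x \<in> mx W" using affine_h_cases[OF V W h] by blast
  then show ?thesis
  proof cases
   case 2
   have "y - poly (- h) x \<in> mx W" "y - poly (- h) x \<in> mx (sigp V)"
    using 2 sigp_h[OF V h(1)] h by auto
   then show ?thesis using affine_same_h[OF W affine_sigp[OF V], of "- h"] h by simp
  qed blast
 next
  case True
  have "W.inert"
  proof (rule ccontr)
   assume "\<not> W.inert"
   then obtain h where h: "h \<in> polys K" "y - poly h x \<in> mx W" unfolding W.inert_def by blast
   then have "V = W \<or> y + poly h x \<in> mx V" using affine_h_cases[OF W V h] by blast
   then show False using True h unfolding V.inert_def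
    using bspec[of "polys K" _ h] by (metis V.inert_def True diff_minus_eq_add poly_minus polys_uminus)
  qed
  then have "V = W"
   by (intro affine_eqI[OF V W]) (simp add: V.el_max_iff_inert True W.el_max_iff_inert)
  then show ?thesis by simp
 qed
qed

text \<open>Each place is charged to a complex root of its polynomial, which is also a root of
  \<open>q\<close>. Places charged to the same root lie over the same irreducible polynomial, so
  there are at most two of them.\<close>

lemma finite_over:
 assumes "q \<in> polys K" "q ~= 0"
 shows "finite {V. place V \<and> x \<in> V \<and> poly q x \<in> mx V}"
proof -
 define S where "S = {V. place V \<and> x \<in> V \<and> poly q x \<in> mx V}"
 define T where "T z = {V. \<exists>p. affine K a b x y V p \<and> poly p z = 0}" for z
 have "finite (T z)" for z
 proof (cases "T z = {}")
  case False
  then obtain V p where V: "affine K a b x y V p" "poly p z = 0" unfolding T_def by blast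
  have "T z \<subseteq> {V, sigp V}"
  proof
   fix W assume "W \<in> T z"
   then obtain p' where W: "affine K a b x y W p'" "poly p' z = 0" unfolding T_def by blast
   have "p dvd p'" by (rule affine_common_root[OF V(1) W(1) V(2) W(2)])
   then have "affine K a b x y W p" using affine_assoc V W by blast
   then show "W \<in> {V, sigp V}" using affine_over_cases[OF V(1)] by blast
  qed
  then show ?thesis by (rule finite_subset) simp
 qed simp
 moreover have "finite {z. poly q z = 0}" using assms(2) poly_roots_finite by blast
 ultimately have "finite (\<Union>z\<in>{z. poly q z = 0}. T z)" by blast
 moreover have "S \<subseteq> (\<Union>z\<in>{z. poly q z = 0}. T z)"
 proof
  fix V assume V: "V \<in> S"
  then obtain p where p: "affine K a b x y V p" using affine_ex unfolding S_def by blast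
  interpret V: affine K a b x y V p by fact
  obtain z where z: "poly p z = 0"
   using fundamental_theorem_of_algebra[of p] V.degp constant_degree[of p] by auto
  have "p dvd q" using V V.dvd_iff[OF assms(1)] unfolding S_def by blast
  then have "poly q z = 0" using z by (metis dvdE mult_zero_left poly_mult)
  then show "V \<in> (\<Union>z\<in>{z. poly q z = 0}. T z)" using z p unfolding T_def by blast
 qed
 ultimately show ?thesis unfolding S_def by (rule finite_subset[rotated])
qed

lemma finite_support:
 assumes "z \<in> F" "z ~= 0"
 shows "finite {V. place V \<and> ord_at V z ~= 0}"
proof -
 obtain u v r where *: "u \<in> polys K" "v \<in> polys K" "r \<in> polys K" "r ~= 0" "z = el u v / poly r x"
  using F_repr[OF assms(1)] .
 have nz: "u ~= 0 \<or> v ~= 0" using assms(2) *(5) by (auto simp: el_def)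
 define q where "q = nrm u v * r"
 have q: "q \<in> polys K" "q ~= 0" using * degree_nrm(1)[OF nz] by (auto simp: q_def)
 have "{V. place V \<and> ord_at V z ~= 0} \<subseteq> insert Inf_pl {V. place V \<and> x \<in> V \<and> poly q x \<in> mx V}"
 proof
  fix V assume V: "V \<in> {V. place V \<and> ord_at V z ~= 0}"
  then have "place V" by simp
  then show "V \<in> insert Inf_pl {V. place V \<and> x \<in> V \<and> poly q x \<in> mx V}"
  proof (cases rule: place_cases)
   case (2 p)
   interpret V: affine K a b x y V p by fact
   have qx: "poly q x = el u v * (el u (- v)*poly r x)" using el_conj[of u v] by (simp add: q_def)
   have "poly q x \<in> mx V"
   proof (rule ccontr)
    assume m: "poly q x \<notin> mx V"
    have "el u v \<notin> mx V"
     using m V.V.max_mult[of "el u v" "el u (- v)*poly r x"] * unfolding qx by auto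
    moreover have "poly r x \<notin> mx V"
     using m V.V.max_mult[of "poly r x" "poly (nrm u v) x"] * unfolding q_def by (auto simp: mult.commute)
    moreover have "el u v ~= 0" "poly r x ~= 0" using assms(2) *(5) by auto
    ultimately have "ord_at V z = 0" unfolding *(5)
     using V.V.ord_divide[of "el u v" "poly r x"] V.V.ord_unit[of "el u v"] V.V.ord_unit[of "poly r x"] *(1-4) by simp
    then show False using V by simp
   qed
   then show ?thesis using V by simp
  qed simp
 qed
 then show ?thesis using finite_over[OF q] finite_subset by blast
qed

end

section \<open>Degrees of places and divisors\<close>

lemma combine_sum_CC:
 fixes R :: "complex ring"
 assumes R: "ring R" "R = CC\<lparr>carrier := V\<rparr>" and "length cs = n"
 shows "ring.combine R cs (map f [0..<n]) = (\<Sum>i<n. cs ! i*f i)"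
 using assms(3)
proof (induction cs arbitrary: n f)
 case (Cons c cs)
 then obtain m where m: "n = Suc m" "length cs = m" by auto
 have "map f [0..<n] = f 0 # map (\<lambda>i. f (Suc i)) [0..<m]"
  unfolding m(1) by (rule map_upt_Suc)
 then have "ring.combine R (c # cs) (map f [0..<n]) = c*f 0 + (\<Sum>i<m. cs ! i*f (Suc i))"
  using Cons.IH[OF m(2), of "\<lambda>i. f (Suc i)"] by (simp only: ring.combine.simps[OF R(1)]) (simp add: R(2))
 then show ?case unfolding m(1) sum.lessThan_Suc_shift by simp
qed (simp add: ring.combine.simps[OF R(1)[unfolded R(2)]] R(2))

text \<open>Turns the abstract dimension of the quotient ring into conditions on elements of
  \<open>V\<close>: a family independent and spanning modulo the maximal ideal.\<close>

lemma (in valring) place_degree_eq: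
 assumes K: "csubfield K" "K \<subseteq> V" and b: "\<And>i. i < n ==> b i \<in> V"
  and lin: "\<And>c. (\<And>i. i < n ==> c i \<in> K) ==> (\<Sum>i<n. c i * b i) \<in> \<mm> ==> \<forall>i<n. c i = 0"
  and span: "\<And>z. z \<in> V ==> \<exists>c. (\<forall>i<n. c i \<in> K) \<and> z - (\<Sum>i<n. c i * b i) \<in> \<mm>"
 shows "place_degree K V = n"
proof -
 define R where "R = CC\<lparr>carrier := V\<rparr>"
 have Rs: "carrier R = V" "\<And>x y. x \<otimes>\<^bsub>R\<^esub> y = x*y" "\<And>x y. x \<oplus>\<^bsub>R\<^esub> y = x + y" "\<one>\<^bsub>R\<^esub> = 1" "\<zero>\<^bsub>R\<^esub> = 0"
  by (simp_all add: R_def)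
 interpret K: csubfield K by fact
 interpret C: cring CC by (rule CC_cring)
 have "subring V CC" using V.csubring_axioms by (simp add: subring_CC_iff)
 then have "subcring V CC" by (rule C.subcringI')
 then have "cring R" unfolding R_def using C.subcring_iff by simp
 then interpret R: cring R .
 have Rminus: "\<ominus>\<^bsub>R\<^esub> z = - z" if "z \<in> V" for z
  using that by (intro R.minus_equality) (auto simp: Rs)
 have sK: "subfield K R"
 proof (rule R.subfieldI)
  show "subcring K R"
   by (intro R.subcringI' R.subringI) (use K(2) Rminus in \<open>auto simp: Rs\<close>)
  show "Units (R\<lparr>carrier := K\<rparr>) = K - {\<zero>\<^bsub>R\<^esub>}"
  proof (intro equalityI subsetI)
   fix u assume "u \<in> Units (R\<lparr>carrier := K\<rparr>)"
   then show "u \<in> K - {\<zero>\<^bsub>R\<^esub>}" by (auto simp: Units_def Rs)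
  next
   fix u assume "u \<in> K - {\<zero>\<^bsub>R\<^esub>}"
   then show "u \<in> Units (R\<lparr>carrier := K\<rparr>)"
    by (auto simp: Units_def Rs intro!: bexI[of _ "inverse u"])
  qed
 qed
 have id: "ideal \<mm> R"
 proof (rule idealI)
  show "ring R" by (rule R.ring_axioms)
  show "subgroup \<mm> (add_monoid R)"
  proof (rule group.subgroupI[OF R.a_group])
   show "\<mm> \<subseteq> carrier (add_monoid R)" using max_sub by (auto simp: Rs)
   show "\<mm> ~= {}" using max_0 by blast
  next
   fix z assume z: "z \<in> \<mm>"
   then show "inv\<^bsub>add_monoid R\<^esub> z \<in> \<mm>"
    using Rminus[OF max_sub[OF z]] max_uminus[OF z] by (simp add: a_inv_def)
  qed (auto simp: Rs max_add)
 qed (auto simp: Rs max_mult max_mult')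
 define S where "S = R Quot \<mm>"
 define h where "h = (+>\<^bsub>R\<^esub>) \<mm>"
 interpret H: ring_hom_ring R S h unfolding S_def h_def by (rule ideal.rcos_ring_hom_ring[OF id])
 have h0: "h z = \<zero>\<^bsub>S\<^esub> \<longleftrightarrow> z \<in> \<mm>" if "z \<in> V" for z
  using R.a_rcos_zero[OF id] ideal.rcos_const_imp_mem[OF id, of z] that
  unfolding h_def S_def FactRing_def by (auto simp: Rs)
 have "\<one>\<^bsub>S\<^esub> ~= \<zero>\<^bsub>S\<^esub>" using h0[of 1] H.hom_one by (auto simp: Rs)
 then have sS: "subfield (h ` K) S" using H.img_is_subfield(2)[OF sK] by blast
 define bs where "bs = map b [0..<n]"
 have bs: "set bs \<subseteq> carrier R" "length bs = n" using b by (auto simp: bs_def Rs)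
 have comb: "R.combine cs bs = (\<Sum>i<n. cs ! i * b i)" if "length cs = n" for cs
  unfolding bs_def by (rule combine_sum_CC[OF R.ring_axioms R_def that])
 have ind: "H.S.independent (h ` K) (map h bs)"
 proof (rule H.S.trivial_combine_imp_independent[OF sS])
  show "set (map h bs) \<subseteq> carrier S" using bs(1) H.hom_closed by auto
  fix Ks assume Ks: "set Ks \<subseteq> h ` K" "H.S.combine Ks (map h bs) = \<zero>\<^bsub>S\<^esub>"
  define cs where "cs = map (inv_into K h) Ks"
  have cs: "set cs \<subseteq> K" "Ks = map h cs" using Ks(1)
   by (auto simp: cs_def inv_into_into f_inv_into_f subset_iff intro!: map_idI[symmetric])
  have csR: "set cs \<subseteq> carrier R" using cs(1) K(2) by (auto simp: Rs)
  \<comment> \<open>\<open>combine\<close> ignores surplus coefficients and treats missing ones as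
    zero, so a coefficient list of any length can be brought to length \<open>n\<close>.\<close>
  define cs1 where "cs1 = take n (cs @ replicate n \<zero>\<^bsub>R\<^esub>)"
  have l1: "length cs1 = n" by (simp add: cs1_def)
  have s1: "set cs1 \<subseteq> K" using cs(1) set_take_subset[of n "cs @ replicate n \<zero>\<^bsub>R\<^esub>"]
   by (auto simp: cs1_def Rs)
  have "R.combine cs1 bs = R.combine (cs @ replicate n \<zero>\<^bsub>R\<^esub>) bs"
   unfolding cs1_def using R.combine_take[of bs "cs @ replicate n \<zero>\<^bsub>R\<^esub>"]
   by (simp only: bs(2))
  also have "\<dots> = R.combine cs bs" by (rule R.combine_append_replicate[OF bs(1)])
  finally have e1: "R.combine cs1 bs = R.combine cs bs" .
  have "h (R.combine cs bs) = \<zero>\<^bsub>S\<^esub>" using H.combine_hom[OF csR bs(1)] Ks(2) cs(2) by simp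
  moreover have "R.combine cs bs \<in> V" using R.combine_in_carrier[OF csR bs(1)] by (simp add: Rs)
  ultimately have "R.combine cs1 bs \<in> \<mm>" using h0 e1 by simp
  then have "\<forall>i<n. cs1 ! i = 0" using lin[of "\<lambda>i. cs1 ! i"] comb[OF l1] s1 l1 by (metis nth_mem subsetD)
  then have z: "set cs1 \<subseteq> {0}" using l1 by (auto simp: in_set_conv_nth)
  have "set (take n cs) \<subseteq> set cs1" by (auto simp: cs1_def)
  then have "set (take n cs) \<subseteq> {0}" using z by blast
  then have "h ` set (take n cs) \<subseteq> {\<zero>\<^bsub>S\<^esub>}" using H.hom_zero by (auto simp: Rs)
  then show "set (take (length (map h bs)) Ks) \<subseteq> {\<zero>\<^bsub>S\<^esub>}" using bs(2) cs(2) by (simp add: take_map)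
 qed
 have "H.S.Span (h ` K) (map h bs) = h ` R.Span K bs"
  by (rule H.Span_hom) (use K(2) bs(1) in \<open>auto simp: Rs\<close>)
 also have "\<dots> = h ` V"
 proof (rule equalityI)
  have "R.Span K bs \<subseteq> V" using R.Span_in_carrier[of K bs] K(2) bs(1) by (simp add: Rs)
  then show "h ` R.Span K bs \<subseteq> h ` V" by (rule image_mono)
  show "h ` V \<subseteq> h ` R.Span K bs"
  proof
   fix s assume "s \<in> h ` V"
   then obtain z where z: "z \<in> V" "s = h z" by blast
   obtain c where c: "\<forall>i<n. c i \<in> K" "z - (\<Sum>i<n. c i * b i) \<in> \<mm>" using span[OF z(1)] by blast
   define cs where "cs = map c [0..<n]"
   have cs: "length cs = n" "set cs \<subseteq> K" using c(1) by (auto simp: cs_def)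
   have "R.combine cs bs = (\<Sum>i<n. c i * b i)" using comb[OF cs(1)] by (simp add: cs_def)
   then have m: "z - R.combine cs bs \<in> \<mm>" using c(2) by simp
   have cV: "R.combine cs bs \<in> V" using R.combine_in_carrier[of cs bs] cs(2) K(2) bs(1) by (auto simp: Rs)
   have "h z = h ((z - R.combine cs bs) + R.combine cs bs)" by simp
   also have "\<dots> = h (z - R.combine cs bs) \<oplus>\<^bsub>S\<^esub> h (R.combine cs bs)"
    using H.hom_add[of "z - R.combine cs bs" "R.combine cs bs"] z(1) cV by (simp add: Rs)
   also have "h (z - R.combine cs bs) = \<zero>\<^bsub>S\<^esub>" using h0 m max_sub by blast
   also have "\<zero>\<^bsub>S\<^esub> \<oplus>\<^bsub>S\<^esub> h (R.combine cs bs) = h (R.combine cs bs)"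
    using H.hom_closed cV by (simp add: Rs)
   finally have "s = h (R.combine cs bs)" using z by simp
   moreover have "R.combine cs bs \<in> R.Span K bs"
    using R.Span_eq_combine_set_length_version[OF sK bs(1)] cs bs(2) by auto
   ultimately show "s \<in> h ` R.Span K bs" by blast
  qed
 qed
 also have "\<dots> = carrier S" unfolding S_def h_def FactRing_def A_RCOSETS_def' by (auto simp: Rs)
 finally have "H.S.dimension n (h ` K) (carrier S)"
  using H.S.dimension_independent[OF ind] bs(2) by simp
 then have "H.S.dim (h ` K) (carrier S) = n"
  using H.S.dimI[OF sS] by (simp add: over_def)
 then show ?thesis unfolding place_degree_def Let_def h_def S_def R_def .
qed

lemma sum_lessThan_add: "(\<Sum>i<m + n. f i) = (\<Sum>i<m. f i) + (\<Sum>i<n. f (m + i))" for f :: "nat \<Rightarrow> complex"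
 by (induction n) (auto simp: add.assoc)

lemma poly_eq_sum: "degree q < n ==> poly q z = (\<Sum>i<n. coeff q i*z^i)" for q :: "complex poly"
proof -
 assume "degree q < n"
 then have "(\<Sum>i<n. coeff q i*z^i) = (\<Sum>i\<le>degree q. coeff q i*z^i)"
  by (intro sum.mono_neutral_right) (auto simp: coeff_eq_0)
 then show ?thesis by (simp add: poly_altdef)
qed

lemma (in csubring) poly_of_coeffs:
 assumes "\<And>i. i < n ==> c i \<in> R" "n > 0"
 shows "\<exists>q\<in>polys R. degree q < n \<and> (\<forall>i<n. coeff q i = c i) \<and> (\<forall>z. poly q z = (\<Sum>i<n. c i*z^i))"
proof -
 define q where "q = (\<Sum>i<n. Polynomial.monom (c i) i)"
 have co: "coeff q i = (if i < n then c i else 0)" for i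
  by (simp add: q_def coeff_sum)
 have d: "degree q < n" using assms(2) by (intro degree_lessI) (auto simp: co)
 show ?thesis
 proof (intro bexI[of _ q] conjI allI impI)
  show "q \<in> polys R" using assms by (auto simp: polys_def co)
 qed (use d co in \<open>simp_all add: poly_eq_sum[OF d]\<close>)
qed

section \<open>Residue fields and degrees of the places\<close>

context infty
begin

lemma degree_eq: "place_degree K V = 1"
proof (rule V.place_degree_eq[where b = "\<lambda>_. 1"])
 show "csubfield K" by (rule csubfield_axioms)
 show "K \<subseteq> V" using K_V by blast
 fix c assume "\<And>i. i < (1::nat) ==> c i \<in> K" "(\<Sum>i<1. c i*1) \<in> mx V"
 then show "\<forall>i<1. c i = 0" using K_unit[of "c 0"] by auto
next
 fix z assume z: "z \<in> V"
 have "\<exists>c\<in>K. z - c \<in> mx V"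
 proof (cases "z \<in> mx V")
  case True
  then show ?thesis by (intro bexI[of _ 0]) auto
 next
  case False
  then have z0: "z \<in> F" "z ~= 0" using z V.in_F by auto
  obtain u v r where *: "u \<in> polys K" "v \<in> polys K" "r \<in> polys K" "r ~= 0" "z = el u v / poly r x"
   using F_repr[OF z0(1)] .
  have nz: "u ~= 0 \<or> v ~= 0" using z0(2) *(5) by (auto simp: el_def)
  have "ord_at V z = 0" by (rule V.ord_unit[OF z False])
  then have d: "degree (nrm u v) = 2*degree r" using ord_quot[OF *(1,2) nz *(3,4)] *(5) by simp
  have "2*degree v + 3 ~= 2*degree r" by presburger
  then have u0: "u ~= 0" and du: "degree u = degree r" and dv: "v = 0 \<or> 2*degree v + 3 < 2*degree r"
   using degree_nrm(2)[OF nz] d nz by (auto split: if_splits simp: max_def)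
  \<comment> \<open>The value of \<open>z\<close> at infinity: \<open>u\<close> and \<open>r\<close>
    have equal degree, and the term with \<open>y\<close> has a smaller pole.\<close>
  define c where "c = lead_coeff u / lead_coeff r"
  have c: "c \<in> K" using * by (simp add: c_def polysD)
  define u' where "u' = u - Polynomial.smult c r"
  have u': "u' \<in> polys K" using * c by (simp add: u'_def)
  have e: "z - c = el u' v / poly r x"
   using poly_x_nz[OF *(3,4)] unfolding *(5) by (simp add: u'_def el_def field_simps)
  have du': "u' = 0 \<or> degree u' < degree r"
  proof -
   have "degree u' \<le> degree r" unfolding u'_def
    by (rule degree_diff_le) (use du degree_smult_le[of c r] in auto)
   moreover have "coeff u' (degree r) = 0" using du *(4) by (simp add: u'_def c_def)
   ultimately show ?thesis by (metis leading_coeff_0_iff order_less_le)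
  qed
  have "z - c \<in> mx V"
  proof (cases "u' = 0 \<and> v = 0")
   case True
   then show ?thesis unfolding e by (simp add: el_def)
  next
   case nz': False
   have "degree (nrm u' v) < 2*degree r"
    using degree_nrm(2)[of u' v] nz' du' dv by (auto split: if_splits)
   then have "ord_at V (z - c) > 0" unfolding e using ord_quot[OF u' *(2) _ *(3,4)] nz' by simp
   then show ?thesis using V.ord_pos_iff[of "z - c"] z0 c K_F by (cases "z - c = 0") auto
  qed
  then show ?thesis using c by blast
 qed
 then obtain c where "c \<in> K" "z - c \<in> mx V" by blast
 then show "\<exists>c. (\<forall>i<1::nat. c i \<in> K) \<and> z - (\<Sum>i<1::nat. c i*1) \<in> mx V"
  by (intro exI[of _ "\<lambda>_. c"]) simp
qed auto

end

context affine
begin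

lemma residue_quot:
 assumes uv: "u \<in> polys K" "v \<in> polys K" and r: "r \<in> polys K" "\<not> p dvd r"
  and z: "z \<in> V" "z*poly r x = el u v"
 shows "\<exists>u\<in>polys K. \<exists>v'\<in>polys K. z - el u v' \<in> mx V \<and> (v = 0 \<longrightarrow> v' = 0)"
proof -
 obtain s where s: "s \<in> polys K" "p dvd s*r - 1" using inv_mod[OF r] .
 have m: "poly (s*r - 1) x \<in> mx V" using dvd_iff[of "s*r - 1"] s r by simp
 have "z - el (s*u) (s * v) = - (poly (s*r - 1) x*z)"
  unfolding el_smult z(2)[symmetric] by (simp add: algebra_simps)
 also have "\<dots> \<in> mx V" using m z(1) V.max_mult V.max_uminus by blast
 finally show ?thesis using s uv by (intro bexI[of _ "s*u"] bexI[of _ "s * v"]) auto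
qed

text \<open>The denominator may be divisible by \<open>p\<close> more often than the numerator
  although \<open>z\<close> is finite at \<open>V\<close>. This happens only at a split place where
  the primitive part of the numerator vanishes. Multiplication by its conjugate, a unit there with
  residue in \<open>K[x]\<close>, replaces it by its norm, and the power of \<open>p\<close>
  cancels.\<close>

lemma residue:
 assumes z: "z \<in> V"
 shows "\<exists>u\<in>polys K. \<exists>v\<in>polys K. z - el u v \<in> mx V"
proof (cases "z \<in> mx V")
 case True
 then show ?thesis by (intro bexI[of _ 0]) (auto simp: el_def)
next
 case False
 then have z0: "z \<in> F" "z ~= 0" using z V.in_F by auto
 obtain u v r where *: "u \<in> polys K" "v \<in> polys K" "r \<in> polys K" "r ~= 0" "z = el u v / poly r x"
  using F_repr[OF z0(1)] .
 have nz: "u ~= 0 \<or> v ~= 0" using z0(2) *(5) by (auto simp: el_def)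
 obtain n u' v' where uv: "u' \<in> polys K" "v' \<in> polys K" "u = p^n*u'" "v = p^n * v'" "\<not> (p dvd u' \<and> p dvd v')"
  using p_split[OF *(1,2) nz] by metis
 obtain j r' where r: "r' \<in> polys K" "r = p^j*r'" "\<not> p dvd r'" using p_split1[OF *(3,4)] .
 have px: "poly p x ~= 0" using poly_x_nz[OF pK p_nz] .
 have rx: "poly r' x ~= 0" using unit_iff[OF r(1,3)] V.max_0 by metis
 have zr: "z*(poly p x^j*poly r' x) = poly p x^n*el u' v'"
  unfolding *(5) uv(3,4) r(2) el_smult using px rx by simp
 have el0: "el u' v' ~= 0" using zr z0(2) px rx by auto
 have oz: "ord_at V z = 0" by (rule V.ord_unit[OF z False])
 have "ord_at V (z*(poly p x^j*poly r' x)) = int j * ord_at V (poly p x)"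
  using z0 px rx r(1) oz V.ord_unit unit_iff[OF r(1,3)] by (simp add: V.ord_mult V.ord_power)
 moreover have "ord_at V (poly p x^n*el u' v') = int n * ord_at V (poly p x) + ord_at V (el u' v')"
  using px el0 uv(1,2) by (simp add: V.ord_mult V.ord_power)
 ultimately have o: "int j * ord_at V (poly p x) = int n * ord_at V (poly p x) + ord_at V (el u' v')"
  using zr by simp
 have op: "ord_at V (poly p x) = (if y \<in> mx V then 2 else 1)" by (rule ord_p)
 show ?thesis
 proof (cases "el u' v' \<in> mx V")
  case False
  then have "ord_at V (el u' v') = 0" using V.ord_unit uv(1,2) by simp
  then have "n = j" using o op by (auto split: if_splits)
  then have "poly p x^n*(z*poly r' x) = poly p x^n*el u' v'" using zr by (simp add: mult_ac)
  then have "z*poly r' x = el u' v'" using px by simp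
  from residue_quot[OF uv(1,2) r(1,3) z this] show ?thesis by blast
 next
  case True
  have "nrm u' v' ~= 0" using uv(5) by (intro degree_nrm) auto
  then obtain k m where m: "m \<in> polys K" "nrm u' v' = p^k*m" "\<not> p dvd m"
   using p_split1[of "nrm u' v'"] uv(1,2) nrm_closed by metis
  have ok: "ord_at V (el u' v') = int k" using ord_prim[OF uv(1,2,5) m] True by simp
  have nram: "y \<notin> mx V"
  proof
   assume ram: "y \<in> mx V"
   obtain f1 where f1: "f1 \<in> polys K" "fpoly = p*f1" "\<not> p dvd f1" using ram_cofactor[OF ram] .
   \<comment> \<open>At a ramified place \<open>p(x)\<close> has order 2, so \<open>k\<close> would
     be even; but there the norm of a primitive element in the ideal contains \<open>p\<close> only
     once.\<close>
   have "2*int j = 2*int n + int k" using o op ok ram by simp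
   then have "even k" by presburger
   have nv: "\<not> p dvd v'" using el_in_max_imp(1)[OF uv(1,2,5) True] .
   have "poly v' x*y \<in> mx V" using V.max_mult'[OF ram, of "poly v' x"] uv by simp
   then have "el u' v' - poly v' x*y \<in> mx V" using True V.max_diff by blast
   then have "p dvd u'" using dvd_iff[OF uv(1)] by (simp add: el_def)
   then obtain u1 where u1: "u1 \<in> polys K" "u' = p*u1" using polys_dvdE[OF uv(1) pK] by blast
   have e: "nrm u' v' = p*(p*u1^2 - v'^2*f1)"
    unfolding nrm_def f1(2) u1(2) by (simp add: square_simps)
   have "k > 0"
   proof (rule ccontr)
    assume "\<not> k > 0"
    then show False using m(2,3) e by auto
   qed
   then obtain i where i: "k = Suc (Suc i)" using \<open>even k\<close> by (metis even_Suc not0_implies_Suc not_gr_zero odd_one One_nat_def)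
   have "p*(p*u1^2 - v'^2*f1) = p*(p*(p^i*m))" by (rule HOL.trans[OF e[symmetric] m(2)[unfolded i power_Suc mult.assoc]])
   then have "p*u1^2 - v'^2*f1 = p*(p^i*m)" using p_nz by simp
   then have "v'^2*f1 = p*(u1^2 - p^i*m)" by (simp add: algebra_simps)
   then have "p dvd v'^2*f1" by simp
   then show False using p_prime[of "v'^2" f1] p_prime[of v' v'] uv f1 nv by (auto simp: power2_eq_square)
  qed
  then have jn: "j = n + k" using o op ok by simp
  define c where "c = el u' (- v')"
  have c: "c \<in> V" "c \<notin> mx V" using conj_max[OF uv(1,2) nram True] uv by (auto simp: c_def)
  have "poly p x^j*(z * c*poly r' x) = poly p x^n*(el u' v' * c)"
   using arg_cong[OF zr, of "\<lambda>t. t * c"] by (simp add: mult_ac)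
  also have "el u' v' * c = poly p x^k*poly m x" using el_conj[of u' v'] m(2) by (simp add: c_def)
  finally have "poly p x^j*(z * c*poly r' x) = poly p x^j*poly m x" by (simp add: jn power_add mult_ac)
  then have "z * c*poly r' x = el m 0" using px by (simp add: el_def)
  from residue_quot[OF m(1) polys_0 r(1,3) _ this] z c
  obtain s' where s': "s' \<in> polys K" "z * c - poly s' x \<in> mx V" by (auto simp: el_def)
  obtain h where h: "h \<in> polys K" "y - poly h x \<in> mx V" using el_in_max_imp(2)[OF uv(1,2,5) True] by blast
  define g where "g = u' - v'*h"
  have g: "g \<in> polys K" "\<not> p dvd g"
   using el_max_iff_h[of u' "- v'" h] uv h c(2) by (auto simp: g_def c_def)
  have cg: "c - poly g x \<in> mx V"
  proof -
   have "c - poly g x = - (poly v' x*(y - poly h x))" by (simp add: c_def g_def el_def algebra_simps)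
   then show ?thesis using V.max_mult'[OF h(2), of "poly v' x"] V.max_uminus uv(2) by simp
  qed
  obtain s where s: "s \<in> polys K" "p dvd s*g - 1" using inv_mod[OF g] .
  have m1: "poly (s*g - 1) x*z \<in> mx V"
   by (rule V.max_mult[OF _ z]) (use dvd_iff[of "s*g - 1"] s g in simp)
  have m2: "(c - poly g x)*(poly s x*z) \<in> mx V" by (rule V.max_mult[OF cg]) (use s z in simp)
  have m3: "(z * c - poly s' x)*poly s x \<in> mx V" by (rule V.max_mult[OF s'(2)]) (use s in simp)
  have "z - el (s * s') 0 = (z * c - poly s' x)*poly s x - (c - poly g x)*(poly s x*z) - poly (s*g - 1) x*z"
   by (simp add: el_def algebra_simps)
  also have "\<dots> \<in> mx V" by (intro V.max_diff m1 m2 m3)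
  finally show ?thesis using s s' by (intro bexI[of _ "s * s'"] bexI[of _ 0]) auto
 qed
qed

lemma reduce_mod:
 assumes "q \<in> polys K"
 obtains r where "r \<in> polys K" "degree r < degree p" "poly q x - poly r x \<in> mx V"
proof -
 obtain k r where r: "k \<in> polys K" "r \<in> polys K" "q = p * k + r" "r = 0 \<or> degree r < degree p"
  using polys_euclid[OF assms pK p_nz] .
 have "poly q x - poly r x = poly p x*poly k x" unfolding r(3) by simp
 also have "\<dots> \<in> mx V" by (rule V.max_mult[OF p_max]) (use r in simp)
 finally show ?thesis using that[of r] r degp by auto
qed

lemma small_dvd: "p dvd q ==> degree q < degree p ==> q = 0"
 using dvd_imp_degree_le by (metis not_le)

lemma degree_noninert:
 assumes "\<not> inert"
 shows "place_degree K V = degree p"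
proof (rule V.place_degree_eq[where b = "\<lambda>i. x^i"])
 show "csubfield K" by (rule csubfield_axioms)
 show "K \<subseteq> V" using K_V by blast
 fix c assume c: "\<And>i. i < degree p ==> c i \<in> K" "(\<Sum>i<degree p. c i*x^i) \<in> mx V"
 obtain q where q: "q \<in> polys K" "degree q < degree p" "\<And>i. i < degree p ==> coeff q i = c i"
  "\<And>z. poly q z = (\<Sum>i<degree p. c i*z^i)" using poly_of_coeffs[of "degree p" c, OF c(1) degp] by blast
 have "p dvd q" using c(2) q(4) dvd_iff[OF q(1)] by simp
 then have "q = 0" using q(2) small_dvd by blast
 then show "\<forall>i<degree p. c i = 0" using q(3) by simp
next
 fix z assume "z \<in> V"
 then obtain u v where uv: "u \<in> polys K" "v \<in> polys K" "z - el u v \<in> mx V" using residue by blast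
 obtain h where h: "h \<in> polys K" "y - poly h x \<in> mx V" using assms unfolding inert_def by blast
 obtain q where q: "q \<in> polys K" "degree q < degree p" "poly (u + v * h) x - poly q x \<in> mx V"
  using reduce_mod[of "u + v * h"] uv h by auto
 have "z - poly q x = (z - el u v) + (poly v x*(y - poly h x)) + (poly (u + v * h) x - poly q x)"
  by (simp add: el_def algebra_simps)
 also have "\<dots> \<in> mx V" by (intro V.max_add uv(3) q(3) V.max_mult'[OF h(2)]) (use uv in simp)
 finally have "z - poly q x \<in> mx V" .
 then show "\<exists>c. (\<forall>i<degree p. c i \<in> K) \<and> z - (\<Sum>i<degree p. c i*x^i) \<in> mx V"
  using q by (intro exI[of _ "coeff q"]) (auto simp: poly_eq_sum polysD)
qed (simp)

lemma degree_inert: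
 assumes "inert"
 shows "place_degree K V = degree p + degree p"
proof (rule V.place_degree_eq[where b = "\<lambda>i. if i < degree p then x^i else x^(i - degree p)*y"])
 let ?b = "\<lambda>i. if i < degree p then x^i else x^(i - degree p)*y"
 have sum: "(\<Sum>i<degree p + degree p. c i*?b i) = (\<Sum>i<degree p. c i*x^i) + (\<Sum>i<degree p. c (degree p + i)*x^i)*y" for c
  unfolding sum_lessThan_add by (simp add: sum_distrib_right mult.assoc)
 show "csubfield K" by (rule csubfield_axioms)
 show "K \<subseteq> V" using K_V by blast
 fix c assume c: "\<And>i. i < degree p + degree p ==> c i \<in> K" "(\<Sum>i<degree p + degree p. c i*?b i) \<in> mx V"
 have c1: "c i \<in> K" "c (degree p + i) \<in> K" if "i < degree p" for i using that c(1) by auto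
 obtain q where q: "q \<in> polys K" "degree q < degree p" "\<And>i. i < degree p ==> coeff q i = c i"
  "\<And>z. poly q z = (\<Sum>i<degree p. c i*z^i)" using poly_of_coeffs[of "degree p" c, OF c1(1) degp] by blast
 obtain q' where q': "q' \<in> polys K" "degree q' < degree p" "\<And>i. i < degree p ==> coeff q' i = c (degree p + i)"
  "\<And>z. poly q' z = (\<Sum>i<degree p. c (degree p + i)*z^i)"
  using poly_of_coeffs[of "degree p" "\<lambda>i. c (degree p + i)", OF c1(2) degp] by blast
 have "el q q' \<in> mx V" using c(2) unfolding sum el_def q(4) q'(4) .
 then have "p dvd q" "p dvd q'" using el_max_iff_inert[OF q(1) q'(1) assms] by auto
 then have "q = 0" "q' = 0" using q(2) q'(2) small_dvd by auto
 then have z: "c i = 0" "c (degree p + i) = 0" if "i < degree p" for i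
  using q(3)[OF that] q'(3)[OF that] by simp_all
 show "\<forall>i<degree p + degree p. c i = 0"
 proof (intro allI impI)
  fix i assume "i < degree p + degree p"
  then show "c i = 0" using z(1)[of i] z(2)[of "i - degree p"] by (cases "i < degree p") auto
 qed
next
 let ?b = "\<lambda>i. if i < degree p then x^i else x^(i - degree p)*y"
 have sum: "(\<Sum>i<degree p + degree p. c i*?b i) = (\<Sum>i<degree p. c i*x^i) + (\<Sum>i<degree p. c (degree p + i)*x^i)*y" for c
  unfolding sum_lessThan_add by (simp add: sum_distrib_right mult.assoc)
 fix z assume "z \<in> V"
 then obtain u v where uv: "u \<in> polys K" "v \<in> polys K" "z - el u v \<in> mx V" using residue by blast
 obtain q where q: "q \<in> polys K" "degree q < degree p" "poly u x - poly q x \<in> mx V"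
  using reduce_mod[OF uv(1)] .
 obtain q' where q': "q' \<in> polys K" "degree q' < degree p" "poly v x - poly q' x \<in> mx V"
  using reduce_mod[OF uv(2)] .
 have "z - el q q' = (z - el u v) + (poly u x - poly q x) + (poly v x - poly q' x)*y"
  by (simp add: el_def algebra_simps)
 also have "\<dots> \<in> mx V" by (intro V.max_add uv(3) q(3) V.max_mult[OF q'(3)] y_V)
 finally have m: "z - el q q' \<in> mx V" .
 define c where "c i = (if i < degree p then coeff q i else coeff q' (i - degree p))" for i
 have "(\<Sum>i<degree p + degree p. c i*?b i) = el q q'"
  unfolding sum el_def poly_eq_sum[OF q(2)] poly_eq_sum[OF q'(2)] by (simp add: c_def)
 then show "\<exists>c. (\<forall>i<degree p + degree p. c i \<in> K) \<and> z - (\<Sum>i<degree p + degree p. c i*?b i) \<in> mx V"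
  using m q q' by (intro exI[of _ c]) (auto simp: c_def polysD)
qed auto

end

section \<open>Principal divisors have degree zero\<close>

abbreviation "lk \<equiv> Poly_Mapping.lookup"

context ell_ff
begin

abbreviation "divi \<equiv> principal_divisor K F"
abbreviation "ddeg \<equiv> divisor_degree K"

lemma ord_mult: "place V ==> z \<in> F ==> z ~= 0 ==> w \<in> F ==> w ~= 0 ==> ord_at V (z*w) = ord_at V z + ord_at V w"
 by (erule place_dvr) (rule dvr.ord_mult)

lemma ord_inverse: "place V ==> z \<in> F ==> z ~= 0 ==> ord_at V (inverse z) = - ord_at V z"
 by (erule place_dvr) (rule dvr.ord_inverse)

lemma ord_1: "place V ==> ord_at V 1 = 0"
 using ord_mult[of V 1 1] by simp

lemma lookup_divi:
 assumes "z \<in> F" "z ~= 0"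
 shows "lk (divi z) V = (if place V then ord_at V z else 0)"
proof -
 let ?S = "{V. place V \<and> ord_at V z ~= 0}"
 have "lk (divi z) V = (\<Sum>W\<in>?S. lk (frag_cmul (ord_at W z) (frag_of W)) V)"
  unfolding principal_divisor_def by (simp only: lookup_sum mem_Collect_eq)
 also have "\<dots> = (\<Sum>W\<in>?S. if W = V then ord_at V z else 0)"
  by (intro sum.cong) auto
 also have "\<dots> = (if V \<in> ?S then ord_at V z else 0)"
  using finite_support[OF assms] by (simp add: sum.delta)
 finally show ?thesis by auto
qed

lemma keys_divi: "z \<in> F ==> z ~= 0 ==> Poly_Mapping.keys (divi z) \<subseteq> places K F"
 by (auto simp: in_keys_iff lookup_divi split: if_splits)

lemma divi_mult: "z \<in> F ==> z ~= 0 ==> w \<in> F ==> w ~= 0 ==> divi (z*w) = divi z + divi w"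
 by (intro poly_mapping_eqI) (simp add: lookup_add lookup_divi ord_mult)

lemma divi_1: "divi 1 = 0"
 by (intro poly_mapping_eqI) (simp add: lookup_divi ord_1)

lemma divi_inverse: "z \<in> F ==> z ~= 0 ==> divi (inverse z) = - divi z"
 by (intro poly_mapping_eqI) (simp add: lookup_divi ord_inverse)

lemma ddeg_on:
 assumes "finite S" "Poly_Mapping.keys D \<subseteq> S"
 shows "ddeg D = (\<Sum>V\<in>S. lk D V*int (place_degree K V))"
 unfolding divisor_degree_def
 by (rule sum.mono_neutral_left[OF assms]) (auto simp: in_keys_iff)

lemma ddeg_add: "ddeg (D + E) = ddeg D + ddeg E"
proof -
 let ?S = "Poly_Mapping.keys D \<union> Poly_Mapping.keys E"
 have "finite ?S" "Poly_Mapping.keys (D + E) \<subseteq> ?S" by (auto simp: in_keys_iff lookup_add)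
 then show ?thesis using ddeg_on[of ?S D] ddeg_on[of ?S E] ddeg_on[of ?S "D + E"]
  by (simp add: lookup_add distrib_right sum.distrib)
qed

lemma ddeg_uminus: "ddeg (- D) = - ddeg D"
 using ddeg_on[of "Poly_Mapping.keys D" "- D"] ddeg_on[of "Poly_Mapping.keys D" D]
 by (simp add: sum_negf in_keys_iff subset_iff)

lemma ddeg_diff: "ddeg (D - E) = ddeg D - ddeg E"
 using ddeg_add[of D "- E"] ddeg_uminus[of E] by simp

lemma ddeg_0: "ddeg 0 = 0" by (simp add: divisor_degree_def)

lemma ddeg_frag: "ddeg (frag_cmul n (frag_of V)) = n*int (place_degree K V)"
proof -
 have "Poly_Mapping.keys (frag_cmul n (frag_of V)) \<subseteq> {V}"
  using keys_cmul[of n "frag_of V"] by (simp add: keys_frag_of)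
 from ddeg_on[OF _ this] show ?thesis by simp
qed

lemma ddeg_divi:
 assumes "z \<in> F" "z ~= 0" "finite S" "\<And>V. place V ==> ord_at V z ~= 0 ==> V \<in> S" "\<And>V. V \<in> S ==> place V"
 shows "ddeg (divi z) = (\<Sum>V\<in>S. ord_at V z*int (place_degree K V))"
proof -
 have "Poly_Mapping.keys (divi z) \<subseteq> S" using assms(4) by (auto simp: in_keys_iff lookup_divi[OF assms(1,2)] split: if_splits)
 then have "ddeg (divi z) = (\<Sum>V\<in>S. lk (divi z) V*int (place_degree K V))" by (rule ddeg_on[OF assms(3)])
 also have "\<dots> = (\<Sum>V\<in>S. ord_at V z*int (place_degree K V))"
  using assms(5) by (intro sum.cong) (auto simp: lookup_divi[OF assms(1,2)])
 finally show ?thesis .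
qed

lemma affine_over_iff:
 assumes "affine K a b x y V p" "affine K a b x y W q"
 shows "poly p x \<in> mx W \<longleftrightarrow> affine K a b x y W p"
proof
 interpret V: affine K a b x y V p by fact
 interpret W: affine K a b x y W q by fact
 assume "poly p x \<in> mx W"
 then have "q dvd p" using W.dvd_iff[of p] by simp
 then have "affine K a b x y V q" using affine_assoc[OF assms(2,1)] by blast
 then interpret V': affine K a b x y V q .
 have "poly q x \<in> mx V" by (rule V'.p_max)
 then have "p dvd q" using V.dvd_iff[of q] by simp
 then show "affine K a b x y W p" by (rule affine_assoc[OF assms(1,2)])
next
 assume "affine K a b x y W p"
 then interpret W: affine K a b x y W p .
 show "poly p x \<in> mx W" by (rule W.p_max)
qed

lemma sigp_eq:
 assumes "affine K a b x y V p"
 shows "affine.inert K x y (sigp V) \<longleftrightarrow> affine.inert K x y V"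
  and "sigp V = V \<longleftrightarrow> affine.inert K x y V \<or> y \<in> mx V"
  and "y \<in> mx (sigp V) \<longleftrightarrow> y \<in> mx V"
proof -
 interpret V: affine K a b x y V p by fact
 interpret S: affine K a b x y "sigp V" p by (rule affine_sigp[OF assms])
 show 1: "S.inert \<longleftrightarrow> V.inert"
 proof -
  have "(\<exists>h\<in>polys K. y - poly h x \<in> mx (sigp V)) \<longleftrightarrow> (\<exists>h\<in>polys K. y + poly h x \<in> mx (sigp V))"
   by (metis diff_minus_eq_add poly_minus polys_uminus add_uminus_conv_diff)
  also have "\<dots> \<longleftrightarrow> (\<exists>h\<in>polys K. y - poly h x \<in> mx V)" using sigp_h[OF assms] by blast
  finally show ?thesis unfolding V.inert_def S.inert_def by blast
 qed
 show 3: "y \<in> mx (sigp V) \<longleftrightarrow> y \<in> mx V"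
  using V.y_max_iff S.y_max_iff by simp
 show "sigp V = V \<longleftrightarrow> V.inert \<or> y \<in> mx V"
 proof
  assume "V.inert \<or> y \<in> mx V"
  then show "sigp V = V"
  proof
   assume i: "V.inert"
   show "sigp V = V"
    by (rule affine_eqI[OF S.affine_axioms V.affine_axioms]) (simp add: V.el_max_iff_inert i S.el_max_iff_inert 1)
  next
   assume "y \<in> mx V"
   then show "sigp V = V" using affine_same_h[OF S.affine_axioms V.affine_axioms, of 0] 3 by simp
  qed
 next
  assume e: "sigp V = V"
  show "V.inert \<or> y \<in> mx V"
  proof (rule ccontr)
   assume n: "\<not> (V.inert \<or> y \<in> mx V)"
   then obtain h where h: "h \<in> polys K" "y - poly h x \<in> mx V" unfolding V.inert_def by blast
   then have "y + poly h x \<in> mx V" using sigp_h[OF assms h(1)] e by simp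
   then have "(y + poly h x) + (y - poly h x) \<in> mx V" using h(2) by (rule V.V.max_add)
   then have "2*y \<in> mx V" by simp
   then show False using V.two_max[of y] n by simp
  qed
 qed
qed

lemma degree_sigp:
 assumes "place V"
 shows "place_degree K (sigp V) = place_degree K V"
 using assms
proof (cases rule: place_cases)
 case 1
 then show ?thesis by (simp add: sigp_O)
next
 case (2 p)
 interpret V: affine K a b x y V p by fact
 interpret S: affine K a b x y "sigp V" p by (rule affine_sigp[OF 2])
 show ?thesis using sigp_eq(1)[OF 2] V.degree_inert V.degree_noninert S.degree_inert S.degree_noninert by metis
qed

lemma ord_p_support:
 assumes "affine K a b x y V p" "place W" "ord_at W (poly p x) ~= 0"
 shows "W \<in> {Inf_pl, V, sigp V}"
 using assms(2)
proof (cases rule: place_cases)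
 case (2 q)
 interpret V: affine K a b x y V p by fact
 interpret W: affine K a b x y W q by fact
 have "poly p x \<in> mx W"
 proof (rule ccontr)
  assume "poly p x \<notin> mx W"
  then have "ord_at W (poly p x) = 0" by (intro W.V.ord_unit) auto
  then show False using assms by simp
 qed
 then have "affine K a b x y W p" using affine_over_iff[OF assms(1) 2] by blast
 then show ?thesis using affine_over_cases[OF assms(1)] by blast
qed simp

text \<open>The pole at infinity contributes \<open>- 2 * degree p\<close>. Over \<open>p\<close>
  there is one inert place (order 1, degree \<open>2 * degree p\<close>), one ramified place (order
  2, degree \<open>degree p\<close>), or a pair of conjugate places (order 1 and degree
  \<open>degree p\<close> each).\<close>

lemma ddeg_p:
 assumes "affine K a b x y V p"
 shows "ddeg (divi (poly p x)) = 0"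
proof -
 interpret V: affine K a b x y V p by fact
 interpret S: affine K a b x y "sigp V" p by (rule affine_sigp[OF assms])
 interpret I: infty K a b x y Inf_pl by (rule infty_O)
 have pz: "poly p x \<in> F" "poly p x ~= 0" using poly_x_nz[OF V.pK V.p_nz] by auto
 have ne: "V ~= Inf_pl" "sigp V ~= Inf_pl" using affine_ne_O V.affine_axioms S.affine_axioms by auto
 have "ddeg (divi (poly p x)) = (\<Sum>W\<in>{Inf_pl, V, sigp V}. ord_at W (poly p x)*int (place_degree K W))"
  by (rule ddeg_divi[OF pz]) (use ord_p_support[OF assms] place_O V.plV S.plV in auto)
 also have "\<dots> = ord_at Inf_pl (poly p x)*int (place_degree K Inf_pl) +
  (\<Sum>W\<in>{V, sigp V}. ord_at W (poly p x)*int (place_degree K W))"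
  using ne by (subst sum.insert) auto
 also have "ord_at Inf_pl (poly p x) = - 2*int (degree p)" by (rule I.ord_poly[OF V.pK V.p_nz])
 also have "place_degree K Inf_pl = 1" by (rule I.degree_eq)
 also have "(\<Sum>W\<in>{V, sigp V}. ord_at W (poly p x)*int (place_degree K W)) = 2*int (degree p)"
 proof (cases "V.inert \<or> y \<in> mx V")
  case True
  then have e: "sigp V = V" using sigp_eq(2)[OF assms] by blast
  have "y \<notin> mx V" if "V.inert" using that unfolding V.inert_def by (metis diff_zero poly_0 polys_0)
  then show ?thesis using True V.degree_inert V.degree_noninert V.ord_p unfolding e by auto
 next
  case False
  then have e: "sigp V ~= V" using sigp_eq(2)[OF assms] by blast
  have "place_degree K V = degree p" using False V.degree_noninert by blast
  moreover have "place_degree K (sigp V) = degree p" using False S.degree_noninert sigp_eq(1)[OF assms] by blast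
  moreover have "ord_at V (poly p x) = 1" "ord_at (sigp V) (poly p x) = 1"
   using V.ord_p S.ord_p False sigp_eq(3)[OF assms] by auto
  ultimately show ?thesis using e by simp
 qed
 finally show ?thesis by simp
qed

text \<open>A place over \<open>q\<close> supplies an irreducible factor to split off, and the
  degree drops.\<close>

lemma ddeg_poly:
 assumes "q \<in> polys K" "q ~= 0"
 shows "ddeg (divi (poly q x)) = 0"
 using assms
proof (induction "degree q" arbitrary: q rule: less_induct)
 case less
 have qz: "poly q x \<in> F" "poly q x ~= 0" using poly_x_nz less.prems by auto
 show ?case
 proof (cases "degree q = 0")
  case True
  then obtain c where c: "q = [:c:]" by (rule degree_eq_zeroE)
  have "ord_at V (poly q x) = 0" if "place V" for V
   using that
  proof (cases rule: place_cases)
   case 1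
   interpret I: infty K a b x y Inf_pl by (rule infty_O)
   show ?thesis using I.ord_poly[OF less.prems] True 1 by simp
  next
   case (2 p)
   interpret V: affine K a b x y V p by fact
   have "c \<in> K" "c ~= 0" using less.prems c by auto
   then have "c \<in> V" "c \<notin> mx V" using V.K_unit by auto
   then have "ord_at V c = 0" by (rule V.V.ord_unit)
   then show ?thesis by (simp add: c)
  qed
  then show ?thesis using ddeg_divi[OF qz, of "{}"] by simp
 next
  case False
  then obtain V where V: "place V" "x \<in> V" "poly q x \<in> mx V"
   using ex_place_over[OF less.prems(1)] by auto
  obtain p where p: "affine K a b x y V p" using affine_ex[OF V(1,2)] .
  interpret V: affine K a b x y V p by fact
  have "p dvd q" using V.dvd_iff less.prems V by blast
  then obtain k where k: "k \<in> polys K" "q = p * k" using polys_dvdE[OF less.prems(1) V.pK] by blast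
  have k0: "k ~= 0" using k less.prems by auto
  have "degree k < degree q" using k k0 V.p_nz V.degp by (simp add: degree_mult_eq)
  then have "ddeg (divi (poly k x)) = 0" using less.hyps k k0 by blast
  moreover have "divi (poly q x) = divi (poly p x) + divi (poly k x)"
   unfolding k(2) poly_mult by (rule divi_mult) (use poly_x_nz[OF V.pK V.p_nz] poly_x_nz[OF k(1) k0] V.pK k(1) in simp_all)
  ultimately show ?thesis using ddeg_p[OF p] by (simp add: ddeg_add)
 qed
qed

lemma ddeg_sig:
 assumes z: "z \<in> F" "z ~= 0"
 shows "ddeg (divi (sig z)) = ddeg (divi z)"
proof -
 define S where "S = {V. place V \<and> ord_at V z ~= 0}"
 have fin: "finite S" unfolding S_def by (rule finite_support[OF z])
 have sz: "sig z \<in> F" "sig z ~= 0" using z sig_eq_0[OF z(1)] by simp_all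
 have VF: "V \<subseteq> F" if "place V" for V using valring.V_sub[OF placeD(1)[OF that]] .
 have inj: "inj_on sigp S"
 proof (rule inj_onI)
  fix V W assume "V \<in> S" "W \<in> S" "sigp V = sigp W"
  moreover have "sigp (sigp V) = V" "sigp (sigp W) = W"
   using sigp_sigp[OF VF] \<open>V \<in> S\<close> \<open>W \<in> S\<close> unfolding S_def by blast+
  ultimately show "V = W" by metis
 qed
 have o: "ord_at (sigp V) (sig z) = ord_at V z" if "place V" for V
  using ord_sigp[OF that sz] sig_sig[OF z(1)] by simp
 have "ddeg (divi (sig z)) = (\<Sum>V\<in>sigp ` S. ord_at V (sig z)*int (place_degree K V))"
 proof (rule ddeg_divi[OF sz])
  show "finite (sigp ` S)" using fin by simp
  fix V assume V: "place V" "ord_at V (sig z) ~= 0"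
  have "ord_at (sigp V) z ~= 0" using ord_sigp[OF V(1) z] V(2) by simp
  then have "sigp V \<in> S" using place_sigp[OF V(1)] by (simp add: S_def)
  then show "V \<in> sigp ` S" using sigp_sigp[OF VF[OF V(1)]] by (metis imageI)
 next
  fix V assume "V \<in> sigp ` S"
  then obtain W where "W \<in> S" "V = sigp W" by blast
  then show "place V" using place_sigp[of W] by (simp add: S_def)
 qed
 also have "\<dots> = (\<Sum>V\<in>S. ord_at V z*int (place_degree K V))"
  unfolding sum.reindex[OF inj] comp_def by (intro sum.cong) (auto simp: S_def o degree_sigp)
 also have "\<dots> = ddeg (divi z)" by (rule ddeg_divi[OF z fin, symmetric]) (auto simp: S_def)
 finally show ?thesis .
qed

text \<open>Conjugation permutes the places and preserves their degrees, and an element times its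
  conjugate is a polynomial in \<open>x\<close>. So twice the degree of the divisor of
  \<open>el u v\<close> is zero.\<close>

theorem ddeg_divi_0:
 assumes "z \<in> F" "z ~= 0"
 shows "ddeg (divi z) = 0"
proof -
 obtain u v r where *: "u \<in> polys K" "v \<in> polys K" "r \<in> polys K" "r ~= 0" "z = el u v / poly r x"
  using F_repr[OF assms(1)] .
 have nz: "u ~= 0 \<or> v ~= 0" using assms(2) *(5) by (auto simp: el_def)
 have e0: "el u v ~= 0" using assms(2) *(5) by auto
 then have e1: "el u (- v) ~= 0" using sig_eq_0[of "el u v"] sig_el1[OF *(1,2)] *(1,2) by simp
 have n0: "nrm u v ~= 0" by (rule degree_nrm(1)[OF nz])
 have "divi (poly (nrm u v) x) = divi (el u v) + divi (el u (- v))"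
  unfolding el_conj[symmetric] by (rule divi_mult) (use * e0 e1 in auto)
 then have "ddeg (divi (el u v)) + ddeg (divi (el u (- v))) = 0"
  using ddeg_poly[OF nrm_closed[OF *(1,2)] n0] by (simp add: ddeg_add)
 moreover have "ddeg (divi (el u (- v))) = ddeg (divi (el u v))"
  using ddeg_sig[of "el u v"] e0 * sig_el1[OF *(1,2)] by simp
 ultimately have "ddeg (divi (el u v)) = 0" by simp
 moreover have rx: "poly r x ~= 0" by (rule poly_x_nz[OF *(3,4)])
 have "divi z = divi (el u v) + divi (inverse (poly r x))"
  unfolding *(5) divide_inverse by (rule divi_mult) (use * e0 rx in auto)
 then have "divi z = divi (el u v) - divi (poly r x)" using divi_inverse[of "poly r x"] rx * by simp
 ultimately show ?thesis using ddeg_poly[OF *(3,4)] by (simp add: ddeg_diff)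
qed

section \<open>Points and divisor classes\<close>

definition "eqv D E \<longleftrightarrow> (\<exists>z\<in>F. z ~= 0 \<and> D - E = divi z)"

lemma eqvI: "z \<in> F ==> z ~= 0 ==> D - E = divi z ==> eqv D E"
 unfolding eqv_def by blast

lemma eqv_refl: "eqv D D"
 by (rule eqvI[of 1]) (auto simp: divi_1)

lemma eqv_uminus: "eqv D E ==> eqv (- D) (- E)"
 unfolding eqv_def
proof clarify
 fix z assume "z \<in> F" "z ~= 0" "D - E = divi z"
 then show "\<exists>z\<in>F. z ~= 0 \<and> - D - - E = divi z"
  using divi_inverse[of z] by (intro bexI[of _ "inverse z"]) (auto simp: algebra_simps)
qed

lemma eqv_add: "eqv D E ==> eqv D' E' ==> eqv (D + D') (E + E')"
 unfolding eqv_def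
proof clarify
 fix z w assume "z \<in> F" "z ~= 0" "D - E = divi z" "w \<in> F" "w ~= 0" "D' - E' = divi w"
 then show "\<exists>z\<in>F. z ~= 0 \<and> D + D' - (E + E') = divi z"
  using divi_mult[of z w] by (intro bexI[of _ "z*w"]) (auto simp: algebra_simps)
qed

lemma eqv_sym: "eqv D E ==> eqv E D"
 using eqv_add[OF eqv_uminus[of D E] eqv_refl[of "D + E"]] by simp

lemma eqv_trans: "eqv D E ==> eqv E D' ==> eqv D D'"
 using eqv_add[of D E E D'] eqv_add[OF _ eqv_refl[of "- E"], of "D + E" "E + D'"] by simp

lemma eqv_diff: "eqv D E ==> eqv D' E' ==> eqv (D - D') (E - E')"
 using eqv_add[of D E "- D'" "- E'"] eqv_uminus by simp

definition "pts = insert None {Some (s, t) |s t. s \<in> K \<and> t \<in> K \<and> t^2 = s^3 + a * s + b}"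

lemma pts_Some: "Some (s, t) \<in> pts \<longleftrightarrow> s \<in> K \<and> t \<in> K \<and> t^2 = s^3 + a * s + b"
 and pts_None [simp]: "None \<in> pts"
 by (auto simp: pts_def)

definition "at_pt s t V \<longleftrightarrow> affine K a b x y V [:- s, 1:] \<and> y - t \<in> mx V"

lemma at_pt_unique: "at_pt s t V ==> at_pt s t W ==> t \<in> K ==> V = W"
 unfolding at_pt_def using affine_same_h[of V "[:- s, 1:]" W "[:t:]"] by auto

lemma affine_linearI:
 assumes "place V" "x \<in> V" "s \<in> K" "x - s \<in> mx V"
 shows "affine K a b x y V [:- s, 1:]"
proof -
 obtain p where "affine K a b x y V p" using affine_ex[OF assms(1,2)] .
 then interpret V: affine K a b x y V p .
 have q: "[:- s, 1:] \<in> polys K" using assms(3) by simp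
 have "p dvd [:- s, 1:]" using V.dvd_iff[OF q] assms(4) by simp
 then obtain k where k: "[:- s, 1:] = p * k" by (rule dvdE)
 have "p ~= 0" "k ~= 0" using k by auto
 then have "degree p + degree k = 1" using arg_cong[OF k, of degree] by (simp add: degree_mult_eq)
 then have "degree k = 0" using V.degp by simp
 then obtain c where c: "k = [:c:]" by (rule degree_eq_zeroE)
 then have "c ~= 0" using \<open>k ~= 0\<close> by auto
 then have "[:- s, 1:] dvd r \<longleftrightarrow> p dvd r" for r unfolding k c by (simp add: smult_dvd_iff)
 then show ?thesis
  by unfold_locales (use V.plV assms q V.dvd_iff in auto)
qed

text \<open>Some place lies over \<open>x - s\<close>, and there \<open>y = t\<close> or
  \<open>y = - t\<close>; in the second case its conjugate is taken.\<close>

lemma at_pt_ex: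
 assumes "Some (s, t) \<in> pts"
 shows "\<exists>V. at_pt s t V"
proof -
 have st: "s \<in> K" "t \<in> K" "t^2 = s^3 + a * s + b" using assms by (auto simp: pts_Some)
 have "[:- s, 1:] \<in> polys K" "degree [:- s, 1:] > 0" using st by auto
 then obtain V where V: "place V" "x \<in> V" "poly [:- s, 1:] x \<in> mx V" using ex_place_over by metis
 have "affine K a b x y V [:- s, 1:]" using affine_linearI[OF V(1,2) st(1)] V(3) by simp
 then interpret V: affine K a b x y V "[:- s, 1:]" .
 have "poly fpoly s - t^2 = 0" using st(3) by (simp add: poly_f)
 then have "[:- s, 1:] dvd fpoly - [:t^2:]" by (simp add: poly_eq_0_iff_dvd[symmetric])
 then have "poly (fpoly - [:t^2:]) x \<in> mx V" using V.dvd_iff[of "fpoly - [:t^2:]"] st by simp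
 moreover have "poly (fpoly - [:t^2:]) x = (y - t)*(y + t)" using y2 by (simp add: square_simps)
 ultimately have "y - t \<in> mx V \<or> y + t \<in> mx V"
  using V.V.max_prime[of "y - t" "y + t"] V.K_V st by simp
 then show ?thesis
 proof
  assume "y - t \<in> mx V"
  then show ?thesis using V.affine_axioms unfolding at_pt_def by blast
 next
  assume "y + t \<in> mx V"
  then have "y - poly [:- t:] x \<in> mx V" by simp
  then have "y + poly [:- t:] x \<in> mx (sigp V)" using sigp_h[OF V.affine_axioms, of "[:- t:]"] st by simp
  then show ?thesis using affine_sigp[OF V.affine_axioms] unfolding at_pt_def by (intro exI[of _ "sigp V"]) simp
 qed
qed

definition "plc P = (case P of None \<Rightarrow> Inf_pl | Some (s, t) \<Rightarrow> (THE V. at_pt s t V))"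

lemma plc_None [simp]: "plc None = Inf_pl" by (simp add: plc_def)

lemma plc_at: "Some (s, t) \<in> pts ==> at_pt s t (plc (Some (s, t)))"
proof -
 assume *: "Some (s, t) \<in> pts"
 then obtain V where V: "at_pt s t V" using at_pt_ex by blast
 then have "(THE V. at_pt s t V) = V" using at_pt_unique * pts_Some by (intro the_equality) blast+
 then show ?thesis using V by (simp add: plc_def)
qed

lemma plc_eqI: "Some (s, t) \<in> pts ==> at_pt s t V ==> plc (Some (s, t)) = V"
 using plc_at at_pt_unique pts_Some by blast

lemma plc_affine: "Some (s, t) \<in> pts ==> affine K a b x y (plc (Some (s, t))) [:- s, 1:]"
 using plc_at unfolding at_pt_def by blast

lemma plc_place: "P \<in> pts ==> place (plc P)"
proof (cases P)
 case (Some c)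
 obtain s t where "c = (s, t)" by (cases c)
 then show "P \<in> pts ==> place (plc P)" using affine.plV[OF plc_affine[of s t]] Some by simp
qed (simp add: place_O)

lemma plc_degree: "P \<in> pts ==> place_degree K (plc P) = 1"
proof (cases P)
 case None
 then show ?thesis using infty.degree_eq[OF infty_O] by simp
next
 case (Some c)
 assume P: "P \<in> pts"
 obtain s t where c: "c = (s, t)" by (cases c)
 interpret V: affine K a b x y "plc P" "[:- s, 1:]" using plc_affine P Some c by simp
 have "y - poly [:t:] x \<in> mx (plc P)" "[:t:] \<in> polys K" using plc_at[of s t] P Some c pts_Some[of s t] unfolding at_pt_def by auto
 then have "\<not> V.inert" unfolding V.inert_def by blast
 then show ?thesis using V.degree_noninert by simp
qed

definition "dv P = frag_of (plc P) - frag_of Inf_pl"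

lemma dv_None [simp]: "dv None = 0" by (simp add: dv_def)

lemma ddeg_dv: "P \<in> pts ==> ddeg (dv P) = 0"
 using ddeg_frag[of 1 "plc P"] ddeg_frag[of 1 Inf_pl] plc_degree[of P] plc_degree[of None] by (simp add: dv_def ddeg_diff)

lemma at_pt_imp_root:
 assumes "at_pt s t V" "affine K a b x y V [:- s', 1:]" "s \<in> K" "s' \<in> K"
 shows "s = s'"
proof (rule ccontr)
 assume ne: "s ~= s'"
 interpret V: affine K a b x y V "[:- s', 1:]" by fact
 interpret W: affine K a b x y V "[:- s, 1:]" using assms(1) unfolding at_pt_def by blast
 have "x - s' \<in> mx V" "x - s \<in> mx V" using V.p_max W.p_max by simp_all
 then have "(x - s') - (x - s) \<in> mx V" by (rule V.V.max_diff)
 then have "s - s' \<in> mx V" by simp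
 then show False using V.K_unit[of "s - s'"] assms ne by simp
qed

end

text \<open>Vieta's relations for \<open>X^3 + a X + b - (l X + c)^2\<close>, whose roots are the
  abscissae of the three points on the line.\<close>

lemma chord_vieta:
 fixes a b s1 t1 s2 t2 :: complex
 assumes e1: "t1^2 = s1^3 + a * s1 + b" and e2: "t2^2 = s2^3 + a * s2 + b"
  and ne: "\<not> (s1 = s2 \<and> t1 = - t2)"
  and l: "l = (if s1 = s2 then (3 * s1\<^sup>2 + a) / (2*t1) else (t2 - t1) / (s2 - s1))"
  and c: "c = t1 - l * s1" and s3: "s3 = l^2 - s1 - s2"
 shows "t2 = l * s2 + c" "a - 2*l * c = s1 * s2 + s1 * s3 + s2 * s3" "c^2 - b = s1 * s2 * s3"
proof -
 have "t2 = l * s2 + c \<and> a - 2*l * c = s1 * s2 + s1 * s3 + s2 * s3 \<and> c^2 - b = s1 * s2 * s3"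
 proof (cases "s1 = s2")
  case True
  then have "(t1 - t2)*(t1 + t2) = 0" using e1 e2 by (simp add: square_simps)
  moreover have "t1 + t2 ~= 0" using ne True by (simp add: eq_neg_iff_add_eq_0)
  ultimately have t: "t1 = t2" by simp
  then have "t1 ~= 0" using \<open>t1 + t2 ~= 0\<close> by auto
  then have lt: "l*(2*t1) = 3 * s1^2 + a" using l True by simp
  have "a - 2*l * c = s1 * s1 + s1 * s3 + s1 * s3"
  proof -
   have "a - 2*l * c = a - l*(2*t1) + 2*l^2 * s1" unfolding c by (simp add: square_simps)
   then show ?thesis unfolding lt s3 True[symmetric] by (simp add: square_simps)
  qed
  moreover have "c^2 - b = s1 * s1 * s3"
  proof -
   have "c^2 - b = t1^2 - s1*(l*(2*t1)) + l^2 * s1^2 - b" unfolding c by (simp add: square_simps)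
   then show ?thesis unfolding lt e1 s3 True[symmetric] by (simp add: cube_simps)
  qed
  ultimately show ?thesis using t True c by simp
 next
  case False
  then have ls: "l*(s2 - s1) = t2 - t1" using l by simp
  then have t2: "t2 = l * s2 + c" unfolding c by (simp add: algebra_simps)
  have t1: "t1 = l * s1 + c" unfolding c by simp
  \<comment> \<open>\<open>A X + B\<close> is the cubic minus
    \<open>(X - s1) (X - s2) (X - s3)\<close>; the quadratic terms agree by the choice of
    \<open>s3\<close>. It vanishes at two distinct points, hence identically.\<close>
  define A where "A = a - 2*l * c - (s1 * s2 + s1 * s3 + s2 * s3)"
  define B where "B = b - c^2 + s1 * s2 * s3"
  have "A * s1 + B = s1^3 + a * s1 + b - (l * s1 + c)^2"
   unfolding A_def B_def s3 by (simp add: cube_simps)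
  then have z1: "A * s1 + B = 0" using e1 t1 by simp
  have "A * s2 + B = s2^3 + a * s2 + b - (l * s2 + c)^2"
   unfolding A_def B_def s3 by (simp add: cube_simps)
  then have z2: "A * s2 + B = 0" using e2 t2 by simp
  have "A*(s1 - s2) = (A * s1 + B) - (A * s2 + B)" by (simp add: algebra_simps)
  then have "A = 0" using z1 z2 False by simp
  then have "B = 0" using z1 by simp
  have "a - 2*l * c = s1 * s2 + s1 * s3 + s2 * s3" using \<open>A = 0\<close> by (simp add: A_def)
  moreover have "c^2 - b = s1 * s2 * s3" using \<open>B = 0\<close> by (simp add: B_def algebra_simps)
  ultimately show ?thesis using t2 by blast
 qed
 then show "t2 = l * s2 + c" "a - 2*l * c = s1 * s2 + s1 * s3 + s2 * s3" "c^2 - b = s1 * s2 * s3" by blast+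
qed

definition ec_neg :: "(complex \<times> complex) option \<Rightarrow> (complex \<times> complex) option" where
 "ec_neg P = map_option (\<lambda>(s, t). (s, - t)) P"

lemma ec_neg_simps [simp]: "ec_neg None = None" "ec_neg (Some (s, t)) = Some (s, - t)"
 by (simp_all add: ec_neg_def)

context ell_ff
begin

text \<open>The function \<open>y - l x - c\<close> has a triple pole at infinity, and its norm is,
  up to sign, the product of the three linear factors; the exponents in the norm are the
  multiplicities of the zeros.\<close>

lemma line_divisor:
 assumes K: "l \<in> K" "c \<in> K" "s1 \<in> K" "s2 \<in> K" "s3 \<in> K"
  and fac: "fpoly - [:c, l:]^2 = [:- s1, 1:]*[:- s2, 1:]*[:- s3, 1:]"
 shows "Some (s1, l * s1 + c) \<in> pts" "Some (s2, l * s2 + c) \<in> pts" "Some (s3, l * s3 + c) \<in> pts"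
  and "eqv (dv (Some (s1, l * s1 + c)) + dv (Some (s2, l * s2 + c)) + dv (Some (s3, l * s3 + c))) 0"
proof -
 have on: "Some (s, l * s + c) \<in> pts" if "s \<in> {s1, s2, s3}" for s
 proof -
  have "poly ([:- s1, 1:]*[:- s2, 1:]*[:- s3, 1:]) s = (s - s1)*(s - s2)*(s - s3)"
   unfolding poly_mult by simp
  then have "poly (fpoly - [:c, l:]^2) s = 0" unfolding fac using that by auto
  then have "(l * s + c)^2 = s^3 + a * s + b" by (simp add: poly_f algebra_simps)
  then show ?thesis using that K by (auto simp: pts_Some)
 qed
 then show P: "Some (s1, l * s1 + c) \<in> pts" "Some (s2, l * s2 + c) \<in> pts" "Some (s3, l * s3 + c) \<in> pts" by auto
 define u where "u = [:- c, - l:]"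
 define z where "z = el u 1"
 have u: "u \<in> polys K" using K by (simp add: u_def)
 have zxy: "z = y - (l*x + c)" by (simp add: z_def el_def u_def algebra_simps)
 have n: "nrm u 1 = - ([:- s1, 1:]*[:- s2, 1:]*[:- s3, 1:])"
 proof -
  have "u = - [:c, l:]" by (simp add: u_def)
  then have "u^2 = [:c, l:]^2" by (simp only: power2_minus)
  then have "nrm u 1 = - (fpoly - [:c, l:]^2)" by (simp add: nrm_def)
  then show ?thesis using fac by simp
 qed
 have z: "z \<in> F" "z ~= 0" using u el_eq_0(2)[OF u polys_1] by (auto simp: z_def)
 let ?P = "\<lambda>s. plc (Some (s, l * s + c))"
 have "divi z = frag_of (?P s1) + frag_of (?P s2) + frag_of (?P s3) - frag_cmul 3 (frag_of Inf_pl)"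
 proof (rule poly_mapping_eqI)
  fix V
  show "lk (divi z) V = lk (frag_of (?P s1) + frag_of (?P s2) + frag_of (?P s3) - frag_cmul 3 (frag_of Inf_pl)) V"
  proof (cases "place V")
   case False
   then have "V ~= ?P s1" "V ~= ?P s2" "V ~= ?P s3" "V ~= Inf_pl" using plc_place[OF P(1)] plc_place[OF P(2)] plc_place[OF P(3)] place_O by blast+
   then show ?thesis using False by (simp add: lookup_divi[OF z] lookup_add lookup_minus)
  next
   case pl: True
   then show ?thesis
   proof (cases rule: place_cases)
    case 1
    interpret I: infty K a b x y Inf_pl by (rule infty_O)
    have "degree (nrm u 1) = 3" unfolding n by (simp add: degree_mult_eq)
    then have "ord_at V z = - 3" using I.ord_el[OF u polys_1] 1 by (simp add: z_def)
    moreover have "Inf_pl ~= ?P s1" "Inf_pl ~= ?P s2" "Inf_pl ~= ?P s3"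
     using affine_ne_O[OF plc_affine[OF P(1)]] affine_ne_O[OF plc_affine[OF P(2)]] affine_ne_O[OF plc_affine[OF P(3)]] by auto
    ultimately show ?thesis using pl by (simp add: lookup_divi[OF z] lookup_add lookup_minus 1)
   next
    case (2 p)
    interpret V: affine K a b x y V p by fact
    have VI: "V ~= Inf_pl" by (rule affine_ne_O[OF 2])
    show ?thesis
    proof (cases "z \<in> mx V")
     case False
     have "V ~= ?P s" if s: "s \<in> {s1, s2, s3}" for s
     proof
      assume e: "V = ?P s"
      have at: "at_pt s (l * s + c) V" using plc_at[OF on[OF s]] e by simp
      then interpret W: affine K a b x y V "[:- s, 1:]" unfolding at_pt_def by blast
      have m: "y - (l * s + c) \<in> mx V" "x - s \<in> mx V"
       using at W.p_max unfolding at_pt_def by simp_all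
      have "z = (y - (l * s + c)) - l*(x - s)" unfolding zxy by (simp add: algebra_simps)
      also have "\<dots> \<in> mx V"
       by (rule V.V.max_diff[OF m(1) V.V.max_mult'[OF m(2)]]) (use K V.K_V in simp)
      finally show False using False by simp
     qed
     then have "V ~= ?P s1" "V ~= ?P s2" "V ~= ?P s3" by auto
     moreover have "ord_at V z = 0" using V.V.ord_unit[OF _ False] u by (simp add: z_def)
     ultimately show ?thesis using VI pl by (simp add: lookup_divi[OF z] lookup_add lookup_minus)
    next
     case True
     have lin: "[:- s, 1:] \<in> polys K" if "s \<in> {s1, s2, s3}" for s using that K by auto
     have "el u 1*el u (- 1) \<in> mx V" by (rule V.V.max_mult) (use True u in \<open>auto simp: z_def\<close>)
     then have "p dvd nrm u 1" unfolding el_conj using V.dvd_iff[of "nrm u 1"] u by simp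
     then have "p dvd [:- s1, 1:]*[:- s2, 1:]*[:- s3, 1:]" unfolding n by (simp only: dvd_minus_iff)
     then have "p dvd [:- s1, 1:] \<or> p dvd [:- s2, 1:] \<or> p dvd [:- s3, 1:]"
      using V.p_prime[OF polys_mult[OF lin lin] lin, of s1 s2 s3] V.p_prime[OF lin lin, of s1 s2] by blast
     then obtain s where s: "s \<in> {s1, s2, s3}" "p dvd [:- s, 1:]" by blast
     have sK: "s \<in> K" using s K by auto
     have "poly [:- s, 1:] x \<in> mx V" using V.dvd_iff[OF lin[OF s(1)]] s(2) by simp
     then have xs: "x - s \<in> mx V" by simp
     have aff: "affine K a b x y V [:- s, 1:]" by (rule affine_linearI[OF V.plV V.xV sK xs])
     interpret W: affine K a b x y V "[:- s, 1:]" by (rule aff)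
     have "y - (l * s + c) = z + l*(x - s)" unfolding zxy by (simp add: algebra_simps)
     also have "\<dots> \<in> mx V"
      by (rule V.V.max_add[OF True V.V.max_mult'[OF xs]]) (use K V.K_V in simp)
     finally have at: "at_pt s (l * s + c) V" unfolding at_pt_def using aff by simp
     have eq: "V = ?P s' \<longleftrightarrow> s' = s" if s': "s' \<in> {s1, s2, s3}" for s'
     proof
      assume "s' = s"
      then show "V = ?P s'" using plc_eqI[OF on[OF s']] at by metis
     next
      assume e: "V = ?P s'"
      have "at_pt s' (l * s' + c) V" using plc_at[OF on[OF s']] unfolding e[symmetric] .
      then show "s' = s" by (rule at_pt_imp_root[OF _ aff]) (use s' sK K in auto)
     qed
     \<comment> \<open>Each linear factor is split into a power of \<open>x - s\<close> and a part
       prime to it, so that coincidences among the three points are counted without a case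
       distinction.\<close>
     define e where "e s' = (if s' = s then 1 else 0 :: nat)" for s'
     define g where "g s' = (if s' = s then 1 else [:- s', 1:])" for s'
     have eg: "[:- s', 1:] = [:- s, 1:]^e s'*g s'" for s' by (simp add: e_def g_def)
     have gK: "g s' \<in> polys K" if "s' \<in> {s1, s2, s3}" for s' using lin[OF that] by (simp add: g_def)
     have gs: "poly (g s') s ~= 0" for s' by (simp add: g_def)
     define m where "m = - (g s1*g s2*g s3)"
     have mK: "m \<in> polys K" unfolding m_def using gK by simp
     have "poly m s ~= 0" using gs by (simp add: m_def)
     then have nd: "\<not> [:- s, 1:] dvd m" by (simp add: poly_eq_0_iff_dvd)
     have nm: "nrm u 1 = [:- s, 1:]^(e s1 + e s2 + e s3)*m"
      unfolding n m_def eg[of s1] eg[of s2] eg[of s3] by (simp only: power_add mult_minus_left mult_minus_right mult_ac)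
     have "\<not> ([:- s, 1:] dvd u \<and> [:- s, 1:] dvd 1)" using W.not_p_dvd_1 by blast
     from W.ord_prim[OF u polys_1 this mK nm nd] True
     have "ord_at V z = int (e s1 + e s2 + e s3)" by (simp add: z_def)
     then show ?thesis using VI pl eq by (simp add: lookup_divi[OF z] lookup_add lookup_minus e_def)
    qed
   qed
  qed
 qed
 moreover have "frag_cmul 3 (frag_of Inf_pl) = frag_of Inf_pl + frag_of Inf_pl + frag_of Inf_pl"
  using frag_cmul_distrib[of 1 1 "frag_of Inf_pl"] frag_cmul_distrib[of 2 1 "frag_of Inf_pl"] by simp
 ultimately show "eqv (dv (Some (s1, l * s1 + c)) + dv (Some (s2, l * s2 + c)) + dv (Some (s3, l * s3 + c))) 0"
  using z by (intro eqvI[of z]) (simp_all add: dv_def)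
qed

lemma ec_neg_pts: "P \<in> pts ==> ec_neg P \<in> pts"
 by (cases P) (auto simp: pts_Some)

text \<open>The divisor of the vertical line \<open>x - s\<close>. The point and its negative have
  the same place exactly where \<open>y\<close> vanishes, and there \<open>x - s\<close> has order
  2.\<close>

lemma eqv_neg:
 assumes "P \<in> pts"
 shows "eqv (dv P + dv (ec_neg P)) 0"
proof (cases P)
 case None
 then show ?thesis using eqv_refl by simp
next
 case (Some q)
 then obtain s t where P: "P = Some (s, t)" by (cases q) auto
 then have st: "s \<in> K" "t \<in> K" "t^2 = s^3 + a * s + b" and pt: "Some (s, t) \<in> pts" using assms pts_Some by auto
 have pt': "Some (s, - t) \<in> pts" using ec_neg_pts[OF pt] by simp
 define q where "q = [:- s, 1:]"
 have q: "q \<in> polys K" "q ~= 0" using st by (auto simp: q_def)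
 have z: "poly q x \<in> F" "poly q x ~= 0" using poly_x_nz[OF q] q by auto
 let ?V = "plc (Some (s, t))" and ?W = "plc (Some (s, - t))"
 have "divi (poly q x) = frag_of ?V + frag_of ?W - frag_cmul 2 (frag_of Inf_pl)"
 proof (rule poly_mapping_eqI)
  fix V
  show "lk (divi (poly q x)) V = lk (frag_of ?V + frag_of ?W - frag_cmul 2 (frag_of Inf_pl)) V"
  proof (cases "place V")
   case False
   then have "V ~= ?V" "V ~= ?W" "V ~= Inf_pl" using plc_place[OF pt] plc_place[OF pt'] place_O by blast+
   then show ?thesis using False by (simp add: lookup_divi[OF z] lookup_add lookup_minus)
  next
   case pl: True
   then show ?thesis
   proof (cases rule: place_cases)
    case 1
    interpret I: infty K a b x y Inf_pl by (rule infty_O)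
    have "ord_at V (poly q x) = - 2" using I.ord_poly[OF q] 1 by (simp add: q_def)
    moreover have "Inf_pl ~= ?V" "Inf_pl ~= ?W"
     using affine_ne_O[OF plc_affine[OF pt]] affine_ne_O[OF plc_affine[OF pt']] by auto
    ultimately show ?thesis using pl by (simp add: lookup_divi[OF z] lookup_add lookup_minus 1)
   next
    case (2 p)
    interpret V: affine K a b x y V p by fact
    have VI: "V ~= Inf_pl" by (rule affine_ne_O[OF 2])
    show ?thesis
    proof (cases "poly q x \<in> mx V")
     case False
     have "V ~= plc (Some (s, t'))" if t': "Some (s, t') \<in> pts" for t'
     proof
      assume e: "V = plc (Some (s, t'))"
      interpret W: affine K a b x y V "[:- s, 1:]" unfolding e by (rule plc_affine[OF t'])
      show False using W.p_max False by (simp add: q_def)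
     qed
     then have "V ~= ?V" "V ~= ?W" using pt pt' by auto
     moreover have "ord_at V (poly q x) = 0" using V.V.ord_unit[OF _ False] q by simp
     ultimately show ?thesis using VI pl by (simp add: lookup_divi[OF z] lookup_add lookup_minus)
    next
     case True
     have aff: "affine K a b x y V [:- s, 1:]"
      by (rule affine_linearI[OF V.plV V.xV st(1)]) (use True in \<open>simp add: q_def\<close>)
     interpret W: affine K a b x y V "[:- s, 1:]" by (rule aff)
     have o: "ord_at V (poly q x) = (if y \<in> mx V then 2 else 1)" using W.ord_p by (simp add: q_def)
     have pe: "V = plc (Some (s, t')) \<longleftrightarrow> y - t' \<in> mx V" if t': "Some (s, t') \<in> pts" for t'
      using plc_eqI[OF t', of V] plc_at[OF t'] aff unfolding at_pt_def by metis
     have eV: "V = ?V \<longleftrightarrow> y - t \<in> mx V" by (rule pe[OF pt])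
     have eW: "V = ?W \<longleftrightarrow> y + t \<in> mx V" using pe[OF pt'] by simp
     interpret PV: affine K a b x y ?V "[:- s, 1:]" by (rule plc_affine[OF pt])
     have "y - poly [:t:] x \<in> mx ?V" using plc_at[OF pt] unfolding at_pt_def by simp
     then have "V = ?V \<or> y + t \<in> mx V"
      using affine_h_cases[OF PV.affine_axioms aff, of "[:t:]"] st by simp
     then have some: "V = ?V \<or> V = ?W" using eW by blast
     have tV: "t \<in> V" using V.K_V st by simp
     have both: "y \<in> mx V \<longleftrightarrow> V = ?V \<and> V = ?W"
     proof
      assume "V = ?V \<and> V = ?W"
      then have "(y - t) + (y + t) \<in> mx V" using eV eW V.V.max_add by blast
      then have "2*y \<in> mx V" by simp
      then show "y \<in> mx V" using V.two_max[of y] by simp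
     next
      assume ym: "y \<in> mx V"
      have "y - (y - t) \<in> mx V \<or> (y + t) - y \<in> mx V"
       using some eV eW V.V.max_diff[OF ym, of "y - t"] V.V.max_diff[OF _ ym, of "y + t"] by blast
      then have "t \<in> mx V" by simp
      then have "t = 0" using V.K_unit st by blast
      then show "V = ?V \<and> V = ?W" using eV eW ym by simp
     qed
     show ?thesis using VI pl some both unfolding lookup_divi[OF z] o lookup_add lookup_minus by auto
    qed
   qed
  qed
 qed
 moreover have "frag_cmul 2 (frag_of Inf_pl) = frag_of Inf_pl + frag_of Inf_pl"
  using frag_cmul_distrib[of 1 1 "frag_of Inf_pl"] by simp
 ultimately show ?thesis using z P by (intro eqvI[of "poly q x"]) (simp_all add: dv_def)
qed

text \<open>The line through \<open>P\<close> and \<open>Q\<close> and the vertical line through its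
  third point give two relations, whose difference is the claim.\<close>

lemma ec_add_eqv:
 assumes P: "P \<in> pts" and Q: "Q \<in> pts"
 shows "ec_add a P Q \<in> pts \<and> eqv (dv P + dv Q) (dv (ec_add a P Q))"
proof (cases "P = None \<or> Q = None")
 case True
 then show ?thesis using P Q eqv_refl by (cases P; cases Q) auto
next
 case False
 then obtain s1 t1 s2 t2 where PQ: "P = Some (s1, t1)" "Q = Some (s2, t2)" by auto
 have on: "s1 \<in> K" "t1 \<in> K" "t1^2 = s1^3 + a * s1 + b" "s2 \<in> K" "t2 \<in> K" "t2^2 = s2^3 + a * s2 + b"
  using P Q PQ pts_Some by auto
 show ?thesis
 proof (cases "s1 = s2 \<and> t1 = - t2")
  case True
  then show ?thesis using eqv_neg[OF P] PQ by simp
 next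
  case ne: False
  define l where "l = (if s1 = s2 then (3 * s1\<^sup>2 + a) / (2*t1) else (t2 - t1) / (s2 - s1))"
  define c where "c = t1 - l * s1"
  define s3 where "s3 = l^2 - s1 - s2"
  have lK: "l \<in> K" unfolding l_def using on by simp
  then have cK: "c \<in> K" "s3 \<in> K" unfolding c_def s3_def using on by simp_all
  note v = chord_vieta[OF on(3,6) ne l_def c_def s3_def]
  have "fpoly - [:c, l:]^2 = pCons (b - c^2) (pCons (a - 2*l * c) [:- (l^2), 1:])"
   by (simp add: fpoly_def power2_eq_square algebra_simps)
  also have "\<dots> = pCons (- (s1 * s2 * s3)) (pCons (s1 * s2 + s1 * s3 + s2 * s3) [:- (s1 + s2 + s3), 1:])"
  proof -
   have "b - c^2 = - (s1 * s2 * s3)" using v(3) by (simp add: algebra_simps)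
   moreover have "l^2 = s1 + s2 + s3" by (simp add: s3_def)
   ultimately show ?thesis using v(2) by simp
  qed
  also have "\<dots> = [:- s1, 1:]*[:- s2, 1:]*[:- s3, 1:]" by (simp add: algebra_simps)
  finally have fac: "fpoly - [:c, l:]^2 = [:- s1, 1:]*[:- s2, 1:]*[:- s3, 1:]" .
  note L = line_divisor[OF lK cK(1) on(1,4) cK(2) fac]
  have t1: "l * s1 + c = t1" by (simp add: c_def)
  have y3: "l*(s1 - s3) - t1 = - (l * s3 + c)" by (simp add: c_def algebra_simps)
  have "ec_add a P Q = Some (s3, l*(s1 - s3) - t1)"
   unfolding PQ ec_add.simps Let_def l_def[symmetric] s3_def[symmetric] using ne by (simp only: if_False)
  then have sum: "ec_add a P Q = ec_neg (Some (s3, l * s3 + c))" by (simp add: y3)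
  have e1: "eqv (dv P + dv Q + dv (Some (s3, l * s3 + c))) 0" using L(4) t1 v(1) PQ by simp
  have e2: "eqv (dv (Some (s3, l * s3 + c)) + dv (ec_add a P Q)) 0" unfolding sum by (rule eqv_neg[OF L(3)])
  have "eqv (dv P + dv Q) (dv (ec_add a P Q))"
   using eqv_add[OF eqv_diff[OF e1 e2] eqv_refl[of "dv (ec_add a P Q)"]] by simp
  then show ?thesis using sum ec_neg_pts[OF L(3)] by simp
 qed
qed

subsection \<open>Every class of degree zero comes from a point\<close>

definition "ptcl = {D. \<exists>P\<in>pts. eqv D (dv P)}"

lemma ptclI: "P \<in> pts ==> eqv D (dv P) ==> D \<in> ptcl"
 unfolding ptcl_def by blast

lemma ptcl_0: "0 \<in> ptcl"
 using ptclI[of None 0] eqv_refl by simp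

lemma ptcl_add: "D \<in> ptcl ==> E \<in> ptcl ==> D + E \<in> ptcl"
proof -
 assume "D \<in> ptcl" "E \<in> ptcl"
 then obtain P Q where "P \<in> pts" "eqv D (dv P)" "Q \<in> pts" "eqv E (dv Q)" unfolding ptcl_def by blast
 then have "eqv (D + E) (dv P + dv Q)" "ec_add a P Q \<in> pts" "eqv (dv P + dv Q) (dv (ec_add a P Q))"
  using ec_add_eqv eqv_add by auto
 then show ?thesis using ptclI eqv_trans by blast
qed

lemma ptcl_uminus: "D \<in> ptcl ==> - D \<in> ptcl"
proof -
 assume "D \<in> ptcl"
 then obtain P where P: "P \<in> pts" "eqv D (dv P)" unfolding ptcl_def by blast
 have "eqv (dv P + dv (ec_neg P) - dv P) (0 - D)" by (rule eqv_diff[OF eqv_neg[OF P(1)] eqv_sym[OF P(2)]])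
 then have "eqv (- D) (dv (ec_neg P))" using eqv_sym by simp
 then show ?thesis using ptclI ec_neg_pts P by blast
qed

lemma ptcl_cmul: "D \<in> ptcl ==> frag_cmul n D \<in> ptcl"
proof -
 assume D: "D \<in> ptcl"
 have *: "frag_cmul (int k) D \<in> ptcl" for k
 proof (induction k)
  case (Suc k)
  have "frag_cmul (int (Suc k)) D = frag_cmul (int k) D + D" by (simp add: frag_cmul_distrib)
  then show ?case using Suc D ptcl_add by simp
 qed (simp add: ptcl_0)
 show ?thesis
 proof (cases "n \<ge> 0")
  case True
  then show ?thesis using *[of "nat n"] by simp
 next
  case False
  then have "frag_cmul n D = - frag_cmul (int (nat (- n))) D" by simp
  then show ?thesis using ptcl_uminus[OF *[of "nat (- n)"]] by simp
 qed
qed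

lemma ptcl_sum: "(\<And>i. i \<in> A ==> f i \<in> ptcl) ==> sum f A \<in> ptcl"
 by (induction A rule: infinite_finite_induct) (auto intro: ptcl_0 ptcl_add)

lemma ptcl_eqv: "eqv D E ==> E \<in> ptcl ==> D \<in> ptcl"
 unfolding ptcl_def using eqv_trans by blast

definition "dcl V = frag_of V - frag_cmul (int (place_degree K V)) (frag_of Inf_pl)"

lemma dcl_Inf: "dcl Inf_pl = 0"
 using plc_degree[of None] by (simp add: dcl_def)

text \<open>The multiples of the point at infinity add up to the degree of the divisor, which is
  zero.\<close>

lemma divi_dcl:
 assumes z: "z \<in> F" "z ~= 0" and S: "finite S" "\<And>V. place V ==> ord_at V z ~= 0 ==> V \<in> S" "\<And>V. V \<in> S ==> place V"
 shows "divi z = (\<Sum>V\<in>S. frag_cmul (ord_at V z) (dcl V))"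
proof -
 have "(\<Sum>V\<in>S. frag_cmul (ord_at V z) (dcl V)) =
  (\<Sum>V\<in>S. frag_cmul (ord_at V z) (frag_of V)) - frag_cmul (\<Sum>V\<in>S. ord_at V z*int (place_degree K V)) (frag_of Inf_pl)"
  by (intro poly_mapping_eqI) (simp add: dcl_def lookup_sum lookup_minus sum_subtractf sum_distrib_right right_diff_distrib)
 also have "(\<Sum>V\<in>S. ord_at V z*int (place_degree K V)) = 0"
  using ddeg_divi[OF z S] ddeg_divi_0[OF z] by simp
 also have "(\<Sum>V\<in>S. frag_cmul (ord_at V z) (frag_of V)) = divi z"
 proof (rule poly_mapping_eqI)
  fix W
  have "lk (\<Sum>V\<in>S. frag_cmul (ord_at V z) (frag_of V)) W = (\<Sum>V\<in>S. if V = W then ord_at W z else 0)"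
   unfolding lookup_sum by (intro sum.cong) auto
  also have "\<dots> = (if W \<in> S then ord_at W z else 0)" using S(1) by simp
  also have "\<dots> = lk (divi z) W" using S(2,3) by (auto simp: lookup_divi[OF z])
  finally show "lk (\<Sum>V\<in>S. frag_cmul (ord_at V z) (frag_of V)) W = lk (divi z) W" .
 qed
 finally show ?thesis by simp
qed

text \<open>Reduction in the style of Cantor's algorithm: if \<open>y - h\<close> vanishes at \<open>V\<close>, then all other zeros of
 \<open>y - h\<close> lie over \<open>(f - h\<^sup>2) / p\<close>, whose degree is smaller than that of \<open>p\<close>.\<close>

lemma dcl_ptcl:
 assumes "affine K a b x y V p"
 shows "dcl V \<in> ptcl"
 using assms
proof (induction "degree p" arbitrary: V p rule: less_induct)
 case less
 interpret V: affine K a b x y V p by (rule less.prems)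
 interpret S: affine K a b x y "sigp V" p by (rule affine_sigp[OF less.prems])
 show ?case
 proof (cases "V.inert")
  case True
  have pz: "poly p x \<in> F" "poly p x ~= 0" using poly_x_nz[OF V.pK V.p_nz] by auto
  have e: "sigp V = V" using sigp_eq(2)[OF less.prems] True by blast
  have "y - poly 0 x \<notin> mx V" using True polys_0 unfolding V.inert_def by blast
  then have o: "ord_at V (poly p x) = 1" using V.ord_p by simp
  have "divi (poly p x) = (\<Sum>W\<in>{Inf_pl, V}. frag_cmul (ord_at W (poly p x)) (dcl W))"
   by (rule divi_dcl[OF pz]) (use ord_p_support[OF less.prems] e V.plV place_O in auto)
  also have "\<dots> = dcl V" using affine_ne_O[OF less.prems] o by (simp add: dcl_Inf)
  finally have "eqv (dcl V) 0" using pz by (intro eqvI[of "poly p x"]) auto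
  then show ?thesis using ptcl_eqv ptcl_0 by blast
 next
  case ni: False
  obtain h where h: "h \<in> polys K" "degree h < degree p" "y - poly h x \<in> mx V" "y \<in> mx V \<longrightarrow> h = 0"
  proof (cases "y \<in> mx V")
   case True
   then show ?thesis using that[of 0] V.degp by simp
  next
   case False
   obtain h0 where h0: "h0 \<in> polys K" "y - poly h0 x \<in> mx V" using ni unfolding V.inert_def by blast
   then obtain h where h: "h \<in> polys K" "degree h < degree p" "poly h0 x - poly h x \<in> mx V"
    using V.reduce_mod by metis
   have "(y - poly h0 x) + (poly h0 x - poly h x) \<in> mx V" by (rule V.V.max_add[OF h0(2) h(3)])
   then show ?thesis using that[OF h(1,2)] False by simp
  qed
  define z where "z = el (- h) 1"
  have zy: "z = y - poly h x" by (simp add: z_def el_def)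
  have hK: "- h \<in> polys K" using h by simp
  have z: "z \<in> F" "z ~= 0" using hK el_eq_0(2)[OF hK polys_1] by (auto simp: z_def)
  have zm: "z \<in> mx V" using h(3) zy by simp
  have nz: "nrm (- h) 1 ~= 0" "degree (nrm (- h) 1) = (if h = 0 then 3 else max (2*degree h) 3)"
   using degree_nrm[of "- h" 1] by auto
  have "el (- h) 1*el (- h) (- 1) \<in> mx V" by (rule V.V.max_mult) (use zm hK in \<open>auto simp: z_def\<close>)
  then have "p dvd nrm (- h) 1" unfolding el_conj using V.dvd_iff[of "nrm (- h) 1"] hK by simp
  then obtain p' where p': "p' \<in> polys K" "nrm (- h) 1 = p*p'"
   using polys_dvdE[OF nrm_closed[OF hK polys_1] V.pK] by blast
  have p'0: "p' ~= 0" using nz(1) p'(2) by auto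
  have dsum: "degree p + degree p' = (if h = 0 then 3 else max (2*degree h) 3)"
   using nz(2) p'0 V.p_nz unfolding p'(2) by (simp add: degree_mult_eq)
  show ?thesis
  proof (cases "degree p = 1")
   case True
   have "\<exists>s\<in>K. \<exists>t\<in>K. x - s \<in> mx V \<and> h = [:t:]"
   proof -
    obtain t where t: "h = [:t:]" using h(2) True by (auto elim: degree_eq_zeroE)
    obtain c0 c1 where c: "p = [:c0, c1:]" "c1 ~= 0"
    proof -
     obtain c0 p1 where p1: "p = pCons c0 p1" by (cases p)
     then have "degree p1 = 0" using True by (auto split: if_splits)
     then obtain c1 where "p1 = [:c1:]" by (rule degree_eq_zeroE)
     then show ?thesis using that p1 True by (auto split: if_splits)
    qed
    have cK: "c0 \<in> K" "c1 \<in> K" using V.pK c by auto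
    have "poly p x*inverse c1 \<in> mx V"
     by (rule V.V.max_mult[OF V.p_max]) (use cK V.K_V in simp)
    also have "poly p x*inverse c1 = x - (- c0 / c1)"         proof -
     have "(c0 + x * c1)*inverse c1 = x*(c1*inverse c1) + c0*inverse c1" by (simp only: algebra_simps)
     then show ?thesis using c by (simp add: divide_inverse)
    qed
    finally show ?thesis using cK t h(1) by (intro bexI[of _ "- c0 / c1"] bexI[of _ t]) auto
   qed
   then obtain s t where st: "s \<in> K" "t \<in> K" "x - s \<in> mx V" "h = [:t:]" by blast
   have aff: "affine K a b x y V [:- s, 1:]" by (rule affine_linearI[OF V.plV V.xV st(1,3)])
   interpret W: affine K a b x y V "[:- s, 1:]" by (rule aff)
   have "poly (nrm (- h) 1) x \<in> mx V" using V.dvd_iff[of "nrm (- h) 1"] p' hK by simp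
   then have "[:- s, 1:] dvd nrm (- h) 1" using W.dvd_iff[of "nrm (- h) 1"] hK by simp
   then have "poly (nrm (- h) 1) s = 0" by (simp only: poly_eq_0_iff_dvd)
   then have "t^2 = s^3 + a * s + b" by (simp add: nrm_def st(4) poly_f)
   then have pt: "Some (s, t) \<in> pts" using st by (simp add: pts_Some)
   have "at_pt s t V" unfolding at_pt_def using aff h(3) st(4) by simp
   then have "plc (Some (s, t)) = V" by (rule plc_eqI[OF pt])
   then have "dcl V = dv (Some (s, t))" using plc_degree[OF pt] by (simp add: dcl_def dv_def)
   then show ?thesis using ptclI[OF pt] eqv_refl by simp
  next
   case False
   then have d2: "degree p \<ge> 2" using V.degp by simp
   \<comment> \<open>The norm has degree at most \<open>max (2 * degree p - 2) 3\<close>, so the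
     cofactor \<open>p'\<close> has degree at most the larger of \<open>degree p - 2\<close> and
     \<open>3 - degree p\<close>; both are below \<open>degree p\<close> once this is at least
     2.\<close>
   have dlt: "degree p' < degree p" using dsum d2 h(2) by (auto split: if_splits)
   have nd: "\<not> p dvd - p'" using V.small_dvd[of p'] dlt p'0 by auto
   have o1: "ord_at V z = 1"
   proof -
    have pr: "\<not> (p dvd - h \<and> p dvd 1)" using V.not_p_dvd_1 by blast
    have "\<not> p dvd p'" using nd by simp
    from V.ord_prim[OF hK polys_1 pr p'(1) _ this, of 1] show ?thesis using p'(2) zm by (simp add: z_def)
   qed
   define T where "T = {W. place W \<and> ord_at W z ~= 0}"
   have finT: "finite T" unfolding T_def by (rule finite_support[OF z])
   have VT: "V \<in> T" using V.plV o1 by (simp add: T_def)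
   have "divi z = (\<Sum>W\<in>T. frag_cmul (ord_at W z) (dcl W))"
    by (rule divi_dcl[OF z finT]) (auto simp: T_def)
   also have "\<dots> = dcl V + (\<Sum>W\<in>T - {V}. frag_cmul (ord_at W z) (dcl W))"
    using sum.remove[OF finT VT, of "\<lambda>W. frag_cmul (ord_at W z) (dcl W)"] o1 by simp
   finally have dz: "dcl V - (- (\<Sum>W\<in>T - {V}. frag_cmul (ord_at W z) (dcl W))) = divi z" by simp
   have mem: "dcl W \<in> ptcl" if W: "W \<in> T - {V}" for W
   proof -
    have Wp: "place W" "ord_at W z ~= 0" "W ~= V" using W by (auto simp: T_def)
    show ?thesis using Wp(1)
    proof (cases rule: place_cases)
     case 1
     then show ?thesis using dcl_Inf ptcl_0 by simp
    next
     case (2 q)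
     interpret W: affine K a b x y W q by fact
     have zW: "z \<in> mx W"
     proof (rule ccontr)
      assume "z \<notin> mx W"
      then have "ord_at W z = 0" using W.V.ord_unit[of z] hK by (simp add: z_def)
      then show False using Wp by simp
     qed
     have "el (- h) 1*el (- h) (- 1) \<in> mx W" by (rule W.V.max_mult) (use zW hK in \<open>auto simp: z_def\<close>)
     then have "q dvd nrm (- h) 1" unfolding el_conj using W.dvd_iff[of "nrm (- h) 1"] hK by simp
     then have "q dvd p*p'" by (simp only: p'(2))
     then have "q dvd p \<or> q dvd p'" using W.p_prime[OF V.pK p'(1)] by blast
     \<comment> \<open>A second zero over \<open>p\<close> would be the conjugate of
       \<open>V\<close>. As \<open>y - h\<close> vanishes at both, \<open>y = h\<close> and
       \<open>y = - h\<close> at \<open>V\<close>; so \<open>y\<close> vanishes there, and the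
       conjugate of \<open>V\<close> is \<open>V\<close> itself.\<close>
     moreover have False if "q dvd p"
     proof -
      have "poly p x \<in> mx W" using W.dvd_iff[OF V.pK] that by blast
      then have "affine K a b x y W p" using affine_over_iff[OF less.prems 2] by blast
      then have Ws: "W = sigp V" using affine_over_cases[OF less.prems] Wp(3) by blast
      have "y - poly h x \<in> mx (sigp V)" using zW zy Ws by simp
      then have "y + poly (- h) x \<in> mx (sigp V)" by simp
      then have "y - poly (- h) x \<in> mx V" using sigp_h[OF less.prems hK] by blast
      then have "(y - poly (- h) x) + (y - poly h x) \<in> mx V" using h(3) by (rule V.V.max_add)
      then have "2*y \<in> mx V" by simp
      then have "y \<in> mx V" using V.two_max[of y] by simp
      then show False using sigp_eq(2)[OF less.prems] Ws Wp(3) by blast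
     qed
     ultimately have "q dvd p'" by blast
     then have "degree q \<le> degree p'" using p'0 dvd_imp_degree_le by blast
     then show ?thesis using less.hyps[OF _ 2] dlt by simp
    qed
   qed
   have "- (\<Sum>W\<in>T - {V}. frag_cmul (ord_at W z) (dcl W)) \<in> ptcl"
    by (intro ptcl_uminus ptcl_sum ptcl_cmul mem)
   then show ?thesis using ptcl_eqv eqvI[OF z dz] by blast
  qed
 qed
qed

lemma ptcl_all:
 assumes "Poly_Mapping.keys D \<subseteq> places K F" "ddeg D = 0"
 shows "D \<in> ptcl"
proof -
 let ?S = "Poly_Mapping.keys D"
 have "D = (\<Sum>V\<in>?S. frag_cmul (lk D V) (dcl V))"
 proof (rule poly_mapping_eqI)
  fix W
  have "lk (\<Sum>V\<in>?S. frag_cmul (lk D V) (dcl V)) W =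
   (\<Sum>V\<in>?S. if V = W then lk D W else 0) - (\<Sum>V\<in>?S. lk D V*int (place_degree K V))*lk (frag_of Inf_pl) W"
   unfolding lookup_sum sum_distrib_right sum_subtractf[symmetric]
   by (intro sum.cong) (auto simp: dcl_def lookup_minus algebra_simps)
  also have "(\<Sum>V\<in>?S. lk D V*int (place_degree K V)) = 0" using assms(2) ddeg_on[of ?S D] by simp
  finally show "lk D W = lk (\<Sum>V\<in>?S. frag_cmul (lk D V) (dcl V)) W" by (simp add: in_keys_iff)
 qed
 moreover have "dcl V \<in> ptcl" if "V \<in> ?S" for V
 proof -
  have "place V" using that assms by blast
  then show ?thesis
  proof (cases rule: place_cases)
   case 1
   then show ?thesis using dcl_Inf ptcl_0 by simp
  next
   case (2 p)
   then show ?thesis by (rule dcl_ptcl)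
  qed
 qed
 ultimately show ?thesis using ptcl_sum[of ?S "\<lambda>V. frag_cmul (lk D V) (dcl V)"] ptcl_cmul by simp
qed

end

section \<open>Distinct points have inequivalent divisors\<close>

context ell_ff
begin

lemma ram_ord_le:
 assumes "affine K a b x y V p" "y \<in> mx V"
  and uv: "u \<in> polys K" "v \<in> polys K" "\<not> (p dvd u \<and> p dvd v)"
 shows "ord_at V (el u v) \<le> 1"
proof (rule ccontr)
 interpret V: affine K a b x y V p by fact
 assume "\<not> ord_at V (el u v) \<le> 1"
 then have o: "ord_at V (el u v) \<ge> 2" by simp
 have el0: "el u v ~= 0" using el_eq_0[OF uv(1,2)] uv(3) by auto
 then have m: "el u v \<in> mx V" using V.V.ord_pos_iff[of "el u v"] o uv by simp
 have px: "poly p x ~= 0" "poly p x \<in> F" using poly_x_nz[OF V.pK V.p_nz] by auto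
 have op: "ord_at V (poly p x) = 2" using V.ord_p assms(2) by simp
 have nv: "\<not> p dvd v" using V.el_in_max_imp(1)[OF uv m] .
 have vy: "poly v x*y \<in> mx V" using V.V.max_mult'[OF assms(2), of "poly v x"] uv by simp
 have "el u v - poly v x*y \<in> mx V" using m vy V.V.max_diff by blast
 then have "p dvd u" using V.dvd_iff[OF uv(1)] by (simp add: el_def)
 then obtain u' where u': "u' \<in> polys K" "u = p*u'" using polys_dvdE[OF uv(1) V.pK] by blast
 have "ord_at V (el u v / poly p x) \<ge> 0" using V.V.ord_divide[of "el u v" "poly p x"] uv el0 px o op by simp
 then have "el u v / poly p x \<in> V" using V.V.ord_nonneg_iff[of "el u v / poly p x"] uv el0 px by simp
 moreover have "poly u x / poly p x = poly u' x" using u'(2) px by simp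
 then have "poly u x / poly p x \<in> V" using u'(1) by simp
 ultimately have "el u v / poly p x - poly u x / poly p x \<in> V" by (rule V.V.V.diff_closed)
 then have vpy: "poly v x*y / poly p x \<in> V" by (simp add: el_def add_divide_distrib)
 have vx: "poly v x ~= 0" "poly v x \<notin> mx V"
  using V.unit_iff[OF uv(2) nv] poly_x_nz[OF uv(2)] nv by auto
 have "ord_at V y = 1" using V.V.ord_t assms(2) by (simp add: V.unif_def)
 then have "ord_at V (poly v x*y) = 1"
  using V.V.ord_mult[of "poly v x" y] vx V.y_nz uv V.V.ord_unit[of "poly v x"] by simp
 then have "ord_at V (poly v x*y / poly p x) = - 1"
  using V.V.ord_divide[of "poly v x*y" "poly p x"] vx V.y_nz uv px op by simp
 then show False using V.V.ord_nonneg_iff[of "poly v x*y / poly p x"] vpy vx V.y_nz uv px by simp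
qed

text \<open>The coordinate ring contains all functions whose poles are at infinity. An irreducible
  factor \<open>p\<close> of the denominator must cancel: a primitive numerator has order at most 1
  at a ramified place, where \<open>p(x)\<close> has order 2, and otherwise it is a unit at
  \<open>V\<close> or at the conjugate of \<open>V\<close>.\<close>

lemma no_pole_imp:
 assumes "u \<in> polys K" "v \<in> polys K" "r \<in> polys K" "r ~= 0" "u ~= 0 \<or> v ~= 0"
  and "\<And>V p. affine K a b x y V p ==> ord_at V (el u v / poly r x) \<ge> 0"
 shows "\<exists>u'\<in>polys K. \<exists>v'\<in>polys K. el u v / poly r x = el u' v'"
 using assms
proof (induction "degree r" arbitrary: u v r rule: less_induct)
 case less
 note uv = less.prems(1,2) and r = less.prems(3,4)
 show ?case
 proof (cases "degree r = 0")
  case True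
  then obtain c where c: "r = [:c:]" by (rule degree_eq_zeroE)
  then have "c \<in> K" "c ~= 0" using r by auto
  then show ?thesis using uv c
   by (intro bexI[of _ "Polynomial.smult (inverse c) u"] bexI[of _ "Polynomial.smult (inverse c) v"])
     (auto simp: el_def divide_inverse algebra_simps)
 next
  case False
  then obtain V where V: "place V" "x \<in> V" "poly r x \<in> mx V"
   using ex_place_over[OF r(1)] by auto
  obtain p where p: "affine K a b x y V p" using affine_ex[OF V(1,2)] .
  interpret V: affine K a b x y V p by fact
  interpret S: affine K a b x y "sigp V" p by (rule affine_sigp[OF p])
  have "p dvd r" using V.dvd_iff[OF r(1)] V(3) by blast
  then obtain r' where r': "r' \<in> polys K" "r = p*r'" using polys_dvdE[OF r(1) V.pK] by blast
  have r'0: "r' ~= 0" using r' r by auto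
  have el0: "el u v ~= 0" using el_eq_0[OF uv] less.prems(5) by blast
  have rx: "poly r x ~= 0" "poly r x \<in> F" using poly_x_nz[OF r] r by auto
  have px: "poly p x ~= 0" "poly p x \<in> F" using poly_x_nz[OF V.pK V.p_nz] by auto
  have r'x: "poly r' x ~= 0" "poly r' x \<in> F" using poly_x_nz[OF r'(1) r'0] r' by auto
  show ?thesis
  proof (cases "p dvd u \<and> p dvd v")
   case True
   obtain u1 where u1: "u1 \<in> polys K" "u = p*u1" using polys_dvdE[OF uv(1) V.pK] True by blast
   obtain v1 where v1: "v1 \<in> polys K" "v = p * v1" using polys_dvdE[OF uv(2) V.pK] True by blast
   have e: "el u v / poly r x = el u1 v1 / poly r' x"
    unfolding u1(2) v1(2) r'(2) el_smult poly_mult using px by simp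
   have "degree r' < degree r" using r'(2) r'0 V.p_nz V.degp by (simp add: degree_mult_eq)
   moreover have "u1 ~= 0 \<or> v1 ~= 0" using less.prems(5) u1 v1 by auto
   ultimately show ?thesis using less.hyps[OF _ u1(1) v1(1) r'(1) r'0] less.prems(6) unfolding e by blast
  next
   case False
   have step: False if "affine K a b x y W p" "W \<in> {V, sigp V}" "ord_at W (el u v) < ord_at W (poly p x)" for W
   proof -
    interpret W: affine K a b x y W p by fact
    have "ord_at W (poly r' x) \<ge> 0" using W.V.ord_nonneg_iff[OF r'x(2,1)] r'(1) by simp
    then have "ord_at W (poly r x) \<ge> ord_at W (poly p x)"
     unfolding r'(2) poly_mult using W.V.ord_mult[OF px(2,1) r'x(2,1)] by simp
    then have "ord_at W (el u v / poly r x) < 0"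
     using W.V.ord_divide[of "el u v" "poly r x"] el0 rx uv that(3) by simp
    then show False using less.prems(6)[OF that(1)] by simp
   qed
   show ?thesis
   proof (cases "y \<in> mx V")
    case True
    then have "ord_at V (el u v) \<le> 1" "ord_at V (poly p x) = 2" using ram_ord_le[OF p True uv False] V.ord_p by auto
    then show ?thesis using step[OF p] by simp
   next
    case nr: False
    show ?thesis
    proof (cases "el u v \<in> mx V")
     case False
     then have "ord_at V (el u v) = 0" using V.V.ord_unit uv by simp
     then show ?thesis using step[OF p] V.ord_p nr by simp
    next
     case True
     have "el u v \<notin> mx (sigp V)"
     proof
      assume "el u v \<in> mx (sigp V)"
      then have "el u (- v) \<in> mx V" using sigp_max[OF V.V.valring_axioms] sig_el1[OF uv] by simp
      then show False using V.conj_max[OF uv nr True] False by blast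
     qed
     then have "ord_at (sigp V) (el u v) = 0" using S.V.ord_unit uv by simp
     then show ?thesis using step[OF S.affine_axioms] S.ord_p nr sigp_eq(3)[OF p] by simp
    qed
   qed
  qed
 qed
qed

text \<open>The point would be the zero of a function with only a simple pole, at infinity. Such a
  function lies in \<open>K[x, y]\<close> and has a norm of degree 1; but norms have even degree or
  degree at least 3.\<close>

lemma dv_eqv_0:
 assumes "P \<in> pts" "eqv (dv P) 0"
 shows "P = None"
proof (rule ccontr)
 assume "P ~= None"
 then obtain s t where P: "P = Some (s, t)" by auto
 obtain z where z: "z \<in> F" "z ~= 0" "dv P = divi z" using assms(2) unfolding eqv_def by auto
 have ne: "plc P ~= Inf_pl" using affine_ne_O[OF plc_affine] assms P by blast
 obtain u v r where *: "u \<in> polys K" "v \<in> polys K" "r \<in> polys K" "r ~= 0" "z = el u v / poly r x"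
  using F_repr[OF z(1)] .
 have nz: "u ~= 0 \<or> v ~= 0" using z(2) *(5) by (auto simp: el_def)
 have "ord_at V (el u v / poly r x) \<ge> 0" if "affine K a b x y V p" for V p
 proof -
  have "lk (dv P) V = ord_at V z" using lookup_divi[OF z(1,2)] affine.plV[OF that] z(3) by simp
  moreover have "lk (dv P) V \<ge> 0" using affine_ne_O[OF that] by (simp add: dv_def lookup_minus)
  ultimately show ?thesis using *(5) by simp
 qed
 then obtain u' v' where u': "u' \<in> polys K" "v' \<in> polys K" "z = el u' v'"
  using no_pole_imp[OF *(1-4) nz] *(5) by metis
 have nz': "u' ~= 0 \<or> v' ~= 0" using z(2) u'(3) by (auto simp: el_def)
 interpret I: infty K a b x y Inf_pl by (rule infty_O)
 have "ord_at Inf_pl z = lk (dv P) Inf_pl" using lookup_divi[OF z(1,2)] place_O z(3) by simp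
 also have "\<dots> = - 1" using ne by (simp add: dv_def lookup_minus)
 finally have "degree (nrm u' v') = 1" using I.ord_el[OF u'(1,2) nz'] u'(3) by simp
 then show False using degree_nrm(2)[OF nz'] by (auto split: if_splits simp: max_def)
qed

lemma dv_inj:
 assumes "P \<in> pts" "Q \<in> pts" "eqv (dv P) (dv Q)"
 shows "P = Q"
proof -
 have "eqv (dv P + dv (ec_neg Q)) (dv Q + dv (ec_neg Q))" by (rule eqv_add[OF assms(3) eqv_refl])
 then have "eqv (dv P + dv (ec_neg Q)) 0" using eqv_neg[OF assms(2)] eqv_trans by blast
 moreover have s: "ec_add a P (ec_neg Q) \<in> pts" "eqv (dv P + dv (ec_neg Q)) (dv (ec_add a P (ec_neg Q)))"
  using ec_add_eqv[OF assms(1) ec_neg_pts[OF assms(2)]] by auto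
 ultimately have "eqv (dv (ec_add a P (ec_neg Q))) 0" using eqv_trans eqv_sym by blast
 then have "ec_add a P (ec_neg Q) = None" by (rule dv_eqv_0[OF s(1)])
 then show ?thesis by (cases P; cases Q) (auto simp: Let_def split: if_splits)
qed

subsection \<open>The class group\<close>

abbreviation "DG \<equiv> divisors0 K F"
abbreviation "PD \<equiv> principal_divisors K F"
abbreviation "Jac \<equiv> jacobian_points K F"

lemma DG_carrier: "D \<in> carrier DG \<longleftrightarrow> Poly_Mapping.keys D \<subseteq> places K F \<and> ddeg D = 0"
 and DG_mult [simp]: "D \<otimes>\<^bsub>DG\<^esub> E = D + E" and DG_one [simp]: "\<one>\<^bsub>DG\<^esub> = 0"
 by (auto simp: divisors0_def free_Abelian_group_def)

lemma DG_comm_group: "comm_group DG"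
proof (rule comm_groupI)
 fix D assume D: "D \<in> carrier DG"
 then have "- D \<in> carrier DG" by (simp add: DG_carrier ddeg_uminus)
 then show "\<exists>E\<in>carrier DG. E \<otimes>\<^bsub>DG\<^esub> D = \<one>\<^bsub>DG\<^esub>" by (intro bexI[of _ "- D"]) auto
next
 fix D E assume *: "D \<in> carrier DG" "E \<in> carrier DG"
 then have "Poly_Mapping.keys (D + E) \<subseteq> places K F" using keys_add[of D E] unfolding DG_carrier by blast
 then show "D \<otimes>\<^bsub>DG\<^esub> E \<in> carrier DG" using * by (simp add: DG_carrier ddeg_add)
qed (auto simp: DG_carrier ddeg_0 algebra_simps)

lemma PD_iff: "D \<in> PD \<longleftrightarrow> eqv D 0"
 by (auto simp: principal_divisors_def eqv_def)

lemma PD_normal: "PD \<lhd> DG"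
proof -
 interpret comm_group DG by (rule DG_comm_group)
 have sub: "PD \<subseteq> carrier DG"
 proof
  fix D assume "D \<in> PD"
  then obtain z where "z \<in> F" "z ~= 0" "D = divi z" by (auto simp: principal_divisors_def)
  then show "D \<in> carrier DG" using keys_divi ddeg_divi_0 by (simp add: DG_carrier)
 qed
 have "subgroup PD DG"
 proof (rule subgroupI[OF sub])
  show "PD ~= {}" using PD_iff eqv_refl by blast
  fix D assume D: "D \<in> PD"
  have DD: "D \<in> carrier DG" using D sub by blast
  then have "- D \<in> carrier DG" by (simp add: DG_carrier ddeg_uminus)
  then have "inv\<^bsub>DG\<^esub> D = - D" using DD by (intro inv_equality) auto
  then show "inv\<^bsub>DG\<^esub> D \<in> PD" using D eqv_uminus[of D 0] by (simp add: PD_iff)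
  fix E assume "E \<in> PD"
  then show "D \<otimes>\<^bsub>DG\<^esub> E \<in> PD" using D eqv_add[of D 0 E 0] by (simp add: PD_iff)
 qed
 then show ?thesis by (rule subgroup_imp_normal)
qed

lemma Jac_comm_group: "comm_group Jac"
 unfolding jacobian_points_def
 by (intro comm_group.abelian_FactGroup DG_comm_group normal.axioms(1)[OF PD_normal])

definition "cls D = PD #>\<^bsub>DG\<^esub> D"

lemma cls_set: "cls D = {E. eqv E D}"
proof -
 have "E \<in> cls D \<longleftrightarrow> (\<exists>G\<in>PD. E = G + D)" for E
  by (auto simp: cls_def r_coset_def)
 also have "(\<exists>G\<in>PD. E = G + D) \<longleftrightarrow> E - D \<in> PD" for E
  by (auto intro: bexI[of _ "E - D"])
 finally show ?thesis by (auto simp: PD_iff eqv_def)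
qed

lemma cls_eq_iff: "cls D = cls E \<longleftrightarrow> eqv D E"
proof
 assume "cls D = cls E"
 then have "D \<in> cls E" using eqv_refl by (auto simp: cls_set)
 then show "eqv D E" by (simp add: cls_set)
next
 assume "eqv D E"
 then show "cls D = cls E" unfolding cls_set using eqv_trans eqv_sym by blast
qed

lemma Jac_carrier: "carrier Jac = cls ` carrier DG"
 by (simp add: jacobian_points_def carrier_FactGroup cls_def image_def)

lemma Jac_mult: "D \<in> carrier DG ==> E \<in> carrier DG ==> cls D \<otimes>\<^bsub>Jac\<^esub> cls E = cls (D + E)"
 using normal.rcos_sum[OF PD_normal, of D E] by (simp add: jacobian_points_def cls_def)

definition "phi P = cls (dv P)"

lemma dv_DG: "P \<in> pts ==> dv P \<in> carrier DG"
proof -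
 assume P: "P \<in> pts"
 have "Poly_Mapping.keys (dv P) \<subseteq> {plc P, Inf_pl}" using keys_diff[of "frag_of (plc P)" "frag_of Inf_pl"] by (auto simp: dv_def)
 then show ?thesis using plc_place[OF P] place_O ddeg_dv[OF P] by (auto simp: DG_carrier)
qed

lemma phi_mult: "P \<in> pts ==> Q \<in> pts ==> phi P \<otimes>\<^bsub>Jac\<^esub> phi Q = phi (ec_add a P Q)"
 using Jac_mult[OF dv_DG dv_DG, of P Q] ec_add_eqv[of P Q] cls_eq_iff by (simp add: phi_def)

lemma phi_bij: "bij_betw phi pts (carrier Jac)"
 unfolding bij_betw_def
proof
 show "inj_on phi pts" by (rule inj_onI) (auto simp: phi_def cls_eq_iff intro: dv_inj)
 show "phi ` pts = carrier Jac"
 proof (intro equalityI subsetI)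
  fix C assume "C \<in> phi ` pts"
  then show "C \<in> carrier Jac" using dv_DG unfolding Jac_carrier phi_def by blast
 next
  fix C assume "C \<in> carrier Jac"
  then obtain D where D: "D \<in> carrier DG" "C = cls D" unfolding Jac_carrier by blast
  then obtain P where "P \<in> pts" "eqv D (dv P)" using ptcl_all unfolding DG_carrier ptcl_def by blast
  then show "C \<in> phi ` pts" using D cls_eq_iff unfolding phi_def by blast
 qed
qed

lemma phi_None: "phi None = \<one>\<^bsub>Jac\<^esub>"
proof -
 have "\<one>\<^bsub>Jac\<^esub> = PD" by (simp add: jacobian_points_def)
 also have "PD = cls 0" by (auto simp: cls_set PD_iff)
 finally show ?thesis by (simp add: phi_def)
qed

lemma ec_add_assoc:
 assumes "P \<in> pts" "Q \<in> pts" "R \<in> pts"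
 shows "ec_add a (ec_add a P Q) R = ec_add a P (ec_add a Q R)"
proof -
 interpret J: comm_group Jac by (rule Jac_comm_group)
 have c: "phi P \<in> carrier Jac" "phi Q \<in> carrier Jac" "phi R \<in> carrier Jac"
  using phi_bij assms by (auto simp: bij_betw_def)
 have "phi (ec_add a (ec_add a P Q) R) = phi P \<otimes>\<^bsub>Jac\<^esub> phi Q \<otimes>\<^bsub>Jac\<^esub> phi R"
  using assms ec_add_eqv by (simp add: phi_mult)
 also have "\<dots> = phi P \<otimes>\<^bsub>Jac\<^esub> (phi Q \<otimes>\<^bsub>Jac\<^esub> phi R)" by (rule J.m_assoc[OF c])
 also have "\<dots> = phi (ec_add a P (ec_add a Q R))" using assms ec_add_eqv by (simp add: phi_mult)
 finally show ?thesis using phi_bij assms ec_add_eqv unfolding bij_betw_def inj_on_def by metis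
qed

end

section \<open>The group law\<close>

lemma countable_generate_field:
 assumes "countable H"
 shows "countable (generate_field CC H)"
proof -
 define step where "step S = S \<union> uminus ` S \<union> inverse ` S \<union> (\<lambda>(x, y). x + y) ` (S \<times> S) \<union> (\<lambda>(x, y). x*y) ` (S \<times> S)" for S :: "complex set"
 define G where "G n = (step ^^ n) (insert 1 H)" for n
 have "countable (step S)" if "countable S" for S using that by (auto simp: step_def)
 then have "countable (G n)" for n unfolding G_def by (induction n) (auto simp: assms)
 then have c: "countable (\<Union>n. G n)" by blast
 have mono: "G m \<subseteq> G (m + k)" for m k
  by (induction k) (auto simp: G_def step_def)
 have S: "G (Suc n) = step (G n)" for n by (simp add: G_def)
 have two: "\<exists>n. x \<in> G n \<and> y \<in> G n" if "x \<in> (\<Union>n. G n)" "y \<in> (\<Union>n. G n)" for x y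
 proof -
  from that obtain m n where "x \<in> G m" "y \<in> G n" by blast
  then show ?thesis using mono[of m n] mono[of n m] by (intro exI[of _ "m + n"]) (auto simp: add.commute)
 qed
 have "csubfield (\<Union>n. G n)"
 proof
  show "1 \<in> (\<Union>n. G n)" by (auto intro!: exI[of _ 0] simp: G_def)
 next
  fix x y assume "x \<in> (\<Union>n. G n)" "y \<in> (\<Union>n. G n)"
  then obtain n where n: "x \<in> G n" "y \<in> G n" using two by blast
  then have "x + y \<in> G (Suc n)" "x*y \<in> G (Suc n)" unfolding S step_def by force+
  then show "x + y \<in> (\<Union>n. G n)" "x*y \<in> (\<Union>n. G n)" by blast+
 next
  fix x assume "x \<in> (\<Union>n. G n)"
  then obtain n where "x \<in> G n" by blast
  then have "- x \<in> G (Suc n)" "inverse x \<in> G (Suc n)" unfolding S step_def by auto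
  then show "- x \<in> (\<Union>n. G n)" "inverse x \<in> (\<Union>n. G n)" by blast+
 qed
 moreover have "H \<subseteq> (\<Union>n. G n)"
 proof
  fix h assume "h \<in> H"
  then have "h \<in> G 0" by (simp add: G_def)
  then show "h \<in> (\<Union>n. G n)" by blast
 qed
 ultimately have "generate_field CC H \<subseteq> (\<Union>n. G n)" by (rule generate_field_min)
 then show ?thesis using c by (rule countable_subset)
qed

lemma ex_transcendental:
 assumes "countable K"
 shows "\<exists>x::complex. \<forall>p\<in>polys K. poly p x = 0 \<longrightarrow> p = 0"
proof -
 have "polys K \<subseteq> Poly ` lists K"
 proof
  fix p assume p: "p \<in> polys K"
  have "coeffs p \<in> lists K" using p by (auto simp: coeffs_def polys_def)
  then show "p \<in> Poly ` lists K" by (metis Poly_coeffs imageI)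
 qed
 moreover have "countable (Poly ` lists K)" by (intro countable_image countable_lists assms)
 ultimately have "countable (polys K)" by (rule countable_subset)
 then have c0: "countable (polys K - {0})" by (rule countable_Diff)
 have c: "countable (\<Union>p\<in>polys K - {0}. {x. poly p x = 0})"
  by (rule countable_UN[OF c0]) (simp add: countable_finite poly_roots_finite)
 obtain x where "x \<notin> (\<Union>p\<in>polys K - {0}. {x. poly p x = 0})"
  using c uncountable_UNIV_complex by (metis UNIV_eq_I)
 then show ?thesis by (intro exI[of _ x]) auto
qed

lemma elliptic_curve_simps [simp]:
 "monoid.mult (elliptic_curve a b) = ec_add a" "\<one>\<^bsub>elliptic_curve a b\<^esub> = None"
 "None \<in> carrier (elliptic_curve a b)"
 "Some (s, t) \<in> carrier (elliptic_curve a b) \<longleftrightarrow> t\<^sup>2 = s^3 + a * s + b"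
 by (auto simp: elliptic_curve_def)

lemma ec_add_commute:
 assumes "P \<in> carrier (elliptic_curve a b)" "Q \<in> carrier (elliptic_curve a b)"
 shows "ec_add a P Q = ec_add a Q P"
proof (cases "P = None \<or> Q = None")
 case True
 then show ?thesis by (cases P; cases Q) auto
next
 case False
 then obtain s1 t1 s2 t2 where PQ: "P = Some (s1, t1)" "Q = Some (s2, t2)" by auto
 show ?thesis
 proof (cases "s1 = s2")
  case True
  then have "t1^2 = t2^2" using assms PQ by simp
  then have "t1 = t2 \<or> t1 = - t2" by (simp add: power2_eq_iff)
  then show ?thesis using True PQ by auto
 next
  case ne: False
  define l where "l = (t2 - t1) / (s2 - s1)"
  have l': "(t1 - t2) / (s1 - s2) = l" unfolding l_def by (metis minus_diff_eq minus_divide_divide)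
  have "l*(s2 - s1) = t2 - t1" using ne by (simp add: l_def)
  then have e: "l*(s1 - s) - t1 = l*(s2 - s) - t2" for s by (simp add: algebra_simps)
  have e': "l^2 - s1 - s2 = l^2 - s2 - s1" by simp
  have "ec_add a P Q = Some (l^2 - s1 - s2, l*(s1 - (l^2 - s1 - s2)) - t1)"
   unfolding PQ ec_add.simps Let_def using ne by (simp add: l_def)
  also have "\<dots> = Some (l^2 - s2 - s1, l*(s2 - (l^2 - s2 - s1)) - t2)" unfolding e e' ..
  also have "\<dots> = ec_add a Q P"
   unfolding PQ ec_add.simps Let_def using ne ne[symmetric] by (simp add: l')
  finally show ?thesis .
 qed
qed

text \<open>Associativity concerns three points, whose coordinates generate with \<open>a\<close>
  and \<open>b\<close> a countable field. Some complex number is transcendental over it, so the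
  function field that the argument needs exists inside the complex numbers.\<close>

theorem elliptic_curve_comm_group:
 assumes disc: "4 * a^3 + 27 * b^2 ~= 0"
 shows "comm_group (elliptic_curve a b)"
proof -
 define coords where "coords P = (case P of None \<Rightarrow> {} | Some (s, t) \<Rightarrow> {s, t})" for P :: "(complex \<times> complex) option"
 have ff: "\<exists>K x y. ell_ff K a b x y \<and> coords P \<union> coords Q \<union> coords R \<subseteq> K" for P Q R
 proof -
  define H where "H = {a, b} \<union> (coords P \<union> coords Q \<union> coords R)"
  define K where "K = generate_field CC H"
  have "finite H" by (auto simp: H_def coords_def split: option.splits)
  then have "countable K" unfolding K_def by (intro countable_generate_field countable_finite)
  then obtain x where x: "\<And>p. p \<in> polys K ==> poly p x = 0 ==> p = 0" using ex_transcendental by metis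
  interpret K: csubfield K unfolding K_def by (rule csubfield_generate_field)
  have HK: "H \<subseteq> K" unfolding K_def by (rule generate_field_subset)
  have "ell_ff K a b x (csqrt (x^3 + a*x + b))"
   by unfold_locales (use HK disc x in \<open>auto simp: H_def\<close>)
  then show ?thesis using HK unfolding H_def by blast
 qed
 have pts: "P \<in> ell_ff.pts K a b" if "ell_ff K a b x y" "coords P \<subseteq> K" "P \<in> carrier (elliptic_curve a b)" for P K x y
 proof -
  interpret E: ell_ff K a b x y by fact
  show ?thesis using that by (cases P) (auto simp: E.pts_Some coords_def)
 qed
 have in_carrier: "P \<in> carrier (elliptic_curve a b)" if "ell_ff K a b x y" "P \<in> ell_ff.pts K a b" for P K x y
 proof -
  interpret E: ell_ff K a b x y by fact
  show ?thesis using that(2) by (cases P) (auto simp: E.pts_Some)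
 qed
 show ?thesis
 proof (rule comm_groupI; (simp only: elliptic_curve_simps)?)
  fix P Q assume PQ: "P \<in> carrier (elliptic_curve a b)" "Q \<in> carrier (elliptic_curve a b)"
  obtain K x y where K: "ell_ff K a b x y" "coords P \<union> coords Q \<union> coords None \<subseteq> K" using ff by blast
  interpret E: ell_ff K a b x y by (rule K)
  have "P \<in> E.pts" "Q \<in> E.pts" using pts[OF K(1)] K(2) PQ by auto
  then show "ec_add a P Q \<in> carrier (elliptic_curve a b)" using in_carrier[OF K(1)] E.ec_add_eqv by blast
  show "ec_add a P Q = ec_add a Q P" by (rule ec_add_commute[OF PQ])
  fix R assume R: "R \<in> carrier (elliptic_curve a b)"
  obtain K' x' y' where K': "ell_ff K' a b x' y'" "coords P \<union> coords Q \<union> coords R \<subseteq> K'" using ff by blast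
  interpret E': ell_ff K' a b x' y' by (rule K')
  have "P \<in> E'.pts" "Q \<in> E'.pts" "R \<in> E'.pts" using pts[OF K'(1)] K'(2) PQ R by auto
  then show "ec_add a (ec_add a P Q) R = ec_add a P (ec_add a Q R)" by (rule E'.ec_add_assoc)
 next
  fix P assume "P \<in> carrier (elliptic_curve a b)"
  then show "\<exists>Q\<in>carrier (elliptic_curve a b). ec_add a Q P = None"
   by (intro bexI[of _ "ec_neg P"]; cases P) auto
 qed simp_all
qed

section \<open>Constant field extensions\<close>

text \<open>\<open>norm_ex\<close> is the algebraicity of \<open>K1\<close> over \<open>K0\<close>
  in the form that is applied: a nonzero polynomial over \<open>K1\<close> divides a nonzero one
  over \<open>K0\<close>.\<close>

locale const_ext = E0: ell_ff K0 a b x y + E1: ell_ff K1 a b x y for K0 K1 a b x y +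
 assumes K01: "K0 \<subseteq> K1"
  and norm_ex: "p \<in> polys K1 ==> p ~= 0 ==> \<exists>q. p*q \<in> polys K0 \<and> p*q ~= 0"
begin

lemma F01: "E0.F \<subseteq> E1.F"
 unfolding E0.F_def E1.F_def by (rule generate_field_mono) (use K01 in auto)

lemma max_inter: "z \<in> E0.F ==> z \<in> mx (W \<inter> E0.F) \<longleftrightarrow> z \<in> mx W"
 by (auto simp: maximal_ideal_def)

text \<open>The danger is that the contraction becomes the whole field. But the polynomial below
  \<open>W\<close> divides one over \<open>K0\<close>, whose value at \<open>x\<close> lies in the
  maximal ideal and has no inverse in \<open>W\<close>.\<close>

lemma place_inter:
 assumes W: "E1.place W"
 shows "E0.place (W \<inter> E0.F)"
proof (rule E0.placeI)
 interpret W: valring E1.F W by (rule E1.placeD(1)[OF W])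
 show "valring E0.F (W \<inter> E0.F)"
 proof
  show "W \<inter> E0.F \<subseteq> E0.F" by simp
  fix z assume z: "z \<in> E0.F"
  then have "z \<in> W \<or> inverse z \<in> W" using W.val F01 by blast
  then show "z \<in> W \<inter> E0.F \<or> inverse z \<in> W \<inter> E0.F" using z by simp
 qed auto
 show "K0 \<subseteq> W \<inter> E0.F" using E1.placeD(2)[OF W] K01 E0.K_F by auto
 show "W \<inter> E0.F ~= E0.F"
 proof
  assume "W \<inter> E0.F = E0.F"
  then have sub: "E0.F \<subseteq> W" by blast
  then have "x \<in> W" using E0.x_F by blast
  then obtain p where p: "affine K1 a b x y W p" using E1.affine_ex[OF W] by metis
  interpret A: affine K1 a b x y W p by (rule p)
  obtain q where q: "p*q \<in> polys K0" "p*q ~= 0" using norm_ex[OF A.pK A.p_nz] by blast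
  have "p*q \<in> polys K1" using q(1) polys_mono[OF K01] by blast
  then have m: "poly (p*q) x \<in> mx W" using A.dvd_iff[of "p*q"] by simp
  have nz: "poly (p*q) x ~= 0" by (rule E0.poly_x_nz[OF q])
  have "inverse (poly (p*q) x) \<in> E0.F" by (rule E0.F.inverse_closed[OF E0.poly_F[OF q(1)]])
  then have "inverse (poly (p*q) x) \<in> W" using sub by blast
  then show False using m nz by (simp add: maximal_ideal_def)
 qed
qed

abbreviation "stdunif V \<equiv> (SOME t. uniformizer V t)"

text \<open>The order at \<open>W\<close> of a function from the smaller field is its order at the
  contraction times the ramification index; this index is the weight that \<open>conorm\<close>
  uses.\<close>

lemma ord_inter:
 assumes W: "E1.place W" and z: "z \<in> E0.F" "z ~= 0"
 shows "ord_at W z = ord_at (W \<inter> E0.F) z * ord_at W (stdunif (W \<inter> E0.F))"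
  and "stdunif (W \<inter> E0.F) \<in> E0.F" "stdunif (W \<inter> E0.F) ~= 0" "ord_at W (stdunif (W \<inter> E0.F)) > 0"
proof -
 let ?V = "W \<inter> E0.F"
 obtain t where "dvr E0.F ?V t" using E0.place_dvr[OF place_inter[OF W]] .
 then interpret V: dvr E0.F ?V t .
 obtain t' where "dvr E1.F W t'" using E1.place_dvr[OF W] .
 then interpret W: dvr E1.F W t' .
 have tF: "t \<in> E0.F" using V.t_max V.max_sub by blast
 have *: "ord_at W w = ord_at ?V w * ord_at W t" if w: "w \<in> E0.F" "w ~= 0" for w
 proof -
  obtain u where u: "u \<in> ?V" "u \<notin> mx ?V" "w = t powi (ord_at ?V w)*u" using V.ordE[OF w] .
  have u': "u \<in> W" "u \<notin> mx W" "u ~= 0" using u max_inter[of u W] V.max_0 by auto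
  have tp: "ord_at W (t powi n) = n * ord_at W t" for n
  proof (cases "n \<ge> 0")
   case True
   then show ?thesis using W.ord_power[of t "nat n"] tF F01 V.t_nz by (auto simp: power_int_def)
  next
   case False
   then have "t powi n = inverse (t^nat (- n))" by (simp add: power_int_def power_inverse)
   then show ?thesis using W.ord_power[of t "nat (- n)"] W.ord_inverse[of "t^nat (- n)"] tF F01 V.t_nz False by auto
  qed
  have "ord_at W w = ord_at W (t powi (ord_at ?V w)*u)" using u(3) by simp
  also have "\<dots> = ord_at W (t powi (ord_at ?V w)) + ord_at W u"
   by (rule W.ord_mult) (use tF F01 V.t_nz u' W.in_F in auto)
  finally show ?thesis using tp W.ord_unit u' by simp
 qed
 have su: "uniformizer ?V (stdunif ?V)" using V.uniformizer_t by (rule someI)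
 have s1: "ord_at ?V (stdunif ?V) = 1" by (rule V.ord_uniformizer[OF su])
 obtain e where e: "e \<in> ?V" "e \<notin> mx ?V" "stdunif ?V = t*e" using V.uniformizer_repr[OF su] .
 have "e ~= 0" using e V.max_0 by metis
 then show sF: "stdunif ?V \<in> E0.F" "stdunif ?V ~= 0" unfolding e(3) using tF e(1) V.t_nz by auto
 have st: "ord_at W (stdunif ?V) = ord_at W t" using *[OF sF] s1 by simp
 then show "ord_at W z = ord_at ?V z * ord_at W (stdunif ?V)" using *[OF z] by simp
 have "t \<in> mx W" using V.t_max max_inter[OF tF] by blast
 then show "ord_at W (stdunif ?V) > 0" using st W.ord_pos_iff[of t] tF F01 V.t_nz by auto
qed

abbreviation "con \<equiv> conorm E0.F K1 E1.F"

lemma finite_fibre: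
 assumes "E0.place V"
 shows "finite {W. E1.place W \<and> W \<inter> E0.F = V}"
proof (cases "{W. E1.place W \<and> W \<inter> E0.F = V} = {}")
 case False
 then obtain W where W: "E1.place W" "W \<inter> E0.F = V" by blast
 have s: "stdunif V \<in> E0.F" "stdunif V ~= 0" using ord_inter(2,3)[OF W(1), of 1] W(2) by auto
 have "{W. E1.place W \<and> W \<inter> E0.F = V} \<subseteq> {W. E1.place W \<and> ord_at W (stdunif V) ~= 0}"
 proof
  fix W assume "W \<in> {W. E1.place W \<and> W \<inter> E0.F = V}"
  then show "W \<in> {W. E1.place W \<and> ord_at W (stdunif V) ~= 0}" using ord_inter(4)[of W 1] by auto
 qed
 then show ?thesis by (rule finite_subset) (use E1.finite_support s F01 in auto)
next
 case True
 then show ?thesis by (simp only: finite.emptyI)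
qed

lemma lookup_con:
 assumes D: "Poly_Mapping.keys D \<subseteq> places K0 E0.F"
 shows "lk (con D) W = (if E1.place W then lk D (W \<inter> E0.F) * ord_at W (stdunif (W \<inter> E0.F)) else 0)"
proof -
 define T where "T V = {W. E1.place W \<and> W \<inter> E0.F = V}" for V
 have fr: "lk (\<Sum>W\<in>T V. frag_cmul (ord_at W (stdunif V)) (frag_of W)) W =
  (if W \<in> T V then ord_at W (stdunif V) else 0)" if "E0.place V" for V
 proof -
  have "lk (\<Sum>W\<in>T V. frag_cmul (ord_at W (stdunif V)) (frag_of W)) W = (\<Sum>W'\<in>T V. if W' = W then ord_at W (stdunif V) else 0)"
   unfolding lookup_sum by (intro sum.cong) auto
  then show ?thesis using finite_fibre[OF that] by (simp add: T_def)
 qed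
 have "lk (con D) W = (\<Sum>V\<in>Poly_Mapping.keys D. lk D V*lk (\<Sum>W\<in>T V. frag_cmul (ord_at W (stdunif V)) (frag_of W)) W)"
  unfolding conorm_def frag_extend_def lookup_sum lookup_frag_cmul T_def mem_Collect_eq ..
 also have "\<dots> = (\<Sum>V\<in>Poly_Mapping.keys D. if V = W \<inter> E0.F then (if E1.place W then lk D V * ord_at W (stdunif V) else 0) else 0)"
 proof (intro sum.cong refl)
  fix V assume "V \<in> Poly_Mapping.keys D"
  then have "E0.place V" using D by blast
  then show "lk D V*lk (\<Sum>W\<in>T V. frag_cmul (ord_at W (stdunif V)) (frag_of W)) W =
   (if V = W \<inter> E0.F then (if E1.place W then lk D V * ord_at W (stdunif V) else 0) else 0)"
   by (subst fr) (auto simp: T_def)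
 qed
 also have "\<dots> = (if E1.place W then lk D (W \<inter> E0.F) * ord_at W (stdunif (W \<inter> E0.F)) else 0)"
  by (simp add: in_keys_iff)
 finally show ?thesis .
qed

lemma con_divi:
 assumes z: "z \<in> E0.F" "z ~= 0"
 shows "con (E0.divi z) = E1.divi z"
proof (rule poly_mapping_eqI)
 fix W
 have z1: "z \<in> E1.F" using z F01 by blast
 show "lk (con (E0.divi z)) W = lk (E1.divi z) W"
  unfolding lookup_con[OF E0.keys_divi[OF z]] E1.lookup_divi[OF z1 z(2)] E0.lookup_divi[OF z]
  using place_inter ord_inter(1)[OF _ z] by simp
qed

lemma pts01: "P \<in> E0.pts ==> P \<in> E1.pts"
 using K01 by (cases P) (auto simp: E0.pts_Some E1.pts_Some)

text \<open>Exactly one place lies above a rational point, as it is described by the same conditions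
  on \<open>x - s\<close> and \<open>y - t\<close> over both fields. It is unramified because one
  function is a uniformizer at both levels: \<open>x - s\<close> or \<open>y\<close>, and
  \<open>x / y\<close> at infinity.\<close>

lemma plc_inter:
 assumes P: "P \<in> E0.pts" and W: "E1.place W"
 shows "W \<inter> E0.F = E0.plc P \<longleftrightarrow> W = E1.plc P"
  and "W = E1.plc P ==> ord_at W (stdunif (W \<inter> E0.F)) = 1"
proof -
 have V: "E0.place (W \<inter> E0.F)" by (rule place_inter[OF W])
 have "(W \<inter> E0.F = E0.plc P \<longleftrightarrow> W = E1.plc P) \<and> (W = E1.plc P \<longrightarrow> ord_at W (stdunif (W \<inter> E0.F)) = 1)"
 proof (cases P)
  case None
  have i0: "W \<inter> E0.F = E0.Inf_pl \<longleftrightarrow> x \<notin> W \<inter> E0.F"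
   using E0.x_O E0.infty_unique[OF _ E0.infty_O] V E0.ell_ff_axioms by (metis infty.intro infty_axioms.intro)
  have i1: "W = E1.Inf_pl \<longleftrightarrow> x \<notin> W"
   using E1.x_O E1.infty_unique[OF _ E1.infty_O] W E1.ell_ff_axioms by (metis infty.intro infty_axioms.intro)
  have "ord_at W (stdunif (W \<inter> E0.F)) = 1" if "W = E1.Inf_pl"
  proof -
   interpret I1: infty K1 a b x y W using E1.infty_O that by simp
   have "W \<inter> E0.F = E0.Inf_pl" using i0 i1 that by blast
   then interpret I0: infty K0 a b x y "W \<inter> E0.F" using E0.infty_O by simp
   have "ord_at W (x / y) = 1" using I1.V.ord_t by (simp add: I1.unif_def)
   moreover have "ord_at (W \<inter> E0.F) (x / y) = 1" using I0.V.ord_t by (simp add: I0.unif_def)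
   ultimately show ?thesis using ord_inter(1)[OF W, of "x / y"] I0.x_nz I0.y_nz by simp
  qed
  then show ?thesis using None i0 i1 by simp
 next
  case (Some q)
  then obtain s t where Pst: "P = Some (s, t)" by (cases q) auto
  have p0: "Some (s, t) \<in> E0.pts" and p1: "Some (s, t) \<in> E1.pts" using P pts01 Pst by auto
  have st: "s \<in> K0" "t \<in> K0" using p0 E0.pts_Some by auto
  have st1: "s \<in> K1" "t \<in> K1" using st K01 by auto
  have mem: "x - s \<in> E0.F" "y - t \<in> E0.F" using st E0.K_F by auto
  have at0: "E0.at_pt s t (W \<inter> E0.F) \<longleftrightarrow> x - s \<in> mx W \<and> y - t \<in> mx W"
  proof
   assume a: "E0.at_pt s t (W \<inter> E0.F)"
   then interpret V: affine K0 a b x y "W \<inter> E0.F" "[:- s, 1:]" unfolding E0.at_pt_def by blast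
   show "x - s \<in> mx W \<and> y - t \<in> mx W"
    using a V.p_max max_inter mem unfolding E0.at_pt_def by simp
  next
   assume m: "x - s \<in> mx W \<and> y - t \<in> mx W"
   then have m': "x - s \<in> mx (W \<inter> E0.F)" "y - t \<in> mx (W \<inter> E0.F)" using max_inter mem by auto
   interpret V: valring E0.F "W \<inter> E0.F" by (rule E0.placeD(1)[OF V])
   have "s \<in> W \<inter> E0.F" using E0.placeD(2)[OF V] st by blast
   then have "x - s + s \<in> W \<inter> E0.F" using V.max_sub[OF m'(1)] by (rule V.V.add_closed[rotated])
   then have "x \<in> W \<inter> E0.F" by simp
   then show "E0.at_pt s t (W \<inter> E0.F)" unfolding E0.at_pt_def
    using E0.affine_linearI[OF V _ st(1) m'(1)] m'(2) by simp
  qed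
  have at1: "E1.at_pt s t W \<longleftrightarrow> x - s \<in> mx W \<and> y - t \<in> mx W"
  proof
   assume a: "E1.at_pt s t W"
   then interpret V: affine K1 a b x y W "[:- s, 1:]" unfolding E1.at_pt_def by blast
   show "x - s \<in> mx W \<and> y - t \<in> mx W"
    using a V.p_max unfolding E1.at_pt_def by simp
  next
   assume m: "x - s \<in> mx W \<and> y - t \<in> mx W"
   interpret V: valring E1.F W by (rule E1.placeD(1)[OF W])
   have "s \<in> W" using E1.placeD(2)[OF W] st1 by blast
   then have "x - s + s \<in> W" using V.max_sub m V.V.add_closed by blast
   then have "x \<in> W" by simp
   then show "E1.at_pt s t W" unfolding E1.at_pt_def
    using E1.affine_linearI[OF W _ st1(1)] m by simp
  qed
  have e0: "W \<inter> E0.F = E0.plc P \<longleftrightarrow> E0.at_pt s t (W \<inter> E0.F)"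
   unfolding Pst using E0.plc_eqI[OF p0] E0.plc_at[OF p0] by metis
  have e1: "W = E1.plc P \<longleftrightarrow> E1.at_pt s t W"
   unfolding Pst using E1.plc_eqI[OF p1] E1.plc_at[OF p1] by metis
  have "ord_at W (stdunif (W \<inter> E0.F)) = 1" if a: "E1.at_pt s t W"
  proof -
   interpret A1: affine K1 a b x y W "[:- s, 1:]" using a unfolding E1.at_pt_def by blast
   have "E0.at_pt s t (W \<inter> E0.F)" using a at0 at1 by blast
   then interpret A0: affine K0 a b x y "W \<inter> E0.F" "[:- s, 1:]" unfolding E0.at_pt_def by blast
   have ye: "y \<in> mx (W \<inter> E0.F) \<longleftrightarrow> y \<in> mx W" by (rule max_inter) simp
   define u where "u = (if y \<in> mx W then y else x - s)"
   have u1: "u = A1.unif" by (simp add: A1.unif_def u_def)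
   have u0: "u = A0.unif" by (simp add: A0.unif_def u_def ye)
   have "ord_at W u = 1" unfolding u1 by (rule A1.V.ord_t)
   moreover have "ord_at (W \<inter> E0.F) u = 1" unfolding u0 by (rule A0.V.ord_t)
   moreover have "u \<in> E0.F" using mem by (simp add: u_def)
   moreover have "u ~= 0" unfolding u0 by (rule A0.unif_nz)
   ultimately show ?thesis using ord_inter(1)[OF W, of u] by simp
  qed
  then show ?thesis using e0 e1 at0 at1 by blast
 qed
 then show "W \<inter> E0.F = E0.plc P \<longleftrightarrow> W = E1.plc P"
  and "W = E1.plc P ==> ord_at W (stdunif (W \<inter> E0.F)) = 1" by blast+
qed

lemma con_plc:
 assumes P: "P \<in> E0.pts"
 shows "con (frag_of (E0.plc P)) = frag_of (E1.plc P)"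
proof (rule poly_mapping_eqI)
 fix W
 have k: "Poly_Mapping.keys (frag_of (E0.plc P)) \<subseteq> places K0 E0.F"
  using E0.plc_place[OF P] by (simp add: keys_frag_of)
 show "lk (con (frag_of (E0.plc P))) W = lk (frag_of (E1.plc P)) W"
  unfolding lookup_con[OF k] using plc_inter[OF P, of W] E1.plc_place[OF pts01[OF P]] by auto
qed

lemma con_dv: "P \<in> E0.pts ==> con (E0.dv P) = E1.dv P"
 using con_plc[of P] con_plc[of None] by (simp add: conorm_def E0.dv_def E1.dv_def frag_extend_diff)

abbreviation "bc \<equiv> base_change E0.F K1 E1.F"

text \<open>On points base change is the inclusion: the conorm takes principal divisors to principal
  divisors and the place of a rational point to the place of the same point.\<close>

lemma bc_phi:
 assumes P: "P \<in> E0.pts"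
 shows "bc (E0.phi P) = E1.phi P"
proof -
 have c: "E1.cls (con D) = E1.phi P" if "D \<in> E0.phi P" for D
 proof -
  have "E0.eqv D (E0.dv P)" using that by (simp add: E0.phi_def E0.cls_set)
  then obtain z where z: "z \<in> E0.F" "z ~= 0" "D - E0.dv P = E0.divi z" unfolding E0.eqv_def by blast
  have "con D - E1.dv P = con (D - E0.dv P)"
   using con_dv[OF P] by (simp add: conorm_def frag_extend_diff)
  also have "\<dots> = E1.divi z" unfolding z(3) by (rule con_divi[OF z(1,2)])
  finally have "E1.eqv (con D) (E1.dv P)" using z F01 by (intro E1.eqvI[of z]) auto
  then show ?thesis by (simp add: E1.phi_def E1.cls_eq_iff)
 qed
 have "E0.dv P \<in> E0.phi P" by (simp add: E0.phi_def E0.cls_set E0.eqv_refl)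
 then show ?thesis using c unfolding base_change_def E1.cls_def by blast
qed

lemma bc_mon: "bc \<in> mon E0.Jac E1.Jac"
proof -
 have ex: "\<exists>P\<in>E0.pts. C = E0.phi P" if "C \<in> carrier E0.Jac" for C
  using E0.phi_bij that by (auto simp: bij_betw_def)
 have "bc \<in> hom E0.Jac E1.Jac"
 proof (rule homI)
  fix C assume "C \<in> carrier E0.Jac"
  then obtain P where P: "P \<in> E0.pts" "C = E0.phi P" using ex by blast
  then show "bc C \<in> carrier E1.Jac" using bc_phi pts01 E1.phi_bij by (auto simp: bij_betw_def)
  fix D assume "D \<in> carrier E0.Jac"
  then obtain Q where Q: "Q \<in> E0.pts" "D = E0.phi Q" using ex by blast
  show "bc (C \<otimes>\<^bsub>E0.Jac\<^esub> D) = bc C \<otimes>\<^bsub>E1.Jac\<^esub> bc D"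
   using P Q E0.ec_add_eqv pts01 by (simp add: E0.phi_mult E1.phi_mult bc_phi)
 qed
 moreover have "inj_on bc (carrier E0.Jac)"
 proof (rule inj_onI)
  fix C D assume "C \<in> carrier E0.Jac" "D \<in> carrier E0.Jac" and e: "bc C = bc D"
  then obtain P Q where PQ: "P \<in> E0.pts" "C = E0.phi P" "Q \<in> E0.pts" "D = E0.phi Q" using ex by metis
  then have "E1.phi P = E1.phi Q" using e bc_phi by simp
  then have "P = Q" using E1.phi_bij pts01 PQ(1,3) unfolding bij_betw_def inj_on_def by blast
  then show "C = D" using PQ by simp
 qed
 ultimately show ?thesis by (simp add: mon_def)
qed

lemma bc_image: "bc ` carrier E0.Jac = E1.phi ` E0.pts"
proof -
 have "carrier E0.Jac = E0.phi ` E0.pts" using E0.phi_bij by (simp add: bij_betw_def)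
 then show ?thesis using bc_phi by (auto simp: image_image)
qed

end

section \<open>Torsion classes as torsion points\<close>

context ell_ff
begin

lemma phi_pow:
 assumes "P \<in> pts"
 shows "P [^]\<^bsub>elliptic_curve a b\<^esub> (n::nat) \<in> pts \<and> phi (P [^]\<^bsub>elliptic_curve a b\<^esub> n) = phi P [^]\<^bsub>Jac\<^esub> n"
proof (induction n)
 case 0
 then show ?case by (simp add: phi_None)
next
 case (Suc n)
 then show ?case using assms phi_mult[of "P [^]\<^bsub>elliptic_curve a b\<^esub> n" P] ec_add_eqv by (simp add: nat_pow_Suc)
qed

lemma phi_eq_one: "P \<in> pts ==> phi P = \<one>\<^bsub>Jac\<^esub> \<longleftrightarrow> P = None"
 using phi_bij phi_None unfolding bij_betw_def inj_on_def by (metis pts_None)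

lemma torsion_Jac:
 "torsion_points Jac = phi ` {P \<in> pts. \<exists>n::nat. n > 0 \<and> P [^]\<^bsub>elliptic_curve a b\<^esub> n = None}"
proof (intro equalityI subsetI)
 fix C assume "C \<in> torsion_points Jac"
 then obtain n :: nat where C: "C \<in> carrier Jac" "n > 0" "C [^]\<^bsub>Jac\<^esub> n = \<one>\<^bsub>Jac\<^esub>" by (auto simp: torsion_points_def)
 have "C \<in> phi ` pts" using C(1) phi_bij by (simp add: bij_betw_def)
 then obtain P where P: "P \<in> pts" "C = phi P" by blast
 have "P [^]\<^bsub>elliptic_curve a b\<^esub> n = None" using phi_pow[OF P(1), of n] C(3) P(2) phi_eq_one by metis
 then show "C \<in> phi ` {P \<in> pts. \<exists>n::nat. n > 0 \<and> P [^]\<^bsub>elliptic_curve a b\<^esub> n = None}" using P C(2) by blast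
next
 fix C assume "C \<in> phi ` {P \<in> pts. \<exists>n::nat. n > 0 \<and> P [^]\<^bsub>elliptic_curve a b\<^esub> n = None}"
 then obtain P and n :: nat where P: "P \<in> pts" "C = phi P" "n > 0" "P [^]\<^bsub>elliptic_curve a b\<^esub> n = None" by blast
 then have "C [^]\<^bsub>Jac\<^esub> n = \<one>\<^bsub>Jac\<^esub>" using phi_pow[OF P(1), of n] phi_None by simp
 moreover have "C \<in> carrier Jac" using P phi_bij by (auto simp: bij_betw_def)
 ultimately show "C \<in> torsion_points Jac" using P(3) by (auto simp: torsion_points_def)
qed

end

section \<open>Multi-quadratic fields\<close>

text \<open>Square roots of rational numbers are adjoined one at a time. The condition
  \<open>s \<notin> K\<close> keeps 1 and \<open>s\<close> independent, on which the norm argument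
  rests.\<close>

inductive quad_tower :: "complex set \<Rightarrow> bool" where
 base: "quad_tower \<rat>"
| step: "quad_tower K ==> s^2 \<in> \<rat> ==> s \<notin> K ==> quad_tower {u + v * s |u v. u \<in> K \<and> v \<in> K}"

lemma csubfield_quad_ext:
 assumes "csubfield K" "s^2 \<in> K"
 shows "csubfield {u + v * s |u v. u \<in> K \<and> v \<in> K}" (is "csubfield ?L")
proof -
 interpret csubfield K by fact
 have I: "u + v * s \<in> ?L" if "u \<in> K" "v \<in> K" for u v using that by blast
 show ?thesis
 proof
  show "1 \<in> ?L" using I[of 1 0] by simp
  fix z w assume "z \<in> ?L" "w \<in> ?L"
  then obtain u v u' v' where *: "u \<in> K" "v \<in> K" "z = u + v * s" "u' \<in> K" "v' \<in> K" "w = u' + v' * s" by blast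
  have e: "z + w = (u + u') + (v + v') * s" unfolding *(3,6) by (simp add: algebra_simps)
  show "z + w \<in> ?L" unfolding e by (rule I) (use *(1,2,4,5) in auto)
  have e: "z*w = (u*u' + v * v' * s^2) + (u * v' + v * u') * s" unfolding *(3,6) by (simp add: square_simps)
  show "z*w \<in> ?L" unfolding e by (rule I) (use *(1,2,4,5) assms(2) in auto)
  have e: "- z = - u + (- v) * s" unfolding *(3) by simp
  show "- z \<in> ?L" unfolding e by (rule I) (use *(1,2) in auto)
  show "inverse z \<in> ?L"
  proof (cases "u - v * s = 0")
   case True
   then have zu: "z = 2*u" unfolding *(3) by simp
   show ?thesis using I[of "inverse (2*u)" 0] *(1) unfolding zu by simp
  next
   case False
   define n where "n = u^2 - v^2 * s^2"
   have nz: "n = z*(u - v * s)" unfolding *(3) n_def by (simp add: square_simps)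
   have nK: "n \<in> K" using *(1,2) assms(2) by (simp add: n_def)
   have "inverse z = (u - v * s)*inverse n" unfolding nz using False by simp
   then have "inverse z = u*inverse n + (- (v * inverse n)) * s" by (simp add: algebra_simps)
   then have e: "inverse z = u*inverse n + (- (v * inverse n)) * s" .
   show ?thesis unfolding e by (rule I) (use *(1,2) nK in auto)
  qed
 qed
qed

lemma quad_ext_superset: "csubfield K ==> K \<subseteq> {u + v * s |u v. u \<in> K \<and> v \<in> K}"
proof
 fix u assume "csubfield K" "u \<in> K"
 then interpret csubfield K by simp
 show "u \<in> {u + v * s |u v. u \<in> K \<and> v \<in> K}" using \<open>u \<in> K\<close> by (intro CollectI exI[of _ u] exI[of _ 0]) simp
qed

lemma quad_tower_csubfield: "quad_tower K ==> csubfield K"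
proof (induction rule: quad_tower.induct)
 case base
 then show ?case by (rule csubfield_Rats)
next
 case (step K s)
 then show ?case using csubfield_quad_ext csubfield.Rats_closed by blast
qed

lemma Rats_csubfield: "csubfield K ==> \<rat> \<subseteq> K"
 using csubfield.Rats_closed by blast

lemma quad_tower_adjoin:
 assumes "quad_tower K" "s^2 \<in> \<rat>"
 shows "quad_tower {u + v * s |u v. u \<in> K \<and> v \<in> K}"
proof (cases "s \<in> K")
 case True
 interpret csubfield K using assms quad_tower_csubfield by blast
 have "{u + v * s |u v. u \<in> K \<and> v \<in> K} \<subseteq> K" using True by auto
 then have "{u + v * s |u v. u \<in> K \<and> v \<in> K} = K" using quad_ext_superset[OF csubfield_axioms, of s] by (rule equalityI)
 then show ?thesis using assms by simp
qed (use assms quad_tower.step in blast)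

text \<open>One conjugate per step: \<open>p1 + s p2\<close> times \<open>p1 - s p2\<close> lies
  over \<open>K\<close>. The product is nonzero, because leading coefficients in
  \<open>p1^2 = s^2 p2^2\<close> would give \<open>s \<in> K\<close>.\<close>

lemma quad_tower_norm:
 assumes "quad_tower K" "p \<in> polys K" "p ~= 0"
 shows "\<exists>q\<in>polys K. p*q \<in> polys \<rat> \<and> p*q ~= 0"
 using assms
proof (induction arbitrary: p rule: quad_tower.induct)
 case base
 interpret csubfield \<rat> by (rule csubfield_Rats)
 show ?case using base by (intro bexI[of _ 1]) auto
next
 case (step K s)
 interpret K: csubfield K using step quad_tower_csubfield by blast
 let ?L = "{u + v * s |u v. u \<in> K \<and> v \<in> K}"
 interpret L: csubfield ?L using csubfield_quad_ext[OF K.csubfield_axioms] step.hyps K.Rats_closed by blast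
 have KL: "polys K \<subseteq> polys ?L" using polys_mono quad_ext_superset[OF K.csubfield_axioms] by blast
 have "\<forall>i. \<exists>u v. u \<in> K \<and> v \<in> K \<and> coeff p i = u + v * s" using step.prems(1) unfolding polys_def by blast
 then obtain U V where UV: "\<And>i. U i \<in> K" "\<And>i. V i \<in> K" "\<And>i. coeff p i = U i + V i * s" by metis
 define p1 where "p1 = (\<Sum>i\<le>degree p. Polynomial.monom (U i) i)"
 define p2 where "p2 = (\<Sum>i\<le>degree p. Polynomial.monom (V i) i)"
 have c1: "coeff p1 i = (if i \<le> degree p then U i else 0)" and c2: "coeff p2 i = (if i \<le> degree p then V i else 0)" for i
  by (simp_all add: p1_def p2_def coeff_sum)
 have pK: "p1 \<in> polys K" "p2 \<in> polys K" using UV by (auto simp: polys_def c1 c2)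
 have p: "p = p1 + Polynomial.smult s p2"
 proof (rule poly_eqI)
  fix i
  show "coeff p i = coeff (p1 + Polynomial.smult s p2) i"
   using UV(3)[of i] by (cases "i \<le> degree p") (simp_all add: c1 c2 coeff_eq_0 mult.commute)
 qed
 define q where "q = p1 - Polynomial.smult s p2"
 have sL: "s \<in> ?L" by (intro CollectI exI[of _ 0] exI[of _ 1]) simp
 have qL: "q \<in> polys ?L" unfolding q_def using pK KL sL by (intro L.polys_diff L.polys_smult) auto
 have pq: "p*q = p1^2 - Polynomial.smult (s^2) (p2^2)"
  unfolding p q_def by (simp add: square_simps)
 have pqK: "p*q \<in> polys K" unfolding pq using pK step.hyps K.Rats_closed by simp
 have "p*q ~= 0"
 proof
  assume "p*q = 0"
  then have e: "p1^2 = Polynomial.smult (s^2) (p2^2)" using pq by simp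
  show False
  proof (cases "p2 = 0")
   case True
   then show False using e p step.prems(2) by simp
  next
   case False
   have "(lead_coeff p1)^2 = (s*lead_coeff p2)^2"
    using arg_cong[OF e, of lead_coeff] by (simp add: lead_coeff_power lead_coeff_smult power_mult_distrib)
   then have "lead_coeff p1 = s*lead_coeff p2 \<or> lead_coeff p1 = - (s*lead_coeff p2)" by (simp only: power2_eq_iff)
   then have "s = lead_coeff p1 / lead_coeff p2 \<or> s = - (lead_coeff p1 / lead_coeff p2)" using False by auto
   moreover have "lead_coeff p1 / lead_coeff p2 \<in> K" using pK by (simp add: polysD)
   ultimately have "s \<in> K" using K.uminus_closed by blast
   then show False using step.hyps by simp
  qed
 qed
 then obtain r where r: "r \<in> polys K" "p*q*r \<in> polys \<rat>" "p*q*r ~= 0" using step.IH[OF pqK] by blast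
 have "q*r \<in> polys ?L" using qL r(1) KL by (intro L.polys_mult) auto
 then show ?case using r(2,3) by (intro bexI[of _ "q*r"]) (simp_all add: mult.assoc)
qed

section \<open>Generation by elements of rational square\<close>

inductive_set add_span :: "complex set \<Rightarrow> complex set" for M where
 zero: "0 \<in> add_span M"
| add: "m \<in> M ==> z \<in> add_span M ==> m + z \<in> add_span M"

lemma add_span_plus: "z \<in> add_span M ==> w \<in> add_span M ==> z + w \<in> add_span M"
 by (induction rule: add_span.induct) (auto simp: add.assoc intro: add_span.intros)

lemma add_span_incl: "m \<in> M ==> m \<in> add_span M"
 using add_span.add[OF _ add_span.zero] by simp

lemma add_span_mono: "z \<in> add_span M ==> M \<subseteq> N ==> z \<in> add_span N"
 by (induction rule: add_span.induct) (auto intro: add_span.intros)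

lemma add_span_scale: "z \<in> add_span M ==> (\<And>m. m \<in> M ==> m * c \<in> N) ==> z * c \<in> add_span N"
 by (induction rule: add_span.induct) (auto simp: distrib_right intro: add_span.intros)

text \<open>Products of the adjoined square roots have rational squares and generate the field over
  the rationals. Their valuations are controlled by those of rational numbers, which is how general
  elements of \<open>K\<close> are reached below.\<close>

lemma quad_tower_span:
 assumes "quad_tower K" "z \<in> K"
 shows "z \<in> add_span {m \<in> K. m^2 \<in> \<rat>}"
 using assms
proof (induction arbitrary: z rule: quad_tower.induct)
 case base
 then show ?case by (intro add_span_incl) auto
next
 case (step K s)
 let ?L = "{u + v * s |u v. u \<in> K \<and> v \<in> K}"
 interpret K: csubfield K using step quad_tower_csubfield by blast
 have sub: "K \<subseteq> ?L" by (rule quad_ext_superset[OF K.csubfield_axioms])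
 obtain u v where uv: "u \<in> K" "v \<in> K" "z = u + v * s" using step.prems by blast
 have "u \<in> add_span {m \<in> ?L. m^2 \<in> \<rat>}"
  by (rule add_span_mono[OF step.IH[OF uv(1)]]) (use sub in blast)
 moreover have "v * s \<in> add_span {m \<in> ?L. m^2 \<in> \<rat>}"
 proof (rule add_span_scale[OF step.IH[OF uv(2)]])
  fix m assume m: "m \<in> {m \<in> K. m^2 \<in> \<rat>}"
  have "m * s \<in> ?L" using m by (intro CollectI exI[of _ 0] exI[of _ m]) auto
  moreover have "(m * s)^2 \<in> \<rat>" using m step.hyps by (simp add: power_mult_distrib)
  ultimately show "m * s \<in> {m \<in> ?L. m^2 \<in> \<rat>}" by blast
 qed
 ultimately show ?case unfolding uv(3) by (rule add_span_plus)
qed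

text \<open>Dimension 2 completes 1 to a rational basis by some \<open>v\<close>; completing the
  square in the quadratic equation of \<open>v\<close> gives \<open>s = v - q / 2\<close>.\<close>

lemma quadratic_field_form:
 assumes "quadratic_number_field L"
 obtains s where "s^2 \<in> \<rat>" "L = {u + v * s |u v. u \<in> \<rat> \<and> v \<in> \<rat>}"
proof -
 interpret C: ring CC by (rule CC_ring)
 interpret Q: csubfield \<rat> by (rule csubfield_Rats)
 have L: "subfield L CC" "C.dimension 2 \<rat> L" using assms by (auto simp: quadratic_number_field_def)
 interpret L: csubfield L by (rule subfield_CC_imp_csubfield[OF L(1)])
 have sQ: "subfield \<rat> CC" by (rule Q.subfield_CC)
 have "C.independent \<rat> [1]" by (intro C.li_Cons C.li_Nil) auto
 then obtain Vs where Vs: "length (Vs @ [1]) = 2" "C.Span \<rat> (Vs @ [1]) = L"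
  using C.complete_base[OF sQ L(2), of "[1]"] by auto
 then obtain v where "Vs = [v]" by (auto simp: length_Suc_conv)
 then have L: "L = C.line_extension \<rat> v (C.line_extension \<rat> 1 {0})" using Vs(2) by simp
 have one: "z \<in> C.line_extension \<rat> 1 {0} \<longleftrightarrow> z \<in> \<rat>" for z
  unfolding C.line_extension_mem_iff by simp
 have mem: "z \<in> L \<longleftrightarrow> (\<exists>k'\<in>\<rat>. \<exists>k\<in>\<rat>. z = k' * v + k)" for z
  unfolding L C.line_extension_mem_iff Bex_def one by simp
 have Lv: "L = {k + k' * v |k k'. k \<in> \<rat> \<and> k' \<in> \<rat>}"
 proof (intro equalityI subsetI)
  fix z assume "z \<in> L"
  then obtain k' k where "k' \<in> \<rat>" "k \<in> \<rat>" "z = k' * v + k" using mem by blast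
  then show "z \<in> {k + k' * v |k k'. k \<in> \<rat> \<and> k' \<in> \<rat>}" by (auto simp: add.commute)
 next
  fix z assume "z \<in> {k + k' * v |k k'. k \<in> \<rat> \<and> k' \<in> \<rat>}"
  then obtain k' k where "k' \<in> \<rat>" "k \<in> \<rat>" "z = k' * v + k" by (auto simp: add.commute)
  then show "z \<in> L" using mem by blast
 qed
 have "v \<in> L" unfolding Lv by (intro CollectI exI[of _ 0] exI[of _ 1]) simp
 then have "v^2 \<in> L" by simp
 then obtain p q where pq: "p \<in> \<rat>" "q \<in> \<rat>" "v^2 = p + q * v" unfolding Lv by blast
 define s where "s = v - q / 2"
 have "s^2 = v^2 - q * v + q^2 / 4" by (simp add: s_def power2_eq_square algebra_simps)
 then have "s^2 = p + q^2 / 4" unfolding pq(3) by simp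
 then have "s^2 \<in> \<rat>" using pq by simp
 moreover have "L = {u + v * s |u v. u \<in> \<rat> \<and> v \<in> \<rat>}"
 proof (intro equalityI subsetI)
  fix z assume "z \<in> L"
  then obtain k k' where k: "k \<in> \<rat>" "k' \<in> \<rat>" "z = k + k' * v" unfolding Lv by blast
  have "z = (k + k'*(q / 2)) + k' * s" unfolding k(3) s_def by (simp add: algebra_simps)
  moreover have "k + k'*(q / 2) \<in> \<rat>" using k pq by simp
  ultimately show "z \<in> {u + v * s |u v. u \<in> \<rat> \<and> v \<in> \<rat>}" using k(2) by blast
 next
  fix z assume "z \<in> {u + v * s |u v. u \<in> \<rat> \<and> v \<in> \<rat>}"
  then obtain k k' where k: "k \<in> \<rat>" "k' \<in> \<rat>" "z = k + k' * s" by blast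
  have "z = (k - k'*(q / 2)) + k' * v" unfolding k(3) s_def by (simp add: algebra_simps)
  moreover have "k - k'*(q / 2) \<in> \<rat>" using k pq by simp
  ultimately show "z \<in> L" unfolding Lv using k(2) by blast
 qed
 ultimately show ?thesis using that by blast
qed

lemma multi_quadratic_tower:
 assumes "multi_quadratic K"
 shows "quad_tower K"
proof -
 obtain \<L> where \<L>: "finite \<L>" "\<forall>L\<in>\<L>. quadratic_number_field L" "K = generate_field CC (\<Union>\<L>)"
  using assms unfolding multi_quadratic_def by blast
 have "quad_tower (generate_field CC (\<Union>\<L>))" using \<L>(1,2)
 proof (induction rule: finite_induct)
  case empty
  have "generate_field CC (\<Union>{}) = \<rat>"
   by (rule equalityI[OF generate_field_min[OF csubfield_Rats] Rats_csubfield[OF csubfield_generate_field]]) simp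
  then show ?case using quad_tower.base by simp
 next
  case (insert L \<L>)
  let ?K = "generate_field CC (\<Union>\<L>)"
  interpret K: csubfield ?K by (rule csubfield_generate_field)
  obtain s where s: "s^2 \<in> \<rat>" "L = {u + v * s |u v. u \<in> \<rat> \<and> v \<in> \<rat>}"
   by (rule quadratic_field_form[of L]) (use insert.prems in simp)
  let ?E = "{u + v * s |u v. u \<in> ?K \<and> v \<in> ?K}"
  interpret G: csubfield "generate_field CC (\<Union>(insert L \<L>))" by (rule csubfield_generate_field)
  have E: "csubfield ?E" by (rule csubfield_quad_ext[OF K.csubfield_axioms K.Rats_closed[OF s(1)]])
  have "s \<in> L" unfolding s(2) by (intro CollectI exI[of _ 0] exI[of _ 1]) simp
  then have sG: "s \<in> generate_field CC (\<Union>(insert L \<L>))" by (intro generate_field.incl) simp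
  have KG: "?K \<subseteq> generate_field CC (\<Union>(insert L \<L>))" by (rule generate_field_mono) auto
  have "generate_field CC (\<Union>(insert L \<L>)) = ?E"
  proof (rule equalityI)
   have "\<Union>\<L> \<subseteq> ?E" using generate_field_subset quad_ext_superset[OF K.csubfield_axioms, of s] by (rule order.trans)
   moreover have "L \<subseteq> ?E"
   proof
    fix z assume "z \<in> L"
    then obtain u v where "u \<in> \<rat>" "v \<in> \<rat>" "z = u + v * s" unfolding s(2) by blast
    then show "z \<in> ?E" using K.Rats_closed[of u] K.Rats_closed[of v] by blast
   qed
   ultimately show "generate_field CC (\<Union>(insert L \<L>)) \<subseteq> ?E" by (intro generate_field_min E) auto
   show "?E \<subseteq> generate_field CC (\<Union>(insert L \<L>))"
   proof
    fix z assume "z \<in> ?E"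
    then obtain u v where "u \<in> ?K" "v \<in> ?K" "z = u + v * s" by blast
    then show "z \<in> generate_field CC (\<Union>(insert L \<L>))"
     using G.add_closed[OF subsetD[OF KG, of u] G.mult_closed[OF subsetD[OF KG, of v] sG]] by simp
   qed
  qed
  then show ?case using quad_tower_adjoin[OF insert.IH s(1)] insert.prems by simp
 qed
 then show ?thesis using \<L>(3) by simp
qed

lemma Q_sqrt_m3_form: "Q_sqrt_m3 = {u + v * csqrt (- 3) |u v. u \<in> \<rat> \<and> v \<in> \<rat>}"
proof -
 let ?s = "csqrt (- 3)" and ?E = "{u + v * csqrt (- 3) |u v. u \<in> \<rat> \<and> v \<in> \<rat>}"
 have s2: "?s^2 \<in> \<rat>" by (simp only: power2_csqrt) simp
 interpret Q: csubfield \<rat> by (rule csubfield_Rats)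
 interpret G: csubfield Q_sqrt_m3 unfolding Q_sqrt_m3_def by (rule csubfield_generate_field)
 have sub: "\<rat> \<union> {?s} \<subseteq> Q_sqrt_m3" unfolding Q_sqrt_m3_def by (rule generate_field_subset)
 have E: "csubfield ?E" by (rule csubfield_quad_ext[OF csubfield_Rats s2])
 have "?s \<in> ?E" by (intro CollectI exI[of _ 0] exI[of _ 1]) simp
 then have "Q_sqrt_m3 \<subseteq> ?E" unfolding Q_sqrt_m3_def
  by (intro generate_field_min E) (use quad_ext_superset[OF csubfield_Rats, of ?s] in blast)
 moreover have "?E \<subseteq> Q_sqrt_m3"
 proof
  fix z assume "z \<in> ?E"
  then obtain u v where uv: "u \<in> \<rat>" "v \<in> \<rat>" "z = u + v * ?s" by blast
  then have "u \<in> Q_sqrt_m3" "v \<in> Q_sqrt_m3" "?s \<in> Q_sqrt_m3" using sub by blast+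
  then show "z \<in> Q_sqrt_m3" unfolding uv(3) by (intro G.add_closed G.mult_closed)
 qed
 ultimately show ?thesis by blast
qed

lemma quad_tower_Q_sqrt_m3: "quad_tower Q_sqrt_m3"
 unfolding Q_sqrt_m3_form by (rule quad_tower_adjoin[OF quad_tower.base]) (simp only: power2_csqrt, simp)

section \<open>Valuations on multi-quadratic fields\<close>

lemma frobenius_sum:
 assumes "csubring R" "prime p" "u \<in> R" "v \<in> R"
 shows "\<exists>r\<in>R. (u + v)^p = u^p + v^p + of_nat p*r"
proof -
 interpret csubring R by fact
 have p: "p > 0" using assms(2) prime_gt_0_nat by blast
 have "(u + v)^p = (\<Sum>k\<le>p. of_nat (p choose k)*u^k * v^(p - k))" by (rule binomial_ring)
 also have "{..p} = insert 0 (insert p {1..<p})" using p by auto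
 also have "(\<Sum>k\<in>\<dots>. of_nat (p choose k)*u^k * v^(p - k)) =
  v^p + (u^p + (\<Sum>k\<in>{1..<p}. of_nat (p choose k)*u^k * v^(p - k)))"
  using p by simp
 also have "(\<Sum>k\<in>{1..<p}. of_nat (p choose k)*u^k * v^(p - k)) =
  (\<Sum>k\<in>{1..<p}. of_nat p*(of_nat ((p choose k) div p)*u^k * v^(p - k)))"
 proof (intro sum.cong refl)
  fix k assume "k \<in> {1..<p}"
  then have "p dvd (p choose k)" using dvd_choose_prime[of k p] assms(2) by auto
  then have "(p choose k) = p*((p choose k) div p)" by simp
  then have "(of_nat (p choose k) :: complex) = of_nat p * of_nat ((p choose k) div p)" by (metis of_nat_mult)
  then show "of_nat (p choose k)*u^k * v^(p - k) = of_nat p*(of_nat ((p choose k) div p)*u^k * v^(p - k))"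
   by (simp add: mult.assoc)
 qed
 also have "\<dots> = of_nat p*(\<Sum>k\<in>{1..<p}. of_nat ((p choose k) div p)*u^k * v^(p - k))"
  by (rule sum_distrib_left[symmetric])
 finally have "(u + v)^p = u^p + v^p + of_nat p*(\<Sum>k\<in>{1..<p}. of_nat ((p choose k) div p)*u^k * v^(p - k))"
  by (simp add: algebra_simps)
 then show ?thesis by (rule bexI) (intro sum_closed, use assms in simp)
qed

lemma power_cong_p:
 assumes "csubring R" "prime p" "u \<in> R" "r \<in> R"
 shows "\<exists>r'\<in>R. (u + of_nat p*r)^p = u^p + of_nat p*r'"
proof -
 interpret csubring R by fact
 obtain r' where r': "r' \<in> R" "(u + of_nat p*r)^p = u^p + (of_nat p*r)^p + of_nat p*r'"
  using frobenius_sum[OF assms(1-3), of "of_nat p*r"] assms(4) by auto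
 obtain k where k: "p = Suc k" using prime_gt_0_nat[OF assms(2)] by (metis gr0_implies_Suc)
 define q where "q = of_nat p*r"
 have "q^p = q*q^k" using k by simp
 then have "(of_nat p*r)^p = of_nat p*(r*(of_nat p*r)^k)" by (simp add: q_def mult.assoc)
 then show ?thesis using r' assms by (intro bexI[of _ "r*(of_nat p*r)^k + r'"]) (auto simp: algebra_simps)
qed

locale p_val = valring UNIV V for V :: "complex set" +
 fixes p :: nat
 assumes p: "prime p" "odd p" and p_max: "of_nat p \<in> \<mm>"
begin

lemma int_unit: "\<not> int p dvd n ==> (of_int n :: complex) \<in> V \<and> of_int n \<notin> \<mm>"
proof -
 assume n: "\<not> int p dvd n"
 have "coprime (int p) n" using n p(1) by (simp add: prime_imp_coprime)
 then obtain u v where "u*int p + v * n = 1" using bezout_int[of "int p" n] by (auto simp: coprime_iff_gcd_eq_1)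
 then have uv: "of_int u * of_nat p + of_int v * of_int n = (1::complex)"
  by (metis of_int_1 of_int_add of_int_mult of_int_of_nat_eq)
 have "of_int n \<notin> \<mm>"
 proof
  assume "of_int n \<in> \<mm>"
  then have "of_int u * of_nat p + of_int v * of_int n \<in> \<mm>" using p_max by (intro max_add max_mult') auto
  then show False unfolding uv by simp
 qed
 then show ?thesis by simp
qed

definition "ratu = {u \<in> \<rat>. u \<in> V \<and> u \<notin> \<mm>}"

lemma p_nz: "(of_nat p :: complex) ~= 0" using prime_gt_0_nat[OF p(1)] by simp

lemma int_repr: "n ~= 0 ==> \<exists>k. \<exists>m. of_int n = (of_nat p :: complex)^k * of_int m \<and> \<not> int p dvd m"
proof -
 assume n: "n ~= 0"
 obtain m where m: "n = int p^multiplicity (int p) n*m" "\<not> int p dvd m"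
  using multiplicity_decompose'[of n "int p"] n prime_gt_1_nat[OF p(1)] by (auto simp: zdvd1_eq)
 then have "of_int n = (of_int (int p^multiplicity (int p) n*m) :: complex)" by simp
 then show ?thesis using m(2) by (intro exI[of _ "multiplicity (int p) n"] exI[of _ m]) simp
qed

lemma ratu_mult: "u \<in> ratu ==> v \<in> ratu ==> u * v \<in> ratu"
 and ratu_inverse: "u \<in> ratu ==> inverse u \<in> ratu"
 using unit_mult unit_inverse by (auto simp: ratu_def)

lemma rat_repr:
 assumes "q \<in> \<rat>" "q ~= 0"
 shows "\<exists>k::int. \<exists>u\<in>ratu. q = of_nat p powi k*u"
proof -
 obtain m n where mn: "q = of_int m / of_int n" "n > 0" using assms(1) by (elim Rats_cases') auto
 have "m ~= 0" using assms(2) mn by auto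
 then obtain k m' where m': "of_int m = (of_nat p :: complex)^k * of_int m'" "\<not> int p dvd m'" using int_repr by blast
 have "n ~= 0" using mn by simp
 then obtain l n' where n': "of_int n = (of_nat p :: complex)^l * of_int n'" "\<not> int p dvd n'" using int_repr by blast
 have "of_int m' \<in> ratu" "of_int n' \<in> ratu" using int_unit m' n' by (auto simp: ratu_def)
 then have "of_int m'*inverse (of_int n') \<in> ratu" using ratu_mult ratu_inverse by blast
 moreover have "q = of_nat p powi (int k - int l)*(of_int m'*inverse (of_int n'))"
  unfolding mn(1) m'(1) n'(1) using p_nz by (simp add: power_int_diff field_simps)
 ultimately show ?thesis by blast
qed

lemma int_fermat: "\<exists>c. (of_int m :: complex)^p = of_int m + of_nat p * of_int c"
proof -
 have Z: "csubring \<int>" by unfold_locales auto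
 have nat: "\<exists>c. (of_nat n :: complex)^p = of_nat n + of_nat p * of_int c" for n
 proof (induction n)
  case 0
  then show ?case using prime_gt_0_nat[OF p(1)] by (intro exI[of _ 0]) simp
 next
  case (Suc n)
  then obtain c where c: "(of_nat n :: complex)^p = of_nat n + of_nat p * of_int c" by blast
  obtain r where r: "r \<in> \<int>" "(of_nat n + 1 :: complex)^p = of_nat n^p + 1^p + of_nat p*r"
   using frobenius_sum[OF Z p(1), of "of_nat n" 1] by auto
  then obtain d where "r = of_int d" by (elim Ints_cases)
  then show ?case using r(2) c by (intro exI[of _ "c + d"]) (simp add: algebra_simps)
 qed
 show ?thesis
 proof (cases "m \<ge> 0")
  case True
  then show ?thesis using nat[of "nat m"] by simp
 next
  case False
  obtain c where c: "(of_nat (nat (- m)) :: complex)^p = of_nat (nat (- m)) + of_nat p * of_int c" using nat by blast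
  have m: "(of_int m :: complex) = - of_nat (nat (- m))" using False by simp
  show ?thesis unfolding m using p(2) c by (intro exI[of _ "- c"]) simp
 qed
qed

text \<open>Fermat's little theorem for numerator and denominator. The cofactor \<open>w\<close> is
  rational, so that \<open>rat_V_R\<close> places it in \<open>R\<close>.\<close>

lemma ratu_fermat:
 assumes "u \<in> ratu"
 shows "\<exists>w\<in>\<rat>. w \<in> V \<and> u^(p - 1) = 1 + of_nat p*w"
proof -
 have u: "u \<in> \<rat>" "u ~= 0" "u \<in> V" "u \<notin> \<mm>" using assms by (auto simp: ratu_def)
 obtain m n where mn: "u = of_int m / of_int n" "n > 0" "coprime m n" using u(1) by (elim Rats_cases') auto
 have nm: "u * of_int n = of_int m" using mn by simp
 have ndvd: "\<not> int p dvd n"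
 proof
  assume d: "int p dvd n"
  then obtain k where "n = int p * k" by blast
  then have "of_int n = (of_nat p * of_int k :: complex)" by simp
  then have "of_int m \<in> \<mm>" unfolding nm[symmetric] using max_mult'[OF max_mult[OF p_max], of "of_int k" u] u by simp
  then have "int p dvd m" using int_unit by blast
  then have "is_unit (int p)" using d mn(3) by (meson coprime_common_divisor)
  then show False using prime_gt_1_nat[OF p(1)] by (simp add: zdvd1_eq)
 qed
 obtain c where c: "(of_int m :: complex)^p = of_int m + of_nat p * of_int c" using int_fermat by blast
 obtain d where d: "(of_int n :: complex)^p = of_int n + of_nat p * of_int d" using int_fermat by blast
 have n0: "(of_int n :: complex) ~= 0" using mn(2) by simp
 have ni: "(of_int (n^p) :: complex) \<in> V" "(of_int (n^p) :: complex) \<notin> \<mm>"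
  using max_power_iff[of p "of_int n"] int_unit[OF ndvd] prime_gt_0_nat[OF p(1)] by auto
 define w where "w = (of_int c - u * of_int d)*inverse (of_int (n^p))*inverse u"
 have "w \<in> V" unfolding w_def using unit_inverse[OF ni] unit_inverse[OF u(3,4)] u by simp
 moreover have "w \<in> \<rat>" using u by (simp add: w_def)
 moreover have "u^(p - 1) = 1 + of_nat p*w"
 proof -
  have "u^p * of_int n^p = u * of_int n^p + of_nat p*(of_int c - u * of_int d)"
   unfolding power_mult_distrib[symmetric] nm c unfolding d nm[symmetric] by (simp add: algebra_simps)
  also have "of_nat p*(of_int c - u * of_int d) = of_nat p*w*u * of_int n^p"
  proof -
   have "w*u * of_int n^p = (of_int c - u * of_int d)*((inverse (of_int (n^p)) * of_int (n^p))*(inverse u*u))"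
    unfolding w_def of_int_power by (simp only: mult_ac)
   also have "(inverse (of_int (n^p)) * of_int (n^p))*(inverse u*u) = (1 :: complex)" using n0 u(2) by simp
   finally show ?thesis by (simp only: mult.assoc mult_1_right)
  qed
  finally have "(u^p) * of_int n^p = (u*(1 + of_nat p*w)) * of_int n^p" by (simp add: algebra_simps)
  then have "u^p = u*(1 + of_nat p*w)" using n0 by simp
  moreover have "u^p = u*u^(p - 1)" using prime_gt_0_nat[OF p(1)] by (metis power_eq_if not_gr_zero)
  ultimately show ?thesis using u(2) by simp
 qed
 ultimately show ?thesis by blast
qed

end

lemma add_span_mult:
 assumes N: "\<And>m n. m \<in> N ==> n \<in> N ==> m*n \<in> N" and z: "z \<in> add_span N" and w: "w \<in> add_span N"
 shows "z*w \<in> add_span N"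
 using w
proof induction
 case zero
 then show ?case by (simp add: add_span.zero)
next
 case (add m w)
 have "z*m \<in> add_span N" by (rule add_span_scale[OF z]) (use N add.hyps in blast)
 then show ?case using add.IH by (simp add: distrib_left add_span_plus)
qed

text \<open>The field is assumed to contain a square root \<open>\<pi>\<close> of \<open>p\<close>.
  This concentrates the ramification in \<open>\<pi>\<close>: a nonzero element of rational square
  is a power of \<open>\<pi>\<close> times one whose square is a rational unit.\<close>

locale p_val_tower = p_val V p for V p +
 fixes K :: "complex set" and \<pi> :: complex
 assumes tower: "quad_tower K" and pi_K: "\<pi> \<in> K" and pi_sq: "\<pi>^2 = of_nat p"
begin

sublocale K: csubfield K by (rule quad_tower_csubfield[OF tower])

lemma pi_max: "\<pi> \<in> \<mm>" and pi_nz: "\<pi> ~= 0"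
proof -
 have m: "\<pi>^2 \<in> \<mm>" using p_max pi_sq by simp
 then have "\<pi>^Suc 1 \<in> V" using max_sub by (simp add: numeral_2_eq_2)
 then have "\<pi> \<in> V" by (rule integral_closed[rotated]) simp
 then show "\<pi> \<in> \<mm>" using m max_power_iff[of 2 \<pi>] by simp
 show "\<pi> ~= 0" using pi_sq p_nz by auto
qed

definition "M0 = {m \<in> K. m^2 \<in> ratu}"

lemma M0_unit: "m \<in> M0 ==> m \<in> V \<and> m \<notin> \<mm>"
proof -
 assume m: "m \<in> M0"
 then have "m^Suc 1 \<in> V" by (simp add: M0_def ratu_def numeral_2_eq_2)
 then have "m \<in> V" by (rule integral_closed[rotated]) simp
 then show ?thesis using m max_power_iff[of 2 m] by (simp add: M0_def ratu_def)
qed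

lemma M0_mult: "m \<in> M0 ==> n \<in> M0 ==> m*n \<in> M0"
 by (simp add: M0_def power_mult_distrib ratu_mult)

lemma ratu_M0: "u \<in> ratu ==> u \<in> M0"
proof -
 assume u: "u \<in> ratu"
 then have "u \<in> K" using K.Rats_closed by (simp add: ratu_def)
 then show ?thesis using ratu_mult[OF u u] by (simp add: M0_def power2_eq_square)
qed

definition "N = {of_nat p^k*m |k m. m \<in> M0}"

lemma N_I: "m \<in> M0 ==> of_nat p^k*m \<in> N"
 unfolding N_def by blast

lemma N_mult: "m \<in> N ==> n \<in> N ==> m*n \<in> N"
proof -
 assume "m \<in> N" "n \<in> N"
 then obtain k l m' n' where *: "m' \<in> M0" "n' \<in> M0" "m = of_nat p^k*m'" "n = of_nat p^l*n'" unfolding N_def by blast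
 have "m*n = of_nat p^(k + l)*(m'*n')" unfolding *(3,4) by (simp add: power_add)
 then show ?thesis using N_I[OF M0_mult[OF *(1,2)]] by simp
qed

text \<open>An unramified subring: modulo \<open>p\<close> its elements satisfy
  \<open>z^(p^2) = z\<close> (\<open>frob_R\<close>), and up to powers of \<open>p\<close> every
  element of \<open>K\<close> lies in \<open>R + \<pi> R\<close> (\<open>decomp\<close>).\<close>

definition "R = add_span N"

lemma one_M0: "1 \<in> M0" using ratu_M0[of 1] by (simp add: ratu_def)

lemma M0_R: "m \<in> M0 ==> m \<in> R"
 using add_span_incl[OF N_I[of m 0]] by (simp add: R_def)

sublocale R: csubring R
proof
 show "1 \<in> R" by (rule M0_R[OF one_M0])
 fix z w assume zw: "z \<in> R" "w \<in> R"
 then show "z + w \<in> R" "z*w \<in> R" using add_span_plus add_span_mult[OF N_mult] unfolding R_def by blast+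
 have "z*(- 1) \<in> add_span N"
 proof (rule add_span_scale[OF zw(1)[unfolded R_def]])
  fix m assume "m \<in> N"
  then obtain k m' where "m' \<in> M0" "m = of_nat p^k*m'" unfolding N_def by blast
  moreover from this have "- m' \<in> M0" by (simp add: M0_def)
  ultimately show "m * - 1 \<in> N" using N_I[of "- m'" k] by simp
 qed
 then show "- z \<in> R" by (simp add: R_def)
qed

lemma R_V: "r \<in> R ==> r \<in> V" and R_K: "r \<in> R ==> r \<in> K"
 unfolding R_def
proof -
 show "r \<in> add_span N ==> r \<in> V"
  by (induction rule: add_span.induct) (auto simp: N_def M0_unit)
 show "r \<in> add_span N ==> r \<in> K"
  by (induction rule: add_span.induct) (auto simp: N_def M0_def)
qed

lemma rat_V_R:
 assumes "w \<in> \<rat>" "w \<in> V"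
 shows "w \<in> R"
proof (cases "w = 0")
 case False
 then obtain k u where u: "u \<in> ratu" "w = of_nat p powi k*u" using rat_repr[OF assms(1)] by blast
 have "k \<ge> 0"
 proof (rule ccontr)
  assume k: "\<not> k \<ge> 0"
  have "(of_nat p :: complex)^nat (- k)*w = u"
   unfolding u(2) using k p_nz by (simp add: power_int_def power_inverse field_simps)
  moreover have "(of_nat p :: complex)^nat (- k) \<in> \<mm>" using max_power_iff[of "nat (- k)" "of_nat p"] p_max k by simp
  ultimately have "u \<in> \<mm>" using max_mult assms(2) by metis
  then show False using u by (simp add: ratu_def)
 qed
 then have "w = of_nat p^nat k*u" using u(2) by (simp add: power_int_def)
 then show ?thesis using N_I[OF ratu_M0[OF u(1)], of "nat k"] by (simp add: R_def add_span_incl)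
qed simp

lemma one_plus_power: "w \<in> R ==> \<exists>w'\<in>R. (1 + of_nat p*w)^j = 1 + of_nat p*w'"
proof (induction j)
 case (Suc j)
 then obtain w' where "w' \<in> R" "(1 + of_nat p*w)^j = 1 + of_nat p*w'" by blast
 then show ?case using Suc.prems by (intro bexI[of _ "w + w' + of_nat p*w*w'"]) (simp_all add: algebra_simps)
qed (auto intro: bexI[of _ 0])

lemma frob_N:
 assumes "n \<in> N"
 shows "\<exists>s\<in>R. n^(p*p) = n + of_nat p * s"
proof -
 obtain k m where m: "m \<in> M0" "n = of_nat p^k*m" using assms unfolding N_def by blast
 show ?thesis
 proof (cases k)
  case 0
  obtain w where w: "w \<in> \<rat>" "w \<in> V" "(m^2)^(p - 1) = 1 + of_nat p*w"
   using ratu_fermat[of "m^2"] m by (auto simp: M0_def)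
  obtain w' where w': "w' \<in> R" "(1 + of_nat p*w)^((p + 1) div 2) = 1 + of_nat p*w'"
   using one_plus_power[OF rat_V_R[OF w(1,2)]] by blast
  \<comment> \<open>This splits off a power of \<open>(m^2)^(p - 1)\<close>, which is 1 modulo
    \<open>p\<close> because \<open>m^2\<close> is a rational unit.\<close>
  have "p*p = Suc (2*((p - 1)*((p + 1) div 2)))"
  proof -
   obtain q where q: "p = 2*q + 1" using p(2) by (elim oddE)
   show ?thesis unfolding q by (simp add: algebra_simps)
  qed
  then have "m^(p*p) = m*((m^2)^(p - 1))^((p + 1) div 2)" by (simp add: power_mult)
  also have "\<dots> = m*(1 + of_nat p*w')" using w(3) w'(2) by simp
  finally have "n^(p*p) = n + of_nat p*(m*w')" using m 0 by (simp add: algebra_simps)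
  then show ?thesis using M0_R[OF m(1)] w' by (intro bexI[of _ "m*w'"]) auto
 next
  case (Suc l)
  define n' where "n' = of_nat p^l*m"
  have n': "n' \<in> R" unfolding n'_def R_def by (rule add_span_incl[OF N_I[OF m(1)]])
  have n: "n = of_nat p*n'" by (simp add: m(2) Suc n'_def)
  obtain q where q: "p*p = Suc q" using prime_gt_0_nat[OF p(1)] by (metis gr0_implies_Suc nat_0_less_mult_iff)
  have "n^(p*p) = n + of_nat p*(n'*n^q - n')"
   unfolding q by (subst n) (simp add: algebra_simps n)
  moreover have "n'*n^q - n' \<in> R" using n' n by simp
  ultimately show ?thesis by blast
 qed
qed

text \<open>Raising to the power \<open>p\<close> is additive modulo \<open>p\<close>; this is
  applied twice.\<close>

lemma frob_R: "r \<in> R ==> \<exists>s\<in>R. r^(p*p) = r + of_nat p * s"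
 unfolding R_def
proof (induction rule: add_span.induct)
 case zero
 have "p*p > 0" using prime_gt_0_nat[OF p(1)] by simp
 then show ?case by (intro bexI[of _ 0]) (auto intro: add_span.zero)
next
 case (add n z)
 have nR: "n \<in> R" and zR: "z \<in> R" using add.hyps add_span_incl by (auto simp: R_def)
 obtain s1 where s1: "s1 \<in> R" "n^(p*p) = n + of_nat p * s1" using frob_N[OF add.hyps(1)] by blast
 obtain s2 where s2: "s2 \<in> R" "z^(p*p) = z + of_nat p * s2" using add.IH R_def by blast
 obtain r1 where r1: "r1 \<in> R" "(n + z)^p = n^p + z^p + of_nat p*r1"
  using frobenius_sum[OF R.csubring_axioms p(1) nR zR] by blast
 obtain r2 where r2: "r2 \<in> R" "(n^p + z^p + of_nat p*r1)^p = (n^p + z^p)^p + of_nat p*r2"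
  using power_cong_p[OF R.csubring_axioms p(1), of "n^p + z^p" r1] nR zR r1 by auto
 obtain r3 where r3: "r3 \<in> R" "(n^p + z^p)^p = (n^p)^p + (z^p)^p + of_nat p*r3"
  using frobenius_sum[OF R.csubring_axioms p(1), of "n^p" "z^p"] nR zR by auto
 have "(n + z)^(p*p) = ((n + z)^p)^p" by (rule power_mult)
 also have "\<dots> = n^(p*p) + z^(p*p) + of_nat p*(r2 + r3)"
  unfolding r1(2) r2(2) r3(2) power_mult by (simp add: algebra_simps)
 also have "\<dots> = n + z + of_nat p*(s1 + s2 + r2 + r3)" unfolding s1(2) s2(2) by (simp add: algebra_simps)
 finally have e: "(n + z)^(p*p) = n + z + of_nat p*(s1 + s2 + r2 + r3)" .
 have "s1 + s2 + r2 + r3 \<in> add_span N" unfolding R_def[symmetric] using s1 s2 r2 r3 by simp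
 with e show ?case by (rule bexI)
qed

lemma bounded_denominator:
 assumes "c \<in> K"
 shows "\<exists>l. of_nat p^l * c \<in> V"
 using quad_tower_span[OF tower assms]
proof induction
 case zero
 then show ?case by simp
next
 case (add m z)
 then obtain l where l: "of_nat p^l*z \<in> V" by blast
 have "\<exists>j. of_nat p^j*m \<in> V"
 proof (cases "m = 0")
  case True
  then show ?thesis by simp
 next
  case False
  then obtain k u where u: "u \<in> ratu" "m^2 = of_nat p powi k*u" using rat_repr[of "m^2"] add.hyps by auto
  define j where "j = nat \<bar>k\<bar>"
  have "(of_nat p^j*m)^2 = of_nat p powi (2*int j + k)*u"
  proof -
   have "(of_nat p^j)^2 = (of_nat p :: complex) powi (2*int j)"
   proof -
    have "(of_nat p^j)^2 = (of_nat p :: complex)^(2*j)" by (simp only: power_mult[symmetric] mult.commute)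
    also have "\<dots> = of_nat p powi (int (2*j))" by (simp only: power_int_of_nat)
    finally show ?thesis by (simp only: of_nat_mult of_nat_numeral)
   qed
   then show ?thesis unfolding power_mult_distrib u(2) using p_nz by (simp add: power_int_add)
  qed
  also have "2*int j + k = int (nat (2*int j + k))" unfolding j_def by auto
  finally have e: "(of_nat p^j*m)^Suc 1 = of_nat p^nat (2*int j + k)*u"
   unfolding numeral_2_eq_2 power_int_of_nat by (simp only: One_nat_def)
  have "of_nat p^nat (2*int j + k)*u \<in> V" using u(1) by (simp add: ratu_def)
  then have "of_nat p^j*m \<in> V" unfolding e[symmetric] by (rule integral_closed[rotated]) simp
  then show ?thesis by (rule exI)
 qed
 then obtain j where j: "of_nat p^j*m \<in> V" by blast
 have "of_nat p^(j + l)*(m + z) = of_nat p^l*(of_nat p^j*m) + of_nat p^j*(of_nat p^l*z)"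
  by (simp add: power_add algebra_simps)
 then show ?case using j l by (intro exI[of _ "j + l"]) simp
qed

text \<open>A generator \<open>m\<close> with \<open>m^2 = p^k u\<close> lies, up to a power of
  \<open>p\<close>, in \<open>R\<close> if \<open>k\<close> is even and in \<open>\<pi> R\<close> if
  \<open>k\<close> is odd.\<close>

lemma decomp:
 assumes "z \<in> K"
 shows "\<exists>l. \<exists>\<alpha>\<in>R. \<exists>\<beta>\<in>R. of_nat p^l*z = \<alpha> + \<pi>*\<beta>"
 using quad_tower_span[OF tower assms]
proof induction
 case zero
 then show ?case by (intro exI[of _ 0] bexI[of _ 0]) auto
next
 case (add m z)
 then obtain l \<alpha> \<beta> where l: "\<alpha> \<in> R" "\<beta> \<in> R" "of_nat p^l*z = \<alpha> + \<pi>*\<beta>" by blast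
 have "\<exists>j. \<exists>\<alpha>\<in>R. \<exists>\<beta>\<in>R. of_nat p^j*m = \<alpha> + \<pi>*\<beta>"
 proof (cases "m = 0")
  case True
  then show ?thesis by (intro exI[of _ 0] bexI[of _ 0]) auto
 next
  case False
  then obtain k u where u: "u \<in> ratu" "m^2 = of_nat p powi k*u" using rat_repr[of "m^2"] add.hyps by auto
  define i where "i = k div 2"
  define j where "j = nat \<bar>i\<bar>"
  have ji: "(of_nat p :: complex)^j * of_nat p powi i = of_nat p^nat (int j + i)"
  proof -
   have "(of_nat p :: complex)^j * of_nat p powi i = of_nat p powi (int j + i)" using p_nz by (simp add: power_int_add)
   also have "int j + i = int (nat (int j + i))" unfolding j_def by auto
   finally show ?thesis by (simp only: power_int_of_nat)
  qed
  have mK: "m \<in> K" using add.hyps by blast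
  have P: "(of_nat p :: complex) powi i ~= 0" by (rule power_int_not_zero[OF disjI1[OF p_nz]])
  have cancel1: "P*P*u*(inverse P)^2 = u" if "P ~= 0" for P :: complex
   using that by (simp add: power2_eq_square divide_simps)
  have cancel3: "q*m = q*P*(m*inverse P)" if "P ~= 0" for q P :: complex
   using that by (simp add: divide_simps)
  have cancel4: "q*m = c*(q*P*(m*inverse P*inverse c))" if "P ~= 0" "c ~= 0" for q P c :: complex
   using that by (simp add: divide_simps)
  have cancel2: "P*P * c*u*inverse (P^2)*inverse c = u" if "P ~= 0" "c ~= 0" for P c :: complex
   using that by (simp add: power2_eq_square divide_simps)
  show ?thesis
  proof (cases "even k")
   case True
   define m0 where "m0 = m * of_nat p powi (- i)"
   have "k = i + i" using True by (simp add: i_def)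
   then have k: "m^2 = of_nat p powi i * of_nat p powi i*u" unfolding u(2) using p_nz by (simp only: power_int_add simp_thms of_nat_eq_0_iff)
   have "m0^2 = u" unfolding m0_def power_mult_distrib k power_int_minus by (rule cancel1[OF P])
   then have "m0 \<in> M0" using u(1) mK by (simp add: M0_def m0_def)
   moreover have "of_nat p^j*m = of_nat p^nat (int j + i)*m0"
    unfolding ji[symmetric] m0_def power_int_minus by (rule cancel3[OF P])
   ultimately have "of_nat p^j*m \<in> R" using N_I by (simp add: R_def add_span_incl)
   then show ?thesis by (intro exI[of _ j] bexI[of _ "of_nat p^j*m"] bexI[of _ 0]) auto
  next
   case False
   define m0 where "m0 = m * of_nat p powi (- i)*inverse \<pi>"
   have "k = i + i + 1" using False by (simp add: i_def odd_two_times_div_two_succ flip: mult_2)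
   then have k: "m^2 = of_nat p powi i * of_nat p powi i * of_nat p*u" unfolding u(2) using p_nz by (simp only: power_int_add power_int_1_right simp_thms of_nat_eq_0_iff)
   have "m0^2 = u" unfolding m0_def power_mult_distrib k power_inverse pi_sq power_int_minus by (rule cancel2[OF P p_nz])
   then have "m0 \<in> M0" using u(1) mK pi_K by (simp add: M0_def m0_def)
   moreover have "of_nat p^j*m = \<pi>*(of_nat p^nat (int j + i)*m0)"
    unfolding ji[symmetric] m0_def power_int_minus by (rule cancel4[OF P pi_nz])
   moreover have "of_nat p^nat (int j + i)*m0 \<in> R" using \<open>m0 \<in> M0\<close> N_I by (simp add: R_def add_span_incl)
   ultimately show ?thesis by (intro exI[of _ j] bexI[of _ 0] bexI[of _ "of_nat p^nat (int j + i)*m0"]) auto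
  qed
 qed
 then obtain j \<alpha>' \<beta>' where j: "\<alpha>' \<in> R" "\<beta>' \<in> R" "of_nat p^j*m = \<alpha>' + \<pi>*\<beta>'" by blast
 have "of_nat p^(j + l)*(m + z) = of_nat p^l*(of_nat p^j*m) + of_nat p^j*(of_nat p^l*z)"
  by (simp add: power_add algebra_simps)
 also have "\<dots> = (of_nat p^l*\<alpha>' + of_nat p^j*\<alpha>) + \<pi>*(of_nat p^l*\<beta>' + of_nat p^j*\<beta>)"
  unfolding l(3) j(3) by (simp add: algebra_simps)
 finally show ?case using l(1,2) j(1,2)
  by (intro exI[of _ "j + l"] bexI[of _ "of_nat p^l*\<alpha>' + of_nat p^j*\<alpha>"] bexI[of _ "of_nat p^l*\<beta>' + of_nat p^j*\<beta>"]) auto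
qed

text \<open>If \<open>r\<close> lies in the ideal, then \<open>r (r^(p^2 - 1) - 1) = p s\<close>
  with \<open>s\<close> in \<open>R\<close>, and the bracket is a unit; so \<open>r\<close> is
  traded for \<open>s\<close> at the cost of one factor \<open>p\<close>. The multiple
  \<open>p^k e\<close> of \<open>r\<close> bounds the number of rounds.\<close>

lemma unit_form_aux:
 "r \<in> R ==> w \<in> V ==> e \<in> V ==> e \<notin> \<mm> ==> r*w = of_nat p^k*e ==>
  \<exists>n. \<exists>a\<in>R - \<mm>. \<exists>b\<in>R - \<mm>. r * b = of_nat p^n * a"
proof (induction k arbitrary: r e)
 case 0
 then have "r*w \<notin> \<mm>" by simp
 then have "r \<notin> \<mm>" using max_mult 0 by blast
 then show ?case using 0 by (intro exI[of _ 0] bexI[of _ r] bexI[of _ 1]) auto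
next
 case (Suc k)
 show ?case
 proof (cases "r \<in> \<mm>")
  case False
  then show ?thesis using Suc.prems by (intro exI[of _ 0] bexI[of _ r] bexI[of _ 1]) auto
 next
  case True
  obtain s where s: "s \<in> R" "r^(p*p) = r + of_nat p * s" using frob_R[OF Suc.prems(1)] by blast
  obtain q where q: "p*p = Suc (Suc q)"
  proof -
   have "p*p \<ge> 2*2" by (rule mult_le_mono) (use prime_ge_2_nat[OF p(1)] in auto)
   then show ?thesis using that[of "p*p - 2"] by simp
  qed
  define d where "d = r^Suc q - 1"
  have dR: "d \<in> R" unfolding d_def using Suc.prems(1) by simp
  have rm: "r^Suc q \<in> \<mm>" using max_power_iff[of "Suc q" r] True R_V[OF Suc.prems(1)] by blast
  have dm: "d \<notin> \<mm>"
  proof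
   assume "d \<in> \<mm>"
   then have "r^Suc q - d \<in> \<mm>" using rm max_diff by blast
   then show False by (simp add: d_def)
  qed
  have rd: "r*d = of_nat p * s" using s(2) unfolding q d_def by (simp add: algebra_simps)
  have "of_nat p*(s*w) = of_nat p*(of_nat p^k*(e*d))"
  proof -
   have "of_nat p*(s*w) = (r*w)*d" using rd by (simp add: mult_ac)
   then show ?thesis using Suc.prems(5) by (simp add: mult_ac)
  qed
  then have sw: "s*w = of_nat p^k*(e*d)" using p_nz by simp
  have "e*d \<in> V" "e*d \<notin> \<mm>" using unit_mult[OF Suc.prems(3,4) R_V[OF dR] dm] Suc.prems(3) R_V[OF dR] by auto
  from Suc.IH[OF s(1) Suc.prems(2) this sw]
  obtain n a b where n: "a \<in> R - \<mm>" "b \<in> R - \<mm>" "s * b = of_nat p^n * a" by blast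
  have "r*(d * b) = of_nat p^Suc n * a"
   using n(3) rd by (metis (no_types, lifting) mult.assoc power_Suc)
  moreover have "d * b \<in> R - \<mm>" using n(2) dR dm unit_mult R_V by auto
  ultimately show ?thesis using n(1) by blast
 qed
qed

text \<open>A norm down to the rationals supplies a nonzero rational multiple of \<open>r\<close>;
  after clearing denominators this is the multiple \<open>p^k e\<close> from which the descent
  starts.\<close>

lemma unit_form:
 assumes "r \<in> R" "r ~= 0"
 shows "\<exists>n. \<exists>a\<in>R - \<mm>. \<exists>b\<in>R - \<mm>. r * b = of_nat p^n * a"
proof -
 obtain q where q: "q \<in> polys K" "[:r:]*q \<in> polys \<rat>" "[:r:]*q ~= 0"
  using quad_tower_norm[OF tower, of "[:r:]"] R_K[OF assms(1)] assms(2) by auto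
 then obtain i where i: "coeff ([:r:]*q) i ~= 0" by (metis leading_coeff_0_iff)
 define c where "c = coeff q i"
 have rc: "r * c \<in> \<rat>" "r * c ~= 0" "c \<in> K" using i polysD[OF q(2), of i] polysD[OF q(1)] by (auto simp: c_def)
 obtain k u where u: "u \<in> ratu" "r * c = of_nat p powi k*u" using rat_repr[OF rc(1,2)] by blast
 obtain l where l: "of_nat p^l * c \<in> V" using bounded_denominator[OF rc(3)] by blast
 define j where "j = nat \<bar>k\<bar>"
 have "r*(of_nat p^j*(of_nat p^l * c)) = of_nat p^(j + l)*(r * c)" by (simp add: power_add mult_ac)
 also have "\<dots> = of_nat p powi (int (j + l) + k)*u" unfolding u(2) power_int_of_nat[symmetric] using p_nz by (simp only: power_int_add mult.assoc of_nat_eq_0_iff simp_thms)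
 also have "int (j + l) + k = int (nat (int (j + l) + k))" unfolding j_def by auto
 finally have "r*(of_nat p^j*(of_nat p^l * c)) = of_nat p^nat (int (j + l) + k)*u" by (simp only: power_int_of_nat)
 then show ?thesis by (rule unit_form_aux[OF assms(1), rotated 3]) (use l u in \<open>auto simp: ratu_def\<close>)
qed

text \<open>Units congruent to a quotient of units of \<open>R\<close>; they inherit
  \<open>z^(p^2) = z\<close> in the residue field.\<close>

definition "good e \<longleftrightarrow> (\<exists>a\<in>R - \<mm>. \<exists>b\<in>R - \<mm>. \<exists>d\<in>\<mm>. e = a*inverse b + d)"

lemma goodI: "a \<in> R - \<mm> ==> b \<in> R - \<mm> ==> d \<in> \<mm> ==> good (a*inverse b + d)"
 unfolding good_def by blast

lemma good_frob:
 assumes "good e"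
 shows "e \<in> V" "e \<notin> \<mm>" "e^(p*p) - e \<in> \<mm>"
proof -
 obtain a b d where *: "a \<in> R" "a \<notin> \<mm>" "b \<in> R" "b \<notin> \<mm>" "d \<in> \<mm>" "e = a*inverse b + d"
  using assms unfolding good_def by blast
 have b: "inverse b \<in> V" "inverse b \<notin> \<mm>" using unit_inverse R_V * by auto
 have u: "a*inverse b \<in> V" "a*inverse b \<notin> \<mm>" using unit_mult b R_V * by auto
 show "e \<in> V" "e \<notin> \<mm>" unfolding *(6) using u unit_add_max *(5) max_sub by auto
 have cong: "x^n - y^n \<in> \<mm>" if "x - y \<in> \<mm>" "x \<in> V" "y \<in> V" for x y and n :: nat
 proof (induction n)
  case (Suc n)
  have "x^Suc n - y^Suc n = (x - y)*x^n + y*(x^n - y^n)" by (simp add: algebra_simps)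
  then show ?case using max_add[OF max_mult[OF that(1), of "x^n"] max_mult'[OF Suc, of y]] that by simp
 qed simp
 have fr: "r^(p*p) - r \<in> \<mm>" if r: "r \<in> R" for r
 proof -
  obtain s where "s \<in> R" "r^(p*p) = r + of_nat p * s" using frob_R[OF r] by blast
  then show ?thesis using max_mult[OF p_max R_V[of s]] by simp
 qed
 let ?n = "p*p"
 have bn: "b^?n \<in> V" "b^?n \<notin> \<mm>" using max_power_iff[of ?n b] R_V * prime_gt_0_nat[OF p(1)] by auto
 have bb: "b ~= 0" using *(4) by auto
 have "(a*inverse b)^?n - a*inverse b = inverse (b^?n)*(inverse b*((a^?n - a) * b - a*(b^?n - b)))"
  using bb by (simp add: power_mult_distrib power_inverse field_simps)
 moreover have "(a^?n - a) * b - a*(b^?n - b) \<in> \<mm>"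
  by (intro max_diff max_mult[OF fr] max_mult'[OF fr]) (use * R_V in auto)
 ultimately have 1: "(a*inverse b)^?n - a*inverse b \<in> \<mm>"
  using max_mult' b(1) unit_inverse[OF bn] by metis
 have 2: "e^?n - (a*inverse b)^?n \<in> \<mm>" by (rule cong) (use *(5,6) \<open>e \<in> V\<close> u in auto)
 have "e^?n - e = (e^?n - (a*inverse b)^?n) + ((a*inverse b)^?n - a*inverse b) - d"
  by (subst (2) *(6)) (simp only: diff_conv_add_uminus minus_add_distrib add.assoc add_minus_cancel minus_add_cancel)
 then show "e^?n - e \<in> \<mm>" using max_diff[OF max_add[OF 2 1] *(5)] by (simp only:)
qed

text \<open>In \<open>\<alpha> + \<pi> \<beta>\<close> the first term has even and the second odd
  order with respect to \<open>\<pi>\<close>, so when both are nonzero one of them dominates, and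
  its unit factor is a quotient of units of \<open>R\<close>.\<close>

lemma K_repr:
 assumes z: "z \<in> K" "z ~= 0"
 shows "\<exists>n::int. \<exists>e. good e \<and> z = \<pi> powi n*e"
proof -
 obtain l \<alpha> \<beta> where l: "\<alpha> \<in> R" "\<beta> \<in> R" "of_nat p^l*z = \<alpha> + \<pi>*\<beta>" using decomp[OF z(1)] by blast
 have pp: "(of_nat p :: complex)^i = \<pi> powi (2*int i)" for i
  unfolding pi_sq[symmetric] by (simp add: power_int_mult)
 have form: "\<exists>i a b. a \<in> R - \<mm> \<and> b \<in> R - \<mm> \<and> r = \<pi> powi (2*int i)*(a*inverse b)" if r: "r \<in> R" "r ~= 0" for r
 proof -
  obtain n a b where n: "a \<in> R - \<mm>" "b \<in> R - \<mm>" "r * b = of_nat p^n * a" using unit_form[OF r] by blast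
  have "b ~= 0" using n by auto
  then have "r = \<pi> powi (2*int n)*(a*inverse b)" using n(3) unfolding pp by (simp add: field_simps)
  then show ?thesis using n by blast
 qed
 have pm: "\<pi> powi n * v \<in> \<mm>" if "n > 0" "v \<in> V" for n v
 proof -
  have "\<pi> powi n = \<pi>^nat n" using that by (simp add: power_int_def)
  moreover have "\<pi>^nat n \<in> \<mm>" using max_power_iff[of "nat n" \<pi>] pi_max max_sub that by simp
  ultimately show ?thesis using max_mult that by simp
 qed
 have uV: "a*inverse b \<in> V" if "a \<in> R - \<mm>" "b \<in> R - \<mm>" for a b
  using that R_V unit_inverse[of b] by auto
 have g0: "good (a*inverse b)" if "a \<in> R - \<mm>" "b \<in> R - \<mm>" for a b
  using goodI[OF that, of 0] by simp
 have "\<exists>n e. good e \<and> of_nat p^l*z = \<pi> powi n*e"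
 proof (cases "\<alpha> = 0")
  case True
  then have "\<beta> ~= 0" using l(3) z(2) p_nz by auto
  then obtain i a b where ab: "a \<in> R - \<mm>" "b \<in> R - \<mm>" "\<beta> = \<pi> powi (2*int i)*(a*inverse b)" using form l(2) by blast
  have "of_nat p^l*z = \<pi> powi (1 + 2*int i)*(a*inverse b)"
   unfolding l(3) True ab(3) using pi_nz by (simp add: power_int_add)
  then show ?thesis using g0[OF ab(1,2)] by blast
 next
  case a0: False
  obtain i a b where ab: "a \<in> R - \<mm>" "b \<in> R - \<mm>" "\<alpha> = \<pi> powi (2*int i)*(a*inverse b)" using form[OF l(1) a0] by blast
  show ?thesis
  proof (cases "\<beta> = 0")
   case True
   then have "of_nat p^l*z = \<pi> powi (2*int i)*(a*inverse b)" using l(3) ab(3) by simp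
   then show ?thesis using g0[OF ab(1,2)] by blast
  next
   case False
   obtain j c d where cd: "c \<in> R - \<mm>" "d \<in> R - \<mm>" "\<beta> = \<pi> powi (2*int j)*(c*inverse d)" using form[OF l(2) False] by blast
   have pb: "\<pi>*\<beta> = \<pi> powi (1 + 2*int j)*(c*inverse d)"
    unfolding cd(3) using pi_nz by (simp add: power_int_add)
   have split: "\<pi> powi m = \<pi> powi n*\<pi> powi (m - n)" for m n
    by (subst power_int_add[symmetric]) (use pi_nz in auto)
   show ?thesis
   proof (cases "2*int i < 1 + 2*int j")
    case True
    have "of_nat p^l*z = \<pi> powi (2*int i)*(a*inverse b + \<pi> powi (1 + 2*int j - 2*int i)*(c*inverse d))"
     unfolding l(3) pb ab(3) split[of "1 + 2*int j" "2*int i"] by (simp only: algebra_simps)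
    moreover have "good (a*inverse b + \<pi> powi (1 + 2*int j - 2*int i)*(c*inverse d))"
     by (intro goodI ab pm uV cd) (use True in simp)
    ultimately show ?thesis by blast
   next
    case False
    then have lt: "2*int i - (1 + 2*int j) > 0" by presburger
    have "of_nat p^l*z = \<pi> powi (1 + 2*int j)*(c*inverse d + \<pi> powi (2*int i - (1 + 2*int j))*(a*inverse b))"
     unfolding l(3) pb ab(3) split[of "2*int i" "1 + 2*int j"] by (simp only: algebra_simps)
    moreover have "good (c*inverse d + \<pi> powi (2*int i - (1 + 2*int j))*(a*inverse b))"
     by (intro goodI ab pm uV cd lt)
    ultimately show ?thesis by blast
   qed
  qed
 qed
 then obtain n e where e: "good e" "of_nat p^l*z = \<pi> powi n*e" by blast
 have "z = inverse (of_nat p^l)*(of_nat p^l*z)" using p_nz by simp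
 also have "\<dots> = \<pi> powi (n - 2*int l)*e" unfolding e(2) unfolding pp using pi_nz by (simp add: power_int_diff field_simps)
 finally show ?thesis using e(1) by blast
qed

lemma K_val:
 assumes z: "z \<in> K" "z \<in> V"
 shows "z^(p*p) - z \<in> \<mm>" "z \<in> \<mm> ==> \<exists>w\<in>V. z^2 = of_nat p*w"
proof -
 have "z^(p*p) - z \<in> \<mm> \<and> (z \<in> \<mm> \<longrightarrow> (\<exists>w\<in>V. z^2 = of_nat p*w))"
 proof (cases "z = 0")
  case True
  have "p*p ~= 0" using prime_gt_0_nat[OF p(1)] by simp
  then have "(0 :: complex)^(p*p) = 0" unfolding power_0_left by (rule if_not_P)
  moreover have "(0 :: complex) \<in> V" "(0 :: complex) \<in> \<mm>" by (simp_all)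
  moreover have "\<exists>w\<in>V. (0 :: complex)^2 = of_nat p*w" by (rule bexI[of _ 0]) simp_all
  ultimately show ?thesis unfolding True by (simp only: diff_0_right simp_thms)
 next
  case False
  obtain n e where e: "good e" "z = \<pi> powi n*e" using K_repr[OF z(1) False] by blast
  note g = good_frob[OF e(1)]
  have n0: "n \<ge> 0"
  proof (rule ccontr)
   assume n: "\<not> n \<ge> 0"
   have "e = \<pi>^nat (- n)*z" unfolding e(2) using n pi_nz by (simp add: power_int_def power_inverse)
   moreover have "\<pi>^nat (- n) \<in> \<mm>" using max_power_iff[of "nat (- n)" \<pi>] pi_max max_sub n by simp
   ultimately show False using g(2) max_mult z(2) by metis
  qed
  show ?thesis
  proof (cases "n = 0")
   case True
   then show ?thesis using e g by simp
  next
   case False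
   then obtain k where k: "n = int (Suc k)" using n0 by (metis not0_implies_Suc nonneg_int_cases of_nat_0)
   have zk: "z = \<pi>*(\<pi>^k*e)" unfolding e(2) k power_int_of_nat by simp
   have pV: "\<pi>^k*e \<in> V" using pi_max max_sub g by simp
   have zm: "z \<in> \<mm>" unfolding zk by (rule max_mult[OF pi_max pV])
   have "z^(p*p) \<in> \<mm>" using max_power_iff[of "p*p" z] zm z(2) prime_gt_0_nat[OF p(1)] by simp
   moreover have "z^2 = of_nat p*(\<pi>^k*e)^2" unfolding zk power_mult_distrib[of \<pi>] pi_sq ..
   moreover have "(\<pi>^k*e)^2 \<in> V" using pV by simp
   ultimately show ?thesis using zm max_diff by blast
  qed
 qed
 then show "z^(p*p) - z \<in> \<mm>" "z \<in> \<mm> ==> \<exists>w\<in>V. z^2 = of_nat p*w" by blast+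
qed

end

text \<open>The last two properties are the bounds for residue degree and ramification index:
  residues satisfy \<open>z^(p^2) = z\<close>, and squares of elements of the ideal are divisible by
  \<open>p\<close>. Chevalley's theorem for the integers gives \<open>V\<close>, and the square root
  of \<open>p\<close> is adjoined to \<open>K\<close> only to reach the setting of
  \<open>p_val_tower\<close>.\<close>

theorem quad_tower_valuation:
 assumes "quad_tower K" "prime p" "odd p"
 obtains V where "valring UNIV V" "of_nat p \<in> mx V"
  "\<And>z. z \<in> K ==> z \<in> V ==> z^(p*p) - z \<in> mx V"
  "\<And>z. z \<in> K ==> z \<in> mx V ==> \<exists>w\<in>V. z^2 = of_nat p*w"
proof -
 have U: "csubfield (UNIV :: complex set)" by unfold_locales auto
 have Z: "csubring \<int>" by unfold_locales auto
 have span: "\<exists>c. z = of_nat p * of_int c" if "z \<in> ideal_span {of_nat p} \<int>" for z :: complex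
  using that
 proof induction
  case zero
  then show ?case by (intro exI[of _ 0]) simp
 next
  case (step s i r)
  then obtain c where c: "s = of_nat p * of_int c" by blast
  obtain d where d: "r = of_int d" using step.hyps by (auto elim: Ints_cases)
  have i: "i = of_nat p" using step.hyps by simp
  show ?case unfolding c d i by (intro exI[of _ "d + c"]) (simp add: algebra_simps)
 qed
 have "1 \<notin> ideal_span {of_nat p} \<int>"
 proof
  assume "1 \<in> ideal_span {of_nat p} \<int>"
  then obtain c where "(1 :: complex) = of_nat p * of_int c" using span by blast
  then have "(of_int 1 :: complex) = of_int (int p * c)" by simp
  then have "1 = int p * c" by (simp only: of_int_eq_iff)
  then have "int p dvd 1" by (rule dvdI)
  then show False using prime_gt_1_nat[OF assms(2)] by (simp only: zdvd1_eq)
 qed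
 then obtain V where V: "valring UNIV V" "{of_nat p} \<subseteq> mx V"
  using chevalley[OF U Z, of "{of_nat p}"] by auto
 interpret valring UNIV V by fact
 define \<pi> where "\<pi> = csqrt (of_nat p)"
 define K' where "K' = {u + v * \<pi> |u v. u \<in> K \<and> v \<in> K}"
 have pi2: "\<pi>^2 = of_nat p" unfolding \<pi>_def by (rule power2_csqrt)
 have KK: "K \<subseteq> K'" unfolding K'_def by (rule quad_ext_superset[OF quad_tower_csubfield[OF assms(1)]])
 interpret K: csubfield K by (rule quad_tower_csubfield[OF assms(1)])
 interpret p_val_tower V p K' \<pi>
 proof unfold_locales
  show "quad_tower K'" unfolding K'_def by (rule quad_tower_adjoin[OF assms(1)]) (simp add: pi2)
  show "\<pi> \<in> K'" unfolding K'_def by (intro CollectI exI[of _ 0] exI[of _ 1]) simp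
 qed (use assms V pi2 in auto)
 show ?thesis
  by (rule that[OF V(1)]) (use V(2) K_val KK max_sub in auto)
qed

section \<open>Torsion of the curve $y^2 = x^3 + 1$\<close>

abbreviation E36 :: "(complex \<times> complex) option monoid" where "E36 \<equiv> elliptic_curve 0 1"

abbreviation E36_pow (infixr \<open>\<star>\<close> 75) where "P \<star> n \<equiv> P [^]\<^bsub>E36\<^esub> (n::nat)"

interpretation E36: comm_group E36
 by (rule elliptic_curve_comm_group) simp

definition coord_pts :: "complex set \<Rightarrow> (complex \<times> complex) option set" where
 "coord_pts K = insert None {Some (s, t) |s t. s \<in> K \<and> t \<in> K}"

lemma coord_pts_simps [simp]: "None \<in> coord_pts K" "Some (s, t) \<in> coord_pts K \<longleftrightarrow> s \<in> K \<and> t \<in> K"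
 by (auto simp: coord_pts_def)

lemma ec_add_coord_pts:
 assumes "csubfield K" "a \<in> K" "P \<in> coord_pts K" "Q \<in> coord_pts K"
 shows "ec_add a P Q \<in> coord_pts K"
proof -
 interpret csubfield K by fact
 consider "P = None" | "Q = None" | s1 t1 s2 t2 where "P = Some (s1, t1)" "Q = Some (s2, t2)"
  by (metis not_None_eq surj_pair)
 then show ?thesis
 proof cases
  case 2
  then show ?thesis using assms by (cases P) auto
 next
  case 3
  then show ?thesis using assms by (simp add: Let_def)
 qed (use assms in auto)
qed

lemma E36_pow_coord_pts:
 assumes "csubfield K" "P \<in> coord_pts K"
 shows "P \<star> n \<in> coord_pts K"
proof -
 interpret csubfield K by fact
 show ?thesis by (induction n) (simp_all add: ec_add_coord_pts assms)
qed

lemma E36_inv: "t^2 = s^3 + 1 ==> inv\<^bsub>E36\<^esub> (Some (s, t)) = Some (s, - t)"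
 by (rule E36.inv_equality) simp_all

section \<open>The kernel of reduction and its formal group\<close>

locale formal_group = valring UNIV V for V :: "complex set"
begin

lemma x_V_iff: "y^2 = x^3 + 1 ==> x \<in> V \<longleftrightarrow> y \<in> V"
proof
 assume e: "y^2 = x^3 + 1"
 { assume "x \<in> V"
  then have "y^Suc 1 \<in> V" using e by (simp add: numeral_2_eq_2)
  then show "y \<in> V" by (rule integral_closed[rotated]) simp }
 { assume "y \<in> V"
  then have "y^2 - 1 \<in> V" by simp
  then have "x^Suc 2 \<in> V" using e by (simp add: numeral_3_eq_3 numeral_2_eq_2)
  then show "x \<in> V" by (rule integral_closed[rotated]) simp }
qed

definition "E1 = insert None {Some (x, y) |x y. y^2 = x^3 + 1 \<and> y \<notin> V}"

lemma E1_simps [simp]: "None \<in> E1" "Some (x, y) \<in> E1 \<longleftrightarrow> y^2 = x^3 + 1 \<and> y \<notin> V"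
 by (auto simp: E1_def)

lemma E1_carrier: "P \<in> E1 ==> P \<in> carrier E36"
 by (cases P) auto

definition zc :: "(complex \<times> complex) option \<Rightarrow> complex" where
 "zc P = (case P of None \<Rightarrow> 0 | Some (x, y) \<Rightarrow> x / y)"

lemma zc_simps [simp]: "zc None = 0" "zc (Some (x, y)) = x / y"
 by (simp_all add: zc_def)

lemma E1_params:
 assumes "y^2 = x^3 + 1" "y \<notin> V"
 shows "y ~= 0" "x ~= 0" "inverse y \<in> \<mm>" "x / y \<in> \<mm>"
  "inverse y = (x / y)^3 + (inverse y)^3"
proof -
 show y: "y ~= 0" using assms by auto
 show x: "x ~= 0" using assms(2) x_V_iff[OF assms(1)] by auto
 show w: "inverse y \<in> \<mm>" using max_inverse assms by blast
 have "inverse y = y^2*(inverse y)^3" using y by (simp add: power2_eq_square power3_eq_cube divide_simps)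
 also have "\<dots> = (x / y)^3 + (inverse y)^3" unfolding assms(1)
  by (simp add: algebra_simps divide_inverse power_mult_distrib)
 finally show e: "inverse y = (x / y)^3 + (inverse y)^3" .
 have "(x / y)^3 = inverse y - (inverse y)^3" using e by (simp add: algebra_simps)
 moreover have "inverse y - (inverse y)^3 \<in> \<mm>"
  using max_diff[OF w, of "(inverse y)^3"] max_power_iff[of 3 "inverse y"] w max_sub by simp
 ultimately have m: "(x / y)^3 \<in> \<mm>" by simp
 then have "(x / y)^Suc 2 \<in> V" using max_sub by (simp add: numeral_3_eq_3 numeral_2_eq_2)
 then have "x / y \<in> V" by (rule integral_closed[rotated]) simp
 then show "x / y \<in> \<mm>" using m max_power_iff[of 3 "x / y"] by simp
qed

lemma one_minus_unit: "d \<in> \<mm> ==> 1 - d ~= 0 \<and> inverse (1 - d) \<in> V"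
proof -
 assume d: "d \<in> \<mm>"
 have "1 - d \<notin> \<mm>" using max_add[of "1 - d" d] d by auto
 moreover have "1 - d \<in> V" using max_sub[OF d] by simp
 ultimately show ?thesis using unit_or_max by blast
qed

text \<open>
 In the coordinates \<open>z = x / y\<close>, \<open>w = 1 / y\<close> the curve is \<open>w = z\<^sup>3 + w\<^sup>3\<close> and the chord is
 \<open>w = \<mu> z + \<nu>\<close> with \<open>\<mu> = - l / c\<close>, \<open>\<nu> = 1 / c\<close>.
\<close>

lemma formal_add:
 assumes e1: "y1^2 = x1^3 + 1" and e2: "y2^2 = x2^3 + 1" and nV: "y1 \<notin> V" "y2 \<notin> V"
  and ne: "\<not> (x1 = x2 \<and> y1 = - y2)" and sum: "ec_add 0 (Some (x1, y1)) (Some (x2, y2)) = Some (X', Y')"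
  and a: "a \<in> V" and u: "u1 \<in> V" "u2 \<in> V" "x1 / y1 = a*u1" "x2 / y2 = a*u2"
 shows "Y' \<notin> V" "\<exists>v\<in>V. X' / Y' = x1 / y1 + x2 / y2 + a^7 * v"
proof -
 define l where "l = (if x1 = x2 then (3*x1\<^sup>2 + 0) / (2*y1) else (y2 - y1) / (x2 - x1))"
 define c where "c = y1 - l*x1"
 define x3 where "x3 = l^2 - x1 - x2"
 define y3 where "y3 = l*x3 + c"
 have e1': "y1^2 = x1^3 + 0*x1 + 1" and e2': "y2^2 = x2^3 + 0*x2 + 1" using e1 e2 by simp_all
 note cv = chord_vieta[OF e1' e2' ne l_def c_def x3_def]
 have X': "X' = x3" and Y': "Y' = - y3"
  using sum ne unfolding ec_add.simps Let_def l_def[symmetric] x3_def[symmetric]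
  by (auto simp: y3_def c_def algebra_simps)
 have y1: "y1 = l*x1 + c" by (simp add: c_def)
 have y2: "y2 = l*x2 + c" by (rule cv(1))
 have s1: "l^2 = x1 + x2 + x3" by (simp add: x3_def)
 have s2: "x1*x2 + x1*x3 + x2*x3 = - 2*l * c" using cv(2) by simp
 have s3: "x1*x2*x3 = c^2 - 1" using cv(3) by simp
 note p1 = E1_params[OF e1 nV(1)] and p2 = E1_params[OF e2 nV(2)]
 define z1 z2 w1 w2 where zw: "z1 = x1 / y1" "z2 = x2 / y2" "w1 = inverse y1" "w2 = inverse y2"
 have zV: "z1 \<in> V" "z2 \<in> V" "w1 \<in> V" "w2 \<in> V" using p1 p2 zw max_sub by auto
 \<comment> \<open>For a line through the origin Vieta's relations give
   \<open>(x1 x2)^2 = x1 + x2\<close>. Divided by the left side, this writes 1 in terms of the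
   inverses of \<open>x1\<close> and \<open>x2\<close>, which lie in the ideal.\<close>
 have c0: "c ~= 0"
 proof
  assume c: "c = 0"
  have "(x1*x2)^2 = x1 + x2"
  proof -
   have e: "x1*x2 = - (x1 + x2)*x3" using s2 c by (simp add: algebra_simps eq_neg_iff_add_eq_0)
   have "(x1*x2)^2 = x1*x2*(x1*x2)" by (simp add: power2_eq_square)
   also have "\<dots> = x1*x2*(- (x1 + x2)*x3)" by (simp only: e[symmetric])
   also have "\<dots> = - (x1 + x2)*(x1*x2*x3)" by simp
   also have "\<dots> = x1 + x2" unfolding s3 c by simp
   finally show ?thesis .
  qed
  moreover have "(x1 + x2)*inverse ((x1*x2)^2) = inverse x1*(inverse x2)^2 + (inverse x1)^2*inverse x2"
   using p1(2) p2(2) by (simp add: field_simps power2_eq_square)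
  moreover have "(x1*x2)^2*inverse ((x1*x2)^2) = 1" using p1(2) p2(2) by simp
  ultimately have "1 = inverse x1*(inverse x2)^2 + (inverse x1)^2*inverse x2" by simp
  moreover have "x1 \<notin> V" "x2 \<notin> V" using x_V_iff e1 e2 nV by auto
  then have i: "inverse x1 \<in> \<mm>" "inverse x2 \<in> \<mm>" using max_inverse by auto
  then have "inverse x1*(inverse x2)^2 + (inverse x1)^2*inverse x2 \<in> \<mm>"
   using max_sub by (intro max_add max_mult i max_mult') auto
  ultimately show False using max_1 by metis
 qed
 define \<mu> \<nu> where ln: "\<mu> = - l / c" "\<nu> = inverse c"
 have line: "inverse y = \<mu>*(x / y) + \<nu>" if "y = l*x + c" "y ~= 0" for x y
 proof -
  have "c = y - l*x" using that by simp
  then have "c*inverse y = 1 - l*(x / y)" using that(2) by (simp add: field_simps)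
  then show ?thesis using c0 unfolding ln by (simp add: field_simps)
 qed
 have l1: "w1 = \<mu>*z1 + \<nu>" and l2: "w2 = \<mu>*z2 + \<nu>" using line[OF y1 p1(1)] line[OF y2 p2(1)] zw by auto
 have k1: "w1 = z1^3 + w1^3" and k2: "w2 = z2^3 + w2^3" using p1(5) p2(5) zw by auto
 define Sw Sz where S: "Sw = w1^2 + w1*w2 + w2^2" "Sz = z1^2 + z1*z2 + z2^2"
 \<comment> \<open>Subtracting the two equations \<open>w = z^3 + w^3\<close> expresses the slope
   with the unit \<open>1 - Sw\<close> as denominator; in the tangent case this is implicit
   differentiation.\<close>
 have lS: "\<mu>*(1 - Sw) = Sz"
 proof (cases "x1 = x2")
  case True
  then have "y1 = y2 \<or> y1 = - y2" using e1 e2 by (simp add: power2_eq_iff[symmetric])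
  then have yy: "y1 = y2" using ne True by simp
  have l: "l*(2*y1) = 3*x1^2" using p1(1) True by (simp add: l_def)
  have "3*x1^3 - y1^2 + 3 = 2*y1^2" unfolding e1 by simp
  then have "l*(3*x1^3 - y1^2 + 3) = l*(2*y1)*y1" by (simp add: power2_eq_square)
  also have "\<dots> = 3*x1^2*y1" unfolding l ..
  finally have "- l*(y1^2 - 3) = 3*x1^2 * c"
   unfolding c_def by (simp add: cube_simps)
  then have "- l*(1 - 3*w1^2)*y1^2 = 3*(z1^2) * c*y1^2"
   using p1(1) by (simp add: zw field_simps power2_eq_square)
  then have "- l*(1 - 3*w1^2) = 3*z1^2 * c"
   by (rule mult_right_cancel[THEN iffD1, rotated]) (use p1(1) in simp)
  moreover have "Sw = 3*w1^2" "Sz = 3*z1^2" using True yy by (simp_all add: S zw power2_eq_square)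
  ultimately show ?thesis using c0 by (simp add: ln field_simps)
 next
  case False
  have zz: "z1 ~= z2"
  proof
   assume zz: "z1 = z2"
   then have "w1 = w2" using l1 l2 by simp
   then have "y1 = y2" by (simp add: zw)
   then show False using zz False p1(1) by (simp add: zw)
  qed
  have "(w2 - w1)*(1 - Sw) = (w2 - w2^3) - (w1 - w1^3)"
   by (simp add: S cube_simps)
  also have "w2 - w2^3 = z2^3" using k2 by (simp add: algebra_simps)
  also have "w1 - w1^3 = z1^3" using k1 by (simp add: algebra_simps)
  also have "z2^3 - z1^3 = (z2 - z1)*Sz" by (simp add: S cube_simps)
  also have "w2 - w1 = (z2 - z1)*\<mu>" unfolding l1 l2 by (simp add: algebra_simps)
  finally show ?thesis using zz by simp
 qed
 have Sm: "Sw \<in> \<mm>" unfolding S power2_eq_square using p1 p2 zV by (intro max_add max_mult) (simp_all add: zw)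
 note Su = one_minus_unit[OF Sm]
 have lam: "\<mu> = Sz*inverse (1 - Sw)" using lS Su by (simp add: field_simps)
 have Szm: "Sz \<in> \<mm>" unfolding S power2_eq_square using p1 p2 zV by (intro max_add max_mult) (simp_all add: zw)
 have lm: "\<mu> \<in> \<mm>" unfolding lam using Szm Su by (intro max_mult) auto
 have nu: "\<nu> = w1 - \<mu>*z1" using l1 by simp
 have nm: "\<nu> \<in> \<mm>" unfolding nu using p1(3) lm zV by (intro max_diff max_mult) (simp_all add: zw)
 define L where "L = (u1^2 + u1*u2 + u2^2)*inverse (1 - Sw)"
 have LV: "L \<in> V" unfolding L_def using u Su by simp
 have lL: "\<mu> = a^2*L"
  unfolding lam L_def S zw u(3,4) by (simp add: power_mult_distrib square_simps)
 have w12: "w1^2 \<in> \<mm>" using max_power_iff[of 2 w1] p1(3) zV by (simp add: zw)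
 note W1u = one_minus_unit[OF w12]
 define N where "N = u1^3*inverse (1 - w1^2) - L*u1"
 have NV: "N \<in> V" unfolding N_def using u W1u LV by simp
 have "w1*(1 - w1^2) = z1^3" using k1 by (simp add: cube_simps)
 then have "w1 = z1^3*inverse (1 - w1^2)" using W1u by (simp add: field_simps)
 then have nN: "\<nu> = a^3*N"
  unfolding nu lL N_def zw(1) u(3) by (simp add: power_mult_distrib cube_simps)
 \<comment> \<open>Substituting the line into \<open>w = z^3 + w^3\<close> gives a cubic in
   \<open>z\<close> with leading coefficient \<open>1 + \<mu>^3\<close> and quadratic coefficient
   \<open>3 \<mu>^2 \<nu>\<close>, so the three parameters add up to
   \<open>- 3 \<mu>^2 \<nu> / D\<close>. As \<open>\<mu> = a^2 L\<close> and
   \<open>\<nu> = a^3 N\<close>, this contains \<open>a^7\<close>.\<close>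
 define D where "D = 1 + \<mu>^3"
 have "- (\<mu>^3) \<in> \<mm>" using max_uminus max_power_iff[of 3 \<mu>] lm max_sub by simp
 then have Du: "D ~= 0" "inverse D \<in> V" using one_minus_unit[of "- (\<mu>^3)"] by (auto simp: D_def)
 have Dc: "c^3*D = c^3 - l^3" unfolding D_def ln using c0 by (simp add: field_simps power_divide)
 have pr: "y1*y2*y3 = c^3 - l^3"
 proof -
  have "y1*y2*y3 = l^3*(x1*x2*x3) + l^2 * c*(x1*x2 + x1*x3 + x2*x3)
    + l * c^2*(x1 + x2 + x3) + c^3"
   unfolding y1 y2 y3_def by (simp add: cube_simps)
  also have "\<dots> = c^3 - l^3" unfolding s1[symmetric] s2 s3 by (simp add: cube_simps)
  finally show ?thesis .
 qed
 have y3: "y3 ~= 0" using pr Dc Du c0 by auto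
 have num: "x1*y2*y3 + x2*y1*y3 + x3*y1*y2 = - 3*l^2"
 proof -
  have "x1*y2*y3 + x2*y1*y3 + x3*y1*y2 = 3*l^2*(x1*x2*x3)
    + 2*l * c*(x1*x2 + x1*x3 + x2*x3) + c^2*(x1 + x2 + x3)"
   unfolding y1 y2 y3_def by (simp add: square_simps)
  also have "\<dots> = - 3*l^2" unfolding s1[symmetric] s2 s3 by (simp add: square_simps)
  finally show ?thesis .
 qed
 have "(z1 + z2 + x3 / y3)*(y1*y2*y3) = x1*y2*y3 + x2*y1*y3 + x3*y1*y2"
  using p1(1) p2(1) y3 by (simp add: zw algebra_simps)
 also have "\<dots> = - 3*l^2" by (rule num)
 finally have "(z1 + z2 + x3 / y3)*(c^3*D) = - 3*l^2" unfolding pr Dc .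
 then have "(z1 + z2 + x3 / y3)*D = - 3*(l^2 / c^3)" using c0 by (simp add: field_simps)
 also have "l^2 / c^3 = \<mu>^2*\<nu>" using c0 by (simp add: ln field_simps power2_eq_square power3_eq_cube)
 finally have "z1 + z2 + x3 / y3 = - 3*\<mu>^2*\<nu>*inverse D" using Du by (simp add: field_simps)
 moreover have "x3 / y3 = (z1 + z2 + x3 / y3) - z1 - z2" by simp
 ultimately have z3: "x3 / y3 = - z1 - z2 - 3*\<mu>^2*\<nu>*inverse D" by simp
 have "x3 / y3 \<in> V" unfolding z3 using zV max_sub[OF lm] max_sub[OF nm] Du by simp
 then have "\<mu>*(x3 / y3) + \<nu> \<in> \<mm>" using lm nm by (intro max_add max_mult) auto
 then have w3: "inverse y3 \<in> \<mm>" using line[OF y3_def y3] by simp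
 show "Y' \<notin> V"
 proof
  assume "Y' \<in> V"
  then have "- Y' \<in> V" by simp
  then have "inverse y3*y3 \<in> \<mm>" using max_mult[OF w3, of y3] Y' by simp
  then show False using y3 by simp
 qed
 have "X' / Y' = z1 + z2 + a^7*(3*L^2*N*inverse D)"
 proof -
  have "X' / Y' = - (x3 / y3)" by (simp add: X' Y')
  also have "\<dots> = z1 + z2 + 3*\<mu>^2*\<nu>*inverse D" unfolding z3 by simp
  also have "\<mu>^2*\<nu> = a^7*(L^2*N)"
   unfolding lL nN by (simp add: power_mult_distrib power_mult[symmetric] mult_ac flip: power_add)
  then have "3*\<mu>^2*\<nu>*inverse D = a^7*(3*L^2*N*inverse D)" by (simp add: mult_ac)
  finally show ?thesis .
 qed
 then show "\<exists>v\<in>V. X' / Y' = x1 / y1 + x2 / y2 + a^7 * v"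
  using LV NV Du by (intro bexI[of _ "3*L^2*N*inverse D"]) (simp_all add: zw)
qed

lemma E1_add:
 assumes "P \<in> E1" "Q \<in> E1" and a: "a \<in> V" "u1 \<in> V" "u2 \<in> V" "zc P = a*u1" "zc Q = a*u2"
 shows "ec_add 0 P Q \<in> E1" "\<exists>v\<in>V. zc (ec_add 0 P Q) = zc P + zc Q + a^7 * v"
proof -
 have "ec_add 0 P Q \<in> E1 \<and> (\<exists>v\<in>V. zc (ec_add 0 P Q) = zc P + zc Q + a^7 * v)"
 proof (cases "P = None \<or> Q = None")
  case True
  then have "ec_add 0 P Q = (if P = None then Q else P)" by (cases P; cases Q) auto
  then show ?thesis using assms True by (auto intro!: bexI[of _ 0])
 next
  case False
  then obtain x1 y1 x2 y2 where PQ: "P = Some (x1, y1)" "Q = Some (x2, y2)" by auto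
  have e: "y1^2 = x1^3 + 1" "y2^2 = x2^3 + 1" "y1 \<notin> V" "y2 \<notin> V" using assms(1,2) PQ by auto
  show ?thesis
  proof (cases "x1 = x2 \<and> y1 = - y2")
   case True
   then show ?thesis using PQ by (auto intro!: bexI[of _ 0])
  next
   case False
   obtain X' Y' where s: "ec_add 0 (Some (x1, y1)) (Some (x2, y2)) = Some (X', Y')"
    using False by (auto simp: Let_def)
   have "Some (X', Y') \<in> carrier E36"
    using E36.m_closed[of P Q] assms(1,2) E1_carrier PQ s by simp
   then have "Y'^2 = X'^3 + 1" by simp
   then show ?thesis using formal_add[OF e False s a(1-3)] a(4,5) s PQ by simp
  qed
 qed
 then show "ec_add 0 P Q \<in> E1" "\<exists>v\<in>V. zc (ec_add 0 P Q) = zc P + zc Q + a^7 * v" by auto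
qed

lemma zc_max: "P \<in> E1 ==> zc P \<in> \<mm>"
 by (cases P) (auto intro: E1_params(4))

lemma zc_eq_0: "P \<in> E1 ==> zc P = 0 \<longleftrightarrow> P = None"
proof (cases P)
 case (Some p)
 assume "P \<in> E1"
 then show ?thesis using Some E1_params(1,2)[of "snd p" "fst p"] by (cases p) auto
qed simp

text \<open>The error terms of the successive additions are all multiples of the seventh power of
  the parameter, so they accumulate in \<open>v\<close>.\<close>

lemma E1_pow:
 assumes P: "P \<in> E1"
 shows "P \<star> n \<in> E1 \<and> (\<exists>v\<in>V. zc (P \<star> n) = of_nat n*zc P + zc P^7 * v)"
proof (induction n)
 case 0
 then show ?case by (auto intro!: bexI[of _ 0])
next
 case (Suc n)
 then obtain v where v: "v \<in> V" "zc (P \<star> n) = of_nat n*zc P + zc P^7 * v" and n: "P \<star> n \<in> E1" by blast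
 have z: "zc P \<in> V" by (rule max_sub[OF zc_max[OF P]])
 have "zc P^7 = zc P*zc P^6" by (simp add: power_Suc[symmetric])
 then have "zc (P \<star> n) = zc P*(of_nat n + zc P^6 * v)" unfolding v(2) by (simp add: algebra_simps)
 note add = E1_add[OF n P z _ _ this, of 1]
 have "of_nat n + zc P^6 * v \<in> V" using z v by simp
 then have a: "ec_add 0 (P \<star> n) P \<in> E1"
  "\<exists>v\<in>V. zc (ec_add 0 (P \<star> n) P) = zc (P \<star> n) + zc P + zc P^7 * v"
  using add by auto
 then obtain v' where v': "v' \<in> V" "zc (ec_add 0 (P \<star> n) P) = zc (P \<star> n) + zc P + zc P^7 * v'" by blast
 have "zc (P \<star> Suc n) = of_nat (Suc n)*zc P + zc P^7*(v + v')"
  using v' v(2) by (simp add: algebra_simps)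
 then show ?case using a(1) v(1) v'(1) by (intro conjI bexI[of _ "v + v'"]) simp_all
qed

end

section \<open>Reduction at 5\<close>

locale E36_reduction = p_val V 5 for V +
 fixes K :: "complex set"
 assumes K: "csubfield K"
  and frob: "\<And>z. z \<in> K ==> z \<in> V ==> z^25 - z \<in> \<mm>"
  and ram: "\<And>z. z \<in> K ==> z \<in> \<mm> ==> \<exists>w\<in>V. z^2 = 5*w"
begin

sublocale formal_group V ..

sublocale K: csubfield K by (rule K)

lemma five_max: "5 \<in> \<mm>"
 using p_max by simp

lemma num_units: "2 \<notin> \<mm>" "3 \<notin> \<mm>" "4 \<notin> \<mm>"
 using int_unit[of 2] int_unit[of 3] int_unit[of 4] by simp_all

text \<open>If \<open>m\<close> kills \<open>P\<close>, dividing \<open>m z + z^7 v = 0\<close> by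
  \<open>z\<close> and using that 5 divides \<open>z^2\<close> puts \<open>m\<close> into
  \<open>25 V\<close>. So \<open>m\<close> is neither prime to 5 nor equal to 5: a factor 5 of
  \<open>n\<close> can be moved into the point, which stays nonzero, and induction applies.\<close>

lemma E1_torsion_free:
 "P \<in> E1 ==> P \<in> coord_pts K ==> P ~= None ==> n > 0 ==> P \<star> n ~= None"
proof (induction n arbitrary: P rule: less_induct)
 case (less n)
 define z where "z = zc P"
 have z0: "z ~= 0" and zm: "z \<in> \<mm>" using zc_eq_0 zc_max less.prems by (auto simp: z_def)
 have zK: "z \<in> K" using less.prems(2) by (cases P) (auto simp: z_def)
 obtain w where w: "w \<in> V" "z^2 = 5*w" using ram[OF zK zm] by blast
 have z6: "z^6 = 5^3*w^3"
  using w(2) power_mult[of z 2 3] by (simp add: power_mult_distrib)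
 have *: "\<exists>v\<in>V. of_nat m = 5*(5 * v)" if "P \<star> m = None" for m
 proof -
  obtain v where v: "v \<in> V" "zc (P \<star> m) = of_nat m*z + z^7 * v"
   using E1_pow[OF less.prems(1), of m] unfolding z_def by blast
  have v2: "of_nat m*z + z^7 * v = 0" using v(2) that by simp
  have "z*(of_nat m + z^6 * v) = of_nat m*z + z^7 * v" by (simp add: algebra_simps eval_nat_numeral)
  then have "of_nat m + z^6 * v = 0" using v2 z0 by simp
  then have "of_nat m = 5*(5*(- 5*w^3 * v))" unfolding z6 by (simp add: eq_neg_iff_add_eq_0 mult.assoc)
  moreover have "- 5*w^3 * v \<in> V" using v(1) w(1) by simp
  ultimately show ?thesis by (rule bexI)
 qed
 show ?case
 proof (cases "5 dvd n")
  case False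
  show ?thesis
  proof
   assume "P \<star> n = None"
   then obtain v where "v \<in> V" "of_nat n = 5*(5 * v)" using * by blast
   then have "of_nat n \<in> \<mm>" using max_mult[OF five_max, of "5 * v"] by simp
   moreover have "\<not> int 5 dvd int n" using False by presburger
   then have "of_int (int n) \<notin> \<mm>" using int_unit by blast
   ultimately show False by simp
  qed
 next
  case True
  then obtain m where m: "n = 5*m" by blast
  define P' where "P' = P \<star> 5"
  have "P' ~= None"
  proof
   assume "P' = None"
   then obtain v where v: "v \<in> V" "of_nat 5 = 5*(5 * v)" using *[of 5] by (auto simp: P'_def)
   then have "5 * v = 1" by simp
   then show False using max_mult[OF five_max v(1)] by simp
  qed
  moreover have "P' \<in> E1" "P' \<in> coord_pts K"
   using E1_pow[OF less.prems(1)] E36_pow_coord_pts[OF K less.prems(2)] by (auto simp: P'_def)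
  ultimately have "P' \<star> m ~= None" using less.IH[of m P'] less.prems(4) m by simp
  then show ?thesis unfolding P'_def m
   by (subst E36.nat_pow_pow[symmetric]) (use E1_carrier less.prems(1) in auto)
 qed
qed

lemma frob_unit: "z \<in> K ==> z \<in> V ==> z \<notin> \<mm> ==> z^24 - 1 \<in> \<mm>"
proof -
 assume z: "z \<in> K" "z \<in> V" "z \<notin> \<mm>"
 have "z*(z^24 - 1) = z^25 - z" by (simp add: algebra_simps eval_nat_numeral)
 then show ?thesis using max_prime[of z "z^24 - 1"] frob[OF z(1,2)] z by simp
qed

text \<open>With \<open>t = x^3\<close> and \<open>t + 1 = y^2\<close> the hypotheses are
  \<open>x^24 = 1\<close> and \<open>y^24 = 1\<close> in the residue field. Modulo 5 they generate
  an ideal that contains the stated product, whose vanishing makes the double of the point a point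
  killed by 3.\<close>

lemma reduction_certificate:
 assumes t: "t \<in> V" and 1: "t^8 - 1 \<in> \<mm>" and 2: "(t + 1)^12 - 1 \<in> \<mm>"
 shows "(t + 2)*(t^4 + 2*t^3 + t + 1) \<in> \<mm>"
proof -
 define q where "q = (t^5 + 1)^2*(t + 1)^2 - 1"
 define r where "r = t^4 + 2*t^3 + 2*t^2 + t"
 have r5: "(t + 1)^5 = t^5 + 1 + 5*r" by (simp add: r_def algebra_simps eval_nat_numeral)
 have "(t + 1)^12 = ((t + 1)^5)^2*(t + 1)^2" by (simp add: power_mult[symmetric] power_add[symmetric])
 also have "\<dots> = (t^5 + 1)^2*(t + 1)^2 + 5*((2*(t^5 + 1)*r + 5*r^2)*(t + 1)^2)"
  unfolding r5 by (simp add: square_simps)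
 finally have "q = ((t + 1)^12 - 1) - 5*((2*(t^5 + 1)*r + 5*r^2)*(t + 1)^2)" by (simp add: q_def)
 moreover have "r \<in> V" using t by (simp add: r_def)
 ultimately have q: "q \<in> \<mm>" using 2 t by (auto intro!: max_diff max_mult[OF five_max])
 \<comment> \<open>Cofactors of the ideal membership modulo 5, lifted to the integers; the third
   summand corrects by a multiple of 5.\<close>
 have "(t^8 - 1)*(3 + 2*t - 3*t^3 - 10*t^4 - 11*t^5 - 4*t^6) + q*(3*t + 4*t^2) + 5*(1 + t - t^2 - 2*t^3 - 2*t^4 - 2*t^5 - 2*t^6 - 4*t^7 - 5*t^8 - 2*t^9) = (t + 2)*(t^4 + 2*t^3 + t + 1)"
  unfolding q_def by (simp add: algebra_simps eval_nat_numeral)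
 moreover have "(t^8 - 1)*(3 + 2*t - 3*t^3 - 10*t^4 - 11*t^5 - 4*t^6) + q*(3*t + 4*t^2) + 5*(1 + t - t^2 - 2*t^3 - 2*t^4 - 2*t^5 - 2*t^6 - 4*t^7 - 5*t^8 - 2*t^9) \<in> \<mm>"
  using 1 q t by (intro max_add max_mult five_max) simp_all
 ultimately show ?thesis by simp
qed

text \<open>\<open>3 X (X^3 + 4)\<close> is the 3-division polynomial, so the conclusion says that
  the double reduces to a point killed by 3. For \<open>X = x (t - 8) / (4 (t + 1))\<close> it is,
  up to a unit, \<open>x\<close> times the polynomial of \<open>reduction_certificate\<close> modulo
  5.\<close>

lemma X_mod:
 assumes xy: "x \<in> K" "y \<in> K" "y^2 = x^3 + 1" "x \<in> V" "y \<notin> \<mm>"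
  and X: "X' \<in> V" "X'*(4*y^2) = x*(x^3 - 8)"
 shows "X'*(X'^3 + 4) \<in> \<mm>"
proof -
 have yV: "y \<in> V" using x_V_iff[OF xy(3)] xy(4) by simp
 define t where "t = x^3"
 have tV: "t \<in> V" using xy by (simp add: t_def)
 have t1: "t + 1 = y^2" using xy(3) by (simp add: t_def)
 have goal: ?thesis if A: "x*((t - 8)*((t*(t - 8)^3) + 256*(t + 1)^3)) \<in> \<mm>"
 proof -
  have "(X'*(4*y^2))*((X'*(4*y^2))^3 + 4*(4*y^2)^3) =
    x*((t - 8)*((t*(t - 8)^3) + 256*(t + 1)^3))"
   unfolding X(2) unfolding t1[symmetric] power_mult_distrib t_def[symmetric] by simp
  moreover have "(X'*(4*y^2))*((X'*(4*y^2))^3 + 4*(4*y^2)^3) = X'*(X'^3 + 4)*(4*y^2)^4"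
   by (simp add: algebra_simps eval_nat_numeral)
  ultimately have m: "X'*(X'^3 + 4)*(4*y^2)^4 \<in> \<mm>" using A by simp
  have "y^2 \<notin> \<mm>" using max_power_iff[of 2 y] xy yV by simp
  then have "4*y^2 \<notin> \<mm>" using unit_mult[of 4 "y^2"] num_units yV by simp
  then have "(4*y^2)^4 \<notin> \<mm>" using max_power_iff[of 4 "4*y^2"] yV by simp
  then show ?thesis using max_prime[OF m] X(1) yV by simp
 qed
 show ?thesis
 proof (cases "x \<in> \<mm>")
  case True
  show ?thesis by (rule goal, rule max_mult[OF True]) (use tV in simp)
 next
  case False
  have "t^8 - 1 \<in> \<mm>" using frob_unit[OF xy(1,4) False] by (simp add: t_def power_mult[symmetric])
  moreover have "(t + 1)^12 - 1 \<in> \<mm>" using frob_unit[OF xy(2) yV xy(5)] by (simp add: t1 power_mult[symmetric])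
  ultimately have m: "(t + 2)*(t^4 + 2*t^3 + t + 1) \<in> \<mm>" by (rule reduction_certificate[OF tV])
  have "(t - 8)*(t*(t - 8)^3 + 256*(t + 1)^3) =
    (t + 2)*(t^4 + 2*t^3 + t + 1) + 5*(- 410 - 359*t - 1485*t^2 - 180*t^3 + 44*t^4)"
   by (simp add: algebra_simps eval_nat_numeral)
  moreover have "(t + 2)*(t^4 + 2*t^3 + t + 1) + 5*(- 410 - 359*t - 1485*t^2 - 180*t^3 + 44*t^4) \<in> \<mm>"
   using m tV by (intro max_add max_mult[OF five_max]) simp_all
  ultimately have "(t - 8)*(t*(t - 8)^3 + 256*(t + 1)^3) \<in> \<mm>" by simp
  then show ?thesis by (rule goal[OF max_mult'[OF _ xy(4)]])
 qed
qed

lemma E1_pow_E1: "P \<in> E1 ==> P \<star> n \<in> E1"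
 using E1_pow by blast

text \<open>In the reduction the double of any point is killed by 3.\<close>

lemma six_times_E1:
 assumes P: "P \<in> carrier E36" "P \<in> coord_pts K"
 shows "P \<star> 6 \<in> E1"
proof -
 have p6: "P \<star> 6 = (P \<otimes>\<^bsub>E36\<^esub> P) \<star> 3"
  using E36.nat_pow_pow[OF P(1), of 2 3] P(1) by (simp add: numeral_2_eq_2)
 show ?thesis
 proof (cases "P \<in> E1 \<or> ec_add 0 P P \<in> E1")
  case True
  then show ?thesis using E1_pow_E1[of P 6] E1_pow_E1[of "ec_add 0 P P" 3] p6 by auto
 next
  case False
  then obtain x y where xy: "P = Some (x, y)" by (cases P) auto
  have e: "y^2 = x^3 + 1" and xyK: "x \<in> K" "y \<in> K" using P xy by auto
  have yV: "y \<in> V" using False xy e by auto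
  have xV: "x \<in> V" using x_V_iff[OF e] yV by simp
  have y0: "y ~= 0" using False xy by auto
  define l where "l = 3*x^2 / (2*y)"
  define X' where "X' = l^2 - 2*x"
  define Y' where "Y' = l*(x - X') - y"
  have dbl: "ec_add 0 P P = Some (X', Y')" using y0 xy
   by (simp add: Let_def l_def X'_def Y'_def eq_neg_iff_add_eq_0 algebra_simps)
  have E: "Y'^2 = X'^3 + 1" using E36.m_closed[OF P(1) P(1)] dbl by simp
  have Y'V: "Y' \<in> V" using False dbl E by auto
  have X'V: "X' \<in> V" using x_V_iff[OF E] Y'V by simp
  have ly: "l*(2*y) = 3*x^2" using y0 by (simp add: l_def)
  have lV: "l \<in> V"
  proof -
   have "l^Suc 1 = X' + 2*x" by (simp add: X'_def numeral_2_eq_2)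
   then have "l^Suc 1 \<in> V" using X'V xV by simp
   then show ?thesis by (rule integral_closed[rotated]) simp
  qed
  \<comment> \<open>The tangent slope \<open>l\<close> is integral because the double is outside the
    kernel of reduction. So \<open>y\<close> in the ideal would force \<open>x\<close> into it,
    against \<open>y^2 - x^3 = 1\<close>.\<close>
  have ym: "y \<notin> \<mm>"
  proof
   assume ym: "y \<in> \<mm>"
   then have "l*(2*y) \<in> \<mm>" using lV by (intro max_mult') simp_all
   then have "3*x^2 \<in> \<mm>" using ly by simp
   then have "x^2 \<in> \<mm>" using max_prime[of 3 "x^2"] num_units xV by simp
   then have "x \<in> \<mm>" using max_power_iff[of 2 x] xV by simp
   then have "x^3 \<in> \<mm>" using max_power_iff[of 3 x] xV by simp
   moreover have "y^2 \<in> \<mm>" using max_power_iff[of 2 y] ym yV by simp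
   ultimately have "y^2 - x^3 \<in> \<mm>" by (rule max_diff[rotated])
   then show False using e by simp
  qed
  have "X'*(4*y^2) = (l*(2*y))^2 - 8*x*y^2"
   by (simp add: X'_def power2_eq_square algebra_simps)
  also have "\<dots> = x*(x^3 - 8)" unfolding ly unfolding e by (simp add: cube_simps)
  finally have "X'*(X'^3 + 4) \<in> \<mm>" by (rule X_mod[OF xyK e xV ym X'V])
  note Xm = this
  define R where "R = Some (X', Y')"
  have R: "R \<in> carrier E36" using E by (simp add: R_def)
  have R3: "P \<star> 6 = ec_add 0 (ec_add 0 R R) R"
   unfolding p6 using R by (simp add: dbl R_def numeral_3_eq_3)
  have Y'm: "Y' \<notin> \<mm>"
  proof
   assume Ym: "Y' \<in> \<mm>"
   then have Y2: "Y'^2 \<in> \<mm>" using max_power_iff[of 2 Y'] Y'V by simp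
   have "X'*3 = X'*(X'^3 + 4) - X'*Y'^2" unfolding E by (simp add: algebra_simps)
   then have "X'*3 \<in> \<mm>" using max_diff[OF Xm max_mult'[OF Y2 X'V]] by simp
   then have "X' \<in> \<mm>" using max_prime[of X' 3] X'V num_units by simp
   then have "X'^3 \<in> \<mm>" using max_power_iff[of 3 X'] X'V by simp
   then have "Y'^2 - X'^3 \<in> \<mm>" using Y2 by (rule max_diff[rotated])
   then show False using E by simp
  qed
  then have Y0: "Y' ~= 0" by auto
  have iY: "inverse Y' \<in> V" using unit_or_max[OF Y'V Y'm] by simp
  have i2: "inverse 2 \<in> V" using unit_or_max[of 2] num_units by simp
  define L where "L = 3*X'^2*(inverse 2*inverse Y')"
  have i2Y: "inverse 2*inverse Y' \<in> V" by (rule V.mult_closed[OF i2 iY])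
  have LV: "L \<in> V" unfolding L_def by (rule V.mult_closed[OF _ i2Y]) (use X'V in simp)
  have LY: "L*(2*Y') = 3*X'^2"
  proof -
   have "L*(2*Y') = 3*X'^2*((inverse 2*2)*(inverse Y'*Y'))" unfolding L_def by (simp only: mult_ac)
   also have "(inverse 2*2)*(inverse Y'*Y') = 1" using Y0 by simp
   finally show ?thesis by simp
  qed
  define X2 where "X2 = L^2 - 2*X'"
  define Y2 where "Y2 = L*(X' - X2) - Y'"
  have "3*X'\<^sup>2 / (2*Y') = L" by (simp only: L_def divide_inverse inverse_mult_distrib)
  then have L': "(3*X'\<^sup>2 + 0) / (2*Y') = L" by simp
  have nY: "\<not> (X' = X' \<and> Y' = - Y')" using Y0 by (simp add: eq_neg_iff_add_eq_0)
  have X2': "X2 = L^2 - X' - X'" by (simp add: X2_def)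
  have dbl2: "ec_add 0 R R = Some (X2, Y2)"
   unfolding R_def ec_add.simps Let_def if_not_P[OF nY] if_P[OF refl] L' X2'[symmetric] Y2_def ..
  have E2: "Y2^2 = X2^3 + 1" using E36.m_closed[OF R R] dbl2 by simp
  have X2V: "X2 \<in> V" "Y2 \<in> V" using LV X'V Y'V by (simp_all add: X2_def Y2_def)
  have "(X2 - X')*(4*Y'^2) = (L*(2*Y'))^2 - 12*X'*Y'^2"
   by (simp add: X2_def power2_eq_square algebra_simps)
  also have "\<dots> = - 3*(X'*(X'^3 + 4))" unfolding LY unfolding E by (simp add: cube_simps)
  finally have "(X2 - X')*(4*Y'^2) \<in> \<mm>" using max_mult'[OF Xm, of "- 3"] by simp
  moreover have "4*Y'^2 \<notin> \<mm>" using unit_mult[of 4 "Y'^2"] num_units max_power_iff[of 2 Y'] Y'V Y'm by simp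
  ultimately have dX: "X2 - X' \<in> \<mm>" using max_prime[of "X2 - X'" "4*Y'^2"] X2V X'V Y'V by simp
  have Ysum: "Y2 + Y' \<in> \<mm>"
  proof -
   have "Y2 + Y' = - L*(X2 - X')" by (simp add: Y2_def algebra_simps)
   then show ?thesis using max_mult'[OF dX, of "- L"] LV by simp
  qed
  have Yd: "Y2 - Y' \<notin> \<mm>"
  proof
   assume "Y2 - Y' \<in> \<mm>"
   then have "Y2 + Y' - (Y2 - Y') \<in> \<mm>" by (rule max_diff[OF Ysum])
   then have "2*Y' \<in> \<mm>" by simp
   then show False using max_prime[of 2 Y'] num_units Y'm Y'V by simp
  qed
  show ?thesis
  proof (cases "X2 = X' \<and> Y2 = - Y'")
   case True
   then show ?thesis unfolding R3 dbl2 by (simp add: R_def)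
  next
   case False
   have "X2 ~= X'"
   proof
    assume "X2 = X'"
    then have "Y2 = Y' \<or> Y2 = - Y'" using E E2 by (simp add: power2_eq_iff[symmetric])
    then show False using False Yd \<open>X2 = X'\<close> by auto
   qed
   \<comment> \<open>Modulo the ideal the double of \<open>R\<close> has the abscissa of
     \<open>R\<close> and the opposite, nonzero ordinate. The slope of the chord is therefore not
     integral, and the sum lies in the kernel of reduction.\<close>
   define m where "m = (Y' - Y2) / (X' - X2)"
   have mV: "m \<notin> V"
   proof
    assume "m \<in> V"
    then have "m*(X2 - X') \<in> \<mm>" by (rule max_mult'[OF dX])
    moreover have "m*(X2 - X') = Y2 - Y'" using \<open>X2 ~= X'\<close> by (simp add: m_def field_simps)
    ultimately show False using Yd by simp
   qed
   define X3 where "X3 = m^2 - X2 - X'"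
   define Y3 where "Y3 = m*(X2 - X3) - Y2"
   have "ec_add 0 (Some (X2, Y2)) (Some (X', Y')) = Some (X3, Y3)"
    unfolding ec_add.simps Let_def using \<open>X2 ~= X'\<close> by (simp add: X3_def Y3_def m_def)
   then have add3: "ec_add 0 (ec_add 0 R R) R = Some (X3, Y3)" unfolding dbl2 unfolding R_def .
   have E3: "Y3^2 = X3^3 + 1" using E36.m_closed[OF E36.m_closed[OF R R] R] add3 by simp
   have "X3 \<notin> V"
   proof
    assume "X3 \<in> V"
    then have "X3 + X2 + X' \<in> V" using X2V X'V by simp
    then have "m^Suc 1 \<in> V" by (simp add: X3_def numeral_2_eq_2)
    then have "m \<in> V" by (rule integral_closed[rotated]) simp
    then show False using mV by simp
   qed
   then have "Y3 \<notin> V" using x_V_iff[OF E3] by simp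
   then show ?thesis unfolding R3 add3 using E3 by simp
  qed
 qed
qed

lemma torsion_six:
 assumes P: "P \<in> carrier E36" "P \<in> coord_pts K" and n: "n > 0" "P \<star> n = None"
 shows "P \<star> 6 = None"
proof (rule ccontr)
 assume ne: "P \<star> 6 ~= None"
 have "(P \<star> 6) \<star> n ~= None"
  by (rule E1_torsion_free[OF six_times_E1[OF P] E36_pow_coord_pts[OF K P(2)] ne n(1)])
 moreover have "(P \<star> 6) \<star> n = (P \<star> n) \<star> 6"
  using P(1) by (simp add: E36.nat_pow_pow mult.commute)
 ultimately show False using E36.nat_pow_one[of 6] n(2) by simp
qed

end

text \<open>Twelve points: infinity, three of order 2, two of order 3 with \<open>x = 0\<close>, and
  six of order 6 with \<open>x^3 = 8\<close>.\<close>

definition E36_pts :: "(complex \<times> complex) option set" where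
 "E36_pts = insert None {Some (x, y) |x y. y = 0 \<and> x^3 = - 1 \<or> x = 0 \<and> y^2 = 1 \<or> x^3 = 8 \<and> y^2 = 9}"

lemma E36_pts_simps [simp]: "None \<in> E36_pts"
 "Some (x, y) \<in> E36_pts \<longleftrightarrow> y = 0 \<and> x^3 = - 1 \<or> x = 0 \<and> y^2 = 1 \<or> x^3 = 8 \<and> y^2 = 9"
 by (auto simp: E36_pts_def)

lemma E36_pts_carrier: "P \<in> E36_pts ==> P \<in> carrier E36"
 by (cases P) auto

lemma E36_double:
 assumes "y^2 = x^3 + 1" "y ~= 0"
 shows "\<exists>x' y'. ec_add 0 (Some (x, y)) (Some (x, y)) = Some (x', y') \<and> x'*(4*y^2) = x*(x^3 - 8)"
proof -
 define l where "l = (3*x^2 + 0) / (2*y)"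
 have nY: "\<not> (x = x \<and> y = - y)" using assms(2) by (simp add: eq_neg_iff_add_eq_0)
 have s: "ec_add 0 (Some (x, y)) (Some (x, y)) = Some (l^2 - x - x, l*(x - (l^2 - x - x)) - y)"
  unfolding ec_add.simps Let_def if_not_P[OF nY] if_P[OF refl] l_def ..
 have ly: "l*(2*y) = 3*x^2" using assms(2) by (simp add: l_def)
 have "(l^2 - x - x)*(4*y^2) = (l*(2*y))^2 - 8*x*y^2"
  by (simp add: power2_eq_square algebra_simps)
 also have "\<dots> = x*(x^3 - 8)" unfolding ly unfolding assms(1) by (simp add: cube_simps)
 finally show ?thesis using s by blast
qed

text \<open>The double is killed by 3, so if it is finite its abscissa is a zero of
  \<open>X (X^3 + 4)\<close>. With the second factor excluded the abscissa is 0, and the doubling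
  formula leaves \<open>x = 0\<close> or \<open>x^3 = 8\<close>.\<close>

lemma six_torsion:
 assumes P: "P \<in> carrier E36" "P \<star> 6 = None"
  and no4: "\<And>x y. ec_add 0 P P = Some (x, y) ==> x^3 ~= - 4"
 shows "P \<in> E36_pts"
proof (cases "ec_add 0 P P")
 case None
 show ?thesis
 proof (cases P)
  case (Some q)
  then obtain x y where xy: "P = Some (x, y)" by (cases q) auto
  have "y = 0"
  proof (rule ccontr)
   assume "y ~= 0"
   then show False using E36_double[of y x] P(1) None unfolding xy by auto
  qed
  then show ?thesis using P(1) xy by (simp add: eq_neg_iff_add_eq_0)
 qed simp
next
 case (Some q)
 then obtain X' Y' where dbl: "ec_add 0 P P = Some (X', Y')" by (cases q) auto
 define R where "R = ec_add 0 P P"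
 have R: "R \<in> carrier E36" using E36.m_closed[OF P(1) P(1)] by (simp add: R_def)
 have RS: "R = Some (X', Y')" by (simp add: R_def dbl)
 have E: "Y'^2 = X'^3 + 1" using R RS by simp
 have "R \<star> 3 = None"
 proof -
  have "R = P \<star> 2" using P(1) by (simp add: R_def numeral_2_eq_2)
  then show ?thesis using E36.nat_pow_pow[OF P(1), of 2 3] P(2) by simp
 qed
 then have "ec_add 0 (ec_add 0 R R) R = None" by (simp add: numeral_3_eq_3)
 then have "inv\<^bsub>E36\<^esub> R = ec_add 0 R R" using E36.inv_equality[of "ec_add 0 R R" R] E36.m_closed[OF R R] R by simp
 then have RR: "ec_add 0 R R = Some (X', - Y')" using E36_inv[OF E] RS by simp
 have Y0: "Y' ~= 0"
 proof
  assume "Y' = 0"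
  then show False using RR RS by simp
 qed
 obtain x' y' where d: "ec_add 0 R R = Some (x', y')" "x'*(4*Y'^2) = X'*(X'^3 - 8)"
  using E36_double[OF E Y0] RS by auto
 then have "X'*(4*Y'^2) = X'*(X'^3 - 8)" using RR by simp
 then have "3*(X'*(X'^3 + 4)) = 0" unfolding E by (simp add: algebra_simps)
 then have "X'*(X'^3 + 4) = 0" by simp
 then have X0: "X' = 0" using no4[OF dbl] by (simp add: eq_neg_iff_add_eq_0)
 obtain x y where xy: "P = Some (x, y)" using dbl by (cases P) auto
 have e: "y^2 = x^3 + 1" using P(1) xy by simp
 have "y ~= 0" using dbl xy by auto
 then have "x*(x^3 - 8) = 0" using E36_double[OF e] dbl X0 unfolding xy by auto
 then have "x = 0 \<or> x^3 = 8" by simp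
 then show ?thesis using e xy by auto
qed

theorem E36_torsion:
 assumes T: "quad_tower K" and P: "P \<in> carrier E36" "P \<in> coord_pts K" and n: "n > 0" "P \<star> n = None"
 shows "P \<in> E36_pts"
proof -
 have cK: "csubfield K" by (rule quad_tower_csubfield[OF T])
 have p5: "prime (5::nat)" "odd (5::nat)" and p7: "prime (7::nat)" "odd (7::nat)" by simp_all
 obtain V where V: "valring UNIV V" "of_nat 5 \<in> mx V"
  "\<And>z. z \<in> K ==> z \<in> V ==> z^(5*5) - z \<in> mx V"
  "\<And>z. z \<in> K ==> z \<in> mx V ==> \<exists>w\<in>V. z^2 = of_nat 5*w"
  by (rule quad_tower_valuation[OF T p5], erule that; blast)
 interpret V: valring UNIV V by (rule V(1))
 interpret cK: csubfield K by (rule cK)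
 interpret E36_reduction V K
  by unfold_locales (use V(2-4) cK p5 in simp_all)
 have six: "P \<star> 6 = None" by (rule torsion_six[OF P n])
 show ?thesis
 proof (rule six_torsion[OF P(1) six])
  fix x y assume "ec_add 0 P P = Some (x, y)"
  then have xK: "x \<in> K" using ec_add_coord_pts[OF cK _ P(2) P(2), of 0] by simp
  obtain W where W: "valring UNIV W" "of_nat 7 \<in> mx W"
   "\<And>z. z \<in> K ==> z \<in> W ==> z^(7*7) - z \<in> mx W"
   "\<And>z. z \<in> K ==> z \<in> mx W ==> \<exists>w\<in>W. z^2 = of_nat 7*w"
   by (rule quad_tower_valuation[OF T p7], erule that; blast)
  interpret W: valring UNIV W by (rule W(1))
  interpret W: p_val W 7 by unfold_locales (use W(2) p7 in simp_all)
  show "x^3 ~= - 4"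
  proof
   assume x3: "x^3 = - 4"
   have "x^Suc 2 = x^3" by (simp add: numeral_3_eq_3 numeral_2_eq_2)
   then have "x^Suc 2 \<in> W" unfolding x3 by simp
   then have xW: "x \<in> W" by (rule W.integral_closed[rotated]) simp
   have "- 4 \<notin> mx W" using W.int_unit[of "- 4"] by simp
   then have xm: "x \<notin> mx W" using W.max_power_iff[of 3 x] xW x3 by simp
   have "x*(x^48 - 1) = x^(7*7) - x" by (simp add: right_diff_distrib power_Suc[symmetric] del: power_Suc)
   then have "x*(x^48 - 1) \<in> mx W" using W(3)[OF xK xW] by simp
   then have "x^48 - 1 \<in> mx W" using W.max_prime[of x "x^48 - 1"] xW xm by simp
   moreover have "x^48 = (x^3)^16" by (simp add: power_mult[symmetric])
   \<comment> \<open>\<open>(-4)^16 - 1 = 2^32 - 1\<close> is 3 modulo 7: -4 is not a cube in the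
     field with 49 elements.\<close>
   then have "x^48 - 1 = of_int 4294967295" unfolding x3 by simp
   ultimately show False using W.int_unit[of 4294967295] by simp
  qed
 qed
qed

section \<open>The equation $u^3 + v^3 = 2 w^3$ over the Eisenstein integers\<close>

definition om :: complex where "om = Complex (- 1 / 2) (sqrt 3 / 2)"

lemma om_sel [simp]: "Re om = - 1 / 2" "Im om = sqrt 3 / 2"
 by (simp_all add: om_def)

lemma om_sq: "om^2 = - 1 - om"
proof (rule complex_eqI)
 have "Re (om^2) = Re om * Re om - Im om*Im om" "Im (om^2) = Re om*Im om + Im om * Re om"
  unfolding power2_eq_square by (rule times_complex.sel)+
 then show "Re (om^2) = Re (- 1 - om)" "Im (om^2) = Im (- 1 - om)" by simp_all
qed

lemma om_cube: "om^3 = 1"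
proof -
 have "om^3 = om * om^2" by (simp add: power3_eq_cube power2_eq_square)
 also have "\<dots> = om*(- 1 - om)" by (simp only: om_sq)
 also have "\<dots> = - om - om^2" by (simp add: right_diff_distrib power2_eq_square)
 also have "\<dots> = 1" by (simp add: om_sq)
 finally show ?thesis .
qed

lemma om_mult_sq: "om * om^2 = 1" "om^2 * om^2 = om"
 using om_cube by (simp_all add: power2_eq_square power3_eq_cube mult.assoc)

lemma pm_one: "z = 1 \<or> z = - 1 ==> z^2 = 1 \<and> z^4 = (1 :: complex)"
 by auto

lemma csqrt_m3: "csqrt (- 3) = 2 * om + 1"
 using csqrt_of_real_nonpos[of "- 3"] by (simp add: complex_eq_iff)

lemma cube_eq_cases: "z^3 = c^3 \<longleftrightarrow> z = c \<or> z = om * c \<or> z = om^2*(c :: complex)"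
proof -
 have "z^3 - c^3 = (z - c)*(z^2 + z * c + c^2)" by (simp add: cube_simps)
 also have "z^2 + z * c + c^2 = (z - om * c)*(z - om^2 * c)"
 proof -
  have "(z - om * c)*(z - om^2 * c) = z^2 - (om + om^2)*(z * c) + om^3 * c^2"
   by (simp add: cube_simps)
  then show ?thesis by (simp add: om_cube om_sq)
 qed
 finally show ?thesis by (metis eq_iff_diff_eq_0 mult_eq_0_iff)
qed

definition eis :: "complex set" where "eis = {of_int m + of_int n * om |m n. True}"

lemma eisI: "of_int m + of_int n * om \<in> eis"
 by (auto simp: eis_def)

lemma eis_mult_form:
 "(of_int m + of_int n * om)*(of_int k + of_int l * om) = of_int (m * k - n*l) + of_int (m*l + n * k - n*l) * om"
proof -
 have "(of_int m + of_int n * om)*(of_int k + of_int l * om) =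
   of_int (m * k) + of_int (m*l + n * k) * om + of_int (n*l) * om^2"
  by (simp add: square_simps)
 then show ?thesis unfolding om_sq by (simp add: algebra_simps)
qed

interpretation eis: csubring eis
proof
 show "1 \<in> eis" using eisI[of 1 0] by simp
 fix z w assume "z \<in> eis" "w \<in> eis"
 then obtain m n k l where *: "z = of_int m + of_int n * om" "w = of_int k + of_int l * om" unfolding eis_def by blast
 show "z*w \<in> eis" unfolding * eis_mult_form by (rule eisI)
 have "z + w = of_int (m + k) + of_int (n + l) * om" unfolding * by (simp add: algebra_simps)
 then show "z + w \<in> eis" using eisI by metis
 have "- z = of_int (- m) + of_int (- n) * om" unfolding * by simp
 then show "- z \<in> eis" using eisI by metis
qed

lemma om_eis [simp]: "om \<in> eis"
 using eisI[of 0 1] by simp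

lemma eis_unique: "of_int m + of_int n * om = of_int k + of_int l * om \<longleftrightarrow> m = k \<and> n = l"
 by (auto simp: complex_eq_iff)

text \<open>The norm, a natural number so that it can serve as measure; on \<open>eis\<close> the
  square of \<open>cmod\<close> is already an integer.\<close>

definition nn :: "complex \<Rightarrow> nat" where "nn z = nat \<lfloor>(cmod z)^2\<rfloor>"

lemma cmod_om: "(cmod (of_real s + of_real t * om))^2 = s^2 - s*t + t^2"
proof -
 have "(t * sqrt 3 / 2)^2 = t^2*3 / 4" by (simp add: power_mult_distrib power_divide)
 then have "(cmod (of_real s + of_real t * om))^2 = (s - t / 2)^2 + t^2*3 / 4"
  unfolding cmod_power2 by simp
 then show ?thesis by (simp add: power2_eq_square algebra_simps)
qed

lemma eis_norm_nonneg: "m^2 - m*n + n^2 \<ge> (0 :: int)"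
proof -
 have "4*(m^2 - m*n + n^2) = (2*m - n)^2 + 3*n^2" by (simp add: square_simps)
 then show ?thesis by (smt (verit) zero_le_power2)
qed

lemma nn_form: "nn (of_int m + of_int n * om) = nat (m^2 - m*n + n^2)"
proof -
 have "(cmod (of_int m + of_int n * om))^2 = of_int (m^2 - m*n + n^2)"
  using cmod_om[of "of_int m" "of_int n"] by simp
 then show ?thesis unfolding nn_def by (simp only: floor_of_int)
qed

lemma nn_cmod: "z \<in> eis ==> real (nn z) = (cmod z)^2"
proof -
 assume "z \<in> eis"
 then obtain m n where z: "z = of_int m + of_int n * om" unfolding eis_def by blast
 have "(cmod z)^2 = of_int (m^2 - m*n + n^2)" using cmod_om[of "of_int m" "of_int n"] z by simp
 then show ?thesis unfolding z nn_form using eis_norm_nonneg[of m n] by (simp only: of_nat_nat)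
qed

lemma nn_mult: "z \<in> eis ==> w \<in> eis ==> nn (z*w) = nn z*nn w"
proof -
 assume "z \<in> eis" "w \<in> eis"
 then have "real (nn (z*w)) = real (nn z*nn w)" by (simp add: nn_cmod norm_mult power_mult_distrib)
 then show ?thesis by (simp only: of_nat_eq_iff)
qed

lemma nn_power: "z \<in> eis ==> nn (z^k) = nn z^k"
 by (induction k) (simp_all add: nn_mult nn_def[of 1])

lemma nn_0_iff: "z \<in> eis ==> nn z = 0 \<longleftrightarrow> z = 0"
 using nn_cmod[of z] by auto

lemma eis_unit_cube:
 assumes "u \<in> eis" "nn u = 1"
 shows "u^3 = 1 \<or> u^3 = - 1"
proof -
 obtain m n where u: "u = of_int m + of_int n * om" using assms(1) unfolding eis_def by blast
 have e: "m^2 - m*n + n^2 = 1" using assms(2) eis_norm_nonneg[of m n] unfolding u nn_form by simp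
 have "(2*m - n)^2 + 3*n^2 = 4" "(2*n - m)^2 + 3*m^2 = 4"
  using e by (simp_all add: square_simps)
 then have "3*n^2 \<le> 4" "3*m^2 \<le> 4" by (smt (verit) zero_le_power2)+
 then have "n^2 \<le> 1" "m^2 \<le> 1" by auto
 then have "\<bar>n\<bar> \<le> 1" "\<bar>m\<bar> \<le> 1" by (simp_all add: abs_square_le_1)
 then have "(m = -1 \<or> m = 0 \<or> m = 1) \<and> (n = -1 \<or> n = 0 \<or> n = 1)" by auto
 then have "u = 1 \<or> u = -1 \<or> u = om \<or> u = - om \<or> u = 1 + om \<or> u = - (1 + om)"
  using e unfolding u by auto
 moreover have "(1 + om)^3 = - 1"
 proof -
  have "(1 + om)^3 = 1 + 3 * om + 3 * om^2 + om^3" by (simp add: cube_simps)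
  then show ?thesis unfolding om_cube om_sq by simp
 qed
 moreover have m: "(- z)^3 = - (z^3)" for z :: complex by (simp add: power_minus_odd)
 ultimately show ?thesis using om_cube
  by (elim disjE) (simp_all only: m power_one minus_minus simp_thms)
qed

text \<open>Rounding both coordinates of \<open>a / b\<close> in the basis \<open>1\<close>,
  \<open>om\<close> leaves an error of norm at most 3/4.\<close>

lemma eis_division:
 assumes "a \<in> eis" "b \<in> eis" "b ~= 0"
 shows "\<exists>q\<in>eis. nn (a - b*q) < nn b"
proof -
 define z where "z = a / b"
 define y where "y = Im z / (sqrt 3 / 2)"
 define x where "x = Re z + y / 2"
 have z: "z = of_real x + of_real y * om" by (simp add: complex_eq_iff x_def y_def)
 define q where "q = of_int (round x) + of_int (round y) * om"
 have q: "q \<in> eis" unfolding q_def by (rule eisI)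
 define s t where st: "s = x - of_int (round x)" "t = y - of_int (round y)"
 have "\<bar>s\<bar> \<le> 1 / 2" "\<bar>t\<bar> \<le> 1 / 2" using of_int_round_abs_le[of x] of_int_round_abs_le[of y] by (simp_all add: st abs_minus_commute)
 then have b2: "s^2 \<le> (1 / 2)^2" "t^2 \<le> (1 / 2)^2" "(s - t)^2 \<le> 1^2" by (intro abs_le_square_iff[THEN iffD1]; simp)+
 have "s^2 - s*t + t^2 = (s^2 + t^2 + (s - t)^2) / 2" by (simp add: square_simps)
 also have "\<dots> \<le> 3 / 4" using b2 by (simp add: power2_eq_square)
 finally have le: "s^2 - s*t + t^2 \<le> 3 / 4" .
 have "z - q = of_real s + of_real t * om" unfolding z q_def st by (simp add: algebra_simps)
 then have "(cmod (z - q))^2 \<le> 3 / 4" using le cmod_om[of s t] by simp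
 moreover have "a - b*q = b*(z - q)" using assms(3) by (simp add: z_def algebra_simps)
 ultimately have "(cmod (a - b*q))^2 = (cmod b)^2*(cmod (z - q))^2" "(cmod (z - q))^2 \<le> 3 / 4"
  by (simp_all only: norm_mult power_mult_distrib)
 then have "(cmod (a - b*q))^2 \<le> (cmod b)^2*(3 / 4)"
  by (simp only:) (rule mult_left_mono, simp_all)
 also have "\<dots> < (cmod b)^2" using assms(3) by simp
 finally have "real (nn (a - b*q)) < real (nn b)" using assms q by (simp add: nn_cmod)
 then show ?thesis using q by (intro bexI[of _ q]) simp_all
qed

lemma eis_gcd:
 assumes ab: "a \<in> eis" "b \<in> eis" "a ~= 0"
 obtains d x y a' b' where "d \<in> eis" "x \<in> eis" "y \<in> eis" "a' \<in> eis" "b' \<in> eis"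
  "d = x * a + y * b" "a = d * a'" "b = d * b'" "d ~= 0"
proof -
 define S where "S = {z. \<exists>x\<in>eis. \<exists>y\<in>eis. z = x * a + y * b}"
 have SI: "x * a + y * b \<in> S" if "x \<in> eis" "y \<in> eis" for x y using that by (auto simp: S_def)
 have Se: "z \<in> eis" if "z \<in> S" for z using that ab by (auto simp: S_def)
 have aS: "a \<in> S" "b \<in> S" using SI[of 1 0] SI[of 0 1] by simp_all
 obtain d where d: "d \<in> S" "d ~= 0" "\<And>z. z \<in> S ==> z ~= 0 ==> nn d \<le> nn z"
  using ex_has_least_nat[of "\<lambda>z. z \<in> S \<and> z ~= 0" a nn] aS ab(3) by blast
 obtain x y where xy: "x \<in> eis" "y \<in> eis" "d = x * a + y * b" using d(1) by (auto simp: S_def)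
 have dvd: "\<exists>c'\<in>eis. c = d * c'" if c: "c \<in> S" for c
 proof -
  obtain q where q: "q \<in> eis" "nn (c - d*q) < nn d" using eis_division[OF Se[OF c] Se[OF d(1)] d(2)] by blast
  obtain u v where uv: "u \<in> eis" "v \<in> eis" "c = u * a + v * b" using c by (auto simp: S_def)
  have "c - d*q = (u - x*q) * a + (v - y*q) * b" unfolding uv(3) xy(3) by (simp add: algebra_simps)
  then have "c - d*q \<in> S" using SI[of "u - x*q" "v - y*q"] uv xy q by simp
  then have "c - d*q = 0" using d(3)[of "c - d*q"] q(2) by linarith
  then show ?thesis using q(1) by (intro bexI[of _ q]) simp_all
 qed
 obtain a' b' where "a' \<in> eis" "a = d * a'" "b' \<in> eis" "b = d * b'" using dvd aS by blast
 then show ?thesis using that[of d x y a' b'] xy d(2) Se[OF d(1)] by blast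
qed

text \<open>Coprimality is expressed by a Bezout relation; with \<open>eis_gcd\<close> this takes
  the place of unique factorization.\<close>

definition cop :: "complex \<Rightarrow> complex \<Rightarrow> bool" where
 "cop a b \<longleftrightarrow> (\<exists>x\<in>eis. \<exists>y\<in>eis. x * a + y * b = 1)"

lemma copI: "x \<in> eis ==> y \<in> eis ==> x * a + y * b = 1 ==> cop a b"
 by (auto simp: cop_def)

lemma cop_sym: "cop a b ==> cop b a"
 unfolding cop_def by (metis add.commute)

lemma cop_mult:
 assumes "cop a b" "cop a c" "a \<in> eis" "b \<in> eis" "c \<in> eis"
 shows "cop a (b * c)"
proof -
 obtain x y x' y' where *: "x \<in> eis" "y \<in> eis" "x * a + y * b = 1" "x' \<in> eis" "y' \<in> eis" "x' * a + y' * c = 1"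
  using assms(1,2) unfolding cop_def by blast
 have "(x*x' * a + x*y' * c + y * b*x') * a + (y*y')*(b * c) = (x * a + y * b)*(x' * a + y' * c)"
  by (simp add: algebra_simps)
 also have "\<dots> = 1" using * by simp
 finally show ?thesis by (rule copI[rotated 2]) (use * assms in simp_all)
qed

lemma cop_dvd:
 assumes "cop (d * a) b" "d \<in> eis"
 shows "cop a b"
proof -
 obtain x y where *: "x \<in> eis" "y \<in> eis" "x*(d * a) + y * b = 1" using assms(1) unfolding cop_def by blast
 show ?thesis by (rule copI[of "x*d" y]) (use * assms(2) in \<open>simp_all add: mult.assoc\<close>)
qed

lemma cop_unit:
 assumes "u = x * a + y * b" "x \<in> eis" "y \<in> eis" "u \<in> eis" "nn u = 1"
 shows "cop a b"
proof -
 define v where "v = u^5"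
 have "(u^3)^2 = 1" using pm_one[OF eis_unit_cube[OF assms(4,5)]] by blast
 then have "u^6 = 1" unfolding power_mult[symmetric] by simp
 then have "v * u = 1" by (simp add: v_def eval_nat_numeral mult_ac)
 then have "(v * x) * a + (v * y) * b = 1" unfolding assms(1) by (simp add: algebra_simps)
 then show ?thesis by (rule copI[rotated 2]) (use assms in \<open>simp_all add: v_def\<close>)
qed

lemma cop_common_unit:
 assumes "cop a b" "a = d * a'" "b = d * b'" "d \<in> eis" "a' \<in> eis" "b' \<in> eis"
 shows "nn d = 1"
proof -
 obtain x y where *: "x \<in> eis" "y \<in> eis" "x * a + y * b = 1" using assms(1) unfolding cop_def by blast
 have "d*(x * a' + y * b') = 1" using *(3) unfolding assms(2,3) by (simp add: algebra_simps)
 then have "nn d*nn (x * a' + y * b') = nn 1" using nn_mult[of d "x * a' + y * b'"] * assms by simp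
 then show ?thesis by (simp add: nn_def[of 1])
qed

text \<open>With \<open>d = gcd a c\<close> the ideal \<open>(a, c)\<^sup>3 = a (a\<^sup>2, a c, c\<^sup>2, b)\<close> is generated by \<open>a\<close>.\<close>

lemma coprime_factor_of_cube:
 assumes abc: "a \<in> eis" "b \<in> eis" "c \<in> eis" and a0: "a ~= 0" and e: "a * b = c^3" and cp: "cop a b"
 obtains \<epsilon> r where "\<epsilon> \<in> eis" "r \<in> eis" "\<epsilon>^3 = 1" "a = \<epsilon>*r^3"
proof -
 obtain d x y a' c' where d: "d \<in> eis" "x \<in> eis" "y \<in> eis" "a' \<in> eis" "c' \<in> eis"
  "d = x * a + y * c" "a = d * a'" "c = d * c'" "d ~= 0" using eis_gcd[OF abc(1,3) a0] by metis
 obtain m n where mn: "m \<in> eis" "n \<in> eis" "m * a + n * b = 1" using cp unfolding cop_def by blast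
 \<comment> \<open>Expanding \<open>d^3 = (x a + y c)^3\<close> with \<open>c^3 = a b\<close> gives
   \<open>d^3 = a f\<close>. Conversely, \<open>a (m a + n b)^2 = a\<close> writes \<open>a\<close>
   as \<open>d^3 g\<close>. So \<open>f g = 1\<close>, and \<open>a\<close> is a unit times a
   cube.\<close>
 define f where "f = x^3 * a^2 + 3*x^2*y * a * c + 3*x*y^2 * c^2 + y^3 * b"
 define k where "k = 2*m*n * a + n^2 * b"
 define g where "g = m^2 * a'^3 + k * c'^3"
 have fg: "f \<in> eis" "k \<in> eis" "g \<in> eis" using abc d(1-5) mn(1,2) by (simp_all add: f_def g_def k_def)
 have "d^3 = x^3 * a^3 + 3*x^2*y * a^2 * c + 3*x*y^2 * a * c^2 + y^3 * c^3"
  unfolding d(6) by (simp add: cube_simps)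
 then have df: "d^3 = a*f" unfolding e[symmetric] f_def by (simp add: cube_simps)
 have "a = a*(m * a + n * b)^2" using mn by simp
 also have "\<dots> = m^2 * a^3 + k*(a * b)" by (simp add: k_def cube_simps)
 also have "\<dots> = m^2*(d * a')^3 + k*(d * c')^3" using e d(7,8) by simp
 also have "\<dots> = d^3*g" by (simp add: g_def power_mult_distrib algebra_simps)
 finally have ag: "a = d^3*g" .
 have "a*(f*g) = a" unfolding mult.assoc[symmetric] df[symmetric] by (rule ag[symmetric])
 then have "f*g = 1" using a0 by simp
 then have "nn f*nn g = nn 1" using nn_mult[of f g] fg by simp
 then have "nn g = 1" by (simp add: nn_def[of 1])
 then have g3: "g^3 = 1 \<or> g^3 = - 1" by (rule eis_unit_cube[OF fg(3)])
 have g4: "g^4 = g*g^3" by (simp add: power_Suc[symmetric] del: power_Suc)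
 have "(g^4)^3 = (g^3)^4" by (simp add: power_mult[symmetric])
 then have "(g^4)^3 = 1" using pm_one[OF g3] by (simp only:)
 \<comment> \<open>\<open>g^6 = 1\<close>, so \<open>g\<close> equals \<open>g^4\<close> times the
   cube \<open>g^9\<close>: a possible sign moves into the cube, and the remaining unit has cube
   1.\<close>
 moreover have "a = g^4*(g^3*d)^3"
 proof -
  have "g*G*(G*d)^3 = G^4*(d^3*g)" for G
  proof -
   have "G^4 = G*G^3" by (simp add: power_Suc[symmetric] del: power_Suc)
   then show ?thesis by (simp only: power_mult_distrib mult_ac)
  qed
  then have "g^4*(g^3*d)^3 = (g^3)^4*(d^3*g)" unfolding g4 .
  then show ?thesis using pm_one[OF g3] ag by (simp only: mult_1_left)
 qed
 ultimately show ?thesis using that[of "g^4" "g^3*d"] fg(3) d(1) by simp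
qed

text \<open>2 is inert: \<open>m^2 - m n + n^2\<close> is even only if \<open>m\<close> and
  \<open>n\<close> both are.\<close>

lemma eis_even:
 assumes "z \<in> eis" "even (nn z)"
 shows "\<exists>z'\<in>eis. z = 2*z'"
proof -
 obtain m n where z: "z = of_int m + of_int n * om" using assms(1) unfolding eis_def by blast
 have "even (m^2 - m*n + n^2)" using assms(2) eis_norm_nonneg[of m n] unfolding z nn_form by (simp add: even_nat_iff)
 then have "even m \<and> even n" by auto
 then obtain k l where "m = 2 * k" "n = 2*l" by blast
 then have "z = 2*(of_int k + of_int l * om)" unfolding z by (simp add: algebra_simps)
 then show ?thesis using eisI by blast
qed

text \<open>Either \<open>r\<close> is divisible by \<open>1 - om\<close>, the prime above 3, or
  \<open>r^3\<close> is 1 or -1 modulo 9. The coefficient of \<open>om\<close> in a cube is always a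
  multiple of 3, whence the form \<open>3 * c2\<close>.\<close>

lemma cube_mod_9:
 assumes "r \<in> eis"
 shows "\<exists>c1 c2. r^3 = of_int c1 + of_int (3 * c2) * om \<and>
  (3 dvd c1 \<and> (\<exists>r'\<in>eis. r = (1 - om)*r') \<or> (c1 mod 9 = 1 \<or> c1 mod 9 = 8) \<and> 3 dvd c2)"
proof -
 obtain m n where r: "r = of_int m + of_int n * om" using assms(1) unfolding eis_def by blast
 define c1 where "c1 = m^3 + n^3 - 3*m*n^2"
 define c2 where "c2 = m*n*(m - n)"
 have "r^3 = of_int (m^3) + of_int (3*m^2*n) * om + of_int (3*m*n^2) * om^2 + of_int (n^3) * om^3"
  unfolding r by (simp add: cube_simps)
 then have e: "r^3 = of_int c1 + of_int (3 * c2) * om"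
  unfolding om_sq om_cube c1_def c2_def by (simp add: square_simps)
 show ?thesis
 proof (cases "3 dvd m + n")
  case True
  then obtain k where k: "m + n = 3 * k" by blast
  then have m: "m = 3 * k - n" by simp
  have "c1 = (m + n)*(m^2 - m*n + n^2) - 3*(m*n^2)"
   by (simp add: c1_def cube_simps)
  then have "3 dvd c1" unfolding k by (simp add: mult.assoc)
  moreover have "r = (1 - om)*(of_int (- n) + of_int k*(2 + om))"
  proof -
   have "(1 - om)*(of_int (- n) + of_int k*(2 + om)) = of_int (2 * k - n) + of_int (n - k) * om - of_int k * om^2"
    by (simp add: square_simps)
   then show ?thesis unfolding r m om_sq by (simp add: algebra_simps)
  qed
  ultimately show ?thesis using e by (intro exI[of _ c1] exI[of _ c2] conjI disjI1 bexI[of _ "of_int (- n) + of_int k*(2 + om)"]) simp_all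
 next
  case False
  define i a j b where ab: "i = m div 3" "a = m mod 3" "j = n div 3" "b = n mod 3"
  have m: "m = 3*i + a" and n: "n = 3*j + b" by (simp_all add: ab)
  have "c1 = 9*(3*i^3 + 3*i^2 * a + i * a^2 + 3*j^3 + 3*j^2 * b + j * b^2
    - i*(9*j^2 + 6*j * b + b^2) - a*(3*j^2 + 2*j * b)) + (a^3 + b^3 - 3 * a * b^2)"
   unfolding c1_def m n by (simp add: cube_simps)
  then have c9: "c1 mod 9 = (a^3 + b^3 - 3 * a * b^2) mod 9" by (simp only: mod_mult_self4)
  have "(a = 0 \<or> a = 1 \<or> a = 2) \<and> (b = 0 \<or> b = 1 \<or> b = 2)" unfolding ab by presburger
  moreover have "\<not> 3 dvd a + b" using False unfolding m n by presburger
  ultimately have cs: "a = 0 \<and> b = 1 \<or> a = 0 \<and> b = 2 \<or> a = 1 \<and> b = 0 \<or> a = 2 \<and> b = 0 \<or> a = 1 \<and> b = 1 \<or> a = 2 \<and> b = 2" by auto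
  have "c1 mod 9 = 1 \<or> c1 mod 9 = 8" unfolding c9 using cs by auto
  moreover have "3 dvd m \<or> 3 dvd n \<or> 3 dvd m - n" unfolding m n using cs by presburger
  then have "3 dvd c2" unfolding c2_def by auto
  ultimately show ?thesis using e by blast
 qed
qed

lemma lam_nonunit: "nn (1 - om) ~= 1"
 using nn_form[of 1 "- 1"] by simp

text \<open>If \<open>\<epsilon>\<close> were \<open>om\<close> or its square, comparing coordinates
  would make the three cubes agree modulo 3 in their rational parts. Then none of \<open>r\<close>,
  \<open>s\<close>, \<open>t\<close> is divisible by \<open>1 - om\<close>, since otherwise two
  coprime ones would be. So each cube is 1 or -1 modulo 9, and \<open>s1 + 2 r1\<close> or
  \<open>t1 + 2 r1\<close> would be 0 modulo 9.\<close>

lemma unit_twist_trivial: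
 assumes rst: "r \<in> eis" "s \<in> eis" "t \<in> eis" and c: "cop r s" "cop r t" "cop s t"
  and e: "\<epsilon>^3 = 1" and eq: "s^3 + \<epsilon>*t^3 = 2*\<epsilon>^2*r^3"
 shows "\<epsilon> = 1"
proof (rule ccontr)
 assume ne: "\<epsilon> ~= 1"
 obtain r1 r2 where r: "r^3 = of_int r1 + of_int (3*r2) * om"
  "3 dvd r1 \<and> (\<exists>r'\<in>eis. r = (1 - om)*r') \<or> (r1 mod 9 = 1 \<or> r1 mod 9 = 8) \<and> 3 dvd r2" using cube_mod_9[OF rst(1)] by blast
 obtain s1 s2 where s: "s^3 = of_int s1 + of_int (3 * s2) * om"
  "3 dvd s1 \<and> (\<exists>r'\<in>eis. s = (1 - om)*r') \<or> (s1 mod 9 = 1 \<or> s1 mod 9 = 8) \<and> 3 dvd s2" using cube_mod_9[OF rst(2)] by blast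
 obtain t1 t2 where t: "t^3 = of_int t1 + of_int (3*t2) * om"
  "3 dvd t1 \<and> (\<exists>r'\<in>eis. t = (1 - om)*r') \<or> (t1 mod 9 = 1 \<or> t1 mod 9 = 8) \<and> 3 dvd t2" using cube_mod_9[OF rst(3)] by blast
 have notboth: "\<not> ((\<exists>r'\<in>eis. r = (1 - om)*r') \<and> (\<exists>r'\<in>eis. s = (1 - om)*r'))"
  using cop_common_unit[OF c(1), of "1 - om"] lam_nonunit by auto
 note om4 = om_mult_sq
 have "\<epsilon> = om \<or> \<epsilon> = om^2" using cube_eq_cases[of \<epsilon> 1] e ne by simp
 then have "s1 - 3*t2 = - 2*r1 + 6*r2 \<and> 3 * s2 + t1 - 3*t2 = - 2*r1 \<or>
   s1 - t1 + 3*t2 = - 6*r2 \<and> 3 * s2 - t1 = 2*r1 - 6*r2"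
 proof
  assume "\<epsilon> = om"
  then have "s^3 + om*t^3 = 2 * om^2*r^3" using eq by simp
  then have "of_int s1 + of_int (3 * s2 + t1) * om + of_int (3*t2) * om^2
    = of_int (2*r1) * om^2 + of_int (6*r2)*(om * om^2)"
   unfolding r s t by (simp add: square_simps)
  then have "of_int (s1 - 3*t2) + of_int (3 * s2 + t1 - 3*t2) * om = of_int (- 2*r1 + 6*r2) + of_int (- 2*r1) * om"
   unfolding om4 unfolding om_sq by (simp add: algebra_simps)
  then show ?thesis unfolding eis_unique by blast
 next
  assume "\<epsilon> = om^2"
  then have "s^3 + om^2*t^3 = 2 * om*r^3" using eq om4 by (simp add: power2_eq_square mult_ac)
  then have "of_int s1 + of_int (3 * s2) * om + of_int t1 * om^2 + of_int (3*t2)*(om * om^2)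
    = of_int (2*r1) * om + of_int (6*r2) * om^2"
   unfolding r s t by (simp add: square_simps)
  then have "of_int (s1 - t1 + 3*t2) + of_int (3 * s2 - t1) * om = of_int (- 6*r2) + of_int (2*r1 - 6*r2) * om"
   unfolding om4 unfolding om_sq by (simp add: algebra_simps)
  then show ?thesis unfolding eis_unique by blast
 qed
 note lin = this
 then have "s1 - r1 = 3*(t2 - r1 + 2*r2) \<and> t1 - r1 = 3*(t2 - s2 - r1) \<or>
   s1 - r1 = 3*(s2 - r1 - t2) \<and> t1 - r1 = 3*(s2 - r1 + 2*r2)" by auto
 then have "3 dvd s1 - r1 \<and> 3 dvd t1 - r1" by (metis dvd_triv_left)
 then have m3: "s1 mod 3 = r1 mod 3 \<and> t1 mod 3 = r1 mod 3" by (simp add: mod_eq_dvd_iff)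
 have u3: "c mod 9 = 1 \<or> c mod 9 = 8 ==> \<not> 3 dvd c" for c :: int by presburger
 have "\<not> 3 dvd r1" using r(2) s(2) t(2) u3[of r1] u3[of s1] u3[of t1] m3 notboth by (metis mod_0_imp_dvd mod_eq_0_iff_dvd)
 then have "\<not> 3 dvd s1" "\<not> 3 dvd t1" using m3 by (simp_all add: dvd_eq_mod_eq_0)
 then have "(r1 mod 9 = 1 \<or> r1 mod 9 = 8) \<and> 3 dvd r2" "(s1 mod 9 = 1 \<or> s1 mod 9 = 8) \<and> 3 dvd s2"
  "(t1 mod 9 = 1 \<or> t1 mod 9 = 8) \<and> 3 dvd t2" using r(2) s(2) t(2) \<open>\<not> 3 dvd r1\<close> by blast+
 note u = this
 then obtain r' s' t' where "r2 = 3*r'" "s2 = 3 * s'" "t2 = 3*t'" by (elim conjE dvdE) blast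
 then have "s1 + 2*r1 = 9*(t' + 2*r') \<or> t1 + 2*r1 = 9*(s' + 2*r')" using lin
 proof (elim disjE conjE)
  assume "r2 = 3*r'" "t2 = 3*t'" "s1 - 3*t2 = - 2*r1 + 6*r2"
  then have "s1 + 2*r1 = 9*(t' + 2*r')" by (simp add: algebra_simps)
  then show ?thesis ..
 next
  assume "r2 = 3*r'" "s2 = 3 * s'" "3 * s2 - t1 = 2*r1 - 6*r2"
  then have "t1 + 2*r1 = 9*(s' + 2*r')" by (simp add: algebra_simps)
  then show ?thesis ..
 qed
 then have "(s1 + 2*r1) mod 9 = 0 \<or> (t1 + 2*r1) mod 9 = 0" by auto
 moreover have nz9: "(c + 2*d) mod 9 ~= 0" if "c mod 9 = 1 \<or> c mod 9 = 8" "d mod 9 = 1 \<or> d mod 9 = 8" for c d :: int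
  using that by presburger
 ultimately show False
  using nz9[OF conjunct1[OF u(2)] conjunct1[OF u(1)]] nz9[OF conjunct1[OF u(3)] conjunct1[OF u(1)]] by (elim disjE) simp_all
qed

text \<open>Pairwise coprime factors of a cube are cubes up to cube roots of unity. Dividing the
  linear relation by the unit of \<open>\<beta>\<close> gives
  \<open>s^3 + \<epsilon> t^3 = 2 \<epsilon>^2 (- r)^3\<close>. The congruence modulo 9 removes
  \<open>\<epsilon>\<close>, and the original equation remains with \<open>- r\<close> in place of
  \<open>w\<close>.\<close>

lemma descent_step:
 assumes abc: "a \<in> eis" "\<beta> \<in> eis" "\<gamma> \<in> eis" "w \<in> eis" "w ~= 0"
  and sum: "2 * a + \<beta> + \<gamma> = 0" and prod: "a*\<beta>*\<gamma> = w^3"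
  and cp: "cop a \<beta>" "cop a \<gamma>" "cop \<beta> \<gamma>"
  and IH: "\<And>r s t. r \<in> eis ==> s \<in> eis ==> t \<in> eis ==> nn r < nn w ==> r ~= 0 ==> s^3 + t^3 = 2*r^3 ==> s^3 = t^3"
 shows "\<beta> = \<gamma>"
proof -
 have nz: "a ~= 0" "\<beta> ~= 0" "\<gamma> ~= 0" using prod abc by auto
 have eq: "a*(\<beta>*\<gamma>) = w^3" "\<beta>*(a*\<gamma>) = w^3" "\<gamma>*(a*\<beta>) = w^3" using prod by (simp_all add: mult_ac)
 have c2: "cop a (\<beta>*\<gamma>)" "cop \<beta> (a*\<gamma>)" "cop \<gamma> (a*\<beta>)"
  using cp cop_sym[OF cp(1)] cop_sym[OF cp(2)] cop_sym[OF cp(3)] abc by (simp_all add: cop_mult)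
 obtain o' r where r: "o' \<in> eis" "r \<in> eis" "o'^3 = 1" "a = o'*r^3"
  using coprime_factor_of_cube[OF abc(1) _ abc(4) nz(1) eq(1) c2(1)] abc by auto
 obtain p s where s: "p \<in> eis" "s \<in> eis" "p^3 = 1" "\<beta> = p * s^3"
  using coprime_factor_of_cube[OF abc(2) _ abc(4) nz(2) eq(2) c2(2)] abc by auto
 obtain q t where t: "q \<in> eis" "t \<in> eis" "q^3 = 1" "\<gamma> = q*t^3"
  using coprime_factor_of_cube[OF abc(3) _ abc(4) nz(3) eq(3) c2(3)] abc by auto
 have rst0: "r ~= 0" "s ~= 0" "t ~= 0" using nz r(4) s(4) t(4) by auto
 define \<rho> where "\<rho> = r * s*t"
 have \<rho>: "\<rho> \<in> eis" "\<rho> ~= 0" using r s t rst0 by (simp_all add: \<rho>_def)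
 have w3: "w^3 = (o'*p*q)*\<rho>^3" unfolding prod[symmetric] r(4) s(4) t(4) by (simp add: \<rho>_def power_mult_distrib mult_ac)
 have n1: "nn e = 1" if "e \<in> eis" "e^3 = 1" for e
 proof -
  have "nn e^3 = 1" using nn_power[OF that(1), of 3] that(2) by (simp add: nn_def[of 1])
  then show ?thesis by simp
 qed
 \<comment> \<open>This product is \<open>w^3\<close> divided by \<open>\<rho>^3\<close>. After
   removing the common divisor of \<open>w\<close> and \<open>\<rho>\<close> it is a quotient of
   cubes of units, so 1 or -1; its own cube is 1.\<close>
 have opq: "o'*p*q = 1"
 proof -
  obtain d x y \<rho>' w' where d: "d \<in> eis" "x \<in> eis" "y \<in> eis" "\<rho>' \<in> eis" "w' \<in> eis"
   "d = x*\<rho> + y*w" "\<rho> = d*\<rho>'" "w = d*w'" "d ~= 0" using eis_gcd[OF \<rho>(1) abc(4) \<rho>(2)] by metis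
  have "d*(x*\<rho>' + y*w') = d*1" using d(6) unfolding d(7,8) by (simp add: algebra_simps)
  then have "x*\<rho>' + y*w' = 1" using d(9) by simp
  then have cp': "cop \<rho>' w'" using copI d by blast
  have "d^3*w'^3 = d^3*(o'*p*q*\<rho>'^3)" using w3 unfolding d(7,8) by (simp add: power_mult_distrib mult_ac)
  then have w'3: "w'^3 = o'*p*q*\<rho>'^3" using d(9) by simp
  have "cop \<rho>' (w'*(w'*w'))" using cp' d(4,5) by (intro cop_mult) simp_all
  moreover have "w'*(w'*w') = \<rho>'*(o'*p*q*\<rho>'^2)" using w'3 by (simp add: power3_eq_cube power2_eq_square mult_ac)
  ultimately have "nn \<rho>' = 1" using cop_common_unit[of \<rho>' "w'*(w'*w')" \<rho>' 1 "o'*p*q*\<rho>'^2"] d(4,5) r(1) s(1) t(1) by simp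
  then have "\<rho>'^3 = 1 \<or> \<rho>'^3 = - 1" using eis_unit_cube d by blast
  moreover have "nn w' = 1"
  proof -
   have "nn w'^3 = nn (o'*p*q*\<rho>'^3)" using nn_power[of w' 3] d(5) w'3 by simp
   also have "\<dots> = 1" using r(1,3) s(1,3) t(1,3) d(4) n1 \<open>nn \<rho>' = 1\<close> by (simp add: nn_mult nn_power)
   finally show ?thesis by simp
  qed
  then have "w'^3 = 1 \<or> w'^3 = - 1" using eis_unit_cube d by blast
  ultimately have pm: "o'*p*q = 1 \<or> o'*p*q = - 1"
   using w'3 by (metis minus_minus mult_minus_right mult_1_right)
  have "(o'*p*q)^3 = 1" using r(3) s(3) t(3) by (simp add: power_mult_distrib)
  then show ?thesis using pm by auto
 qed
 define \<epsilon> where "\<epsilon> = q*p^2"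
 have e3: "\<epsilon>^3 = 1"
 proof -
  have "\<epsilon>^3 = q^3*(p^3)^2" by (simp add: \<epsilon>_def power_mult_distrib power_mult[symmetric])
  then show ?thesis using s t by simp
 qed
 have pp: "p^2*p = 1" using s(3) by (simp add: power2_eq_square power3_eq_cube)
 have qq: "q^2*q = 1" using t(3) by (simp add: power2_eq_square power3_eq_cube)
 have op: "o'*p^2 = \<epsilon>^2"
 proof -
  have "\<epsilon>^2 = (q^2*p)*(p^2*p)" by (simp add: \<epsilon>_def power2_eq_square mult_ac)
  also have "\<dots> = (o'*p*q)*(q^2*p)" unfolding pp opq by simp
  also have "\<dots> = o'*p^2*(q^2*q)" by (simp add: power2_eq_square mult_ac)
  finally show ?thesis unfolding qq by simp
 qed
 have "p^2*(2 * a + \<beta> + \<gamma>) = 2*(o'*p^2)*r^3 + (p^2*p) * s^3 + \<epsilon>*t^3"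
  unfolding r(4) s(4) t(4) \<epsilon>_def by (simp add: algebra_simps)
 then have "2*\<epsilon>^2*r^3 + s^3 + \<epsilon>*t^3 = 0" unfolding sum pp op by simp
 moreover have "(- r)^3 = - (r^3)" by (simp add: power_minus_odd)
 ultimately have eqn: "s^3 + \<epsilon>*t^3 = 2*\<epsilon>^2*(- r)^3"
  by (simp add: algebra_simps eq_neg_iff_add_eq_0)
 have crs: "cop (- r) s" "cop (- r) t" "cop s t"
 proof -
  have 1: "a = (- o'*r^2)*(- r)" "\<beta> = (p * s^2) * s" "\<gamma> = (q*t^2)*t"
   unfolding r(4) s(4) t(4) by (simp_all add: power2_eq_square power3_eq_cube)
  have *: "cop x y" if "cop (c*x) (d*y)" "c \<in> eis" "d \<in> eis" for c d x y
   using cop_dvd[OF cop_sym[OF cop_dvd[OF that(1,2)]] that(3)] by (rule cop_sym)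
  show "cop (- r) s" by (rule *[OF cp(1)[unfolded 1(1,2)]]) (use r(1,2) s(1,2) in simp_all)
  show "cop (- r) t" by (rule *[OF cp(2)[unfolded 1(1,3)]]) (use r(1,2) t(1,2) in simp_all)
  show "cop s t" by (rule *[OF cp(3)[unfolded 1(2,3)]]) (use s(1,2) t(1,2) in simp_all)
 qed
 have e1: "\<epsilon> = 1" by (rule unit_twist_trivial[OF _ s(2) t(2) crs e3 eqn]) (use r in simp)
 have pq: "q = p"
 proof -
  have "q = q*(p^2*p)" using pp by simp
  also have "\<dots> = \<epsilon>*p" by (simp add: \<epsilon>_def)
  finally show ?thesis using e1 by simp
 qed
 have st: "s^3 + t^3 = 2*(- r)^3" using eqn e1 by simp
 \<comment> \<open>If \<open>s\<close> and \<open>t\<close> are units, their cubes are 1 or -1 with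
   nonzero sum, hence equal. Otherwise \<open>nn r\<close> is below
   \<open>nn w = nn r * nn s * nn t\<close> and the hypothesis of the descent applies.\<close>
 have "s^3 = t^3"
 proof (cases "nn s = 1 \<and> nn t = 1")
  case True
  then have "s^3 = 1 \<or> s^3 = - 1" "t^3 = 1 \<or> t^3 = - 1" using eis_unit_cube s t by blast+
  moreover have "s^3 + t^3 ~= 0" using st rst0 by simp
  ultimately show ?thesis by auto
 next
  case False
  have "nn w^3 = nn \<rho>^3"
  proof -
   have "nn w^3 = nn (w^3)" using nn_power[OF abc(4)] by simp
   also have "w^3 = \<rho>^3" using w3 opq by simp
   finally show ?thesis using nn_power[OF \<rho>(1)] by simp
  qed
  then have "nn w = nn \<rho>" by (simp add: power_eq_iff_eq_base)
  then have wn: "nn w = nn r*(nn s*nn t)" using r s t by (simp add: \<rho>_def nn_mult)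
  have "nn r ~= 0" "nn s ~= 0" "nn t ~= 0" using nn_0_iff r(2) s(2) t(2) rst0 by simp_all
  then have "nn s*nn t > 1" using False by (metis One_nat_def less_one linorder_neqE_nat mult_eq_1_iff mult_is_0)
  then have "nn r < nn w" unfolding wn using \<open>nn r ~= 0\<close> by simp
  moreover have "nn (- r) = nn r" by (simp add: nn_def)
  ultimately show ?thesis using IH[of "- r" s t] st r s t rst0 by simp
 qed
 then show ?thesis unfolding s(4) t(4) pq by simp
qed

text \<open>The linear factors of \<open>s^3 + t^3\<close>, scaled by powers of \<open>om\<close> so
  that they add up to 0. In this symmetric form it does not matter which of the three is
  even.\<close>

lemma triple_of_cubes:
 fixes s t :: complex
 defines "\<alpha> \<equiv> s + t" and "\<beta> \<equiv> om * s + om^2*t" and "\<gamma> \<equiv> om^2 * s + om*t"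
 shows "\<alpha> + \<beta> + \<gamma> = 0" "\<alpha>*\<beta>*\<gamma> = s^3 + t^3"
  "\<alpha> = \<beta> \<or> \<beta> = \<gamma> \<or> \<gamma> = \<alpha> ==> s^3 = t^3"
proof -
 note om4 = om_mult_sq
 show "\<alpha> + \<beta> + \<gamma> = 0" unfolding \<alpha>_def \<beta>_def \<gamma>_def om_sq by (simp add: algebra_simps)
 have "\<beta>*\<gamma> = (om * om^2) * s^2 + (om * om + om^2 * om^2)*(s*t) + (om * om^2)*t^2"
  unfolding \<beta>_def \<gamma>_def by (simp add: square_simps)
 also have "\<dots> = s^2 - s*t + t^2" unfolding om4 power2_eq_square[symmetric, of om] by (simp add: om_sq)
 finally have "\<alpha>*(\<beta>*\<gamma>) = (s + t)*(s^2 - s*t + t^2)" by (simp add: \<alpha>_def)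
 then show "\<alpha>*\<beta>*\<gamma> = s^3 + t^3" by (simp add: cube_simps)
 have om1: "om - 1 ~= 0" by (auto simp: complex_eq_iff)
 have "\<beta> - \<alpha> = (om - 1)*(s - om^2*t)"
 proof -
  have "(om - 1)*(s - om^2*t) = om * s - s - (om * om^2)*t + om^2*t" by (simp add: algebra_simps)
  then show ?thesis unfolding om4 by (simp add: \<alpha>_def \<beta>_def)
 qed
 moreover have "\<beta> - \<gamma> = om*(om - 1)*(t - s)"
  unfolding \<beta>_def \<gamma>_def by (simp add: square_simps)
 moreover have "\<gamma> - \<alpha> = (om^2 - 1)*(s - om*t)"
 proof -
  have "(om^2 - 1)*(s - om*t) = om^2 * s - s - (om * om^2)*t + om*t" by (simp add: algebra_simps)
  then show ?thesis unfolding om4 by (simp add: \<alpha>_def \<gamma>_def)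
 qed
 moreover have "om^2 - 1 ~= 0" "om ~= 0" unfolding om_sq by (auto simp: complex_eq_iff)
 ultimately have "\<alpha> = \<beta> \<or> \<beta> = \<gamma> \<or> \<gamma> = \<alpha> ==> s = t \<or> s = om*t \<or> s = om^2*t"
  using om1 by auto
 then show "\<alpha> = \<beta> \<or> \<beta> = \<gamma> \<or> \<gamma> = \<alpha> ==> s^3 = t^3" using cube_eq_cases[of s t] by blast
qed

text \<open>A common divisor of the three factors and \<open>w\<close> is divided out, which lowers
  \<open>nn w\<close>. If there is none but units, the cube of the common divisor \<open>g\<close>
  of the factors divides 2, so \<open>g\<close> is a unit and the factors are pairwise coprime. One
  of them is even, and \<open>descent_step\<close> shows that the other two are equal.\<close>

lemma descent:
 "w \<in> eis ==> w ~= 0 ==> \<alpha> \<in> eis ==> \<beta> \<in> eis ==> \<gamma> \<in> eis ==> \<alpha> + \<beta> + \<gamma> = 0 ==>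
  \<alpha>*\<beta>*\<gamma> = 2*w^3 ==> \<alpha> = \<beta> \<or> \<beta> = \<gamma> \<or> \<gamma> = \<alpha>"
proof (induction "nn w" arbitrary: w \<alpha> \<beta> \<gamma> rule: less_induct)
 case less
 note w = less.prems(1,2) and abc = less.prems(3-5) and sum = less.prems(6) and prod = less.prems(7)
 have nz: "\<alpha> ~= 0" "\<beta> ~= 0" "\<gamma> ~= 0" using prod w(2) by auto
 have IH: "s^3 = t^3" if "r \<in> eis" "s \<in> eis" "t \<in> eis" "nn r < nn w" "r ~= 0" "s^3 + t^3 = 2*r^3" for r s t
 proof -
  have "s + t \<in> eis" "om * s + om^2*t \<in> eis" "om^2 * s + om*t \<in> eis" using that by simp_all
  then show ?thesis
   using less.hyps[OF that(4,1,5) _ _ _ triple_of_cubes(1)[of s t]] triple_of_cubes(2,3)[of s t] that(6) by simp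
 qed
 obtain g x y \<alpha>1 \<beta>1 where g: "g \<in> eis" "x \<in> eis" "y \<in> eis" "\<alpha>1 \<in> eis" "\<beta>1 \<in> eis"
  "g = x*\<alpha> + y*\<beta>" "\<alpha> = g*\<alpha>1" "\<beta> = g*\<beta>1" "g ~= 0" using eis_gcd[OF abc(1,2) nz(1)] by metis
 define \<gamma>1 where "\<gamma>1 = - \<alpha>1 - \<beta>1"
 have \<gamma>1: "\<gamma> = g*\<gamma>1" "\<gamma>1 \<in> eis"
 proof -
  have "\<gamma> = - \<alpha> - \<beta>" using sum by (simp add: eq_neg_iff_add_eq_0 algebra_simps)
  then show "\<gamma> = g*\<gamma>1" unfolding g(7,8) \<gamma>1_def by (simp add: algebra_simps)
  show "\<gamma>1 \<in> eis" using g(4,5) by (simp add: \<gamma>1_def)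
 qed
 obtain d x' y' g' w' where d: "d \<in> eis" "x' \<in> eis" "y' \<in> eis" "g' \<in> eis" "w' \<in> eis"
  "d = x'*g + y'*w" "g = d*g'" "w = d*w'" "d ~= 0" using eis_gcd[OF g(1) w(1) g(9)] by metis
 show ?case
 proof (cases "nn d = 1")
  case False
  have w'0: "w' ~= 0" using d(8) w(2) by auto
  have "nn w = nn d*nn w'" unfolding d(8) using d(1,5) by (rule nn_mult)
  moreover have "nn d ~= 0" "nn w' ~= 0" using nn_0_iff d(1,5,9) w'0 by simp_all
  ultimately have lt: "nn w' < nn w" using False by simp
  have f: "\<alpha> = d*(g'*\<alpha>1)" "\<beta> = d*(g'*\<beta>1)" "\<gamma> = d*(g'*\<gamma>1)"
   using g(7,8) \<gamma>1(1) unfolding d(7) by (simp_all only: mult.assoc)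
  have "d*(g'*\<alpha>1 + g'*\<beta>1 + g'*\<gamma>1) = 0" using sum unfolding f by (simp add: algebra_simps)
  then have s': "g'*\<alpha>1 + g'*\<beta>1 + g'*\<gamma>1 = 0" using d(9) by simp
  have "d^3*(g'*\<alpha>1*(g'*\<beta>1)*(g'*\<gamma>1)) = d^3*(2*w'^3)"
   using prod unfolding f d(8) by (simp add: power_mult_distrib power3_eq_cube mult_ac)
  then have p': "g'*\<alpha>1*(g'*\<beta>1)*(g'*\<gamma>1) = 2*w'^3" using d(9) by simp
  have e': "g'*\<alpha>1 \<in> eis" "g'*\<beta>1 \<in> eis" "g'*\<gamma>1 \<in> eis" using d(4) g(4,5) \<gamma>1(2) by simp_all
  show ?thesis using less.hyps[OF lt d(5) w'0 e' s' p'] unfolding f by auto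
 next
  case True
  have gw: "cop g w" by (rule cop_unit[OF d(6,2,3,1) True])
  have "cop g (w*(w*w))" using gw g(1) w by (intro cop_mult) simp_all
  then have "cop (w^3) g" using cop_sym by (simp add: power3_eq_cube mult_ac)
  then have "cop (w^3) (g*(g*g))" using g(1) w by (intro cop_mult) simp_all
  then obtain m n where mn: "m \<in> eis" "n \<in> eis" "m*w^3 + n*(g*(g*g)) = 1" unfolding cop_def by blast
  have "2 = m*(2*w^3) + 2*n*g^3" using arg_cong[OF mn(3), of "\<lambda>z. 2*z"] by (simp add: algebra_simps power3_eq_cube)
  also have "\<dots> = g^3*(m*\<alpha>1*\<beta>1*\<gamma>1 + 2*n)"
   unfolding prod[symmetric] g(7,8) \<gamma>1(1) by (simp add: algebra_simps power3_eq_cube)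
  finally have "nn 2 = nn g^3*nn (m*\<alpha>1*\<beta>1*\<gamma>1 + 2*n)"
   using nn_mult[of "g^3" "m*\<alpha>1*\<beta>1*\<gamma>1 + 2*n"] nn_power[OF g(1)] g(1,4,5) mn(1,2) \<gamma>1(2) by simp
  moreover have "nn 2 = 4" using nn_form[of 2 0] by simp
  ultimately have n4: "nn g^3 dvd 4" by (metis dvd_triv_left)
  have "nn g < 2"
  proof (rule ccontr)
   assume "\<not> nn g < 2"
   then have "2^3 \<le> nn g^3" by (intro power_mono) simp_all
   then show False using dvd_imp_le[OF n4] by simp
  qed
  then have g1: "nn g = 1" using nn_0_iff[OF g(1)] g(9) by simp
  have ab: "cop \<alpha> \<beta>" by (rule cop_unit[OF g(6,2,3,1) g1])
  have c3: "cop p q'" if h: "cop p r" "p + r + q' = 0" "p \<in> eis" for p r q'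
  proof -
   obtain x y where *: "x \<in> eis" "y \<in> eis" "x*p + y*r = 1" using h(1) unfolding cop_def by blast
   have "q' = - p - r" using h(2) by (simp add: eq_neg_iff_add_eq_0 algebra_simps)
   then have "(x - y)*p + (- y)*q' = (x - y)*p + (- y)*(- p - r)" by (simp only:)
   also have "\<dots> = x*p + y*r" by (simp add: algebra_simps)
   finally have "(x - y)*p + (- y)*q' = x*p + y*r" .
   then have "(x - y)*p + (- y)*q' = 1" using *(3) by simp
   then show ?thesis by (rule copI[rotated 2]) (use * in simp_all)
  qed
  have ac: "cop \<alpha> \<gamma>" by (rule c3[OF ab sum abc(1)])
  have bc: "cop \<beta> \<gamma>" by (rule c3[OF cop_sym[OF ab] _ abc(2)]) (use sum in \<open>simp add: add_ac\<close>)
  have two: "(2::complex) \<in> eis" by simp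
  have step: "q = r" if *: "p \<in> eis" "q \<in> eis" "r \<in> eis" "cop p q" "cop p r" "cop q r" "p + q + r = 0" "p*q*r = 2*w^3" "even (nn p)" for p q r
  proof -
   obtain p' where p': "p' \<in> eis" "p = 2*p'" using eis_even[OF *(1,9)] by blast
   have "2*(p'*q*r) = 2*w^3" using *(8) unfolding p'(2) by (simp only: mult.assoc)
   then have pr: "p'*q*r = w^3" by (rule mult_left_cancel[THEN iffD1, rotated]) simp
   show ?thesis
    by (rule descent_step[OF p'(1) *(2,3) w *(7)[unfolded p'(2)] pr cop_dvd[OF *(4)[unfolded p'(2)] two]
     cop_dvd[OF *(5)[unfolded p'(2)] two] *(6) IH])
  qed
  have "even (nn \<alpha>*nn \<beta>*nn \<gamma>)"
  proof -
   have "nn \<alpha>*nn \<beta>*nn \<gamma> = nn (2*w^3)" unfolding prod[symmetric] using abc by (simp add: nn_mult)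
   also have "\<dots> = 4*nn (w^3)" using nn_mult[of 2 "w^3"] w \<open>nn 2 = 4\<close> by simp
   finally show ?thesis by simp
  qed
  then consider "even (nn \<alpha>)" | "even (nn \<beta>)" | "even (nn \<gamma>)" by auto
  then show ?thesis
  proof cases
   case 1
   then show ?thesis using step[OF abc ab ac bc sum prod] by blast
  next
   case 2
   have "\<alpha> = \<gamma>"
    by (rule step[OF abc(2,1,3) cop_sym[OF ab] bc ac _ _ 2]) (use sum prod in \<open>simp_all add: mult_ac add_ac\<close>)
   then show ?thesis by simp
  next
   case 3
   have "\<alpha> = \<beta>"
    by (rule step[OF abc(3,1,2) cop_sym[OF ac] cop_sym[OF bc] ab _ _ 3]) (use sum prod in \<open>simp_all add: mult_ac add_ac\<close>)
   then show ?thesis by simp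
  qed
 qed
qed

theorem sum_of_cubes_twice_cube:
 assumes "u \<in> eis" "v \<in> eis" "w \<in> eis" "u^3 + v^3 = 2*w^3" "w ~= 0"
 shows "u^3 = v^3"
proof -
 have "u + v \<in> eis" "om*u + om^2 * v \<in> eis" "om^2*u + om * v \<in> eis" using assms by simp_all
 then show ?thesis
  using descent[OF assms(3,5) _ _ _ triple_of_cubes(1)[of u v]] triple_of_cubes(2,3)[of u v] assms(4) by simp
qed

lemma Q_sqrt_m3_denominator:
 assumes "z \<in> Q_sqrt_m3"
 shows "\<exists>n::nat. n > 0 \<and> of_nat n*z \<in> eis"
proof -
 obtain u v where uv: "u \<in> \<rat>" "v \<in> \<rat>" "z = u + v * (2 * om + 1)"
  using assms unfolding Q_sqrt_m3_form csqrt_m3 by blast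
 obtain a b where ab: "u = of_int a / of_int b" "b > 0" using uv(1) by (elim Rats_cases') auto
 obtain c d where cd: "v = of_int c / of_int d" "d > 0" using uv(2) by (elim Rats_cases') auto
 have "of_int (b*d)*z = of_int (a*d) + of_int (c * b)*(2 * om + 1)"
  unfolding uv(3) ab(1) cd(1) using ab(2) cd(2) by (simp add: field_simps)
 moreover have "of_int (a*d) + of_int (c * b)*(2 * om + 1) \<in> eis" by simp
 moreover have "of_nat (nat (b*d)) = (of_int (b*d) :: complex)" using ab(2) cd(2) by simp
 ultimately have "of_nat (nat (b*d))*z \<in> eis" by metis
 moreover have "nat (b*d) > 0" using ab(2) cd(2) by simp
 ultimately show ?thesis by blast
qed

theorem E36_rational_points:
 assumes P: "P \<in> carrier E36" "P \<in> coord_pts Q_sqrt_m3"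
 shows "P \<in> E36_pts"
proof (cases P)
 case (Some p)
 then obtain x y where xy: "P = Some (x, y)" by (cases p) auto
 have e: "y^2 = x^3 + 1" and K: "x \<in> Q_sqrt_m3" "y \<in> Q_sqrt_m3" using P xy by auto
 obtain m where m: "m > 0" "of_nat m*x \<in> eis" using Q_sqrt_m3_denominator[OF K(1)] by blast
 obtain n where n: "n > 0" "of_nat n*y \<in> eis" using Q_sqrt_m3_denominator[OF K(2)] by blast
 define D :: complex where "D = of_nat m * of_nat n"
 define th where "th = 2 * om + 1"
 have th2: "th^2 = - 3"
 proof -
  have "th^2 = 4 * om^2 + 4 * om + 1" by (simp add: th_def power2_eq_square algebra_simps)
  then show ?thesis by (simp add: om_sq)
 qed
 have D0: "D ~= 0" using m n by (simp add: D_def)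
 have Dx: "D*x \<in> eis" "D*y \<in> eis" "D \<in> eis"
  using eis.mult_closed[OF eis.of_nat_closed[of n] m(2)] eis.mult_closed[OF eis.of_nat_closed[of m] n(2)]
  by (simp_all add: D_def mult_ac)
 show ?thesis
 proof (cases "x = 0")
  case True
  then show ?thesis using e xy by simp
 next
  case x0: False
  \<comment> \<open>As \<open>th^2 = -3\<close>, one gets
    \<open>A^3 + B^3 = 54 (y^2 - 1) = 2 (3 x)^3\<close>, which carries the curve to the cubic of the
    descent. Its trivial solutions \<open>A^3 = B^3\<close> are \<open>y = 0\<close> and
    \<open>y^2 = 9\<close>.\<close>
  define A where "A = th*y - 3"
  define B where "B = - (th*y + 3)"
  have "A^3 + B^3 = - 18*th^2*y^2 - 54"
   by (simp add: A_def B_def cube_simps)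
  then have "A^3 + B^3 = 2*(3*x)^3" unfolding th2 e by (simp add: power_mult_distrib)
  then have eqn: "(D*A)^3 + (D*B)^3 = 2*(D*(3*x))^3"
   by (simp add: power_mult_distrib distrib_left[symmetric])
  have "D*A = th*(D*y) - 3*D" "D*B = - (th*(D*y) + 3*D)" "D*(3*x) = 3*(D*x)"
   by (simp_all add: A_def B_def algebra_simps)
  note DABC = this
  have the: "th \<in> eis" by (simp add: th_def)
  have "D*A \<in> eis" "D*B \<in> eis" "D*(3*x) \<in> eis" unfolding DABC using Dx the by simp_all
  moreover have "D*(3*x) ~= 0" using D0 x0 by simp
  ultimately have "(D*A)^3 = (D*B)^3" using sum_of_cubes_twice_cube[OF _ _ _ eqn] by blast
  then have "A^3 - B^3 = 0" using D0 by (simp add: power_mult_distrib)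
  moreover have "A^3 - B^3 = 2*(th*y)*(th^2*y^2 + 27)"
   by (simp add: A_def B_def cube_simps)
  moreover have "th ~= 0" using th2 by auto
  ultimately have "y = 0 \<or> th^2*y^2 + 27 = 0" by (simp only: mult_eq_0_iff) simp
  moreover have "3*y^2 = 27 - ((- 3)*y^2 + 27)" by simp
  ultimately have "y = 0 \<or> 3*y^2 = 27" unfolding th2 by (metis diff_0_right)
  then have "y = 0 \<or> y^2 = 9" by auto
  moreover have x3: "x^3 = y^2 - 1" unfolding e by simp
  ultimately have "y = 0 \<and> x^3 = - 1 \<or> x^3 = 8 \<and> y^2 = 9"
   unfolding x3 by (elim disjE) simp_all
  then show ?thesis unfolding xy E36_pts_simps by blast
 qed
qed simp

section \<open>The function field of $X_1(6,6)$\<close>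

text \<open>Matches \<open>Polynomial.algebraic\<close> with algebraicity over \<open>\<rat>\<close>
  in the ring \<open>CC\<close>, whose algebraic elements form a subfield. There a polynomial is a
  coefficient list with the leading coefficient first, hence the use of \<open>rev\<close>.\<close>

lemma algebraic_csubfield: "csubfield {z :: complex. Polynomial.algebraic z}"
proof -
 interpret C: field CC by (rule CC_field)
 have pw: "z [^]\<^bsub>CC\<^esub> n = z^n" for z and n :: nat
  by (induction n) (simp_all add: mult.commute)
 have ev: "C.eval l z = poly (Poly (rev l)) z" for l z
  by (induction l) (simp_all add: Poly_snoc poly_monom pw)
 have sQ: "subfield \<rat> CC" by (rule csubfield.subfield_CC[OF csubfield_Rats])
 have "(C.algebraic over \<rat>) z \<longleftrightarrow> Polynomial.algebraic z" for z
 proof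
  assume "(C.algebraic over \<rat>) z"
  then obtain l where l: "l \<in> carrier (\<rat> [X]\<^bsub>CC\<^esub>)" "l ~= []" "C.eval l z = \<zero>\<^bsub>CC\<^esub>"
   using C.algebraicE[OF subfieldE(1)[OF sQ], of z] by auto
  have c: "set l \<subseteq> \<rat>" "hd l ~= 0" using l(1,2) unfolding univ_poly_carrier[symmetric] polynomial_def by auto
  have "coeff (Poly (rev l)) (length l - 1) = hd l"
   using l(2) by (simp add: coeff_Poly_eq nth_default_nth rev_nth hd_conv_nth)
  then have "Poly (rev l) ~= 0" using c(2) by (metis coeff_0)
  moreover have "coeff (Poly (rev l)) i \<in> \<rat>" for i
   using c(1) nth_mem[of i "rev l"] by (auto simp: coeff_Poly_eq nth_default_def)
  moreover have "poly (Poly (rev l)) z = 0" using l(3) unfolding ev by simp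
  ultimately show "Polynomial.algebraic z" unfolding algebraic_altdef by blast
 next
  assume "Polynomial.algebraic z"
  then obtain p where p: "\<And>i. coeff p i \<in> \<rat>" "p ~= 0" "poly p z = 0" unfolding algebraic_altdef by blast
  have "rev (coeffs p) \<in> carrier (\<rat> [X]\<^bsub>CC\<^esub>)"
   unfolding univ_poly_carrier[symmetric] polynomial_def
   using p(1,2) by (auto simp: hd_rev last_coeffs_eq_coeff_degree coeffs_def)
  moreover have "rev (coeffs p) ~= []" using p(2) by simp
  moreover have "C.eval (rev (coeffs p)) z = \<zero>\<^bsub>CC\<^esub>" using p(3) by (simp add: ev)
  ultimately show "(C.algebraic over \<rat>) z" using C.algebraicI by blast
 qed
 then have "{z :: complex. Polynomial.algebraic z} = {z \<in> carrier CC. (C.algebraic over \<rat>) z}" by simp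
 then show ?thesis using C.subfield_of_algebraics[OF sQ] subfield_CC_imp_csubfield by metis
qed

section \<open>Points of order dividing 2, 3 and 6 on a Weierstrass curve\<close>

locale wcurve =
 fixes a b :: complex
 assumes disc: "4 * a^3 + 27 * b^2 ~= 0"
begin

sublocale G: comm_group "elliptic_curve a b"
 by (rule elliptic_curve_comm_group[OF disc])

abbreviation "tor n \<equiv> {S \<in> carrier (elliptic_curve a b). S [^]\<^bsub>elliptic_curve a b\<^esub> (n::nat) = None}"

lemma two_torsion: "Some (x, y) \<in> tor 2 \<longleftrightarrow> y = 0 \<and> x^3 + a*x + b = 0"
proof -
 have "y = - y \<longleftrightarrow> y = 0" by (auto simp: eq_neg_iff_add_eq_0)
 then have "ec_add a (Some (x, y)) (Some (x, y)) = None \<longleftrightarrow> y = 0" by (simp add: Let_def)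
 then show ?thesis by (auto simp: numeral_2_eq_2)
qed

text \<open>Equating the abscissa of the double with \<open>x\<close> gives the 3-division
  polynomial; it has no zero with \<open>y = 0\<close>, because the discriminant is nonzero.\<close>

lemma three_torsion:
 assumes y: "y^2 = x^3 + a*x + b"
 shows "Some (x, y) \<in> tor 3 \<longleftrightarrow> 3*x^4 + 6 * a*x^2 + 12 * b*x - a^2 = 0"
proof -
 let ?T = "Some (x, y)" and ?psi = "3*x^4 + 6 * a*x^2 + 12 * b*x - a^2"
 have T: "?T \<in> carrier (elliptic_curve a b)" using y by simp
 have inv: "inv\<^bsub>elliptic_curve a b\<^esub> ?T = Some (x, - y)" by (rule G.inv_equality) (use y in simp_all)
 have "?T [^]\<^bsub>elliptic_curve a b\<^esub> (3::nat) = ec_add a (ec_add a ?T ?T) ?T" by (simp add: numeral_3_eq_3 del: ec_add.simps(3))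
 moreover have "ec_add a (ec_add a ?T ?T) ?T = None \<longleftrightarrow> ec_add a ?T ?T = Some (x, - y)"
  using G.inv_equality[of "ec_add a ?T ?T" ?T] G.m_closed[OF T T] T G.l_inv[OF T] unfolding inv elliptic_curve_simps(1,2) by metis
 ultimately have tor: "?T \<in> tor 3 \<longleftrightarrow> ec_add a ?T ?T = Some (x, - y)" using T by simp
 have psi: "?psi = 12*x*y^2 - (3*x^2 + a)^2"
  unfolding y by (simp add: algebra_simps eval_nat_numeral)
 show ?thesis
 proof (cases "y = 0")
  case True
  have "?psi ~= 0"
  proof
   assume "?psi = 0"
   then have "(3*x^2 + a)^2 = 0" unfolding psi True by simp
   then have "a = - 3*x^2" by (simp add: eq_neg_iff_add_eq_0 add.commute)
   moreover have "b = - (x^3) - a*x" using y True by (simp add: eq_neg_iff_add_eq_0 algebra_simps)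
   ultimately have "4 * a^3 + 27 * b^2 = 0" by (simp add: algebra_simps eval_nat_numeral)
   then show False using disc by simp
  qed
  then show ?thesis unfolding tor using True by simp
 next
  case False
  define l where "l = (3*x^2 + a) / (2*y)"
  have nY: "\<not> (x = x \<and> y = - y)" using False by (simp add: eq_neg_iff_add_eq_0)
  have "ec_add a ?T ?T = Some (l^2 - x - x, l*(x - (l^2 - x - x)) - y)"
   unfolding ec_add.simps Let_def if_not_P[OF nY] if_P[OF refl] l_def ..
  then have "ec_add a ?T ?T = Some (x, - y) \<longleftrightarrow> l^2 - x - x = x" by auto
  also have "\<dots> \<longleftrightarrow> l^2*(4*y^2) = 3*x*(4*y^2)" using False by (simp add: algebra_simps)
  also have "l^2*(4*y^2) = (3*x^2 + a)^2" using False by (simp add: l_def power_divide power_mult_distrib)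
  also have "(3*x^2 + a)^2 = 3*x*(4*y^2) \<longleftrightarrow> ?psi = 0" unfolding psi by (auto simp: mult.assoc mult.left_commute)
  finally show ?thesis unfolding tor .
 qed
qed

text \<open>\<open>S = 3 S + 4 S\<close>, because \<open>6 S = 0\<close>.\<close>

lemma six_torsion_split:
 assumes S: "S \<in> tor 6"
 shows "\<exists>A\<in>tor 2. \<exists>B\<in>tor 3. S = ec_add a A B"
proof -
 let ?E = "elliptic_curve a b"
 have c: "S \<in> carrier ?E" and 6: "S [^]\<^bsub>?E\<^esub> (6::nat) = \<one>\<^bsub>?E\<^esub>" using S by auto
 have "(S [^]\<^bsub>?E\<^esub> (3::nat)) [^]\<^bsub>?E\<^esub> (2::nat) = None" using c 6 by (simp add: G.nat_pow_pow)
 moreover have "(S [^]\<^bsub>?E\<^esub> (4::nat)) [^]\<^bsub>?E\<^esub> (3::nat) = (S [^]\<^bsub>?E\<^esub> (6::nat)) [^]\<^bsub>?E\<^esub> (2::nat)" using c by (simp add: G.nat_pow_pow)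
 then have "(S [^]\<^bsub>?E\<^esub> (4::nat)) [^]\<^bsub>?E\<^esub> (3::nat) = None" unfolding 6 G.nat_pow_one by simp
 moreover have "S [^]\<^bsub>?E\<^esub> (3::nat) \<otimes>\<^bsub>?E\<^esub> S [^]\<^bsub>?E\<^esub> (4::nat) = S [^]\<^bsub>?E\<^esub> (6::nat) \<otimes>\<^bsub>?E\<^esub> S [^]\<^bsub>?E\<^esub> (1::nat)"
  using c by (simp only: G.nat_pow_mult) simp
 then have "S [^]\<^bsub>?E\<^esub> (3::nat) \<otimes>\<^bsub>?E\<^esub> S [^]\<^bsub>?E\<^esub> (4::nat) = S" unfolding 6 using c by simp
 ultimately show ?thesis using c G.nat_pow_closed[OF c]
  by (intro bexI[of _ "S [^]\<^bsub>?E\<^esub> (3::nat)"] bexI[of _ "S [^]\<^bsub>?E\<^esub> (4::nat)"]) auto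
qed

end

text \<open>
 The Hesse parameter \<open>t\<close> of the 3-torsion satisfies \<open>j = 27 t\<^sup>3 (t\<^sup>3 + 8)\<^sup>3 / (t\<^sup>3 - 1)\<^sup>3\<close>; the curve is
 \<open>y\<^sup>2 = x\<^sup>3 - 27 t (t\<^sup>3 + 8) x + 54 (t\<^sup>6 - 20 t\<^sup>3 - 8)\<close> up to a twist by \<open>\<mu>\<close>, and its 2-torsion corresponds
 to the roots \<open>Z\<close> of \<open>Z\<^sup>3 - 3 t Z + 2\<close>. Writing one root as \<open>2 / s\<close>, the others are \<open>(-1 \<plusminus> w) / s\<close>
 with \<open>w\<^sup>2 = s\<^sup>3 + 1\<close>.
\<close>

locale hesse =
 fixes j t s w :: complex
 assumes jt: "27*t^3*(t^3 + 8)^3 = j*(t^3 - 1)^3"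
  and j0: "j ~= 0" and j1: "j ~= 1728" and s0: "s ~= 0" and ts: "3*t * s^2 = s^3 + 4" and ws: "w^2 = s^3 + 1"
begin

definition "A = - 27*t*(t^3 + 8)"
definition "B = 54*(t^6 - 20*t^3 - 8)"
text \<open>The coefficient of \<open>universal_curve j\<close>. The Hesse model with coefficients
  \<open>A\<close> and \<open>B\<close> is scaled to it by \<open>\<mu>\<close>, as
  \<open>\<mu>^2 A = \<mu>^3 B = c\<close>.\<close>

definition "c = - 27*j / (4*(j - 1728))"
definition "\<mu> = A / B"
text \<open>In the Hesse model, the abscissa of the 2-torsion point that belongs to the root
  \<open>Z\<close>.\<close>

definition "ez Z = - 6*t^2 - 6*Z + 3*t*Z^2"

lemma t1: "t^3 ~= 1"
 using jt by auto

lemma t_eq: "t = (s^3 + 4) / (3 * s^2)"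
 using ts s0 by (simp add: field_simps)

lemma A0: "A ~= 0"
proof
 assume "A = 0"
 then have "t*(t^3 + 8) = 0" by (simp add: A_def)
 then have "27*t^3*(t^3 + 8)^3 = 0" by auto
 then show False using jt j0 t1 by simp
qed

lemma jB: "(j - 1728)*(t^3 - 1)^3 = 27*(t^6 - 20*t^3 - 8)^2"
proof -
 have "27*T*(T + 8)^3 - 1728*(T - 1)^3 = 27*(T^2 - 20*T - 8)^2" for T :: complex
  by (simp add: algebra_simps eval_nat_numeral)
 from this[of "t^3"] show ?thesis unfolding jt by (simp add: algebra_simps power_mult[symmetric])
qed

lemma B0: "B ~= 0"
proof
 assume "B = 0"
 then have "t^6 - 20*t^3 - 8 = 0" unfolding B_def by (metis mult_eq_0_iff zero_neq_numeral)
 then show False using jB j1 t1 by (simp only:) simp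
qed

lemma cAB: "c*B^2 = A^3"
proof -
 define q where "q = (t^6 - 20*t^3 - 8)^2"
 define d where "d = (t^3 - 1)^3"
 have "c*(4*(j - 1728)) = - 27*j" using j1 by (simp add: c_def)
 then have "c*(4*((j - 1728)*d)) = - 27*(j*d)" by (simp only: mult.assoc[symmetric])
 then have h: "c*(4*(27*q)) = - 27*(27*t^3*(t^3 + 8)^3)" unfolding jt d_def q_def jB .
 have "c*B^2 = 27*(c*(4*(27*q)))" unfolding B_def power_mult_distrib q_def[symmetric] by simp
 also have "\<dots> = A^3" unfolding h A_def power_mult_distrib by simp
 finally show ?thesis .
qed

lemma mu0: "\<mu> ~= 0" and c_mu: "c = \<mu>^2*A" "c = \<mu>^3*B"
proof -
 show "\<mu> ~= 0" using A0 B0 by (simp add: \<mu>_def)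
 have "c = A^3 / B^2" using cAB B0 by (simp add: field_simps)
 then show "c = \<mu>^2*A" "c = \<mu>^3*B" using B0 by (simp_all add: \<mu>_def field_simps power2_eq_square power3_eq_cube)
qed

sublocale wcurve c c
proof
 have "c ~= 0" using cAB A0 by auto
 moreover have "4 * c + 27 ~= 0" using j1 by (simp add: c_def field_simps)
 moreover have "4 * c^3 + 27 * c^2 = c^2*(4 * c + 27)" by (simp add: cube_simps)
 ultimately show "4 * c^3 + 27 * c^2 ~= 0" by simp
qed

definition "Zs = {2 / s, (w - 1) / s, (- w - 1) / s}"

lemma Z_root: "Z \<in> Zs ==> Z^3 = 3*t*Z - 2"
proof -
 assume "Z \<in> Zs"
 define u where "u = Z * s"
 have Zu: "Z = u / s" using s0 by (simp add: u_def)
 have "u = 2 \<or> u + 1 = w \<or> u + 1 = - w" using \<open>Z \<in> Zs\<close> s0 unfolding Zs_def u_def by auto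
 then have "u - 2 = 0 \<or> (u + 1)^2 = w^2" by auto
 then have "(u - 2)*((u + 1)^2 - (s^3 + 1)) = 0" unfolding ws by auto
 then have "u^3 - (s^3 + 4)*u + 2 * s^3 = 0" by (simp add: cube_simps)
 then have "u^3 = 3*t * s^2*u - 2 * s^3" unfolding ts by (simp add: algebra_simps)
 then show ?thesis unfolding Zu power_divide using s0 by (simp add: field_simps power2_eq_square power3_eq_cube)
qed

text \<open>Reducing \<open>Z * ez Z\<close> modulo the cubic of \<open>Z\<close> leaves a relation
  linear in \<open>Z\<close>. If the coefficient of \<open>Z\<close> vanished, so would
  \<open>1 - t^3\<close>.\<close>

lemma recover_Z:
 assumes "Z^3 = 3*t*Z - 2"
 shows "Z = - (6*t^2 + 2*(ez Z + 6*t^2)) / (t*(ez Z + 6*t^2) - 9*t^3 + 12)"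
  "t*(ez Z + 6*t^2) - 9*t^3 + 12 ~= 0"
proof -
 let ?d = "t*(ez Z + 6*t^2) - 9*t^3 + 12"
 have "Z*?d = 3*t^2*Z^3 - 6*t*Z^2 - 9*t^3*Z + 12*Z" by (simp add: ez_def cube_simps)
 also have "\<dots> = - (6*t^2 + 2*(ez Z + 6*t^2))" unfolding assms by (simp add: ez_def cube_simps)
 finally have e: "Z*?d = - (6*t^2 + 2*(ez Z + 6*t^2))" .
 show d: "?d ~= 0"
 proof
  assume d: "?d = 0"
  have "2*?d = t*(6*t^2 + 2*(ez Z + 6*t^2)) + 24 - 24*t^3" by (simp add: cube_simps)
  also have "6*t^2 + 2*(ez Z + 6*t^2) = 0"
   using e[symmetric] unfolding d mult_zero_right by (simp only: neg_equal_0_iff_equal)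
  finally show False using d t1 by simp
 qed
 show "Z = - (6*t^2 + 2*(ez Z + 6*t^2)) / ?d" unfolding e[symmetric] using d by simp
qed

lemma ez_root:
 assumes "Z \<in> Zs"
 shows "(\<mu>*ez Z)^3 + c*(\<mu>*ez Z) + c = 0"
proof -
 have "ez Z^3 + A*ez Z + B = (Z^3 - 3*t*Z + 2)*(27*t^3*Z^3 - 162*t^2*Z^2 + (324*t - 81*t^4)*Z + 108*t^3 - 216)"
  by (simp add: ez_def A_def B_def algebra_simps eval_nat_numeral)
 then have "ez Z^3 + A*ez Z + B = 0" using Z_root[OF assms] by simp
 moreover have "c*(\<mu>*ez Z) = \<mu>^3*(A*ez Z)" unfolding c_mu(1) by (simp add: power2_eq_square power3_eq_cube)
 ultimately show ?thesis unfolding c_mu(2)[symmetric] power_mult_distrib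
  using c_mu(2) by (metis (no_types, lifting) distrib_left mult_zero_right)
qed

text \<open>A coincidence would mean \<open>w = 3\<close>, \<open>w = -3\<close> or
  \<open>w = 0\<close>, so \<open>s^3 = 8\<close> or \<open>s^3 = -1\<close>, and either gives
  \<open>t^3 = 1\<close>.\<close>

lemma Zs_distinct: "2 / s ~= (w - 1) / s" "2 / s ~= (- w - 1) / s" "(w - 1) / s ~= (- w - 1) / s"
proof -
 have s8: "s^3 ~= 8"
 proof
  assume "s^3 = 8"
  then have "t * s^2 = 4" using ts by simp
  then have "t^3*(s^3)^2 = 4^3" by (metis power_mult_distrib power_mult mult.commute)
  then show False using t1 \<open>s ^ 3 = 8\<close> by simp
 qed
 have s1: "s^3 ~= - 1"
 proof
  assume "s^3 = - 1"
  then have "t * s^2 = 1" using ts by simp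
  then have "t^3*(s^3)^2 = 1^3" by (metis power_mult_distrib power_mult mult.commute)
  then show False using t1 \<open>s ^ 3 = - 1\<close> by simp
 qed
 have s3: "s^3 = w^2 - 1" using ws by simp
 have w: "w ~= 3" "w ~= - 3" "w ~= 0" using s8 s1 unfolding s3 by auto
 have "2 ~= w - 1" "2 ~= - w - 1" "w - 1 ~= - w - 1"
 proof -
  show "2 ~= w - 1"
  proof
   assume "2 = w - 1"
   then have "w = 2 + 1" by (metis diff_add_cancel)
   then show False using w by simp
  qed
  show "2 ~= - w - 1"
  proof
   assume "2 = - w - 1"
   then have "w = - (2 + 1)" by (metis diff_add_cancel minus_minus)
   then show False using w by simp
  qed
  show "w - 1 ~= - w - 1" using w by (simp add: eq_neg_iff_add_eq_0)
 qed
 then show "2 / s ~= (w - 1) / s" "2 / s ~= (- w - 1) / s" "(w - 1) / s ~= (- w - 1) / s"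
  using s0 by (simp_all only: divide_cancel_right simp_thms)
qed

text \<open>Three distinct roots of a cubic without quadratic term add up to 0. A fourth root could
  be exchanged for one of the three without changing the sum, so it equals that one.\<close>

lemma two_roots:
 assumes "e^3 + c*e + c = 0"
 shows "\<exists>Z\<in>Zs. e = \<mu>*ez Z"
proof (rule ccontr)
 assume ne: "\<not> ?thesis"
 have *: "p^2 + p*q + q^2 + c = 0" if "p^3 + c*p + c = 0" "q^3 + c*q + c = 0" "p ~= q" for p q
 proof -
  have "(p - q)*(p^2 + p*q + q^2 + c) = (p^3 + c*p + c) - (q^3 + c*q + c)"
   by (simp add: cube_simps)
  then show ?thesis using that by simp
 qed
 have **: "p + q + r = 0" if "p^3 + c*p + c = 0" "q^3 + c*q + c = 0" "r^3 + c*r + c = 0" "p ~= q" "p ~= r" "q ~= r" for p q r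
 proof -
  have "(q - r)*(p + q + r) = (p^2 + p*q + q^2 + c) - (p^2 + p*r + r^2 + c)"
   by (simp add: square_simps)
  then show ?thesis using *[OF that(1,2,4)] *[OF that(1,3,5)] that(6) by simp
 qed
 have inj: "\<mu>*ez Z ~= \<mu>*ez Z'" if "Z \<in> Zs" "Z' \<in> Zs" "Z ~= Z'" for Z Z'
  using recover_Z(1)[OF Z_root[OF that(1)]] recover_Z(1)[OF Z_root[OF that(2)]] that(3) mu0 by auto
 let ?e = "\<lambda>Z. \<mu>*ez Z"
 have z: "2 / s \<in> Zs" "(w - 1) / s \<in> Zs" "(- w - 1) / s \<in> Zs" by (simp_all add: Zs_def)
 have d: "?e (2 / s) ~= ?e ((w - 1) / s)" "?e (2 / s) ~= ?e ((- w - 1) / s)" "?e ((w - 1) / s) ~= ?e ((- w - 1) / s)"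
  using inj z Zs_distinct by blast+
 have n: "?e (2 / s) ~= e" "?e ((w - 1) / s) ~= e" "?e ((- w - 1) / s) ~= e" using ne z by blast+
 have "?e (2 / s) + ?e ((w - 1) / s) + e = 0" by (rule **[OF ez_root[OF z(1)] ez_root[OF z(2)] assms d(1) n(1,2)])
 moreover have "?e (2 / s) + ?e ((w - 1) / s) + ?e ((- w - 1) / s) = 0" by (rule **[OF ez_root[OF z(1)] ez_root[OF z(2)] ez_root[OF z(3)] d])
 ultimately show False using n(3) by (metis add_left_cancel)
qed

definition "Xs = {\<mu>*(- 9*t^2), \<mu>*(3*(t + 2)^2), \<mu>*(3*(t + 2 * om)^2), \<mu>*(3*(t + 2 * om^2)^2)}"

text \<open>Over \<open>\<rat>(t, om)\<close> the division polynomial splits into linear factors: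
  one special root and the three roots \<open>3 (t + 2 z)^2\<close>, with \<open>z\<close> a cube
  root of unity, all scaled by \<open>\<mu>\<close>.\<close>

lemma three_roots: "3*x^4 + 6 * c*x^2 + 12 * c*x - c^2 = 0 \<longleftrightarrow> x \<in> Xs"
proof -
 define \<xi> where "\<xi> = x / \<mu>"
 have x: "x = \<mu>*\<xi>" using mu0 by (simp add: \<xi>_def)
 have cc: "c^2 = \<mu>^4*A^2" unfolding c_mu(1) by (simp add: power_mult_distrib power_mult[symmetric])
 have "6 * c*x^2 = \<mu>^4*(6*A*\<xi>^2)" unfolding x c_mu(1) by (simp add: algebra_simps eval_nat_numeral)
 moreover have "12 * c*x = \<mu>^4*(12*B*\<xi>)" unfolding x c_mu(2) by (simp add: algebra_simps eval_nat_numeral)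
 moreover have "3*x^4 = \<mu>^4*(3*\<xi>^4)" by (simp add: x power_mult_distrib)
 ultimately have "3*x^4 + 6 * c*x^2 + 12 * c*x - c^2 = \<mu>^4*(3*\<xi>^4 + 6*A*\<xi>^2 + 12*B*\<xi> - A^2)"
  by (simp only: cc distrib_left right_diff_distrib)
 also have "3*\<xi>^4 + 6*A*\<xi>^2 + 12*B*\<xi> - A^2 =
   3*(\<xi> + 9*t^2)*(\<xi> - 3*(t + 2)^2)*(\<xi>^2 - 6*(t^2 - 2*t - 2)*\<xi> + 9*(t^2 - 2*t + 4)^2)"
  by (simp add: A_def B_def algebra_simps eval_nat_numeral)
 also have "\<xi>^2 - 6*(t^2 - 2*t - 2)*\<xi> + 9*(t^2 - 2*t + 4)^2 = (\<xi> - 3*(t + 2 * om)^2)*(\<xi> - 3*(t + 2 * om^2)^2)"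
 proof -
  have s: "(t + 2 * om)^2 + (t + 2 * om^2)^2 = 2*t^2 + 4*t*(om + om^2) + 4*(om^2 + om^2 * om^2)"
   by (simp add: square_simps)
  have p: "(t + 2 * om)*(t + 2 * om^2) = t^2 + 2*t*(om + om^2) + 4*(om * om^2)"
   by (simp add: square_simps)
  have o1: "om + om^2 = - 1" "om^2 + om^2 * om^2 = - 1" unfolding om_mult_sq by (simp_all add: om_sq)
  have "(\<xi> - 3*(t + 2 * om)^2)*(\<xi> - 3*(t + 2 * om^2)^2) =
    \<xi>^2 - 3*((t + 2 * om)^2 + (t + 2 * om^2)^2)*\<xi> + 9*((t + 2 * om)*(t + 2 * om^2))^2"
   by (simp add: power_mult_distrib algebra_simps) (simp add: power2_eq_square algebra_simps)?
  also have "\<dots> = \<xi>^2 - 6*(t^2 - 2*t - 2)*\<xi> + 9*(t^2 - 2*t + 4)^2"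
   unfolding s p o1 om_mult_sq(1) by (simp add: algebra_simps)
  finally show ?thesis by simp
 qed
 finally have f: "3*x^4 + 6 * c*x^2 + 12 * c*x - c^2 = 0 \<longleftrightarrow> (\<mu>^4 = 0 \<or> ((3 :: complex) = 0 \<or> \<xi> + 9*t^2 = 0) \<or>
   \<xi> = 3*(t + 2)^2) \<or> \<xi> = 3*(t + 2 * om)^2 \<or> \<xi> = 3*(t + 2 * om^2)^2"
  by (simp only: mult_eq_0_iff right_minus_eq disj_assoc)
 have "\<xi> = - 9*t^2 \<longleftrightarrow> \<xi> + 9*t^2 = 0" by (simp add: eq_neg_iff_add_eq_0)
 moreover have "x \<in> Xs \<longleftrightarrow> \<xi> = - 9*t^2 \<or> \<xi> = 3*(t + 2)^2 \<or> \<xi> = 3*(t + 2 * om)^2 \<or> \<xi> = 3*(t + 2 * om^2)^2"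
  unfolding Xs_def x using mu0 by (simp only: insert_iff empty_iff mult_cancel_left simp_thms)
 moreover have "\<mu>^4 ~= 0" "(3 :: complex) ~= 0" using mu0 by simp_all
 ultimately show ?thesis unfolding f by blast
qed

text \<open>At most 4 points are killed by 2 and at most 9 by 3, which leaves at most 36 sums. An
  upper bound suffices, since a level structure supplies 36 points.\<close>

lemma card_tor_6: "finite (tor 6)" "card (tor 6) \<le> 36"
proof -
 let ?e = "\<lambda>Z. Some (\<mu>*ez Z, 0 :: complex)" and ?r = "\<lambda>x. csqrt (x^3 + c*x + c)"
 let ?x0 = "\<mu>*(- 9*t^2)" and ?x1 = "\<mu>*(3*(t + 2)^2)" and ?x2 = "\<mu>*(3*(t + 2 * om)^2)" and ?x3 = "\<mu>*(3*(t + 2 * om^2)^2)"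
 let ?l2 = "[None, ?e (2 / s), ?e ((w - 1) / s), ?e ((- w - 1) / s)]"
 let ?l3 = "[None, Some (?x0, ?r ?x0), Some (?x0, - ?r ?x0), Some (?x1, ?r ?x1), Some (?x1, - ?r ?x1),
  Some (?x2, ?r ?x2), Some (?x2, - ?r ?x2), Some (?x3, ?r ?x3), Some (?x3, - ?r ?x3)]"
 have 2: "T \<in> set ?l2" if "T \<in> tor 2" for T
 proof (cases T)
  case (Some q)
  obtain x y where q: "q = (x, y)" by (cases q)
  then have "y = 0" "x^3 + c*x + c = 0" using that two_torsion[of x y] Some by auto
  moreover from this obtain Z where "Z \<in> Zs" "x = \<mu>*ez Z" using two_roots by blast
  ultimately show ?thesis unfolding Some q Zs_def insert_iff by (elim disjE) (simp_all only: list.set insert_iff simp_thms empty_iff)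
 qed simp
 have 3: "T \<in> set ?l3" if T: "T \<in> tor 3" for T
 proof (cases T)
  case (Some q)
  obtain x y where q: "q = (x, y)" by (cases q)
  have y: "y^2 = x^3 + c*x + c" using T unfolding Some q by simp
  then have "y^2 = (?r x)^2" by simp
  then have "y = ?r x \<or> y = - ?r x" by (simp only: power2_eq_iff)
  moreover have "x \<in> Xs" using three_torsion[OF y] three_roots T unfolding Some q by blast
  ultimately show ?thesis unfolding Some q Xs_def insert_iff by (elim disjE) (simp_all only: list.set insert_iff simp_thms empty_iff)
 qed simp
 have sub: "tor 6 \<subseteq> (\<lambda>(U, W). ec_add c U W) ` (set ?l2 \<times> set ?l3)"
 proof
  fix S assume "S \<in> tor 6"
  then obtain U W where "U \<in> tor 2" "W \<in> tor 3" "S = ec_add c U W" using six_torsion_split by blast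
  then show "S \<in> (\<lambda>(U, W). ec_add c U W) ` (set ?l2 \<times> set ?l3)" using 2[of U] 3[of W] by blast
 qed
 have fin: "finite (set ?l2 \<times> set ?l3)" by blast
 show "finite (tor 6)" by (rule finite_subset[OF sub]) (use fin in blast)
 have "card (tor 6) \<le> card ((\<lambda>(U, W). ec_add c U W) ` (set ?l2 \<times> set ?l3))" by (rule card_mono[OF _ sub]) (use fin in blast)
 also have "\<dots> \<le> card (set ?l2 \<times> set ?l3)" by (rule card_image_le[OF fin])
 also have "\<dots> = card (set ?l2) * card (set ?l3)" by (rule card_cartesian_product)
 also have "\<dots> \<le> length ?l2*length ?l3" by (rule mult_le_mono[OF card_length card_length])
 finally show "card (tor 6) \<le> 36" by simp
qed

lemma level_structure_tor_6:
 assumes "Gamma1_structure 6 1 (universal_curve j) P Q"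
 shows "tor 6 = {P [^]\<^bsub>universal_curve j\<^esub> r \<otimes>\<^bsub>universal_curve j\<^esub> Q [^]\<^bsub>universal_curve j\<^esub> r' |(r::nat) (r'::nat). True}"
proof -
 have E: "universal_curve j = elliptic_curve c c" by (simp add: universal_curve_def c_def Let_def)
 let ?E = "elliptic_curve c c" and ?f = "\<lambda>(r::nat, r'::nat). P [^]\<^bsub>elliptic_curve c c\<^esub> r \<otimes>\<^bsub>elliptic_curve c c\<^esub> Q [^]\<^bsub>elliptic_curve c c\<^esub> r'"
 have PQ: "P \<in> carrier ?E" "Q \<in> carrier ?E" "P [^]\<^bsub>?E\<^esub> (6::nat) = \<one>\<^bsub>?E\<^esub>" "Q [^]\<^bsub>?E\<^esub> (6::nat) = \<one>\<^bsub>?E\<^esub>" "inj_on ?f ({..<6} \<times> {..<6})"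
  using assms unfolding Gamma1_structure_def E by simp_all
 have in6: "?f p \<in> tor 6" for p
 proof -
  obtain r r' where p: "p = (r, r')" by (cases p)
  have "(P [^]\<^bsub>?E\<^esub> r) [^]\<^bsub>?E\<^esub> (6::nat) = (P [^]\<^bsub>?E\<^esub> (6::nat)) [^]\<^bsub>?E\<^esub> r" "(Q [^]\<^bsub>?E\<^esub> r') [^]\<^bsub>?E\<^esub> (6::nat) = (Q [^]\<^bsub>?E\<^esub> (6::nat)) [^]\<^bsub>?E\<^esub> r'"
   using PQ(1,2) by (simp_all only: G.nat_pow_pow mult.commute)
  then have "?f p [^]\<^bsub>?E\<^esub> (6::nat) = \<one>\<^bsub>?E\<^esub>"
   unfolding p prod.case using PQ(1,2) by (simp only: G.nat_pow_distrib G.nat_pow_closed PQ(3,4) G.nat_pow_one G.one_closed G.l_one)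
  moreover have "?f p \<in> carrier ?E" unfolding p prod.case by (intro G.m_closed G.nat_pow_closed PQ)
  ultimately show ?thesis by simp
 qed
 have "card (?f ` ({..<6} \<times> {..<6})) = 36" using card_image[OF PQ(5)] by (simp add: card_cartesian_product)
 moreover have sub: "?f ` ({..<6} \<times> {..<6}) \<subseteq> tor 6" by (rule image_subsetI) (rule in6)
 ultimately have "?f ` ({..<6} \<times> {..<6}) = tor 6" by (intro card_seteq[OF card_tor_6(1) sub]) (use card_tor_6(2) in linarith)
 then have "tor 6 \<subseteq> range ?f" by blast
 moreover have "range ?f \<subseteq> tor 6" by (rule image_subsetI) (rule in6)
 ultimately have "tor 6 = range ?f" by blast
 then show ?thesis unfolding E by auto
qed

text \<open>By \<open>level_structure_tor_6\<close> the abscissae to be adjoined are those of all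
  points killed by 6, whatever \<open>P\<close> and \<open>Q\<close> are. They are rational in
  \<open>s\<close>, \<open>w\<close> and \<open>om\<close>; conversely they yield
  \<open>\<mu>\<close>, then \<open>t\<close>, then the roots \<open>Z\<close>, and from these
  \<open>s\<close> and \<open>w\<close>.\<close>

theorem function_field:
 assumes K: "csubfield K" and om: "om \<in> K" and "Gamma1_structure 6 1 (universal_curve j) P Q"
 shows "X1_function_field K j P Q = generate_field CC (K \<union> {s, w})"
proof -
 define xs where "xs = {x. \<exists>y. Some (x, y) \<in> tor 6}"
 have X1: "X1_function_field K j P Q = generate_field CC (K \<union> {j} \<union> xs)"
 proof -
  have "{x. \<exists>y (r::nat) (r'::nat). P [^]\<^bsub>universal_curve j\<^esub> r \<otimes>\<^bsub>universal_curve j\<^esub> Q [^]\<^bsub>universal_curve j\<^esub> r' = Some (x, y)} = xs"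
   unfolding xs_def level_structure_tor_6[OF assms(3)] by (auto; metis)
  then show ?thesis unfolding X1_function_field_def by simp
 qed
 define M where "M = generate_field CC (K \<union> {j} \<union> xs)"
 define L where "L = generate_field CC (K \<union> {s, w})"
 interpret M: csubfield M unfolding M_def by (rule csubfield_generate_field)
 interpret L: csubfield L unfolding L_def by (rule csubfield_generate_field)
 have KM: "K \<subseteq> M" "xs \<subseteq> M" using generate_field_subset[of "K \<union> {j} \<union> xs"] unfolding M_def by auto
 have KL: "K \<subseteq> L" "s \<in> L" "w \<in> L" using generate_field_subset[of "K \<union> {s, w}"] unfolding L_def by auto
 have omM: "om \<in> M" and omL: "om \<in> L" using om KM KL by auto
 have tL: "t \<in> L" unfolding t_eq using KL by simp
 have jL: "j \<in> L"
 proof -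
  have "j = 27*t^3*(t^3 + 8)^3 / (t^3 - 1)^3" unfolding jt using t1 by simp
  then show ?thesis using tL by simp
 qed
 have cL: "c \<in> L" unfolding c_def using jL by simp
 have muL: "\<mu> \<in> L" unfolding \<mu>_def A_def B_def using tL by simp
 have ZL: "Z \<in> L" if "Z \<in> Zs" for Z using that KL unfolding Zs_def by auto
 have eL: "\<mu>*ez Z \<in> L" if "Z \<in> Zs" for Z using ZL[OF that] muL tL by (simp add: ez_def)
 have XL: "Xs \<subseteq> L" unfolding Xs_def using muL tL omL by auto
 have xsL: "xs \<subseteq> L"
 proof
  fix x assume "x \<in> xs"
  then obtain y where "Some (x, y) \<in> tor 6" by (auto simp: xs_def)
  then obtain U W where UW: "U \<in> tor 2" "W \<in> tor 3" "Some (x, y) = ec_add c U W" using six_torsion_split by blast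
  have U: "e \<in> L \<and> f = 0" if "U = Some (e, f)" for e f
   using UW(1) two_torsion[of e f] two_roots[of e] eL unfolding that by auto
  have W: "x' \<in> L \<and> y'^2 = x'^3 + c*x' + c" if "W = Some (x', y')" for x' y'
  proof -
   have y: "y'^2 = x'^3 + c*x' + c" using UW(2) that by simp
   then show ?thesis using three_torsion[OF y] three_roots[of x'] UW(2) XL unfolding that by auto
  qed
  show "x \<in> L"
  proof (cases U)
   case None
   then show ?thesis using W[of x y] UW(3) by simp
  next
   case (Some q)
   obtain e f where q: "q = (e, f)" by (cases q)
   have e: "e \<in> L" "f = 0" using U[of e f] Some q by auto
   show ?thesis
   proof (cases W)
    case None
    then show ?thesis using e UW(3) Some q by simp
   next
    case W': (Some q')
    obtain x' y' where q': "q' = (x', y')" by (cases q')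
    have x': "x' \<in> L" "y'^2 = x'^3 + c*x' + c" using W[of x' y'] W' q' by auto
    have ne: "e ~= x'"
    proof
     assume "e = x'"
     then have "y'^2 = 0" using x'(2) UW(1) two_torsion[of e f] unfolding Some q by simp
     then show False using UW(3) \<open>e = x'\<close> e(2) unfolding Some q W' q' by simp
    qed
    \<comment> \<open>The 2-torsion point has ordinate 0, so the ordinate \<open>y'\<close> enters
      only through its square, which is rational in \<open>x'\<close>.\<close>
    then have "x = ((y' - f) / (x' - e))^2 - e - x'" using UW(3) unfolding Some q W' q' by (simp add: Let_def)
    also have "\<dots> = (x'^3 + c*x' + c) / (x' - e)^2 - e - x'" unfolding e(2) x'(2)[symmetric] by (simp add: power_divide)
    finally show ?thesis using x' e cL by simp
   qed
  qed
 qed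
 have "M \<subseteq> L" unfolding M_def by (rule generate_field_min[OF L.csubfield_axioms]) (use KL jL xsL in auto)
 moreover have "L \<subseteq> M"
 proof -
  have t6: "T \<in> tor 6" if "T \<in> tor 2 \<or> T \<in> tor 3" for T
  proof -
   have "T \<in> carrier (elliptic_curve c c)" using that by auto
   then have p: "T [^]\<^bsub>elliptic_curve c c\<^esub> (6::nat) = (T [^]\<^bsub>elliptic_curve c c\<^esub> (2::nat)) [^]\<^bsub>elliptic_curve c c\<^esub> (3::nat)"
    "T [^]\<^bsub>elliptic_curve c c\<^esub> (6::nat) = (T [^]\<^bsub>elliptic_curve c c\<^esub> (3::nat)) [^]\<^bsub>elliptic_curve c c\<^esub> (2::nat)" by (simp_all add: G.nat_pow_pow)
   then have "T [^]\<^bsub>elliptic_curve c c\<^esub> (6::nat) = None" using that G.nat_pow_one[of 2] G.nat_pow_one[of 3] by auto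
   then show ?thesis using that by auto
  qed
  have X: "Xs \<subseteq> M"
  proof
   fix x assume x: "x \<in> Xs"
   have y: "(csqrt (x^3 + c*x + c))^2 = x^3 + c*x + c" by (rule power2_csqrt)
   then have "Some (x, csqrt (x^3 + c*x + c)) \<in> tor 3" using three_torsion[OF y] three_roots[of x] x by blast
   then have "x \<in> xs" unfolding xs_def using t6 by blast
   then show "x \<in> M" using KM by blast
  qed
  have e: "\<mu>*ez Z \<in> M" if "Z \<in> Zs" for Z
  proof -
   have "Some (\<mu>*ez Z, 0) \<in> tor 2" using two_torsion ez_root[OF that] by blast
   then show ?thesis using t6 KM unfolding xs_def by blast
  qed
  define x1 x2 x3 where xd: "x1 = \<mu>*(3*(t + 2)^2)" "x2 = \<mu>*(3*(t + 2 * om)^2)" "x3 = \<mu>*(3*(t + 2 * om^2)^2)"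
  have xM: "x1 \<in> M" "x2 \<in> M" "x3 \<in> M" using X unfolding Xs_def xd by auto
  have o4: "om*(t + 2 * om)^2 = om*t^2 + 4 * om^2*t + 4" "om^2*(t + 2 * om)^2 = om^2*t^2 + 4*t + 4 * om"
   "om^2*(t + 2 * om^2)^2 = om^2*t^2 + 4 * om*t + 4" "om*(t + 2 * om^2)^2 = om*t^2 + 4*t + 4 * om^2"
  proof -
   have "om*(t + 2 * om)^2 = om*t^2 + 4 * om^2*t + 4*(om * om^2)" by (simp add: square_simps)
   then show "om*(t + 2 * om)^2 = om*t^2 + 4 * om^2*t + 4" unfolding om_mult_sq by simp
   have "om^2*(t + 2 * om)^2 = om^2*t^2 + 4*t*(om * om^2) + 4*(om^2 * om^2)" by (simp add: square_simps)
   then show "om^2*(t + 2 * om)^2 = om^2*t^2 + 4*t + 4 * om" unfolding om_mult_sq by simp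
   have "om^2*(t + 2 * om^2)^2 = om^2*t^2 + 4*t*(om^2 * om^2) + 4*(om^2*(om^2 * om^2))" by (simp add: square_simps)
   then show "om^2*(t + 2 * om^2)^2 = om^2*t^2 + 4 * om*t + 4" unfolding om_mult_sq mult.commute[of "om^2" om] by simp
   have "om*(t + 2 * om^2)^2 = om*t^2 + 4*t*(om * om^2) + 4*(om^2*(om * om^2))" by (simp add: square_simps)
   then show "om*(t + 2 * om^2)^2 = om*t^2 + 4*t + 4 * om^2" unfolding om_mult_sq by simp
  qed
  \<comment> \<open>A discrete Fourier transform over the cube roots of unity: these weights isolate
    \<open>\<mu>\<close>, and the conjugate weights \<open>\<mu> t\<close>.\<close>
  have "x1 + om*x2 + om^2*x3 = 3*\<mu>*((t + 2)^2 + om*(t + 2 * om)^2 + om^2*(t + 2 * om^2)^2)"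
   unfolding xd by (simp only: distrib_left mult_ac)
  also have "\<dots> = 36*\<mu>" unfolding o4 unfolding om_sq by (simp add: square_simps)
  finally have mu: "\<mu> = (x1 + om*x2 + om^2*x3) / 36" by simp
  have "x1 + om^2*x2 + om*x3 = 3*\<mu>*((t + 2)^2 + om^2*(t + 2 * om)^2 + om*(t + 2 * om^2)^2)"
   unfolding xd by (simp only: distrib_left mult_ac)
  also have "\<dots> = 36*\<mu>*t" unfolding o4 unfolding om_sq by (simp add: square_simps)
  finally have t: "t = (x1 + om^2*x2 + om*x3) / (36*\<mu>)" using mu0 by simp
  have muM: "\<mu> \<in> M" by (subst mu) (use xM omM in simp)
  have tM: "t \<in> M" by (subst t) (use xM omM muM in simp)
  have ZM: "Z \<in> M" if Z: "Z \<in> Zs" for Z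
  proof -
   have "ez Z = \<mu>*ez Z / \<mu>" using mu0 by simp
   then have "ez Z \<in> M" using e[OF Z] muM M.divide_closed by metis
   then show ?thesis by (subst recover_Z(1)[OF Z_root[OF Z]]) (use tM in simp)
  qed
  have "s = 2 / (2 / s)" by simp
  then have sM: "s \<in> M" using ZM[of "2 / s"] M.divide_closed[of 2 "2 / s"] by (simp add: Zs_def)
  have "w = (w - 1) / s * s + 1" using s0 by simp
  then have "w \<in> M" using ZM[of "(w - 1) / s"] sM M.add_closed[OF M.mult_closed[of "(w - 1) / s" s] M.one_closed] by (simp add: Zs_def)
  then show ?thesis unfolding L_def by (intro generate_field_min[OF M.csubfield_axioms]) (use KM sM in auto)
 qed
 ultimately show ?thesis unfolding X1 M_def[symmetric] L_def[symmetric] by blast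
qed

text \<open>An equation for \<open>s\<close> over \<open>K\<close> becomes rational through
  \<open>quad_tower_norm\<close>; then \<open>s\<close>, hence \<open>t\<close> and
  \<open>j\<close>, would be algebraic.\<close>

lemma s_transcendental:
 assumes K: "quad_tower K" and j: "\<not> Polynomial.algebraic j" and p: "p \<in> polys K" "poly p s = 0"
 shows "p = 0"
proof (rule ccontr)
 assume "p ~= 0"
 then obtain q where q: "p*q \<in> polys \<rat>" "p*q ~= 0" using quad_tower_norm[OF K p(1)] by blast
 let ?A = "{z :: complex. Polynomial.algebraic z}"
 interpret L: csubfield ?A by (rule algebraic_csubfield)
 have s: "s \<in> ?A" unfolding mem_Collect_eq algebraic_altdef using q p(2) polysD[OF q(1)] by (intro exI[of _ "p*q"]) simp
 have tL: "t \<in> ?A" unfolding t_eq using s by (simp del: mem_Collect_eq)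
 have "j = 27*t^3*(t^3 + 8)^3 / (t^3 - 1)^3" unfolding jt using t1 by simp
 moreover have "27*t^3*(t^3 + 8)^3 / (t^3 - 1)^3 \<in> ?A" using tL by (simp del: mem_Collect_eq)
 ultimately show False using j by simp
qed

end

lemma hesse_ex:
 assumes j: "\<not> Polynomial.algebraic j"
 obtains t s w where "hesse j t s w"
proof -
 have nQ: "j \<notin> \<rat>" using csubfield.Rats_closed[OF algebraic_csubfield] j by blast
 then have rat: "j ~= 0" "j ~= 1728" by auto
 let ?p = "[:0, 0, 0, 27:]*[:8, 0, 0, 1:]^3 - smult j ([:- 1, 0, 0, 1:]^3)"
 have pv: "poly ?p x = 27*x^3*(x^3 + 8)^3 - j*(x^3 - 1)^3" for x
  by (simp add: power3_eq_cube algebra_simps)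
 have "\<exists>x. poly ?p x = 0"
 proof (rule ccontr)
  assume ne: "\<not> (\<exists>x. poly ?p x = 0)"
  have "constant (poly ?p)" using fundamental_theorem_of_algebra[of ?p] ne by blast
  then have "poly ?p 0 = poly ?p 1" unfolding constant_def by blast
  \<comment> \<open>The values of \<open>?p\<close> at 0 and 1 are \<open>j\<close> and
    \<open>27 * 9^3\<close>.\<close>
  then have "j = 27*729" unfolding pv by simp
  then show False using nQ by simp
 qed
 then obtain t where t: "27*t^3*(t^3 + 8)^3 = j*(t^3 - 1)^3" unfolding pv by auto
 let ?q = "[:4, 0, - 3*t, 1:]"
 have qv: "poly ?q x = x^3 + 4 - 3*t*x^2" for x by (simp add: power3_eq_cube power2_eq_square algebra_simps)
 have "\<not> constant (poly ?q)"
 proof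
  assume "constant (poly ?q)"
  then have "poly ?q 1 = poly ?q 0" "poly ?q (- 1) = poly ?q 0" unfolding constant_def by blast+
  then show False unfolding qv by simp
 qed
 then obtain s where s: "poly ?q s = 0" using fundamental_theorem_of_algebra by blast
 have "hesse j t s (csqrt (s^3 + 1))"
 proof
  show "s ~= 0" using s unfolding qv by auto
  show "3*t * s^2 = s^3 + 4" using s unfolding qv by simp
 qed (use t rat in \<open>simp_all add: power2_csqrt\<close>)
 then show ?thesis by (rule that)
qed

section \<open>Proof of the theorem\<close>

interpretation W36: wcurve 0 1
 by unfold_locales simp

lemma E36_pts_six:
 assumes "P \<in> E36_pts"
 shows "P \<star> 6 = None"
proof (cases P)
 case (Some p)
 then obtain x y where xy: "P = Some (x, y)" by (cases p) auto
 have c: "P \<in> carrier E36" by (rule E36_pts_carrier[OF assms])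
 then have e: "y^2 = x^3 + 1" using xy by simp
 have six: "P \<star> 6 = (P \<star> 2) \<star> 3"
  "P \<star> 6 = (P \<star> 3) \<star> 2"
  using c by (simp_all add: E36.nat_pow_pow)
 have t3: "Some (0, v) \<star> 3 = None" if "v^2 = 1" for v
  using W36.three_torsion[of v 0] that by simp
 consider "y = 0" | "x = 0" "y^2 = 1" | "x^3 = 8" "y^2 = 9" using assms unfolding xy E36_pts_simps by blast
 then show ?thesis
 proof cases
  case 1
  then have "P \<star> 2 = None" using W36.two_torsion[of x y] e unfolding xy by simp
  then show ?thesis unfolding six(1) using E36.nat_pow_one[of 3] by simp
 next
  case 2
  then have "P \<star> 3 = None" using t3 unfolding xy by simp
  then show ?thesis unfolding six(2) using E36.nat_pow_one[of 2] by simp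
 next
  case 3
  then have "y ~= 0" by auto
  then obtain x' y' where d: "ec_add 0 P P = Some (x', y')" "x'*(4*y^2) = x*(x^3 - 8)" using E36_double[OF e] xy by blast
  then have "x' = 0" using 3 by simp
  moreover have "y'^2 = x'^3 + 1" using E36.m_closed[OF c c] d(1) by simp
  ultimately have "Some (x', y') \<star> 3 = None" using t3[of y'] by simp
  moreover have "P \<star> 2 = ec_add 0 P P" using c by (simp add: numeral_2_eq_2)
  ultimately show ?thesis unfolding six(1) d(1) by simp
 qed
qed (use E36.nat_pow_one[of 6] in simp)

lemma om_Q_sqrt_m3: "om \<in> Q_sqrt_m3"
proof -
 have "om = (- 1 / 2) + (1 / 2) * csqrt (- 3)" unfolding csqrt_m3 by (simp add: algebra_simps)
 moreover have "(- 1 / 2 :: complex) \<in> \<rat>" "(1 / 2 :: complex) \<in> \<rat>" by simp_all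
 ultimately show ?thesis unfolding Q_sqrt_m3_form by blast
qed

lemma E36_pts_list:
 "E36_pts \<subseteq> set ([None] @ map (\<lambda>x. Some (x, 0)) [- 1, om * - 1, om^2 * - 1] @ [Some (0, 1), Some (0, - 1)] @
  map (\<lambda>x. Some (x, 3)) [2, om*2, om^2*2] @ map (\<lambda>x. Some (x, - 3)) [2, om*2, om^2*2])" (is "_ \<subseteq> ?L")
proof
 fix P assume P: "P \<in> E36_pts"
 have m1: "x^3 = - 1 \<longleftrightarrow> x \<in> {- 1, om * - 1, om^2 * - 1}" for x :: complex using cube_eq_cases[of x "- 1"] by simp
 have 8: "x^3 = 8 \<longleftrightarrow> x \<in> {2, om*2, om^2*2}" for x :: complex using cube_eq_cases[of x 2] by simp
 have 1: "y^2 = 1 \<longleftrightarrow> y \<in> {1, - 1}" for y :: complex by (simp add: power2_eq_1_iff)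
 have 9: "y^2 = 9 \<longleftrightarrow> y \<in> {3, - 3}" for y :: complex using power2_eq_iff[of y 3] by simp
 show "P \<in> ?L"
 proof (cases P)
  case (Some p)
  obtain x y where p: "p = (x, y)" by (cases p)
  show ?thesis using P unfolding Some p E36_pts_simps m1 8 1 9 by auto
 qed simp
qed

lemma E36_pts_coord: "E36_pts \<subseteq> coord_pts Q_sqrt_m3"
proof -
 interpret csubfield Q_sqrt_m3 by (rule quad_tower_csubfield[OF quad_tower_Q_sqrt_m3])
 show ?thesis using E36_pts_list om_Q_sqrt_m3 by fastforce
qed

lemma E36_pts_card: "finite E36_pts" "card E36_pts \<le> 12"
 using finite_subset[OF E36_pts_list finite_set] card_mono[OF finite_set E36_pts_list]
  order.trans[OF card_mono[OF finite_set E36_pts_list] card_length] by simp_all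

lemma E36_rational: "carrier E36 \<inter> coord_pts Q_sqrt_m3 = E36_pts"
 using E36_pts_coord E36_pts_carrier E36_rational_points by blast

lemma (in group) pow_mod_eq:
 assumes "z \<in> carrier G" "z [^] m = \<one>" 
 shows "z [^] ((n::nat) mod m) = z [^] n"
proof -
 have "z [^] n = z [^] (m*(n div m) + n mod m)" by simp
 also have "\<dots> = (z [^] m) [^] (n div m) \<otimes> z [^] (n mod m)" using assms(1) by (simp only: nat_pow_mult nat_pow_pow)
 also have "\<dots> = z [^] (n mod m)" using assms by simp
 finally show ?thesis ..
qed

text \<open>\<open>E36_pts_card\<close> bounds the number of points by 12 only from above; an
  injective homomorphism from a group of order 12 is therefore onto.\<close>

lemma Z2_Z6_iso:
 assumes G: "group G" and bij: "bij_betw \<phi> E36_pts (carrier G)"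
  and hom: "\<And>P Q. P \<in> E36_pts ==> Q \<in> E36_pts ==> \<phi> P \<otimes>\<^bsub>G\<^esub> \<phi> Q = \<phi> (ec_add 0 P Q)"
  and one: "\<phi> None = \<one>\<^bsub>G\<^esub>"
 shows "G \<cong> integer_mod_group 2 \<times>\<times> integer_mod_group 6"
proof -
 let ?Z = "integer_mod_group 2 \<times>\<times> integer_mod_group 6"
 \<comment> \<open>\<open>S\<close> has order 6 and \<open>3 S = (-1, 0)\<close>; \<open>T\<close>
   is a point of order 2 different from it, so \<open>T\<close> is not a multiple of
   \<open>S\<close>.\<close>
 define T S :: "(complex \<times> complex) option" where "T = Some (- om, 0)" and "S = Some (2, 3)"
 have om_ne: "om ~= 0" "- om ~= 2" "- om ~= - 1" "om ~= 1" "om ~= - 2" using om_sel by (auto simp: complex_eq_iff)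
 have TS: "T \<in> E36_pts" "S \<in> E36_pts" using om_cube by (simp_all add: T_def S_def power_minus_odd)
 note c = E36_pts_carrier[OF TS(1)] E36_pts_carrier[OF TS(2)]
 have T2: "T \<star> 2 = None" by (simp add: numeral_2_eq_2 T_def)
 have S2: "S \<star> Suc (Suc 0) = Some (0, 1)" by (simp add: S_def Let_def)
 have S3: "S \<star> Suc (Suc (Suc 0)) = Some (- 1, 0)" by (subst E36.nat_pow_Suc) (simp only: S2, simp add: S_def Let_def)
 have S4: "S \<star> Suc (Suc (Suc (Suc 0))) = Some (0, - 1)" by (subst E36.nat_pow_Suc) (simp only: S3, simp add: S_def Let_def)
 have S5: "S \<star> Suc (Suc (Suc (Suc (Suc 0)))) = Some (2, - 3)" by (subst E36.nat_pow_Suc) (simp only: S4, simp add: S_def Let_def)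
 have S6: "S \<star> 6 = None" by (rule E36_pts_six[OF TS(2)])
 have Sk: "S \<star> k \<in> {Some (2, 3), Some (0, 1), Some (- 1, 0), Some (0, - 1), Some (2, - 3)}" if "0 < k" "k < 6" for k :: nat
 proof -
  have "k = Suc 0 \<or> k = Suc (Suc 0) \<or> k = Suc (Suc (Suc 0)) \<or> k = Suc (Suc (Suc (Suc 0))) \<or> k = Suc (Suc (Suc (Suc (Suc 0))))" using that by auto
  moreover have "S \<star> Suc 0 = Some (2, 3)" by (simp add: S_def)
  ultimately show ?thesis using S2 S3 S4 S5 by (elim disjE) (simp_all only: insert_iff simp_thms)
 qed
 define h where "h = (\<lambda>(m, n). T \<star> nat m \<otimes>\<^bsub>E36\<^esub> S \<star> nat n)"
 have hc: "h p \<in> carrier E36" for p unfolding h_def using c by (cases p) (simp only: prod.case E36.m_closed E36.nat_pow_closed)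
 have hp: "h p \<in> E36_pts" for p
 proof -
  obtain m n where p: "p = (m, n)" by (cases p)
  interpret Q: csubfield Q_sqrt_m3 by (rule quad_tower_csubfield[OF quad_tower_Q_sqrt_m3])
  have "h p \<in> coord_pts Q_sqrt_m3" unfolding p h_def prod.case elliptic_curve_simps
   using TS E36_pts_coord by (intro ec_add_coord_pts E36_pow_coord_pts Q.csubfield_axioms) auto
  then show ?thesis using hc[of p] E36_rational by blast
 qed
 have car: "carrier ?Z = {0..<2} \<times> {0..<6}" by (simp add: carrier_integer_mod_group)
 have hh: "h ((m + m') mod 2, (n + n') mod 6) = h (m, n) \<otimes>\<^bsub>E36\<^esub> h (m', n')" if "m \<ge> 0" "m' \<ge> 0" "n \<ge> 0" "n' \<ge> 0" for m m' n n'
 proof -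
  have "nat ((m + m') mod 2) = (nat m + nat m') mod 2" "nat ((n + n') mod 6) = (nat n + nat n') mod 6"
   using that by (simp_all add: nat_mod_distrib nat_add_distrib)
  then have "h ((m + m') mod 2, (n + n') mod 6) = T \<star> (nat m + nat m') \<otimes>\<^bsub>E36\<^esub> S \<star> (nat n + nat n')"
   using E36.pow_mod_eq[OF c(1), of 2] E36.pow_mod_eq[OF c(2), of 6] T2 S6 by (simp add: h_def)
  also have "\<dots> = (T \<star> nat m \<otimes>\<^bsub>E36\<^esub> T \<star> nat m') \<otimes>\<^bsub>E36\<^esub> (S \<star> nat n \<otimes>\<^bsub>E36\<^esub> S \<star> nat n')"
   using c by (simp only: E36.nat_pow_mult)
  also have "\<dots> = h (m, n) \<otimes>\<^bsub>E36\<^esub> h (m', n')" unfolding h_def prod.case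
   using c by (simp only: E36.m_ac E36.m_closed E36.nat_pow_closed)
  finally show ?thesis .
 qed
 let ?f = "\<lambda>p. \<phi> (h p)"
 have fhom: "?f \<in> hom ?Z G"
 proof (rule homI)
  fix p q assume "p \<in> carrier ?Z" "q \<in> carrier ?Z"
  then obtain m n m' n' where pq: "p = (m, n)" "q = (m', n')" "m \<ge> 0" "m' \<ge> 0" "n \<ge> 0" "n' \<ge> 0" unfolding car by (cases p; cases q) auto
  have "p \<otimes>\<^bsub>?Z\<^esub> q = ((m + m') mod 2, (n + n') mod 6)" unfolding pq(1,2) by (simp add: mult_integer_mod_group)
  then have "?f (p \<otimes>\<^bsub>?Z\<^esub> q) = \<phi> (h p \<otimes>\<^bsub>E36\<^esub> h q)" using hh[OF pq(3-6)] pq(1,2) by simp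
  then show "?f (p \<otimes>\<^bsub>?Z\<^esub> q) = ?f p \<otimes>\<^bsub>G\<^esub> ?f q" using hom[OF hp hp] by simp
 qed (use hp bij in \<open>auto simp: bij_betw_def\<close>)
 have gZ: "group ?Z" by (intro DirProd_group group_integer_mod_group)
 interpret f: group_hom ?Z G ?f using gZ G fhom by (simp add: group_hom_def group_hom_axioms_def)
 have oneZ: "\<one>\<^bsub>?Z\<^esub> = (0, 0)" by (simp add: one_integer_mod_group)
 have ker: "p = (0, 0)" if p: "p \<in> carrier ?Z" "?f p = \<one>\<^bsub>G\<^esub>" for p
 proof -
  obtain m n where mn: "p = (m, n)" "0 \<le> m" "m < 2" "0 \<le> n" "n < 6" using p(1) unfolding car by (cases p) auto
  have "inj_on \<phi> E36_pts" using bij by (simp add: bij_betw_def)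
  then have "h p = None" using p(2) hp[of p] one by (metis E36_pts_simps(1) inj_onD)
  then have N: "ec_add 0 (T \<star> nat m) (S \<star> nat n) = None" by (simp add: h_def mn(1))
  have m: "m = 0 \<or> m = 1" using mn by auto
  have T1: "T \<star> nat 0 = None" "T \<star> nat 1 = T" using c(1) by (simp_all add: T_def)
  show ?thesis
  proof (cases "n = 0")
   case True
   then have "T \<star> nat m = None" using N by (cases "T \<star> nat m") simp_all
   then have "m ~= 1" using T1 by (auto simp: T_def)
   then show ?thesis using m mn(1) True by simp
  next
   case False
   then have k: "S \<star> nat n \<in> {Some (2, 3), Some (0, 1), Some (- 1, 0), Some (0, - 1), Some (2, - 3)}" using Sk[of "nat n"] mn by simp
   have "ec_add 0 (T \<star> nat m) q ~= None" if "q \<in> {Some (2, 3), Some (0, 1), Some (- 1, 0), Some (0, - 1), Some (2, - 3)}" for q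
    using m that T1 om_ne unfolding T_def by (auto simp: Let_def)
   then show ?thesis using N k by blast
  qed
 qed
 have inj: "inj_on ?f (carrier ?Z)"
  unfolding f.inj_iff_trivial_ker using ker f.one_closed by (auto simp: kernel_def oneZ car simp del: f.one_closed) (metis f.hom_one oneZ)
 have "?f ` carrier ?Z = carrier G"
 proof (rule card_seteq)
  have cG: "card (carrier G) = card E36_pts" using bij_betw_same_card[OF bij] by simp
  show "finite (carrier G)" using bij_betw_finite[OF bij] E36_pts_card by blast
  show "?f ` carrier ?Z \<subseteq> carrier G" using f.hom_closed by blast
  have "card (?f ` carrier ?Z) = card (carrier ?Z)" by (rule card_image[OF inj])
  also have "\<dots> = 12" unfolding car by (simp add: card_cartesian_product)
  finally have "card (?f ` carrier ?Z) = 12" .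
  then show "card (carrier G) \<le> card (?f ` carrier ?Z)" unfolding cG using E36_pts_card by linarith
 qed
 then have "?f \<in> iso ?Z G" using fhom inj by (simp add: iso_def bij_betw_def)
 then have "?Z \<cong> G" by (auto simp: is_iso_def)
 then show ?thesis by (rule group.iso_sym[OF gZ])
qed

theorem theorem4p12:
  fixes K :: "complex set" and j :: complex and P Q :: "(complex \<times> complex) option"
  assumes "multi_quadratic K"
    and "Q_sqrt_m3 \<subseteq> K"
    and "\<not> Polynomial.algebraic j"
    and "Gamma1_structure 6 1 (universal_curve j) P Q"
  shows "J1_base_change Q_sqrt_m3 K j P Q \<in> mon (J1_points Q_sqrt_m3 j P Q) (J1_points K j P Q) \<and>
         torsion_points (J1_points K j P Q) =
           J1_base_change Q_sqrt_m3 K j P Q ` carrier (J1_points Q_sqrt_m3 j P Q) \<and>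
         J1_points Q_sqrt_m3 j P Q \<cong> integer_mod_group 2 \<times>\<times> integer_mod_group 6"
proof -
 have towers: "quad_tower K" "quad_tower Q_sqrt_m3" by (rule multi_quadratic_tower[OF assms(1)], rule quad_tower_Q_sqrt_m3)
 note sub = towers[THEN quad_tower_csubfield]
 \<comment> \<open>The parameters depend on \<open>j\<close> alone, so one pair \<open>s\<close>,
   \<open>w\<close> generates the function fields over both constant fields.\<close>
 obtain t s w where hesse: "hesse j t s w" by (rule hesse_ex[OF assms(3)])
 interpret H: hesse j t s w by (rule hesse)
 have ff: "ell_ff L 0 1 s w" if L: "quad_tower L" for L
 proof -
  interpret L: csubfield L by (rule quad_tower_csubfield[OF L])
  show ?thesis by unfold_locales (use H.ws H.s_transcendental[OF L assms(3)] in simp_all)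
 qed
 have norm: "\<exists>q. p*q \<in> polys Q_sqrt_m3 \<and> p*q \<noteq> 0" if p: "p \<in> polys K" "p \<noteq> 0" for p
 proof -
  obtain q where q: "p*q \<in> polys \<rat>" "p*q \<noteq> 0" using quad_tower_norm[OF towers(1) p] by blast
  then have "p*q \<in> polys Q_sqrt_m3" using csubfield.Rats_closed[OF sub(2)] by (auto simp: polys_def)
  then show ?thesis using q(2) by blast
 qed
 interpret C: const_ext Q_sqrt_m3 K 0 1 s w
  by (intro const_ext.intro const_ext_axioms.intro ff towers assms(2) norm)
 have F0: "X1_function_field Q_sqrt_m3 j P Q = C.E0.F"
  unfolding C.E0.F_def by (rule H.function_field[OF sub(2) om_Q_sqrt_m3 assms(4)])
 have F1: "X1_function_field K j P Q = C.E1.F"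
  unfolding C.E1.F_def by (rule H.function_field[OF sub(1) _ assms(4)]) (use om_Q_sqrt_m3 assms(2) in blast)
 have pts: "C.E0.pts = E36_pts"
 proof -
  have "C.E0.pts = carrier E36 \<inter> coord_pts Q_sqrt_m3"
   unfolding C.E0.pts_def elliptic_curve_def coord_pts_def by auto
  then show ?thesis unfolding E36_rational .
 qed
 \<comment> \<open>Both sides are \<open>E36_pts\<close>: the torsion over \<open>K\<close> by
   reduction, all points over \<open>Q_sqrt_m3\<close> by descent.\<close>
 have tors: "{R \<in> C.E1.pts. \<exists>n::nat. n > 0 \<and> R [^]\<^bsub>E36\<^esub> n = None} = C.E0.pts"
 proof (intro equalityI subsetI)
  fix R assume "R \<in> {R \<in> C.E1.pts. \<exists>n::nat. n > 0 \<and> R [^]\<^bsub>E36\<^esub> n = None}"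
  then obtain n :: nat where n: "R \<in> C.E1.pts" "n > 0" "R [^]\<^bsub>E36\<^esub> n = None" by blast
  have "R \<in> carrier E36" "R \<in> coord_pts K" using n(1) unfolding C.E1.pts_def by auto
  then show "R \<in> C.E0.pts" unfolding pts by (rule E36_torsion[OF towers(1) _ _ n(2,3)])
 next
  fix R assume R: "R \<in> C.E0.pts"
  then have "R [^]\<^bsub>E36\<^esub> (6::nat) = None" unfolding pts by (rule E36_pts_six)
  then show "R \<in> {R \<in> C.E1.pts. \<exists>n::nat. n > 0 \<and> R [^]\<^bsub>E36\<^esub> n = None}"
   using C.pts01[OF R] by (intro CollectI conjI exI[of _ "6::nat"]) simp_all
 qed
 have "torsion_points C.E1.Jac = C.bc ` carrier C.E0.Jac"
  unfolding C.E1.torsion_Jac tors C.bc_image ..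
 moreover have "C.E0.Jac \<cong> integer_mod_group 2 \<times>\<times> integer_mod_group 6"
  by (rule Z2_Z6_iso[where \<phi> = C.E0.phi]) (use C.E0.Jac_comm_group C.E0.phi_bij C.E0.phi_mult C.E0.phi_None in \<open>simp_all add: pts comm_group_def\<close>)
 ultimately show ?thesis
  unfolding J1_base_change_def J1_points_def F0 F1 using C.bc_mon by blast
qed

end
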